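(* Let $R$ be a commutative Noetherian ring with identity, let $\mathfrak{a}$ be an ideal of $R$, let $M$ be a finitely generated $R$-module of finite projective dimension and let $N$ be a weakly Laskerian $R$-module of finite dimension. Let $t>\operatorname{pd} M$ be an integer such that $H^j_{\mathfrak{a}}(M,N)$ is Artinian for all $j>t$. Then $H^t_{\mathfrak{a}}(M,N)/\mathfrak{a}H^t_{\mathfrak{a}}(M,N)$ is Artinian.
   Context: All modules are unitary. For $R$-modules $M,N$ and $i\ge0$, the $i$-th generalized local cohomology module with respect to $\mathfrak{a}$ is $H^i_{\mathfrak{a}}(M,N):=\varinjlim_n \operatorname{Ext}^i_R(M/\mathfrak{a}^nM,N)$. An $R$-module $N$ is weakly Laskerian if every quotient of $N$ has only finitely many associated prime ideals. The dimension of a (not necessarily finitely generated) $R$-module $N$ is the dimension of $\operatorname{Supp}_R N$. $\operatorname{pd}M$ denotes the projective dimension of $M$. *)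

theory Defs
  imports "HOL-Algebra.Algebra" "HOL-Library.Extended_Real"
begin

section \<open>Modules\<close>

text \<open>
  The record type \<^typ>\<open>('a, 'b) module\<close> of the library extends that of rings. The fields
  \<open>mult\<close> and \<open>one\<close> play no role in the locale \<^locale>\<open>module\<close>; they are left
  \<^term>\<open>undefined\<close> below.
\<close>

definition quot_module ::
  "('a, 'r) ring_scheme \<Rightarrow> ('a, 'b, 'c) module_scheme \<Rightarrow> 'b set \<Rightarrow> ('a, 'b set) module" where
  "quot_module R N L =
    \<lparr>carrier = a_rcosets\<^bsub>N\<^esub> L, monoid.mult = undefined, one = undefined, ring.zero = L,
     add = set_add N, smult = (\<lambda>r C. L <+>\<^bsub>N\<^esub> (\<lambda>x. r \<odot>\<^bsub>N\<^esub> x) ` C)\<rparr>"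

definition gen_submodule ::
  "('a, 'r) ring_scheme \<Rightarrow> ('a, 'b, 'c) module_scheme \<Rightarrow> 'b set \<Rightarrow> 'b set" where
  "gen_submodule R M S = \<Inter>{L. submodule L R M \<and> S \<subseteq> L}"

definition fin_gen_module :: "('a, 'r) ring_scheme \<Rightarrow> ('a, 'b, 'c) module_scheme \<Rightarrow> bool" where
  "fin_gen_module R M \<longleftrightarrow> module R M \<and>
    (\<exists>S. finite S \<and> S \<subseteq> carrier M \<and> gen_submodule R M S = carrier M)"

definition artinian_module :: "('a, 'r) ring_scheme \<Rightarrow> ('a, 'b, 'c) module_scheme \<Rightarrow> bool" where
  "artinian_module R M \<longleftrightarrow> module R M \<and>
    (\<forall>L :: nat \<Rightarrow> 'b set.
      (\<forall>n. submodule (L n) R M) \<and> (\<forall>n. L (Suc n) \<subseteq> L n) \<longrightarrow> (\<exists>n. \<forall>m\<ge>n. L m = L n))"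

definition ideal_smult ::
  "('a, 'r) ring_scheme \<Rightarrow> 'a set \<Rightarrow> ('a, 'b, 'c) module_scheme \<Rightarrow> 'b set" where
  "ideal_smult R I M = gen_submodule R M {r \<odot>\<^bsub>M\<^esub> x | r x. r \<in> I \<and> x \<in> carrier M}"

definition mod_hom ::
  "('a, 'r) ring_scheme \<Rightarrow> ('a, 'b, 'c) module_scheme \<Rightarrow> ('a, 'd, 'e) module_scheme \<Rightarrow> ('b \<Rightarrow> 'd) set"
  where
  "mod_hom R A B = {h \<in> carrier A \<rightarrow>\<^sub>E carrier B.
    (\<forall>x\<in>carrier A. \<forall>y\<in>carrier A. h (x \<oplus>\<^bsub>A\<^esub> y) = h x \<oplus>\<^bsub>B\<^esub> h y) \<and>
    (\<forall>r\<in>carrier R. \<forall>x\<in>carrier A. h (r \<odot>\<^bsub>A\<^esub> x) = r \<odot>\<^bsub>B\<^esub> h x)}"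

definition hom_module ::
  "('a, 'r) ring_scheme \<Rightarrow> ('a, 'b, 'c) module_scheme \<Rightarrow> ('a, 'd, 'e) module_scheme
    \<Rightarrow> ('a, 'b \<Rightarrow> 'd) module" where
  "hom_module R A B =
    \<lparr>carrier = mod_hom R A B, monoid.mult = undefined, one = undefined,
     ring.zero = (\<lambda>x\<in>carrier A. \<zero>\<^bsub>B\<^esub>),
     add = (\<lambda>f g. \<lambda>x\<in>carrier A. f x \<oplus>\<^bsub>B\<^esub> g x),
     smult = (\<lambda>r f. \<lambda>x\<in>carrier A. r \<odot>\<^bsub>B\<^esub> f x)\<rparr>"


section \<open>Associated primes, support, dimension\<close>

definition annihilator ::
  "('a, 'r) ring_scheme \<Rightarrow> ('a, 'b, 'c) module_scheme \<Rightarrow> 'b \<Rightarrow> 'a set" where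
  "annihilator R N x = {r \<in> carrier R. r \<odot>\<^bsub>N\<^esub> x = \<zero>\<^bsub>N\<^esub>}"

definition Ass :: "('a, 'r) ring_scheme \<Rightarrow> ('a, 'b, 'c) module_scheme \<Rightarrow> 'a set set" where
  "Ass R N = {p. primeideal p R \<and> (\<exists>x\<in>carrier N. p = annihilator R N x)}"

definition weakly_laskerian :: "('a, 'r) ring_scheme \<Rightarrow> ('a, 'b, 'c) module_scheme \<Rightarrow> bool" where
  "weakly_laskerian R N \<longleftrightarrow> module R N \<and>
    (\<forall>L. submodule L R N \<longrightarrow> finite (Ass R (quot_module R N L)))"

text \<open>The equality of fractions \<open>x/s = y/u\<close> in the localization \<open>N\<^sub>p\<close>.\<close>

definition frac_rel ::
  "('a, 'r) ring_scheme \<Rightarrow> ('a, 'b, 'c) module_scheme \<Rightarrow> 'a set \<Rightarrow> (('b \<times> 'a) \<times> ('b \<times> 'a)) set" where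
  "frac_rel R N p = {((x, s), (y, u)).
    x \<in> carrier N \<and> y \<in> carrier N \<and> s \<in> carrier R - p \<and> u \<in> carrier R - p \<and>
    (\<exists>v\<in>carrier R - p. v \<odot>\<^bsub>N\<^esub> (u \<odot>\<^bsub>N\<^esub> x) = v \<odot>\<^bsub>N\<^esub> (s \<odot>\<^bsub>N\<^esub> y))}"

definition localized_carrier ::
  "('a, 'r) ring_scheme \<Rightarrow> ('a, 'b, 'c) module_scheme \<Rightarrow> 'a set \<Rightarrow> ('b \<times> 'a) set set" where
  "localized_carrier R N p = (carrier N \<times> (carrier R - p)) // frac_rel R N p"

definition Supp :: "('a, 'r) ring_scheme \<Rightarrow> ('a, 'b, 'c) module_scheme \<Rightarrow> 'a set set" where
  "Supp R N = {p. primeideal p R \<and>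
    localized_carrier R N p \<noteq> {frac_rel R N p `` {(\<zero>\<^bsub>N\<^esub>, \<one>\<^bsub>R\<^esub>)}}}"

text \<open>
  The supremum of the lengths of chains of primes in the support. It is \<open>-\<infinity>\<close> for the zero
  module, which therefore counts as a module of finite dimension.
\<close>

definition module_dim :: "('a, 'r) ring_scheme \<Rightarrow> ('a, 'b, 'c) module_scheme \<Rightarrow> ereal" where
  "module_dim R N = Sup {ereal (real n) | n.
    \<exists>c :: nat \<Rightarrow> 'a set. (\<forall>i\<le>n. c i \<in> Supp R N) \<and> (\<forall>i<n. c i \<subset> c (Suc i))}"


section \<open>Projective modules and resolutions\<close>

text \<open>
  Projectivity is the lifting property against surjections \<open>A \<rightarrow> B\<close>. As HOL cannot quantify over
  types in a formula, \<open>B\<close> ranges over all modules on the type \<open>'p\<close> of \<open>P\<close> and \<open>A\<close> over all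
  modules on \<open>'p \<Rightarrow> 'a\<close>. That is no restriction: these types contain \<open>P\<close> and the free module on
  the set of elements of \<open>P\<close>, so \<open>P\<close> is a direct summand of a free module and the lifting
  property holds for modules on any types.
\<close>

definition projective_module :: "('a, 'r) ring_scheme \<Rightarrow> ('a, 'p) module \<Rightarrow> bool" where
  "projective_module R P \<longleftrightarrow> module R P \<and>
    (\<forall>(A :: ('a, 'p \<Rightarrow> 'a) module) (B :: ('a, 'p) module) g f.
      module R A \<and> module R B \<and> g \<in> mod_hom R A B \<and> g ` carrier A = carrier B \<and>
      f \<in> mod_hom R P B \<longrightarrow>
      (\<exists>h\<in>mod_hom R P A. \<forall>x\<in>carrier P. g (h x) = f x))"

text \<open>\<open>\<dots> \<rightarrow> P 2 \<rightarrow> P 1 \<rightarrow> P 0 \<rightarrow> M \<rightarrow> 0\<close> with \<open>d i : P (i + 1) \<rightarrow> P i\<close> and \<open>e : P 0 \<rightarrow> M\<close>.\<close>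

definition projective_resolution ::
  "('a, 'r) ring_scheme \<Rightarrow> ('a, 'm, 'k) module_scheme \<Rightarrow> (nat \<Rightarrow> ('a, 'p) module)
    \<Rightarrow> (nat \<Rightarrow> 'p \<Rightarrow> 'p) \<Rightarrow> ('p \<Rightarrow> 'm) \<Rightarrow> bool" where
  "projective_resolution R M P d e \<longleftrightarrow>
    (\<forall>i. projective_module R (P i)) \<and>
    e \<in> mod_hom R (P 0) M \<and> (\<forall>i. d i \<in> mod_hom R (P (Suc i)) (P i)) \<and>
    e ` carrier (P 0) = carrier M \<and>
    d 0 ` carrier (P 1) = {x \<in> carrier (P 0). e x = \<zero>\<^bsub>M\<^esub>} \<and>
    (\<forall>i. d (Suc i) ` carrier (P (Suc (Suc i))) = {x \<in> carrier (P (Suc i)). d i x = \<zero>\<^bsub>P i\<^esub>})"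


section \<open>The standard free resolution\<close>

text \<open>The free module on \<open>I\<close>: functions of finite support.\<close>

definition free_module :: "('a, 'r) ring_scheme \<Rightarrow> 's set \<Rightarrow> ('a, 's \<Rightarrow> 'a) module" where
  "free_module R I =
    \<lparr>carrier = {f. (\<forall>s\<in>I. f s \<in> carrier R) \<and> (\<forall>s. s \<notin> I \<longrightarrow> f s = \<zero>\<^bsub>R\<^esub>) \<and> finite {s. f s \<noteq> \<zero>\<^bsub>R\<^esub>}},
     monoid.mult = undefined, one = undefined, ring.zero = (\<lambda>s. \<zero>\<^bsub>R\<^esub>),
     add = (\<lambda>f g s. f s \<oplus>\<^bsub>R\<^esub> g s), smult = (\<lambda>r f s. r \<otimes>\<^bsub>R\<^esub> f s)\<rparr>"

definition free_basis :: "('a, 'r) ring_scheme \<Rightarrow> 's \<Rightarrow> 's \<Rightarrow> 'a" where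
  "free_basis R s = (\<lambda>s'. if s' = s then \<one>\<^bsub>R\<^esub> else \<zero>\<^bsub>R\<^esub>)"

text \<open>The linear map from the free module on \<open>I\<close> to \<open>A\<close> that maps the basis element \<open>s\<close> to \<open>v s\<close>.\<close>

definition lin_ext ::
  "('a, 'r) ring_scheme \<Rightarrow> 's set \<Rightarrow> ('a, 'b, 'c) module_scheme \<Rightarrow> ('s \<Rightarrow> 'b) \<Rightarrow> ('s \<Rightarrow> 'a) \<Rightarrow> 'b" where
  "lin_ext R I A v =
    (\<lambda>f\<in>carrier (free_module R I). \<Oplus>\<^bsub>A\<^esub>s\<in>{s. f s \<noteq> \<zero>\<^bsub>R\<^esub>}. f s \<odot>\<^bsub>A\<^esub> v s)"

text \<open>
  Every module \<open>M\<close> has a functorial free resolution: \<open>F 0\<close> is free on the elements of \<open>M\<close>, and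
  \<open>F (i + 1)\<close> is free on the formal linear combinations, written as lists
  \<open>[(s\<^sub>1, r\<^sub>1), \<dots>, (s\<^sub>k, r\<^sub>k)]\<close>, of basis elements of \<open>F i\<close> that lie in the kernel of the
  preceding map. The datatype provides one type for the basis elements in all degrees. Different
  lists may denote the same element of the kernel; this only makes the generating set redundant.
\<close>

datatype ('a, 'm) syz = Gen (gen_val: 'm) | Rel (rel_val: "(('a, 'm) syz \<times> 'a) list")

primrec list_comb :: "('a, 'r) ring_scheme \<Rightarrow> ('s \<times> 'a) list \<Rightarrow> 's \<Rightarrow> 'a" where
  "list_comb R [] = (\<lambda>s. \<zero>\<^bsub>R\<^esub>)"
| "list_comb R (t # ts) =
    (\<lambda>s. (if s = fst t then snd t else \<zero>\<^bsub>R\<^esub>) \<oplus>\<^bsub>R\<^esub> list_comb R ts s)"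

fun syz_basis ::
  "('a, 'r) ring_scheme \<Rightarrow> ('a, 'm, 'k) module_scheme \<Rightarrow> nat \<Rightarrow> ('a, 'm) syz set" where
  "syz_basis R M 0 = Gen ` carrier M"
| "syz_basis R M (Suc 0) = {Rel l | l. set l \<subseteq> syz_basis R M 0 \<times> carrier R \<and>
    lin_ext R (syz_basis R M 0) M gen_val (list_comb R l) = \<zero>\<^bsub>M\<^esub>}"
| "syz_basis R M (Suc (Suc i)) = {Rel l | l. set l \<subseteq> syz_basis R M (Suc i) \<times> carrier R \<and>
    lin_ext R (syz_basis R M (Suc i)) (free_module R (syz_basis R M i))
      (\<lambda>s. list_comb R (rel_val s)) (list_comb R l) = (\<lambda>s. \<zero>\<^bsub>R\<^esub>)}"

definition free_res ::
  "('a, 'r) ring_scheme \<Rightarrow> ('a, 'm, 'k) module_scheme \<Rightarrow> nat \<Rightarrow> ('a, ('a, 'm) syz \<Rightarrow> 'a) module" where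
  "free_res R M i = free_module R (syz_basis R M i)"

definition free_res_aug ::
  "('a, 'r) ring_scheme \<Rightarrow> ('a, 'm, 'k) module_scheme \<Rightarrow> (('a, 'm) syz \<Rightarrow> 'a) \<Rightarrow> 'm" where
  "free_res_aug R M = lin_ext R (syz_basis R M 0) M gen_val"

definition free_res_diff ::
  "('a, 'r) ring_scheme \<Rightarrow> ('a, 'm, 'k) module_scheme \<Rightarrow> nat
    \<Rightarrow> (('a, 'm) syz \<Rightarrow> 'a) \<Rightarrow> (('a, 'm) syz \<Rightarrow> 'a)" where
  "free_res_diff R M i =
    lin_ext R (syz_basis R M (Suc i)) (free_res R M i) (\<lambda>s. list_comb R (rel_val s))"

text \<open>The chain map of the standard resolutions over a homomorphism \<open>f : M \<rightarrow> M'\<close>.\<close>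

definition free_res_map ::
  "('a, 'r) ring_scheme \<Rightarrow> ('a, 'm, 'k) module_scheme \<Rightarrow> ('a, 'n, 'l) module_scheme \<Rightarrow> ('m \<Rightarrow> 'n)
    \<Rightarrow> nat \<Rightarrow> (('a, 'm) syz \<Rightarrow> 'a) \<Rightarrow> (('a, 'n) syz \<Rightarrow> 'a)" where
  "free_res_map R M M' f i =
    lin_ext R (syz_basis R M i) (free_res R M' i) (\<lambda>s. free_basis R (map_syz id f s))"

text \<open>
  The resolutions live on the type of the standard resolution. That is no restriction:
  if \<open>M\<close> has projective dimension at most \<open>n\<close>, then the \<open>n\<close>-th syzygy of the standard resolution
  is projective, so that one may be cut off there (for \<open>n = 0\<close>, \<open>M\<close> is a direct summand of \<open>F 0\<close>).
  Letting \<open>n\<close> range over the integers gives the zero module the projective dimension \<open>-\<infinity>\<close>.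
\<close>

definition proj_dim :: "('a, 'r) ring_scheme \<Rightarrow> ('a, 'm, 'k) module_scheme \<Rightarrow> ereal" where
  "proj_dim R M = Inf {ereal (real_of_int n) | n.
    \<exists>(P :: nat \<Rightarrow> ('a, ('a, 'm) syz \<Rightarrow> 'a) module) d e.
      projective_resolution R M P d e \<and> (\<forall>i. n < int i \<longrightarrow> carrier (P i) = {\<zero>\<^bsub>P i\<^esub>})}"


section \<open>Ext\<close>

definition ext_cocycles ::
  "('a, 'r) ring_scheme \<Rightarrow> nat \<Rightarrow> ('a, 'm, 'k) module_scheme \<Rightarrow> ('a, 'n, 'l) module_scheme
    \<Rightarrow> ((('a, 'm) syz \<Rightarrow> 'a) \<Rightarrow> 'n) set" where
  "ext_cocycles R i M N = {h \<in> mod_hom R (free_res R M i) N.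
    \<forall>x\<in>carrier (free_res R M (Suc i)). h (free_res_diff R M i x) = \<zero>\<^bsub>N\<^esub>}"

fun ext_coboundaries ::
  "('a, 'r) ring_scheme \<Rightarrow> nat \<Rightarrow> ('a, 'm, 'k) module_scheme \<Rightarrow> ('a, 'n, 'l) module_scheme
    \<Rightarrow> ((('a, 'm) syz \<Rightarrow> 'a) \<Rightarrow> 'n) set" where
  "ext_coboundaries R 0 M N = {\<zero>\<^bsub>hom_module R (free_res R M 0) N\<^esub>}"
| "ext_coboundaries R (Suc i) M N =
    (\<lambda>h. \<lambda>x\<in>carrier (free_res R M (Suc i)). h (free_res_diff R M i x)) ` mod_hom R (free_res R M i) N"

text \<open>The \<open>i\<close>-th cohomology module of the complex of homomorphisms from the standard resolution.\<close>

definition ext_module ::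
  "('a, 'r) ring_scheme \<Rightarrow> nat \<Rightarrow> ('a, 'm, 'k) module_scheme \<Rightarrow> ('a, 'n, 'l) module_scheme
    \<Rightarrow> ('a, ((('a, 'm) syz \<Rightarrow> 'a) \<Rightarrow> 'n) set) module" where
  "ext_module R i M N =
    quot_module R (hom_module R (free_res R M i) N\<lparr>carrier := ext_cocycles R i M N\<rparr>)
      (ext_coboundaries R i M N)"

text \<open>The map \<open>Ext\<^sup>i(M', N) \<rightarrow> Ext\<^sup>i(M, N)\<close> induced by \<open>f : M \<rightarrow> M'\<close>.\<close>

definition ext_map ::
  "('a, 'r) ring_scheme \<Rightarrow> nat \<Rightarrow> ('a, 'm, 'k) module_scheme \<Rightarrow> ('a, 'p, 'q) module_scheme
    \<Rightarrow> ('a, 'n, 'l) module_scheme \<Rightarrow> ('m \<Rightarrow> 'p)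
    \<Rightarrow> ((('a, 'p) syz \<Rightarrow> 'a) \<Rightarrow> 'n) set \<Rightarrow> ((('a, 'm) syz \<Rightarrow> 'a) \<Rightarrow> 'n) set" where
  "ext_map R i M M' N f C =
    ext_coboundaries R i M N <+>\<^bsub>hom_module R (free_res R M i) N\<^esub>
      ((\<lambda>h. \<lambda>x\<in>carrier (free_res R M i). h (free_res_map R M M' f i x)) ` C)"


section \<open>Generalized local cohomology\<close>

text \<open>The direct limit of a sequence of modules \<open>E n\<close> with maps \<open>T n m : E n \<rightarrow> E m\<close> for \<open>n \<le> m\<close>.\<close>

definition dir_lim_rel ::
  "(nat \<Rightarrow> ('a, 'b) module) \<Rightarrow> (nat \<Rightarrow> nat \<Rightarrow> 'b \<Rightarrow> 'b) \<Rightarrow> ((nat \<times> 'b) \<times> (nat \<times> 'b)) set" where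
  "dir_lim_rel E T = {((n, x), (m, y)). x \<in> carrier (E n) \<and> y \<in> carrier (E m) \<and>
    (\<exists>k. n \<le> k \<and> m \<le> k \<and> T n k x = T m k y)}"

definition dir_lim ::
  "(nat \<Rightarrow> ('a, 'b) module) \<Rightarrow> (nat \<Rightarrow> nat \<Rightarrow> 'b \<Rightarrow> 'b) \<Rightarrow> ('a, (nat \<times> 'b) set) module" where
  "dir_lim E T =
    \<lparr>carrier = (SIGMA n:UNIV. carrier (E n)) // dir_lim_rel E T,
     monoid.mult = undefined, one = undefined,
     ring.zero = dir_lim_rel E T `` {(0, \<zero>\<^bsub>E 0\<^esub>)},
     add = (\<lambda>C D. \<Union>(n, x)\<in>C. \<Union>(m, y)\<in>D.
       dir_lim_rel E T `` {(max n m, T n (max n m) x \<oplus>\<^bsub>E (max n m)\<^esub> T m (max n m) y)}),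
     smult = (\<lambda>r C. \<Union>(n, x)\<in>C. dir_lim_rel E T `` {(n, r \<odot>\<^bsub>E n\<^esub> x)})\<rparr>"

definition ideal_power_smult ::
  "('a, 'r) ring_scheme \<Rightarrow> 'a set \<Rightarrow> nat \<Rightarrow> ('a, 'm, 'k) module_scheme \<Rightarrow> 'm set" where
  "ideal_power_smult R I n M = ideal_smult R (I [^]\<^bsub>ideals_set R\<^esub> n) M"

text \<open>
  For \<open>n \<le> m\<close> the natural map \<open>M/I\<^sup>mM \<rightarrow> M/I\<^sup>nM\<close> takes a coset \<open>C\<close> of \<open>I\<^sup>mM\<close> to the coset
  \<open>I\<^sup>nM + C\<close> of \<open>I\<^sup>nM\<close>.
\<close>

definition gen_loc_coh ::
  "('a, 'r) ring_scheme \<Rightarrow> 'a set \<Rightarrow> nat \<Rightarrow> ('a, 'm, 'k) module_scheme \<Rightarrow> ('a, 'n, 'l) module_scheme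
    \<Rightarrow> ('a, (nat \<times> ((('a, 'm set) syz \<Rightarrow> 'a) \<Rightarrow> 'n) set) set) module" where
  "gen_loc_coh R I i M N =
    (let Q = (\<lambda>n. quot_module R M (ideal_power_smult R I n M))
     in dir_lim (\<lambda>n. ext_module R i (Q n) N)
          (\<lambda>n m. ext_map R i (Q m) (Q n) N (\<lambda>C. ideal_power_smult R I n M <+>\<^bsub>M\<^esub> C)))"

section \<open>The standard free resolution is a projective resolution\<close>

lemma free_module_sel [simp]:
  "\<zero>\<^bsub>free_module R I\<^esub> = (\<lambda>s. \<zero>\<^bsub>R\<^esub>)"
  "f \<oplus>\<^bsub>free_module R I\<^esub> g = (\<lambda>s. f s \<oplus>\<^bsub>R\<^esub> g s)"
  "r \<odot>\<^bsub>free_module R I\<^esub> f = (\<lambda>s. r \<otimes>\<^bsub>R\<^esub> f s)"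
  by (simp_all add: free_module_def)

lemma free_module_carrier:
  "f \<in> carrier (free_module R I) \<longleftrightarrow>
    (\<forall>s\<in>I. f s \<in> carrier R) \<and> (\<forall>s. s \<notin> I \<longrightarrow> f s = \<zero>\<^bsub>R\<^esub>) \<and> finite {s. f s \<noteq> \<zero>\<^bsub>R\<^esub>}"
  by (simp add: free_module_def)

lemma free_module_closed:
  assumes "cring R" "f \<in> carrier (free_module R I)"
  shows "f s \<in> carrier R"
proof -
  interpret cring R by fact
  show ?thesis using assms(2) by (cases "s \<in> I") (auto simp: free_module_carrier)
qed

lemma module_free_module:
  assumes "cring R"
  shows "module R (free_module R I)"
proof -
  interpret cring R by fact
  have fin: "finite {s. f s \<oplus>\<^bsub>R\<^esub> g s \<noteq> \<zero>\<^bsub>R\<^esub>}"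
    if "finite {s. f s \<noteq> \<zero>\<^bsub>R\<^esub>}" "finite {s. g s \<noteq> \<zero>\<^bsub>R\<^esub>}" for f g :: "'s \<Rightarrow> 'a"
    by (rule finite_subset[of _ "{s. f s \<noteq> \<zero>\<^bsub>R\<^esub>} \<union> {s. g s \<noteq> \<zero>\<^bsub>R\<^esub>}"]) (use that in auto)
  note cl = free_module_closed[OF assms]
  have ag: "abelian_group (free_module R I)"
  proof (rule abelian_groupI)
    fix x y assume "x \<in> carrier (free_module R I)" "y \<in> carrier (free_module R I)"
    then show "x \<oplus>\<^bsub>free_module R I\<^esub> y \<in> carrier (free_module R I)"
      using fin by (auto simp: free_module_carrier)
  next
    show "\<zero>\<^bsub>free_module R I\<^esub> \<in> carrier (free_module R I)"
      by (auto simp: free_module_carrier)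
  next
    fix x assume x: "x \<in> carrier (free_module R I)"
    have "(\<lambda>s. \<ominus>\<^bsub>R\<^esub> x s) \<in> carrier (free_module R I)"
    proof -
      have "{s. \<ominus>\<^bsub>R\<^esub> x s \<noteq> \<zero>\<^bsub>R\<^esub>} \<subseteq> {s. x s \<noteq> \<zero>\<^bsub>R\<^esub>}" by auto
      then show ?thesis using x finite_subset by (fastforce simp: free_module_carrier)
    qed
    then show "\<exists>y\<in>carrier (free_module R I). y \<oplus>\<^bsub>free_module R I\<^esub> x = \<zero>\<^bsub>free_module R I\<^esub>"
      by (rule bexI[rotated]) (simp add: l_neg cl[OF x])
  qed (auto simp: cl a_ac)
  show ?thesis
  proof (rule moduleI[OF assms ag])
    fix a x assume a: "a \<in> carrier R" and x: "x \<in> carrier (free_module R I)"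
    have "{s. a \<otimes>\<^bsub>R\<^esub> x s \<noteq> \<zero>\<^bsub>R\<^esub>} \<subseteq> {s. x s \<noteq> \<zero>\<^bsub>R\<^esub>}" using a by auto
    then show "a \<odot>\<^bsub>free_module R I\<^esub> x \<in> carrier (free_module R I)"
      using a x finite_subset by (fastforce simp: free_module_carrier)
  qed (auto simp: cl l_distr r_distr m_assoc)
qed

lemma free_basis_closed: "cring R \<Longrightarrow> s \<in> I \<Longrightarrow> free_basis R s \<in> carrier (free_module R I)"
proof -
  assume "cring R" "s \<in> I"
  then interpret cring R by simp
  have "{s'. free_basis R s s' \<noteq> \<zero>\<^bsub>R\<^esub>} \<subseteq> {s}" by (auto simp: free_basis_def)
  then have "finite {s'. free_basis R s s' \<noteq> \<zero>\<^bsub>R\<^esub>}" using finite_subset by blast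
  then show ?thesis using \<open>s \<in> I\<close> one_closed zero_closed
    by (auto simp: free_module_carrier free_basis_def)
qed

lemma list_comb_Cons_eq:
  assumes "cring R" "r \<in> carrier R"
  shows "list_comb R ((s, r) # l) =
    r \<odot>\<^bsub>free_module R I\<^esub> free_basis R s \<oplus>\<^bsub>free_module R I\<^esub> list_comb R l"
proof -
  interpret cring R by fact
  show ?thesis using assms(2) by (auto simp: free_basis_def fun_eq_iff)
qed

lemma list_comb_closed:
  assumes "cring R" "set l \<subseteq> I \<times> carrier R"
  shows "list_comb R l \<in> carrier (free_module R I)"
  using assms(2)
proof (induction l)
  case Nil
  interpret F: module R "free_module R I" using module_free_module assms(1) .
  show ?case using F.zero_closed by simp
next
  case (Cons t l)
  interpret F: module R "free_module R I" using module_free_module assms(1) .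
  obtain s r where t: "t = (s, r)" by force
  have r: "r \<in> carrier R" and s: "s \<in> I" and l: "set l \<subseteq> I \<times> carrier R" using Cons.prems t by auto
  show ?case
    unfolding t list_comb_Cons_eq[OF assms(1) r, where I = I]
    by (rule F.a_closed[OF F.smult_closed[OF r free_basis_closed[OF assms(1) s]] Cons.IH[OF l]])
qed

lemma list_comb_surj:
  assumes "cring R" "f \<in> carrier (free_module R I)"
  obtains l where "set l \<subseteq> I \<times> carrier R" "list_comb R l = f"
proof -
  interpret cring R by fact
  have fin: "finite {s. f s \<noteq> \<zero>\<^bsub>R\<^esub>}" using assms(2) by (simp add: free_module_carrier)
  obtain xs where xs: "set xs = {s. f s \<noteq> \<zero>\<^bsub>R\<^esub>}" "distinct xs"
    using finite_distinct_list[OF fin] by blast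
  have *: "list_comb R (map (\<lambda>s. (s, f s)) ys) s' = (if s' \<in> set ys then f s' else \<zero>\<^bsub>R\<^esub>)"
    if "distinct ys" for ys s'
    using that by (induction ys) (auto simp: free_module_closed[OF assms])
  have "list_comb R (map (\<lambda>s. (s, f s)) xs) = f"
    by (rule ext) (auto simp: *[OF xs(2)] xs(1))
  moreover have "set (map (\<lambda>s. (s, f s)) xs) \<subseteq> I \<times> carrier R"
    using assms(2) xs(1) by (auto simp: free_module_carrier)
  ultimately show thesis using that by blast
qed

lemma free_module_induct [consumes 2, case_names zero step]:
  assumes "cring R" "f \<in> carrier (free_module R I)"
    and "P \<zero>\<^bsub>free_module R I\<^esub>"
    and "\<And>r s f. r \<in> carrier R \<Longrightarrow> s \<in> I \<Longrightarrow> f \<in> carrier (free_module R I) \<Longrightarrow> P f \<Longrightarrow>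
      P (r \<odot>\<^bsub>free_module R I\<^esub> free_basis R s \<oplus>\<^bsub>free_module R I\<^esub> f)"
  shows "P f"
proof -
  obtain l where l: "set l \<subseteq> I \<times> carrier R" "list_comb R l = f"
    using list_comb_surj[OF assms(1,2)] .
  have "P (list_comb R l)" using l(1)
  proof (induction l)
    case Nil
    then show ?case using assms(3) by simp
  next
    case (Cons t l)
    obtain s r where t: "t = (s, r)" by force
    have "r \<in> carrier R" "s \<in> I" "set l \<subseteq> I \<times> carrier R" using Cons.prems t by auto
    then show ?case unfolding t list_comb_Cons_eq[OF assms(1) \<open>r \<in> carrier R\<close>, where I = I]
      using Cons.IH assms(4) list_comb_closed[OF assms(1)] by blast
  qed
  then show ?thesis using l by simp
qed

lemma lin_ext_hom:
  assumes "module R A" "v \<in> I \<rightarrow> carrier A"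
  shows "lin_ext R I A v \<in> mod_hom R (free_module R I) A"
proof -
  interpret A: module R A by fact
  have cr: "cring R" by unfold_locales
  interpret F: module R "free_module R I" using module_free_module cr .
  note cl = free_module_closed[OF cr]
  have v: "f s \<odot>\<^bsub>A\<^esub> v s \<in> carrier A" if "f \<in> carrier (free_module R I)" "f s \<noteq> \<zero>\<^bsub>R\<^esub>" for f s
    using that assms(2) by (auto simp: free_module_carrier)
  have ext: "lin_ext R I A v f = (\<Oplus>\<^bsub>A\<^esub>s\<in>S. f s \<odot>\<^bsub>A\<^esub> v s)"
    if "f \<in> carrier (free_module R I)" "finite S" "{s. f s \<noteq> \<zero>\<^bsub>R\<^esub>} \<subseteq> S" "S \<subseteq> I" for f S
  proof -
    have "(\<Oplus>\<^bsub>A\<^esub>s\<in>{s. f s \<noteq> \<zero>\<^bsub>R\<^esub>}. f s \<odot>\<^bsub>A\<^esub> v s) = (\<Oplus>\<^bsub>A\<^esub>s\<in>S. f s \<odot>\<^bsub>A\<^esub> v s)"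
      by (rule A.add.finprod_mono_neutral_cong_left) (use that assms(2) cl[OF that(1)] in \<open>auto simp: Pi_iff subset_iff\<close>)
    then show ?thesis using that(1) by (simp add: lin_ext_def)
  qed
  have supp: "finite {s. f s \<noteq> \<zero>\<^bsub>R\<^esub>}" "{s. f s \<noteq> \<zero>\<^bsub>R\<^esub>} \<subseteq> I"
    if "f \<in> carrier (free_module R I)" for f
    using that by (auto simp: free_module_carrier)
  show ?thesis
    unfolding mod_hom_def
  proof (intro CollectI conjI ballI)
    show "lin_ext R I A v \<in> carrier (free_module R I) \<rightarrow>\<^sub>E carrier A"
      by (auto simp: lin_ext_def v intro!: A.finsum_closed)
  next
    fix x y assume x: "x \<in> carrier (free_module R I)" and y: "y \<in> carrier (free_module R I)"
    define S where "S = {s. x s \<noteq> \<zero>\<^bsub>R\<^esub>} \<union> {s. y s \<noteq> \<zero>\<^bsub>R\<^esub>}"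
    have S: "finite S" "S \<subseteq> I" using supp[OF x] supp[OF y] by (simp_all add: S_def)
    have xS: "{s. x s \<noteq> \<zero>\<^bsub>R\<^esub>} \<subseteq> S" and yS: "{s. y s \<noteq> \<zero>\<^bsub>R\<^esub>} \<subseteq> S"
      by (simp_all add: S_def)
    have xyS: "{s. (x \<oplus>\<^bsub>free_module R I\<^esub> y) s \<noteq> \<zero>\<^bsub>R\<^esub>} \<subseteq> S"
      by (auto simp: S_def)
    have vS: "s \<in> S \<Longrightarrow> v s \<in> carrier A" for s using S assms(2) by auto
    have "lin_ext R I A v (x \<oplus>\<^bsub>free_module R I\<^esub> y) =
        (\<Oplus>\<^bsub>A\<^esub>s\<in>S. (x s \<oplus>\<^bsub>R\<^esub> y s) \<odot>\<^bsub>A\<^esub> v s)"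
      unfolding ext[OF F.a_closed[OF x y] S(1) xyS S(2)] by simp
    also have "\<dots> = (\<Oplus>\<^bsub>A\<^esub>s\<in>S. x s \<odot>\<^bsub>A\<^esub> v s \<oplus>\<^bsub>A\<^esub> y s \<odot>\<^bsub>A\<^esub> v s)"
      by (intro A.finsum_cong') (auto simp: cl[OF x] cl[OF y] vS A.smult_l_distr)
    also have "\<dots> = (\<Oplus>\<^bsub>A\<^esub>s\<in>S. x s \<odot>\<^bsub>A\<^esub> v s) \<oplus>\<^bsub>A\<^esub> (\<Oplus>\<^bsub>A\<^esub>s\<in>S. y s \<odot>\<^bsub>A\<^esub> v s)"
      by (intro A.finsum_addf) (auto simp: cl[OF x] cl[OF y] vS)
    also have "\<dots> = lin_ext R I A v x \<oplus>\<^bsub>A\<^esub> lin_ext R I A v y"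
      unfolding ext[OF x S(1) xS S(2)] ext[OF y S(1) yS S(2)] ..
    finally show "lin_ext R I A v (x \<oplus>\<^bsub>free_module R I\<^esub> y) =
        lin_ext R I A v x \<oplus>\<^bsub>A\<^esub> lin_ext R I A v y" .
  next
    fix r x assume r: "r \<in> carrier R" and x: "x \<in> carrier (free_module R I)"
    define S where "S = {s. x s \<noteq> \<zero>\<^bsub>R\<^esub>}"
    have S: "finite S" "S \<subseteq> I" using supp[OF x] by (simp_all add: S_def)
    have xS: "{s. x s \<noteq> \<zero>\<^bsub>R\<^esub>} \<subseteq> S" by (simp add: S_def)
    have rxS: "{s. (r \<odot>\<^bsub>free_module R I\<^esub> x) s \<noteq> \<zero>\<^bsub>R\<^esub>} \<subseteq> S"
      using r by (auto simp: S_def)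
    have vS: "s \<in> S \<Longrightarrow> v s \<in> carrier A" for s using S assms(2) by auto
    have "lin_ext R I A v (r \<odot>\<^bsub>free_module R I\<^esub> x) = (\<Oplus>\<^bsub>A\<^esub>s\<in>S. (r \<otimes>\<^bsub>R\<^esub> x s) \<odot>\<^bsub>A\<^esub> v s)"
      unfolding ext[OF F.smult_closed[OF r x] S(1) rxS S(2)] by simp
    also have "\<dots> = (\<Oplus>\<^bsub>A\<^esub>s\<in>S. r \<odot>\<^bsub>A\<^esub> (x s \<odot>\<^bsub>A\<^esub> v s))"
      by (intro A.finsum_cong') (auto simp: cl[OF x] r vS A.smult_assoc1)
    also have "\<dots> = r \<odot>\<^bsub>A\<^esub> (\<Oplus>\<^bsub>A\<^esub>s\<in>S. x s \<odot>\<^bsub>A\<^esub> v s)"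
      by (intro A.finsum_smult_ldistr[symmetric]) (auto simp: S r cl[OF x] vS)
    also have "\<dots> = r \<odot>\<^bsub>A\<^esub> lin_ext R I A v x"
      unfolding ext[OF x S(1) xS S(2)] ..
    finally show "lin_ext R I A v (r \<odot>\<^bsub>free_module R I\<^esub> x) = r \<odot>\<^bsub>A\<^esub> lin_ext R I A v x" .
  qed
qed

lemma lin_ext_basis:
  assumes "module R A" "v \<in> I \<rightarrow> carrier A" "s \<in> I"
  shows "lin_ext R I A v (free_basis R s) = v s"
proof -
  interpret A: module R A by fact
  have cr: "cring R" by unfold_locales
  have vs: "v s \<in> carrier A" using assms by auto
  show ?thesis
  proof (cases "\<one>\<^bsub>R\<^esub> = \<zero>\<^bsub>R\<^esub>")
    case True
    then have "v s = \<zero>\<^bsub>A\<^esub>" using A.smult_one[OF vs] A.smult_l_null[OF vs] by simp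
    moreover have "{s'. free_basis R s s' \<noteq> \<zero>\<^bsub>R\<^esub>} = {}" using True by (simp add: free_basis_def)
    ultimately show ?thesis
      by (simp add: lin_ext_def free_basis_closed[OF cr assms(3)] A.finsum_empty)
  next
    case False
    then have "{s'. free_basis R s s' \<noteq> \<zero>\<^bsub>R\<^esub>} = {s}" by (auto simp: free_basis_def)
    then show ?thesis using vs
      by (simp add: lin_ext_def free_basis_closed[OF cr assms(3)] A.finsum_insert A.finsum_empty)
         (simp add: free_basis_def)
  qed
qed

lemma mod_hom_zero:
  assumes "module R A" "module R B" "h \<in> mod_hom R A B"
  shows "h \<zero>\<^bsub>A\<^esub> = \<zero>\<^bsub>B\<^esub>"
proof -
  interpret A: module R A by fact
  interpret B: module R B by fact
  have "h (\<zero>\<^bsub>R\<^esub> \<odot>\<^bsub>A\<^esub> \<zero>\<^bsub>A\<^esub>) = \<zero>\<^bsub>R\<^esub> \<odot>\<^bsub>B\<^esub> h \<zero>\<^bsub>A\<^esub>" "h \<zero>\<^bsub>A\<^esub> \<in> carrier B"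
    using assms(3) A.zero_closed A.R.zero_closed by (auto simp: mod_hom_def simp del: A.smult_l_null A.smult_r_null)
  then show ?thesis by simp
qed

lemma mod_hom_closed: "h \<in> mod_hom R A B \<Longrightarrow> x \<in> carrier A \<Longrightarrow> h x \<in> carrier B"
  by (auto simp: mod_hom_def)

lemma mod_hom_linear:
  assumes "module R A" "h \<in> mod_hom R A B" "r \<in> carrier R" "x \<in> carrier A" "y \<in> carrier A"
  shows "h (r \<odot>\<^bsub>A\<^esub> x \<oplus>\<^bsub>A\<^esub> y) = r \<odot>\<^bsub>B\<^esub> h x \<oplus>\<^bsub>B\<^esub> h y"
proof -
  have rx: "r \<odot>\<^bsub>A\<^esub> x \<in> carrier A" using module.smult_closed[OF assms(1,3,4)] .
  have add: "\<forall>x\<in>carrier A. \<forall>y\<in>carrier A. h (x \<oplus>\<^bsub>A\<^esub> y) = h x \<oplus>\<^bsub>B\<^esub> h y"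
    and smult: "\<forall>r\<in>carrier R. \<forall>x\<in>carrier A. h (r \<odot>\<^bsub>A\<^esub> x) = r \<odot>\<^bsub>B\<^esub> h x"
    using assms(2) by (simp_all add: mod_hom_def)
  show ?thesis
    unfolding add[rule_format, OF rx assms(5)] smult[rule_format, OF assms(3,4)] ..
qed

lemma projective_free_module:
  fixes R :: "('a, 'r) ring_scheme" and I :: "'s set"
  assumes "cring R"
  shows "projective_module R (free_module R I)"
  unfolding projective_module_def
proof (intro conjI allI impI)
  let ?F = "free_module R I"
  show F: "module R ?F" using module_free_module[OF assms] .
  fix A :: "('a, ('s \<Rightarrow> 'a) \<Rightarrow> 'a) module" and B :: "('a, 's \<Rightarrow> 'a) module" and g f
  assume H: "module R A \<and> module R B \<and> g \<in> mod_hom R A B \<and> g ` carrier A = carrier B \<and>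
    f \<in> mod_hom R ?F B"
  from H have A: "module R A" and B: "module R B" and g: "g \<in> mod_hom R A B"
    and surj: "g ` carrier A = carrier B" and f: "f \<in> mod_hom R ?F B"
    by blast+
  have "\<forall>s\<in>I. \<exists>a\<in>carrier A. g a = f (free_basis R s)"
  proof
    fix s assume "s \<in> I"
    then have "f (free_basis R s) \<in> carrier B"
      using mod_hom_closed[OF f free_basis_closed[OF assms]] by blast
    then have "f (free_basis R s) \<in> g ` carrier A" unfolding surj .
    then show "\<exists>a\<in>carrier A. g a = f (free_basis R s)" by (metis imageE)
  qed
  then obtain v where v: "\<And>s. s \<in> I \<Longrightarrow> v s \<in> carrier A \<and> g (v s) = f (free_basis R s)"
    by metis
  let ?h = "lin_ext R I A v"
  have vI: "v \<in> I \<rightarrow> carrier A" using v by (intro Pi_I) blast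
  have h: "?h \<in> mod_hom R ?F A" by (rule lin_ext_hom[OF A vI])
  have "g (?h x) = f x" if "x \<in> carrier ?F" for x
    using assms that
  proof (induction x rule: free_module_induct)
    case zero
    show ?case
      unfolding mod_hom_zero[OF F A h] mod_hom_zero[OF F B f]
      by (rule mod_hom_zero[OF A B g])
  next
    case (step r s x)
    have b: "free_basis R s \<in> carrier ?F" using free_basis_closed[OF assms step(2)] .
    have gb: "g (?h (free_basis R s)) = f (free_basis R s)"
      unfolding lin_ext_basis[OF A vI step(2)] using v[OF step(2)] ..
    show ?case
      unfolding mod_hom_linear[OF F h step(1) b step(3)] mod_hom_linear[OF F f step(1) b step(3)]
        mod_hom_linear[OF A g step(1) mod_hom_closed[OF h b] mod_hom_closed[OF h step(3)]]
        gb step(4) ..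
  qed
  then show "\<exists>h\<in>mod_hom R ?F A. \<forall>x\<in>carrier ?F. g (h x) = f x" using h by blast
qed

lemma syzygy_step:
  assumes A: "module R A" and h: "h \<in> mod_hom R (free_module R I) A"
    and J: "J = {Rel l | l. set l \<subseteq> I \<times> carrier R \<and> h (list_comb R l) = \<zero>\<^bsub>A\<^esub>}"
  defines "d \<equiv> lin_ext R J (free_module R I) (\<lambda>s. list_comb R (rel_val s))"
  shows "d \<in> mod_hom R (free_module R J) (free_module R I)"
    and "d ` carrier (free_module R J) = {x \<in> carrier (free_module R I). h x = \<zero>\<^bsub>A\<^esub>}"
proof -
  interpret A: module R A by fact
  have cr: "cring R" by unfold_locales
  let ?F = "free_module R I" and ?G = "free_module R J"
  let ?K = "{x \<in> carrier ?F. h x = \<zero>\<^bsub>A\<^esub>}"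
  interpret F: module R ?F using module_free_module[OF cr] .
  interpret G: module R ?G using module_free_module[OF cr] .
  have v: "(\<lambda>s. list_comb R (rel_val s)) \<in> J \<rightarrow> carrier ?F"
    using list_comb_closed[OF cr] by (auto simp: J)
  show d: "d \<in> mod_hom R ?G ?F"
    unfolding d_def by (rule lin_ext_hom[OF F.module_axioms v])
  have K: "r \<odot>\<^bsub>?F\<^esub> x \<oplus>\<^bsub>?F\<^esub> y \<in> ?K" if "r \<in> carrier R" "x \<in> ?K" "y \<in> ?K" for r x y
  proof -
    have x: "x \<in> carrier ?F" "h x = \<zero>\<^bsub>A\<^esub>" and y: "y \<in> carrier ?F" "h y = \<zero>\<^bsub>A\<^esub>"
      using that by auto
    have "h (r \<odot>\<^bsub>?F\<^esub> x \<oplus>\<^bsub>?F\<^esub> y) = \<zero>\<^bsub>A\<^esub>"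
      unfolding mod_hom_linear[OF F.module_axioms h that(1) x(1) y(1)] x(2) y(2)
      using that(1) by simp
    then show ?thesis
      using F.a_closed[OF F.smult_closed[OF that(1) x(1)] y(1)] by blast
  qed
  have "d x \<in> ?K" if "x \<in> carrier ?G" for x
    using cr that
  proof (induction x rule: free_module_induct)
    case zero
    show ?case
      unfolding mod_hom_zero[OF G.module_axioms F.module_axioms d]
      using mod_hom_zero[OF F.module_axioms A.module_axioms h] F.zero_closed by blast
  next
    case (step r s x)
    have b: "free_basis R s \<in> carrier ?G" using free_basis_closed[OF cr step(2)] .
    have "d (free_basis R s) = list_comb R (rel_val s)"
      unfolding d_def by (rule lin_ext_basis[OF F.module_axioms v step(2)])
    moreover have "list_comb R (rel_val s) \<in> ?K"
      using step(2) list_comb_closed[OF cr] by (auto simp: J)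
    ultimately have "d (free_basis R s) \<in> ?K" by simp
    then show ?case
      unfolding mod_hom_linear[OF G.module_axioms d step(1) b step(3)]
      by (rule K[OF step(1) _ step(4)])
  qed
  moreover have "x \<in> d ` carrier ?G" if "x \<in> ?K" for x
  proof -
    have x: "x \<in> carrier ?F" using that by simp
    obtain l where l: "set l \<subseteq> I \<times> carrier R" "list_comb R l = x"
      using list_comb_surj[OF cr x] .
    then have s: "Rel l \<in> J" using that by (auto simp: J)
    have "d (free_basis R (Rel l)) = x"
      unfolding d_def lin_ext_basis[OF F.module_axioms v s] using l(2) by simp
    then show ?thesis using free_basis_closed[OF cr s] by (metis imageI)
  qed
  ultimately show "d ` carrier ?G = ?K" by blast
qed

theorem projective_resolution_free_res:
  assumes M: "module R M"
  shows "projective_resolution R M (free_res R M) (free_res_diff R M) (free_res_aug R M)"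
proof -
  interpret M: module R M by fact
  have cr: "cring R" by unfold_locales
  let ?B = "syz_basis R M"
  have v: "gen_val \<in> ?B 0 \<rightarrow> carrier M" by auto
  have aug: "free_res_aug R M \<in> mod_hom R (free_res R M 0) M"
    unfolding free_res_aug_def free_res_def by (rule lin_ext_hom[OF M v])
  have surj: "free_res_aug R M ` carrier (free_res R M 0) = carrier M"
  proof
    show "free_res_aug R M ` carrier (free_res R M 0) \<subseteq> carrier M"
      using aug by (auto simp: mod_hom_def)
    show "carrier M \<subseteq> free_res_aug R M ` carrier (free_res R M 0)"
    proof
      fix m assume "m \<in> carrier M"
      then have s: "Gen m \<in> ?B 0" by simp
      show "m \<in> free_res_aug R M ` carrier (free_res R M 0)"
        using lin_ext_basis[OF M v s] free_basis_closed[OF cr s]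
        unfolding free_res_aug_def free_res_def by (metis image_eqI syz.sel(1))
    qed
  qed
  have B1: "?B (Suc 0) = {Rel l | l. set l \<subseteq> ?B 0 \<times> carrier R \<and>
      free_res_aug R M (list_comb R l) = \<zero>\<^bsub>M\<^esub>}"
    by (simp add: free_res_aug_def)
  note step0 = syzygy_step[OF M aug[unfolded free_res_def] B1,
      folded free_res_def, folded free_res_diff_def]
  have B2: "?B (Suc (Suc i)) = {Rel l | l. set l \<subseteq> ?B (Suc i) \<times> carrier R \<and>
      free_res_diff R M i (list_comb R l) = \<zero>\<^bsub>free_res R M i\<^esub>}" for i
    by (simp add: free_res_diff_def free_res_def)
  have F: "module R (free_res R M i)" for i
    unfolding free_res_def by (rule module_free_module[OF cr])
  have diff: "free_res_diff R M i \<in> mod_hom R (free_res R M (Suc i)) (free_res R M i)" for i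
  proof (induction i)
    case 0
    show ?case using step0(1) .
  next
    case (Suc i)
    show ?case
      using syzygy_step(1)[OF F Suc[unfolded free_res_def[of R M "Suc i"]] B2,
        folded free_res_def, folded free_res_diff_def] .
  qed
  have ex: "free_res_diff R M (Suc i) ` carrier (free_res R M (Suc (Suc i))) =
      {x \<in> carrier (free_res R M (Suc i)). free_res_diff R M i x = \<zero>\<^bsub>free_res R M i\<^esub>}" for i
    using syzygy_step(2)[OF F diff[of i, unfolded free_res_def[of R M "Suc i"]] B2,
        folded free_res_def, folded free_res_diff_def] .
  show ?thesis
    unfolding projective_resolution_def
    using aug surj diff ex step0(2) projective_free_module[OF cr]
    by (auto simp: free_res_def)
qed

end

theory Submission
  imports Defs
begin

text \<open>
  The proof is an induction on the dimension of \<open>N\<close>. Killing the submodule \<open>T\<close> of \<open>I\<close>-torsion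
  elements of \<open>N\<close> does not change \<open>H\<^sup>j(M, N)\<close> for \<open>j \<ge> t\<close>, since \<open>H\<^sup>j(M, T) = 0\<close> for
  all \<open>j > pd M\<close>. As \<open>N/T\<close> has finitely many associated primes, and none of them contains \<open>I\<close>,
  prime avoidance provides an \<open>x \<in> I\<close> that is regular on \<open>N/T\<close>. The module \<open>N/(T + xN)\<close> has smaller
  dimension, and the long exact sequence of \<open>0 \<rightarrow> N/T \<rightarrow> N/T \<rightarrow> N/(T + xN) \<rightarrow> 0\<close>, in which the first map is
  multiplication by \<open>x\<close>, passes the hypothesis on to \<open>N/(T + xN)\<close> and the conclusion back to \<open>N/T\<close>. In
  the second direction let \<open>U\<close> be the image of \<open>H\<^sup>t(M, N/T)\<close> in \<open>B = H\<^sup>t(M, N/(T + xN))\<close>. Then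
  \<open>U/IU\<close> is \<open>H\<^sup>t(M, N/T)/I H\<^sup>t(M, N/T)\<close>, because \<open>x \<in> I\<close>. It is a submodule of \<open>B/IU\<close>, which is an
  extension of the Artinian module \<open>B/IB\<close> by \<open>IB/IU\<close>; and \<open>IB/IU\<close> has a finite filtration whose factors
  are quotients of \<open>B/U\<close>, a submodule of \<open>H\<^sup>t\<^sup>+\<^sup>1(M, N/T)\<close>.

  All coefficient modules in this induction are quotients \<open>N/L\<close> of one module \<open>N\<close>. Their
  cohomology is expressed inside a single complex \<open>G\<close>, the direct limit of the complexes of
  homomorphisms from the standard resolutions of the \<open>M/I\<^sup>nM\<close> to \<open>N\<close>: homomorphisms with values in \<open>L\<close>
  form a subcomplex \<open>C L\<close>, and \<open>H\<^sup>j(M, N/L)\<close> is the quotient of \<open>{g. d g \<in> C L}\<close> by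
  \<open>d G + C L\<close>. That a subquotient \<open>B/A\<close> is Artinian becomes the descending chain condition for the
  submodules between \<open>A\<close> and \<open>B\<close> (\<open>dcc\<close>). The locale \<open>filtered_complex\<close> collects what the induction
  requires of \<open>G\<close>.

  The vanishing for torsion coefficients \<open>T\<close> (\<open>ext_limit_vanishes\<close>) is proved without injective
  resolutions. Let \<open>P\<close> be a projective resolution of \<open>M\<close> with \<open>P j = 0\<close>, and let \<open>Y\<close> be a resolution of \<open>I\<^sup>nM\<close> by
  finitely generated free modules. The mapping cone of a lift \<open>Y \<rightarrow> P\<close> of the inclusion resolves \<open>M/I\<^sup>nM\<close>, and in
  degree \<open>j\<close> it is the finitely generated module \<open>Y (j - 1)\<close>. A homomorphism from it to \<open>T\<close> therefore kills
  \<open>I\<^sup>c Y (j - 1)\<close> for some \<open>c\<close>. By Artin--Rees, for large \<open>m\<close> the inclusion of \<open>I\<^sup>mM\<close> in \<open>I\<^sup>nM\<close> lifts to a map of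
  resolutions with image in \<open>I\<^sup>c Y (j - 1)\<close> in degree \<open>j - 1\<close>, so that the class of the homomorphism vanishes at
  stage \<open>m\<close>. Only a weak form of Artin--Rees is necessary, and it follows from the ascending chain condition.
\<close>

section \<open>Submodules\<close>

lemma (in module) submodule_iff:
  "submodule H R M \<longleftrightarrow> H \<subseteq> carrier M \<and> \<zero>\<^bsub>M\<^esub> \<in> H \<and>
    (\<forall>x\<in>H. \<forall>y\<in>H. x \<oplus>\<^bsub>M\<^esub> y \<in> H) \<and> (\<forall>r\<in>carrier R. \<forall>x\<in>H. r \<odot>\<^bsub>M\<^esub> x \<in> H)"
  (is "_ \<longleftrightarrow> ?P")
proof
  assume H: "submodule H R M"
  then have "\<zero>\<^bsub>M\<^esub> \<in> H"
    using subgroup.one_closed[OF submodule.axioms(1)] by fastforce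
  then show ?P using submoduleE[OF H] by blast
next
  assume P: ?P
  show "submodule H R M"
  proof (rule submoduleI)
    fix a assume a: "a \<in> H"
    then have "(\<ominus>\<^bsub>R\<^esub> \<one>\<^bsub>R\<^esub>) \<odot>\<^bsub>M\<^esub> a \<in> H" using P by blast
    moreover have "(\<ominus>\<^bsub>R\<^esub> \<one>\<^bsub>R\<^esub>) \<odot>\<^bsub>M\<^esub> a = \<ominus>\<^bsub>M\<^esub> a"
      using a P by (subst smult_l_minus) auto
    ultimately show "\<ominus>\<^bsub>M\<^esub> a \<in> H" by simp
  qed (use P in auto)
qed

lemma (in module) submoduleD:
  assumes "submodule H R M"
  shows "H \<subseteq> carrier M" "x \<in> H \<Longrightarrow> x \<in> carrier M" "\<zero>\<^bsub>M\<^esub> \<in> H"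
    "x \<in> H \<Longrightarrow> y \<in> H \<Longrightarrow> x \<oplus>\<^bsub>M\<^esub> y \<in> H"
    "r \<in> carrier R \<Longrightarrow> x \<in> H \<Longrightarrow> r \<odot>\<^bsub>M\<^esub> x \<in> H"
    "x \<in> H \<Longrightarrow> \<ominus>\<^bsub>M\<^esub> x \<in> H"
    "x \<in> H \<Longrightarrow> y \<in> H \<Longrightarrow> x \<ominus>\<^bsub>M\<^esub> y \<in> H"
  using assms submoduleE[OF assms] by (auto simp: submodule_iff a_minus_def)

lemma (in module) submodule_add_cancel:
  assumes "submodule H R M" "x \<in> H" "y \<in> carrier M" "x \<oplus>\<^bsub>M\<^esub> y \<in> H"
  shows "y \<in> H"
proof -
  have x: "x \<in> carrier M" using submoduleD(2)[OF assms(1,2)] .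
  have "\<ominus>\<^bsub>M\<^esub> x \<oplus>\<^bsub>M\<^esub> (x \<oplus>\<^bsub>M\<^esub> y) \<in> H"
    by (rule submoduleD(4)[OF assms(1) submoduleD(6)[OF assms(1,2)] assms(4)])
  then show ?thesis using x assms(3) M.r_neg1 by simp
qed

lemma (in module) submodule_Int:
  "submodule H R M \<Longrightarrow> submodule K R M \<Longrightarrow> submodule (H \<inter> K) R M"
  by (auto simp: submodule_iff)

lemma (in module) submodule_zero: "submodule {\<zero>\<^bsub>M\<^esub>} R M"
  by (auto simp: submodule_iff)

lemma set_add_iff: "x \<in> A <+>\<^bsub>G\<^esub> B \<longleftrightarrow> (\<exists>a\<in>A. \<exists>b\<in>B. x = a \<oplus>\<^bsub>G\<^esub> b)"
  by (auto simp: set_add_def')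

lemma set_addI: "a \<in> A \<Longrightarrow> b \<in> B \<Longrightarrow> a \<oplus>\<^bsub>G\<^esub> b \<in> A <+>\<^bsub>G\<^esub> B"
  by (auto simp: set_add_iff)

lemma set_addE:
  assumes "x \<in> A <+>\<^bsub>G\<^esub> B"
  obtains a b where "a \<in> A" "b \<in> B" "x = a \<oplus>\<^bsub>G\<^esub> b"
  using assms by (auto simp: set_add_iff)

lemma set_add_mono: "A \<subseteq> A' \<Longrightarrow> B \<subseteq> B' \<Longrightarrow> A <+>\<^bsub>G\<^esub> B \<subseteq> A' <+>\<^bsub>G\<^esub> B'"
  unfolding set_add_iff subset_iff by blast

lemma (in module) add_swap4:
  assumes "a \<in> carrier M" "b \<in> carrier M" "c \<in> carrier M" "d \<in> carrier M"
  shows "(a \<oplus>\<^bsub>M\<^esub> b) \<oplus>\<^bsub>M\<^esub> (c \<oplus>\<^bsub>M\<^esub> d) = (a \<oplus>\<^bsub>M\<^esub> c) \<oplus>\<^bsub>M\<^esub> (b \<oplus>\<^bsub>M\<^esub> d)"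
  using assms by (simp add: M.a_ac)

lemma (in module) submodule_sum:
  assumes H: "submodule H R M" and K: "submodule K R M"
  shows "submodule (H <+>\<^bsub>M\<^esub> K) R M"
  unfolding submodule_iff
proof (intro conjI subsetI ballI)
  note h = submoduleD[OF H] and k = submoduleD[OF K]
  show "x \<in> carrier M" if "x \<in> H <+>\<^bsub>M\<^esub> K" for x
    using that h k by (auto simp: set_add_iff)
  show "\<zero>\<^bsub>M\<^esub> \<in> H <+>\<^bsub>M\<^esub> K"
    unfolding set_add_iff by (intro bexI[OF _ h(3)] bexI[OF _ k(3)]) simp
  show "x \<oplus>\<^bsub>M\<^esub> y \<in> H <+>\<^bsub>M\<^esub> K" if xy: "x \<in> H <+>\<^bsub>M\<^esub> K" "y \<in> H <+>\<^bsub>M\<^esub> K" for x y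
  proof -
    obtain a b c d where *: "a \<in> H" "b \<in> K" "x = a \<oplus>\<^bsub>M\<^esub> b" "c \<in> H" "d \<in> K" "y = c \<oplus>\<^bsub>M\<^esub> d"
      using xy by (auto simp: set_add_iff)
    then have "x \<oplus>\<^bsub>M\<^esub> y = (a \<oplus>\<^bsub>M\<^esub> c) \<oplus>\<^bsub>M\<^esub> (b \<oplus>\<^bsub>M\<^esub> d)" using add_swap4 h(2) k(2) by blast
    then show ?thesis using * h(4) k(4) unfolding set_add_iff by blast
  qed
  show "r \<odot>\<^bsub>M\<^esub> x \<in> H <+>\<^bsub>M\<^esub> K" if rx: "r \<in> carrier R" "x \<in> H <+>\<^bsub>M\<^esub> K" for r x
  proof -
    obtain a b where *: "a \<in> H" "b \<in> K" "x = a \<oplus>\<^bsub>M\<^esub> b" using rx by (auto simp: set_add_iff)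
    then have "r \<odot>\<^bsub>M\<^esub> x = r \<odot>\<^bsub>M\<^esub> a \<oplus>\<^bsub>M\<^esub> r \<odot>\<^bsub>M\<^esub> b" using smult_r_distr rx(1) h(2) k(2) by blast
    then show ?thesis using * h(5) k(5) rx(1) unfolding set_add_iff by blast
  qed
qed

lemma (in module) sum_ge:
  assumes "submodule H R M" "submodule K R M"
  shows "H \<subseteq> H <+>\<^bsub>M\<^esub> K" "K \<subseteq> H <+>\<^bsub>M\<^esub> K"
proof
  fix x assume "x \<in> H"
  then show "x \<in> H <+>\<^bsub>M\<^esub> K"
    unfolding set_add_iff using submoduleD[OF assms(1)] submoduleD(3)[OF assms(2)] M.r_zero by metis
next
  show "K \<subseteq> H <+>\<^bsub>M\<^esub> K"
  proof
  fix x assume "x \<in> K"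
  then show "x \<in> H <+>\<^bsub>M\<^esub> K"
    unfolding set_add_iff using submoduleD[OF assms(2)] submoduleD(3)[OF assms(1)] M.l_zero by metis
  qed
qed

lemma (in module) sum_least:
  assumes "submodule S R M" "H \<subseteq> S" "K \<subseteq> S"
  shows "H <+>\<^bsub>M\<^esub> K \<subseteq> S"
proof
  fix x assume "x \<in> H <+>\<^bsub>M\<^esub> K"
  then obtain a b where "a \<in> H" "b \<in> K" "x = a \<oplus>\<^bsub>M\<^esub> b" by (rule set_addE)
  then show "x \<in> S" using submoduleD(4)[OF assms(1)] assms(2,3) by blast
qed


section \<open>Descending chains between two submodules\<close>

text \<open>
  The quotient \<open>B/A\<close> is Artinian. Chains between two submodules of a fixed module express this for all
  subquotients of that module at once, without a change of type.
\<close>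

definition dcc :: "('a, 'r) ring_scheme \<Rightarrow> ('a, 'b, 'c) module_scheme \<Rightarrow> 'b set \<Rightarrow> 'b set \<Rightarrow> bool" where
  "dcc R M A B \<longleftrightarrow> (\<forall>L :: nat \<Rightarrow> 'b set.
    (\<forall>n. submodule (L n) R M \<and> A \<subseteq> L n \<and> L n \<subseteq> B) \<and> (\<forall>n. L (Suc n) \<subseteq> L n) \<longrightarrow>
    (\<exists>n. \<forall>m\<ge>n. L m = L n))"

lemma dccD:
  assumes "dcc R M A B" "\<And>n. submodule (L n) R M" "\<And>n. A \<subseteq> L n" "\<And>n. L n \<subseteq> B"
    "\<And>n. L (Suc n) \<subseteq> L n"
  shows "\<exists>n. \<forall>m\<ge>n. L m = L n"
  using assms unfolding dcc_def by simp

lemma dcc_subinterval: "dcc R M A B \<Longrightarrow> A \<subseteq> A' \<Longrightarrow> B' \<subseteq> B \<Longrightarrow> dcc R M A' B'"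
  unfolding dcc_def by (meson subset_trans)

lemma dcc_transfer:
  assumes "dcc R' M' A' B'"
    and f: "\<And>S. submodule S R M \<Longrightarrow> A \<subseteq> S \<Longrightarrow> S \<subseteq> B \<Longrightarrow> submodule (f S) R' M' \<and> A' \<subseteq> f S \<and> f S \<subseteq> B'"
    and mono: "\<And>S S'. S \<subseteq> S' \<Longrightarrow> f S \<subseteq> f S'"
    and inj: "\<And>S S'. submodule S R M \<Longrightarrow> A \<subseteq> S \<Longrightarrow> S' \<subseteq> B \<Longrightarrow> submodule S' R M \<Longrightarrow> S \<subseteq> S' \<Longrightarrow>
      f S = f S' \<Longrightarrow> S' \<subseteq> S"
  shows "dcc R M A B"
  unfolding dcc_def
proof (intro allI impI, elim conjE)
  fix L :: "nat \<Rightarrow> _"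
  assume L: "\<forall>n. submodule (L n) R M \<and> A \<subseteq> L n \<and> L n \<subseteq> B" "\<forall>n. L (Suc n) \<subseteq> L n"
  have "\<exists>n. \<forall>m\<ge>n. f (L m) = f (L n)"
    by (rule dccD[OF assms(1)]) (simp_all add: f mono L)
  then obtain n where n: "\<And>m. m \<ge> n \<Longrightarrow> f (L m) = f (L n)" by blast
  have dec: "L m \<subseteq> L n" if "m \<ge> n" for m
    using that by (induction m rule: dec_induct) (use L(2) in blast)+
  have "L m = L n" if "m \<ge> n" for m
    using inj[of "L m" "L n"] L(1) dec[OF that] n[OF that] by blast
  then show "\<exists>n. \<forall>m\<ge>n. L m = L n" by blast
qed

text \<open>
  By the modular law, \<open>L' \<subseteq> L\<close> are equal as soon as \<open>L' \<inter> B = L \<inter> B\<close> and \<open>B + L' = B + L\<close>.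
\<close>

lemma (in module) dcc_trans:
  assumes B: "submodule B R M" and "A \<subseteq> B" "B \<subseteq> C"
    and "dcc R M A B" "dcc R M B C" and C: "submodule C R M"
  shows "dcc R M A C"
  unfolding dcc_def
proof (intro allI impI, elim conjE)
  fix L :: "nat \<Rightarrow> _"
  assume L: "\<forall>n. submodule (L n) R M \<and> A \<subseteq> L n \<and> L n \<subseteq> C" "\<forall>n. L (Suc n) \<subseteq> L n"
  have "\<exists>n. \<forall>m\<ge>n. L m \<inter> B = L n \<inter> B"
    by (rule dccD[OF assms(4)]) (use L assms(2) submodule_Int[OF _ B] in auto)
  then obtain n1 where n1: "\<And>m. m \<ge> n1 \<Longrightarrow> L m \<inter> B = L n1 \<inter> B" by blast
  have "\<exists>n. \<forall>m\<ge>n. B <+>\<^bsub>M\<^esub> L m = B <+>\<^bsub>M\<^esub> L n"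
  proof (rule dccD[OF assms(5)])
    fix n
    show "submodule (B <+>\<^bsub>M\<^esub> L n) R M" using submodule_sum B L by blast
    show "B \<subseteq> B <+>\<^bsub>M\<^esub> L n" using sum_ge B L by blast
    show "B <+>\<^bsub>M\<^esub> L n \<subseteq> C" using sum_least[OF C assms(3)] L by blast
    show "B <+>\<^bsub>M\<^esub> L (Suc n) \<subseteq> B <+>\<^bsub>M\<^esub> L n" using L(2) by (simp add: set_add_mono)
  qed
  then obtain n2 where n2: "\<And>m. m \<ge> n2 \<Longrightarrow> B <+>\<^bsub>M\<^esub> L m = B <+>\<^bsub>M\<^esub> L n2" by blast
  define n where "n = max n1 n2"
  have "L m = L n" if m: "m \<ge> n" for m
  proof
    show le: "L m \<subseteq> L n" using m by (induction m rule: dec_induct) (use L(2) in blast)+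
    have i: "L m \<inter> B = L n \<inter> B" using n1[of m] n1[of n] m by (simp add: n_def)
    have s: "B <+>\<^bsub>M\<^esub> L m = B <+>\<^bsub>M\<^esub> L n" using n2[of m] n2[of n] m by (simp add: n_def)
    have Lm: "submodule (L m) R M" and Ln: "submodule (L n) R M" using L by blast+
    show "L n \<subseteq> L m"
    proof
      fix x assume x: "x \<in> L n"
      then have "x \<in> B <+>\<^bsub>M\<^esub> L m" using s sum_ge(2)[OF B Ln] by blast
      then obtain b y where bs: "b \<in> B" "y \<in> L m" "x = b \<oplus>\<^bsub>M\<^esub> y" by (auto simp: set_add_iff)
      have bc: "b \<in> carrier M" "y \<in> carrier M"
        using submoduleD(2)[OF B bs(1)] submoduleD(2)[OF Lm bs(2)] .
      have "y \<oplus>\<^bsub>M\<^esub> b \<in> L n" using x M.a_comm[OF bc] bs(3) by simp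
      then have "b \<in> L n" using submodule_add_cancel[OF Ln _ bc(1)] bs(2) le by blast
      then have "b \<in> L m" using i bs(1) by blast
      then show "x \<in> L m" using bs submoduleD(4)[OF Lm] by simp
    qed
  qed
  then show "\<exists>n. \<forall>m\<ge>n. L m = L n" by blast
qed

text \<open>
  Both directions of the second isomorphism theorem: \<open>S \<mapsto> S \<inter> Y\<close> and \<open>S \<mapsto> V + S\<close> are inverse to each
  other on the submodules between \<open>V\<close> and \<open>V + Y\<close> and those between \<open>V \<inter> Y\<close> and \<open>Y\<close>.
\<close>

lemma (in module) dcc_second_iso1:
  assumes V: "submodule V R M" and Y: "submodule Y R M" and "dcc R M (V \<inter> Y) Y"
  shows "dcc R M V (V <+>\<^bsub>M\<^esub> Y)"
proof (rule dcc_transfer[OF assms(3), of _ _ _ _ "\<lambda>S. S \<inter> Y"])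
  fix S S' assume S: "submodule S R M" "V \<subseteq> S" "S' \<subseteq> V <+>\<^bsub>M\<^esub> Y" "submodule S' R M" "S \<subseteq> S'" "S \<inter> Y = S' \<inter> Y"
  show "S' \<subseteq> S"
  proof
    fix s assume s: "s \<in> S'"
    then have "s \<in> V <+>\<^bsub>M\<^esub> Y" using S(3) by blast
    then obtain x y where xy: "x \<in> V" "y \<in> Y" "s = x \<oplus>\<^bsub>M\<^esub> y" by (rule set_addE)
    then have "y \<in> S'"
      using submodule_add_cancel[OF S(4), of x y] s S(2,5) submoduleD(2)[OF Y xy(2)] by blast
    then show "s \<in> S" using xy S submoduleD(4)[OF S(1)] by blast
  qed
qed (use submodule_Int Y in auto)

lemma (in module) dcc_second_iso2:
  assumes V: "submodule V R M" and Y: "submodule Y R M" and "dcc R M V (V <+>\<^bsub>M\<^esub> Y)"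
  shows "dcc R M (V \<inter> Y) Y"
proof (rule dcc_transfer[OF assms(3), of _ _ _ _ "\<lambda>S. V <+>\<^bsub>M\<^esub> S"])
  show "V <+>\<^bsub>M\<^esub> S \<subseteq> V <+>\<^bsub>M\<^esub> S'" if "S \<subseteq> S'" for S S' using that by (simp add: set_add_mono)
  show "submodule (V <+>\<^bsub>M\<^esub> S) R M \<and> V \<subseteq> V <+>\<^bsub>M\<^esub> S \<and> V <+>\<^bsub>M\<^esub> S \<subseteq> V <+>\<^bsub>M\<^esub> Y"
    if "submodule S R M" "S \<subseteq> Y" for S
    using that submodule_sum[OF V that(1)] sum_ge(1)[OF V that(1)] set_add_mono[OF order_refl that(2)] by blast
  fix S S' assume S: "submodule S R M" "V \<inter> Y \<subseteq> S" "S' \<subseteq> Y" "submodule S' R M" "S \<subseteq> S'"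
    "V <+>\<^bsub>M\<^esub> S = V <+>\<^bsub>M\<^esub> S'"
  show "S' \<subseteq> S"
  proof
    fix s assume s: "s \<in> S'"
    then have "s \<in> V <+>\<^bsub>M\<^esub> S" using S(6) sum_ge(2)[OF V S(4)] by blast
    then obtain x y where xy: "x \<in> V" "y \<in> S" "s = x \<oplus>\<^bsub>M\<^esub> y" by (auto simp: set_add_iff)
    have yY: "y \<in> Y" using xy(2) S(3,5) by blast
    have xc: "x \<in> carrier M" "y \<in> carrier M"
      using submoduleD(2)[OF V xy(1)] submoduleD(2)[OF Y yY] .
    have "y \<oplus>\<^bsub>M\<^esub> x \<in> Y" using s S(3) M.a_comm[OF xc] xy(3) by auto
    then have "x \<in> Y" using submodule_add_cancel[OF Y yY xc(1)] by blast
    then show "s \<in> S" using xy S(2) submoduleD(4)[OF S(1)] by blast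
  qed
qed

text \<open>
  The submodule \<open>IY\<close> for a submodule \<open>Y\<close> of \<open>M\<close>.
\<close>

definition ideal_span ::
  "('a, 'r) ring_scheme \<Rightarrow> ('a, 'b, 'c) module_scheme \<Rightarrow> 'a set \<Rightarrow> 'b set \<Rightarrow> 'b set" where
  "ideal_span R M I Y = gen_submodule R M {r \<odot>\<^bsub>M\<^esub> y | r y. r \<in> I \<and> y \<in> Y}"

lemma ideal_smult_eq_span: "ideal_smult R I M = ideal_span R M I (carrier M)"
  by (simp add: ideal_smult_def ideal_span_def)

lemma (in module) submodule_gen_submodule:
  assumes "S \<subseteq> carrier M"
  shows "submodule (gen_submodule R M S) R M"
proof -
  have "gen_submodule R M S \<subseteq> carrier M"
    using carrier_is_submodule assms by (auto simp: gen_submodule_def)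
  then show ?thesis by (auto simp: submodule_iff gen_submodule_def)
qed

lemma gen_submodule_le_iff:
  assumes "submodule W R M"
  shows "gen_submodule R M S \<subseteq> W \<longleftrightarrow> S \<subseteq> W"
  using assms by (auto simp: gen_submodule_def)

lemma gen_submodule_ge: "S \<subseteq> gen_submodule R M S"
  by (auto simp: gen_submodule_def)

lemma (in module) submodule_ideal_span:
  assumes "I \<subseteq> carrier R" "Y \<subseteq> carrier M"
  shows "submodule (ideal_span R M I Y) R M"
  unfolding ideal_span_def by (rule submodule_gen_submodule) (use assms in auto)

lemma ideal_span_le_iff:
  assumes "submodule W R M"
  shows "ideal_span R M I Y \<subseteq> W \<longleftrightarrow> (\<forall>r\<in>I. \<forall>y\<in>Y. r \<odot>\<^bsub>M\<^esub> y \<in> W)"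
  unfolding ideal_span_def gen_submodule_le_iff[OF assms] by blast

lemma ideal_span_mem: "r \<in> I \<Longrightarrow> y \<in> Y \<Longrightarrow> r \<odot>\<^bsub>M\<^esub> y \<in> ideal_span R M I Y"
  unfolding ideal_span_def by (rule subsetD[OF gen_submodule_ge]) auto

lemma (in module) submodule_smult_image:
  assumes "x \<in> carrier R" "submodule B R M"
  shows "submodule ((\<lambda>b. x \<odot>\<^bsub>M\<^esub> b) ` B) R M"
  unfolding submodule_iff
proof (intro conjI ballI subsetI)
  note b = submoduleD[OF assms(2)]
  show "\<zero>\<^bsub>M\<^esub> \<in> (\<lambda>b. x \<odot>\<^bsub>M\<^esub> b) ` B" using b(3) assms(1) by (metis imageI smult_r_null)
  fix y assume y: "y \<in> (\<lambda>b. x \<odot>\<^bsub>M\<^esub> b) ` B"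
  then obtain c where c: "c \<in> B" "y = x \<odot>\<^bsub>M\<^esub> c" by blast
  show "y \<in> carrier M" using c b assms(1) by blast
  show "y \<oplus>\<^bsub>M\<^esub> z \<in> (\<lambda>b. x \<odot>\<^bsub>M\<^esub> b) ` B" if "z \<in> (\<lambda>b. x \<odot>\<^bsub>M\<^esub> b) ` B" for z
    using that c b(4) smult_r_distr[OF assms(1) b(2) b(2)] by force
  show "r \<odot>\<^bsub>M\<^esub> y \<in> (\<lambda>b. x \<odot>\<^bsub>M\<^esub> b) ` B" if "r \<in> carrier R" for r
  proof -
    have "r \<odot>\<^bsub>M\<^esub> y = x \<odot>\<^bsub>M\<^esub> (r \<odot>\<^bsub>M\<^esub> c)"
      unfolding c(2) smult_assoc1[OF that assms(1) b(2)[OF c(1)], symmetric]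
        smult_assoc1[OF assms(1) that b(2)[OF c(1)], symmetric] R.m_comm[OF that assms(1)] ..
    then show ?thesis using b(5)[OF that c(1)] by blast
  qed
qed

text \<open>
  Multiplication by \<open>x\<close> induces a surjection from \<open>B/U\<close> to \<open>(W + xB)/W\<close>.
\<close>

lemma (in module) dcc_smult:
  assumes U: "submodule U R M" and B: "submodule B R M" and "U \<subseteq> B" "dcc R M U B"
    and W: "submodule W R M" and x: "x \<in> carrier R" and xU: "\<And>u. u \<in> U \<Longrightarrow> x \<odot>\<^bsub>M\<^esub> u \<in> W"
  shows "dcc R M W (W <+>\<^bsub>M\<^esub> (\<lambda>b. x \<odot>\<^bsub>M\<^esub> b) ` B)"
proof (rule dcc_transfer[OF assms(4), of _ _ _ _ "\<lambda>S. {b \<in> B. x \<odot>\<^bsub>M\<^esub> b \<in> S}"])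
  fix S assume S: "submodule S R M" "W \<subseteq> S"
  note b = submoduleD[OF B] and s = submoduleD[OF S(1)]
  have "submodule {b \<in> B. x \<odot>\<^bsub>M\<^esub> b \<in> S} R M"
    unfolding submodule_iff
  proof (intro conjI ballI)
    show "\<zero>\<^bsub>M\<^esub> \<in> {b \<in> B. x \<odot>\<^bsub>M\<^esub> b \<in> S}" using b(3) s(3) smult_r_null[OF x] by simp
    fix y assume y: "y \<in> {b \<in> B. x \<odot>\<^bsub>M\<^esub> b \<in> S}"
    show "r \<odot>\<^bsub>M\<^esub> y \<in> {b \<in> B. x \<odot>\<^bsub>M\<^esub> b \<in> S}" if r: "r \<in> carrier R" for r
    proof -
      have yM: "y \<in> carrier M" using b y by blast
      have "x \<odot>\<^bsub>M\<^esub> (r \<odot>\<^bsub>M\<^esub> y) = r \<odot>\<^bsub>M\<^esub> (x \<odot>\<^bsub>M\<^esub> y)"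
        using smult_assoc1[OF r x yM] smult_assoc1[OF x r yM] R.m_comm[OF r x] by simp
      then show ?thesis using b(5)[OF r] s(5)[OF r] y by simp
    qed
    show "y \<oplus>\<^bsub>M\<^esub> z \<in> {b \<in> B. x \<odot>\<^bsub>M\<^esub> b \<in> S}" if "z \<in> {b \<in> B. x \<odot>\<^bsub>M\<^esub> b \<in> S}" for z
      using that y b(4) s(4) smult_r_distr[OF x b(2) b(2)] by simp
  qed (use b in blast)
  then show "submodule {b \<in> B. x \<odot>\<^bsub>M\<^esub> b \<in> S} R M \<and> U \<subseteq> {b \<in> B. x \<odot>\<^bsub>M\<^esub> b \<in> S} \<and>
      {b \<in> B. x \<odot>\<^bsub>M\<^esub> b \<in> S} \<subseteq> B"
    using assms(3) xU S(2) by blast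
next
  fix S S' assume S: "submodule S R M" "W \<subseteq> S" "S' \<subseteq> W <+>\<^bsub>M\<^esub> (\<lambda>b. x \<odot>\<^bsub>M\<^esub> b) ` B" "submodule S' R M"
    "S \<subseteq> S'" "{b \<in> B. x \<odot>\<^bsub>M\<^esub> b \<in> S} = {b \<in> B. x \<odot>\<^bsub>M\<^esub> b \<in> S'}"
  show "S' \<subseteq> S"
  proof
    fix s assume s: "s \<in> S'"
    then have "s \<in> W <+>\<^bsub>M\<^esub> (\<lambda>b. x \<odot>\<^bsub>M\<^esub> b) ` B" using S(3) by blast
    then obtain w b where wb: "w \<in> W" "b \<in> B" "s = w \<oplus>\<^bsub>M\<^esub> x \<odot>\<^bsub>M\<^esub> b" by (auto elim: set_addE)
    then have "x \<odot>\<^bsub>M\<^esub> b \<in> S'"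
      using submodule_add_cancel[OF S(4), of w "x \<odot>\<^bsub>M\<^esub> b"] s S(2,5)
        smult_closed[OF x submoduleD(2)[OF B wb(2)]] by blast
    then have "x \<odot>\<^bsub>M\<^esub> b \<in> S" using S(6) wb(2) by blast
    then show "s \<in> S" using wb S(2) submoduleD(4)[OF S(1)] by blast
  qed
qed auto

text \<open>
  For generators of an ideal \<open>I\<close> this bounds \<open>IB/IU\<close>: adding the submodules \<open>xB\<close> one at a time gives
  a filtration whose factors are quotients of \<open>B/U\<close>.
\<close>

lemma (in module) dcc_smult_finite:
  assumes "finite V" "V \<subseteq> carrier R"
    and U: "submodule U R M" and B: "submodule B R M" and "U \<subseteq> B" "dcc R M U B"
    and W: "submodule W R M" and xU: "\<And>x u. x \<in> V \<Longrightarrow> u \<in> U \<Longrightarrow> x \<odot>\<^bsub>M\<^esub> u \<in> W"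
  shows "\<exists>W'. submodule W' R M \<and> W \<subseteq> W' \<and> (\<forall>x\<in>V. \<forall>b\<in>B. x \<odot>\<^bsub>M\<^esub> b \<in> W') \<and> dcc R M W W'"
  using assms(1,2) xU
proof (induction V rule: finite_induct)
  case empty
  have "dcc R M W W" unfolding dcc_def by (meson subset_antisym subset_trans)
  then show ?case using W by blast
next
  case (insert x V)
  then obtain W' where W': "submodule W' R M" "W \<subseteq> W'" "\<forall>x\<in>V. \<forall>b\<in>B. x \<odot>\<^bsub>M\<^esub> b \<in> W'" "dcc R M W W'"
    by blast
  let ?xB = "(\<lambda>b. x \<odot>\<^bsub>M\<^esub> b) ` B"
  have x: "x \<in> carrier R" using insert by blast
  have xB: "submodule ?xB R M" using submodule_smult_image[OF x B] .
  have "dcc R M W' (W' <+>\<^bsub>M\<^esub> ?xB)"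
    by (rule dcc_smult[OF U B assms(5,6) W'(1) x]) (use insert.prems W'(2) in blast)
  then have "dcc R M W (W' <+>\<^bsub>M\<^esub> ?xB)"
    using dcc_trans[OF W'(1,2) sum_ge(1)[OF W'(1) xB] W'(4) _ submodule_sum[OF W'(1) xB]] by blast
  moreover have "\<forall>y\<in>insert x V. \<forall>b\<in>B. y \<odot>\<^bsub>M\<^esub> b \<in> W' <+>\<^bsub>M\<^esub> ?xB"
    using sum_ge[OF W'(1) xB] W'(3) by (auto 4 4)
  ultimately show ?case using submodule_sum[OF W'(1) xB] sum_ge(1)[OF W'(1) xB] W'(2) by blast
qed


section \<open>Homomorphisms and quotients\<close>

lemma mod_homI:
  assumes "\<And>x. x \<in> carrier A \<Longrightarrow> f x \<in> carrier B"
    "\<And>x y. x \<in> carrier A \<Longrightarrow> y \<in> carrier A \<Longrightarrow> x \<oplus>\<^bsub>A\<^esub> y \<in> carrier A \<Longrightarrow> f (x \<oplus>\<^bsub>A\<^esub> y) = f x \<oplus>\<^bsub>B\<^esub> f y"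
    "\<And>r x. r \<in> carrier R \<Longrightarrow> x \<in> carrier A \<Longrightarrow> r \<odot>\<^bsub>A\<^esub> x \<in> carrier A \<Longrightarrow> f (r \<odot>\<^bsub>A\<^esub> x) = r \<odot>\<^bsub>B\<^esub> f x"
    and "module R A"
  shows "(\<lambda>x\<in>carrier A. f x) \<in> mod_hom R A B"
proof -
  interpret A: module R A by fact
  show ?thesis unfolding mod_hom_def using assms A.smult_closed A.a_closed by auto
qed

lemma mod_hom_add: "h \<in> mod_hom R A B \<Longrightarrow> x \<in> carrier A \<Longrightarrow> y \<in> carrier A \<Longrightarrow> h (x \<oplus>\<^bsub>A\<^esub> y) = h x \<oplus>\<^bsub>B\<^esub> h y"
  and mod_hom_smult: "h \<in> mod_hom R A B \<Longrightarrow> r \<in> carrier R \<Longrightarrow> x \<in> carrier A \<Longrightarrow> h (r \<odot>\<^bsub>A\<^esub> x) = r \<odot>\<^bsub>B\<^esub> h x"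
  by (auto simp: mod_hom_def)

lemma mod_hom_minus:
  assumes "module R A" "module R B" "h \<in> mod_hom R A B" "x \<in> carrier A"
  shows "h (\<ominus>\<^bsub>A\<^esub> x) = \<ominus>\<^bsub>B\<^esub> h x"
proof -
  interpret A: module R A by fact
  interpret B: module R B by fact
  have hx: "h x \<in> carrier B" using mod_hom_closed[OF assms(3,4)] .
  have "h ((\<ominus>\<^bsub>R\<^esub> \<one>\<^bsub>R\<^esub>) \<odot>\<^bsub>A\<^esub> x) = (\<ominus>\<^bsub>R\<^esub> \<one>\<^bsub>R\<^esub>) \<odot>\<^bsub>B\<^esub> h x"
    by (rule mod_hom_smult[OF assms(3) _ assms(4)]) simp
  then show ?thesis using A.smult_l_minus[OF A.R.one_closed assms(4)] B.smult_l_minus[OF A.R.one_closed hx]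
      A.smult_one[OF assms(4)] B.smult_one[OF hx] by simp
qed

lemma mod_hom_diff:
  assumes "module R A" "module R B" "h \<in> mod_hom R A B" "x \<in> carrier A" "y \<in> carrier A"
  shows "h (x \<ominus>\<^bsub>A\<^esub> y) = h x \<ominus>\<^bsub>B\<^esub> h y"
proof -
  interpret A: module R A by fact
  show ?thesis unfolding a_minus_def
    using mod_hom_add[OF assms(3,4) A.a_inv_closed[OF assms(5)]] mod_hom_minus[OF assms(1-3,5)] by simp
qed

lemma mod_hom_eqI:
  assumes "f \<in> mod_hom R A B" "g \<in> mod_hom R A B'" "\<And>x. x \<in> carrier A \<Longrightarrow> f x = g x"
  shows "f = g"
proof -
  have "f \<in> extensional (carrier A)" "g \<in> extensional (carrier A)"
    using assms(1,2) by (auto simp: mod_hom_def PiE_def)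
  then show ?thesis using assms(3) by (rule extensionalityI)
qed

lemma mod_hom_compose:
  assumes "module R A" "f \<in> mod_hom R A B" "g \<in> mod_hom R B C"
  shows "(\<lambda>x\<in>carrier A. g (f x)) \<in> mod_hom R A C"
  by (rule mod_homI[OF _ _ _ assms(1)])
    (simp_all add: mod_hom_closed[OF assms(2)] mod_hom_closed[OF assms(3)] mod_hom_add[OF assms(2)]
      mod_hom_add[OF assms(3)] mod_hom_smult[OF assms(2)] mod_hom_smult[OF assms(3)])

lemma hom_module_sel [simp]:
  "carrier (hom_module R A B) = mod_hom R A B"
  "\<zero>\<^bsub>hom_module R A B\<^esub> = (\<lambda>x\<in>carrier A. \<zero>\<^bsub>B\<^esub>)"
  "f \<oplus>\<^bsub>hom_module R A B\<^esub> g = (\<lambda>x\<in>carrier A. f x \<oplus>\<^bsub>B\<^esub> g x)"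
  "r \<odot>\<^bsub>hom_module R A B\<^esub> f = (\<lambda>x\<in>carrier A. r \<odot>\<^bsub>B\<^esub> f x)"
  by (simp_all add: hom_module_def)

lemma module_hom_module:
  assumes "module R A" "module R B"
  shows "module R (hom_module R A B)"
proof -
  interpret A: module R A by fact
  interpret B: module R B by fact
  let ?H = "hom_module R A B"
  note cl = mod_hom_closed and ad = mod_hom_add and sm = mod_hom_smult
  have add: "(\<lambda>x\<in>carrier A. f x \<oplus>\<^bsub>B\<^esub> g x) \<in> mod_hom R A B" if "f \<in> mod_hom R A B" "g \<in> mod_hom R A B" for f g
    by (rule mod_homI[OF _ _ _ assms(1)])
      (simp_all add: cl[OF that(1)] cl[OF that(2)] ad[OF that(1)] ad[OF that(2)] sm[OF that(1)] sm[OF that(2)]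
        B.add_swap4 B.smult_r_distr)
  have smu: "(\<lambda>x\<in>carrier A. r \<odot>\<^bsub>B\<^esub> f x) \<in> mod_hom R A B" if "f \<in> mod_hom R A B" "r \<in> carrier R" for f r
    by (rule mod_homI[OF _ _ _ assms(1)])
      (simp_all add: cl[OF that(1)] ad[OF that(1)] sm[OF that(1)] that(2)
        B.smult_r_distr B.smult_assoc1[symmetric] A.R.m_comm)
  have ze: "(\<lambda>x\<in>carrier A. \<zero>\<^bsub>B\<^esub>) \<in> mod_hom R A B"
    by (rule mod_homI[OF _ _ _ assms(1)]) simp_all
  have eq: "f = g" if "f \<in> mod_hom R A B" "g \<in> mod_hom R A B" "\<And>x. x \<in> carrier A \<Longrightarrow> f x = g x" for f g
    using mod_hom_eqI that by blast
  have ag: "abelian_group ?H"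
  proof (rule abelian_groupI)
    fix f assume f: "f \<in> carrier ?H"
    have m: "(\<lambda>x\<in>carrier A. (\<ominus>\<^bsub>R\<^esub> \<one>\<^bsub>R\<^esub>) \<odot>\<^bsub>B\<^esub> f x) \<in> mod_hom R A B" using smu f by simp
    show "\<exists>g\<in>carrier ?H. g \<oplus>\<^bsub>?H\<^esub> f = \<zero>\<^bsub>?H\<^esub>"
    proof (rule bexI)
      show "(\<lambda>x\<in>carrier A. (\<ominus>\<^bsub>R\<^esub> \<one>\<^bsub>R\<^esub>) \<odot>\<^bsub>B\<^esub> f x) \<oplus>\<^bsub>?H\<^esub> f = \<zero>\<^bsub>?H\<^esub>"
        using f cl[of f R A B] by (auto simp: B.smult_l_minus B.M.l_neg intro!: restrict_ext)
    qed (use m in simp)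
    show "\<zero>\<^bsub>?H\<^esub> \<oplus>\<^bsub>?H\<^esub> f = f"
      by (rule eq) (use f add[OF ze, of f] cl[of f R A B] in \<open>auto\<close>)
    fix g assume g: "g \<in> carrier ?H"
    show "f \<oplus>\<^bsub>?H\<^esub> g = g \<oplus>\<^bsub>?H\<^esub> f"
      using f g cl by (auto intro!: restrict_ext B.M.a_comm)
    show "f \<oplus>\<^bsub>?H\<^esub> g \<in> carrier ?H" using f g add by simp
    fix h assume h: "h \<in> carrier ?H"
    show "f \<oplus>\<^bsub>?H\<^esub> g \<oplus>\<^bsub>?H\<^esub> h = f \<oplus>\<^bsub>?H\<^esub> (g \<oplus>\<^bsub>?H\<^esub> h)"
      using f g h cl by (auto intro!: restrict_ext B.M.a_assoc)
  qed (use ze in simp)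
  show ?thesis
  proof (rule moduleI[OF _ ag])
    show "cring R" by unfold_locales
    fix f assume f: "f \<in> carrier ?H"
    have fc: "f x \<in> carrier B" if "x \<in> carrier A" for x using f cl that by simp
    show "\<one>\<^bsub>R\<^esub> \<odot>\<^bsub>?H\<^esub> f = f"
      by (rule eq) (use f smu[of f "\<one>\<^bsub>R\<^esub>"] fc in \<open>auto\<close>)
    fix r assume r: "r \<in> carrier R"
    show "r \<odot>\<^bsub>?H\<^esub> f \<in> carrier ?H" using f r smu by simp
    show "r \<odot>\<^bsub>?H\<^esub> (f \<oplus>\<^bsub>?H\<^esub> g) = r \<odot>\<^bsub>?H\<^esub> f \<oplus>\<^bsub>?H\<^esub> r \<odot>\<^bsub>?H\<^esub> g" if "g \<in> carrier ?H" for g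
      using that r fc cl[of g R A B] by (auto intro!: restrict_ext B.smult_r_distr)
    fix s assume s: "s \<in> carrier R"
    show "(r \<oplus>\<^bsub>R\<^esub> s) \<odot>\<^bsub>?H\<^esub> f = r \<odot>\<^bsub>?H\<^esub> f \<oplus>\<^bsub>?H\<^esub> s \<odot>\<^bsub>?H\<^esub> f"
      using r s fc by (auto intro!: restrict_ext B.smult_l_distr)
    show "(r \<otimes>\<^bsub>R\<^esub> s) \<odot>\<^bsub>?H\<^esub> f = r \<odot>\<^bsub>?H\<^esub> (s \<odot>\<^bsub>?H\<^esub> f)"
      using r s fc by (auto intro!: restrict_ext B.smult_assoc1)
  qed
qed

lemma module_restrict:
  assumes "module R A" "submodule L R A"
  shows "module R (A\<lparr>carrier := L\<rparr>)"
  using submodule.submodule_is_module[OF assms(2,1)] .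

lemma submodule_restrict_iff:
  assumes "module R A" "submodule K R A"
  shows "submodule L R (A\<lparr>carrier := K\<rparr>) \<longleftrightarrow> submodule L R A \<and> L \<subseteq> K"
proof -
  interpret A: module R A by fact
  interpret K: module R "A\<lparr>carrier := K\<rparr>" using module_restrict[OF assms] .
  show ?thesis using A.submoduleD(1)[OF assms(2)] by (auto simp: A.submodule_iff K.submodule_iff)
qed

context module
begin

lemma subgroup_of_submodule: "submodule L R M \<Longrightarrow> subgroup L (add_monoid M)"
  by (rule submodule.axioms(1))

lemma coset_eq_iff:
  assumes L: "submodule L R M" and x: "x \<in> carrier M" and y: "y \<in> carrier M"
  shows "L +>\<^bsub>M\<^esub> x = L +>\<^bsub>M\<^esub> y \<longleftrightarrow> x \<ominus>\<^bsub>M\<^esub> y \<in> L"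
proof
  note l = submoduleD[OF L]
  have mem: "z \<in> L +>\<^bsub>M\<^esub> w \<longleftrightarrow> (\<exists>l\<in>L. z = l \<oplus>\<^bsub>M\<^esub> w)" for z w
    by (auto simp: a_r_coset_def')
  { assume "L +>\<^bsub>M\<^esub> x = L +>\<^bsub>M\<^esub> y"
    moreover have "x \<in> L +>\<^bsub>M\<^esub> x" unfolding mem by (rule bexI[OF _ l(3)]) (use x in simp)
    ultimately obtain a where "a \<in> L" "x = a \<oplus>\<^bsub>M\<^esub> y" using mem by blast
    moreover from this have "a \<oplus>\<^bsub>M\<^esub> y \<ominus>\<^bsub>M\<^esub> y = a"
      unfolding a_minus_def using l(2) y by (simp add: M.a_assoc M.r_neg)
    ultimately show "x \<ominus>\<^bsub>M\<^esub> y \<in> L" by simp }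
  assume xy: "x \<ominus>\<^bsub>M\<^esub> y \<in> L"
  have sub: "L +>\<^bsub>M\<^esub> x \<subseteq> L +>\<^bsub>M\<^esub> y" if xy: "x \<ominus>\<^bsub>M\<^esub> y \<in> L" "x \<in> carrier M" "y \<in> carrier M" for x y
  proof
    fix z assume "z \<in> L +>\<^bsub>M\<^esub> x"
    then obtain a where a: "a \<in> L" "z = a \<oplus>\<^bsub>M\<^esub> x" unfolding mem by blast
    have "z = (a \<oplus>\<^bsub>M\<^esub> (x \<ominus>\<^bsub>M\<^esub> y)) \<oplus>\<^bsub>M\<^esub> y"
      unfolding a(2) a_minus_def using xy l(2)[OF a(1)] by (simp add: M.a_assoc M.l_neg)
    then show "z \<in> L +>\<^bsub>M\<^esub> y" unfolding mem using l(4)[OF a(1) xy(1)] by blast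
  qed
  have "y \<ominus>\<^bsub>M\<^esub> x = \<ominus>\<^bsub>M\<^esub> (x \<ominus>\<^bsub>M\<^esub> y)"
    unfolding a_minus_def using x y by (simp add: M.minus_add M.a_comm)
  then have yx: "y \<ominus>\<^bsub>M\<^esub> x \<in> L" using l(6)[OF xy] by simp
  show "L +>\<^bsub>M\<^esub> x = L +>\<^bsub>M\<^esub> y"
    using sub[OF xy x y] sub[OF yx y x] by blast
qed

lemma coset_mem_iff:
  assumes "submodule L R M" "x \<in> carrier M"
  shows "L +>\<^bsub>M\<^esub> x = L \<longleftrightarrow> x \<in> L"
proof -
  have "L +>\<^bsub>M\<^esub> \<zero>\<^bsub>M\<^esub> = L" using a_coset_add_zero submoduleD(1)[OF assms(1)] by blast
  moreover have "x \<ominus>\<^bsub>M\<^esub> \<zero>\<^bsub>M\<^esub> = x"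
    unfolding a_minus_def using assms(2) M.add.inv_one M.r_zero by simp
  ultimately show ?thesis using coset_eq_iff[OF assms(1,2) M.zero_closed] by simp
qed

lemma quot_carrier: "carrier (quot_module R M L) = (\<lambda>x. L +>\<^bsub>M\<^esub> x) ` carrier M"
  by (auto simp: quot_module_def A_RCOSETS_def')

lemma quot_sel [simp]: "\<zero>\<^bsub>quot_module R M L\<^esub> = L"
  by (simp add: quot_module_def)

lemma quot_add:
  assumes "submodule L R M" "x \<in> carrier M" "y \<in> carrier M"
  shows "(L +>\<^bsub>M\<^esub> x) \<oplus>\<^bsub>quot_module R M L\<^esub> (L +>\<^bsub>M\<^esub> y) = L +>\<^bsub>M\<^esub> (x \<oplus>\<^bsub>M\<^esub> y)"
proof -
  interpret S: abelian_subgroup L M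
    by (rule abelian_subgroupI3[OF additive_subgroup.intro[OF subgroup_of_submodule[OF assms(1)]]])
      unfold_locales
  show ?thesis using S.a_rcos_sum assms by (simp add: quot_module_def)
qed

lemma quot_smult:
  assumes L: "submodule L R M" and r: "r \<in> carrier R" and x: "x \<in> carrier M"
  shows "r \<odot>\<^bsub>quot_module R M L\<^esub> (L +>\<^bsub>M\<^esub> x) = L +>\<^bsub>M\<^esub> (r \<odot>\<^bsub>M\<^esub> x)"
proof -
  note l = submoduleD[OF L]
  have "z \<in> L <+>\<^bsub>M\<^esub> (\<lambda>y. r \<odot>\<^bsub>M\<^esub> y) ` (L +>\<^bsub>M\<^esub> x) \<longleftrightarrow> z \<in> L +>\<^bsub>M\<^esub> (r \<odot>\<^bsub>M\<^esub> x)" for z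
  proof
    assume "z \<in> L <+>\<^bsub>M\<^esub> (\<lambda>y. r \<odot>\<^bsub>M\<^esub> y) ` (L +>\<^bsub>M\<^esub> x)"
    then obtain a b where ab: "a \<in> L" "b \<in> L" "z = a \<oplus>\<^bsub>M\<^esub> r \<odot>\<^bsub>M\<^esub> (b \<oplus>\<^bsub>M\<^esub> x)"
      by (auto simp: set_add_iff a_r_coset_def')
    then have "z = (a \<oplus>\<^bsub>M\<^esub> r \<odot>\<^bsub>M\<^esub> b) \<oplus>\<^bsub>M\<^esub> r \<odot>\<^bsub>M\<^esub> x"
      using r x l(2) by (simp add: smult_r_distr M.a_assoc)
    then show "z \<in> L +>\<^bsub>M\<^esub> (r \<odot>\<^bsub>M\<^esub> x)" using l(4)[OF ab(1) l(5)[OF r ab(2)]] by (auto simp: a_r_coset_def')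
  next
    assume "z \<in> L +>\<^bsub>M\<^esub> (r \<odot>\<^bsub>M\<^esub> x)"
    then obtain a where a: "a \<in> L" "z = a \<oplus>\<^bsub>M\<^esub> r \<odot>\<^bsub>M\<^esub> x" by (auto simp: a_r_coset_def')
    moreover have "x \<in> L +>\<^bsub>M\<^esub> x" using l(3) x M.l_zero by (force simp: a_r_coset_def')
    ultimately show "z \<in> L <+>\<^bsub>M\<^esub> (\<lambda>y. r \<odot>\<^bsub>M\<^esub> y) ` (L +>\<^bsub>M\<^esub> x)" by (auto simp: set_add_iff)
  qed
  then show ?thesis by (auto simp: quot_module_def)
qed

lemma module_quot_module:
  assumes L: "submodule L R M"
  shows "module R (quot_module R M L)"
proof -
  let ?Q = "quot_module R M L" and ?c = "\<lambda>x. L +>\<^bsub>M\<^esub> x"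
  note add = quot_add[OF L] and sm = quot_smult[OF L]
  have z: "\<zero>\<^bsub>?Q\<^esub> = ?c \<zero>\<^bsub>M\<^esub>" using coset_mem_iff[OF L M.zero_closed] submoduleD(3)[OF L] by simp
  have ag: "abelian_group ?Q"
  proof (rule abelian_groupI, unfold quot_carrier z)
    fix C assume "C \<in> ?c ` carrier M"
    then obtain x where x: "x \<in> carrier M" "C = ?c x" by blast
    show "?c \<zero>\<^bsub>M\<^esub> \<oplus>\<^bsub>?Q\<^esub> C = C" using x by (simp add: add)
    show "\<exists>D\<in>?c ` carrier M. D \<oplus>\<^bsub>?Q\<^esub> C = ?c \<zero>\<^bsub>M\<^esub>"
      by (rule bexI[of _ "?c (\<ominus>\<^bsub>M\<^esub> x)"]) (use x in \<open>auto simp: add M.l_neg\<close>)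
  qed (auto simp: add M.a_ac)
  show ?thesis
  proof (rule moduleI[OF _ ag], unfold quot_carrier)
    show "cring R" by unfold_locales
  qed (auto simp: add sm smult_l_distr smult_r_distr smult_assoc1)
qed

lemma quot_map_hom:
  assumes L: "submodule L R M"
  shows "(\<lambda>x\<in>carrier M. L +>\<^bsub>M\<^esub> x) \<in> mod_hom R M (quot_module R M L)"
  by (rule mod_homI) (auto simp: quot_carrier quot_add[OF L] quot_smult[OF L] module_axioms)

end

lemma submodule_vimage:
  assumes "module R A" "module R B" "f \<in> mod_hom R A B" "submodule S R B"
  shows "submodule {x \<in> carrier A. f x \<in> S} R A"
proof -
  interpret A: module R A by fact
  interpret B: module R B by fact
  note s = B.submoduleD[OF assms(4)]
  show ?thesis unfolding A.submodule_iff
    using mod_hom_zero[OF assms(1-3)] mod_hom_add[OF assms(3)] mod_hom_smult[OF assms(3)] s by auto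
qed

lemma submodule_image:
  assumes "module R A" "module R B" "f \<in> mod_hom R A B" "submodule S R A"
  shows "submodule (f ` S) R B"
proof -
  interpret A: module R A by fact
  interpret B: module R B by fact
  note s = A.submoduleD[OF assms(4)]
  show ?thesis unfolding B.submodule_iff
  proof (intro conjI ballI)
    show "f ` S \<subseteq> carrier B" using mod_hom_closed[OF assms(3)] s by blast
    show "\<zero>\<^bsub>B\<^esub> \<in> f ` S" using mod_hom_zero[OF assms(1-3)] s(3) by (metis imageI)
    fix x assume "x \<in> f ` S"
    then obtain a where a: "a \<in> S" "x = f a" by blast
    show "r \<odot>\<^bsub>B\<^esub> x \<in> f ` S" if "r \<in> carrier R" for r
      using mod_hom_smult[OF assms(3) that s(2)[OF a(1)]] s(5)[OF that a(1)] a(2) by (metis imageI)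
    fix y assume "y \<in> f ` S"
    then obtain b where b: "b \<in> S" "y = f b" by blast
    show "x \<oplus>\<^bsub>B\<^esub> y \<in> f ` S"
      using mod_hom_add[OF assms(3) s(2)[OF a(1)] s(2)[OF b(1)]] s(4)[OF a(1) b(1)] a(2) b(2) by (metis imageI)
  qed
qed

lemma artinian_iff_dcc:
  assumes "module R M"
  shows "artinian_module R M \<longleftrightarrow> dcc R M {\<zero>\<^bsub>M\<^esub>} (carrier M)"
proof -
  interpret module R M by fact
  have "submodule L R M \<longleftrightarrow> submodule L R M \<and> {\<zero>\<^bsub>M\<^esub>} \<subseteq> L \<and> L \<subseteq> carrier M" for L
    using submoduleD by blast
  then show ?thesis unfolding artinian_module_def dcc_def using assms by metis
qed

section \<open>Finiteness over a Noetherian ring\<close>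

lemma (in noetherian_ring) ideal_family_maximal:
  assumes "\<A> \<noteq> {}" "\<And>J. J \<in> \<A> \<Longrightarrow> ideal J R"
  shows "\<exists>J\<in>\<A>. \<forall>K\<in>\<A>. J \<subseteq> K \<longrightarrow> K = J"
proof (rule subset_Zorn_nonempty[OF assms(1)])
  fix \<C> assume C: "\<C> \<noteq> {}" "subset.chain \<A> \<C>"
  have CA: "\<C> \<subseteq> \<A>" and "\<forall>x\<in>\<C>. \<forall>y\<in>\<C>. x \<subset> y \<or> x = y \<or> y \<subset> x"
    using C(2) unfolding pred_on.chain_def by auto
  moreover from CA have "\<C> \<subseteq> {J. ideal J R}" using assms(2) by auto
  ultimately have "subset.chain {J. ideal J R} \<C>" unfolding pred_on.chain_def by auto
  from ideal_chain_is_trivial[OF C(1) this] show "\<Union>\<C> \<in> \<A>" using CA by auto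
qed

lemma (in cring) idealI_simple:
  assumes "J \<subseteq> carrier R" "\<zero>\<^bsub>R\<^esub> \<in> J" "\<And>x y. x \<in> J \<Longrightarrow> y \<in> J \<Longrightarrow> x \<oplus>\<^bsub>R\<^esub> y \<in> J"
    "\<And>r x. r \<in> carrier R \<Longrightarrow> x \<in> J \<Longrightarrow> r \<otimes>\<^bsub>R\<^esub> x \<in> J"
  shows "ideal J R"
proof (rule idealI)
  show "ring R" by unfold_locales
  show "subgroup J (add_monoid R)"
  proof
    fix x assume x: "x \<in> J"
    have "(\<ominus>\<^bsub>R\<^esub> \<one>\<^bsub>R\<^esub>) \<otimes>\<^bsub>R\<^esub> x \<in> J" using assms(4) x by blast
    moreover have "(\<ominus>\<^bsub>R\<^esub> \<one>\<^bsub>R\<^esub>) \<otimes>\<^bsub>R\<^esub> x = \<ominus>\<^bsub>R\<^esub> x" using x assms(1) by (subst l_minus) auto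
    ultimately show "inv\<^bsub>add_monoid R\<^esub> x \<in> J" by (simp add: a_inv_def)
  qed (use assms in auto)
  fix a x assume "a \<in> J" "x \<in> carrier R"
  then show "x \<otimes>\<^bsub>R\<^esub> a \<in> J" "a \<otimes>\<^bsub>R\<^esub> x \<in> J" using assms(4) m_comm[of a x] assms(1) by auto
qed

lemma (in cring) idealD:
  assumes "ideal J R"
  shows "J \<subseteq> carrier R" "\<zero>\<^bsub>R\<^esub> \<in> J" "\<And>x y. x \<in> J \<Longrightarrow> y \<in> J \<Longrightarrow> x \<oplus>\<^bsub>R\<^esub> y \<in> J"
    "\<And>r x. r \<in> carrier R \<Longrightarrow> x \<in> J \<Longrightarrow> r \<otimes>\<^bsub>R\<^esub> x \<in> J"
    "\<And>r x. r \<in> carrier R \<Longrightarrow> x \<in> J \<Longrightarrow> x \<otimes>\<^bsub>R\<^esub> r \<in> J"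
    "\<And>x. x \<in> J \<Longrightarrow> \<ominus>\<^bsub>R\<^esub> x \<in> J"
proof -
  interpret J: ideal J R by fact
  show "J \<subseteq> carrier R" by (rule J.a_subset)
  show "\<zero>\<^bsub>R\<^esub> \<in> J" by (rule J.zero_closed)
  show "\<And>x y. x \<in> J \<Longrightarrow> y \<in> J \<Longrightarrow> x \<oplus>\<^bsub>R\<^esub> y \<in> J" by (rule J.a_closed)
  show "\<And>r x. r \<in> carrier R \<Longrightarrow> x \<in> J \<Longrightarrow> r \<otimes>\<^bsub>R\<^esub> x \<in> J" by (rule J.I_l_closed)
  show "\<And>r x. r \<in> carrier R \<Longrightarrow> x \<in> J \<Longrightarrow> x \<otimes>\<^bsub>R\<^esub> r \<in> J" by (rule J.I_r_closed)
  show "\<And>x. x \<in> J \<Longrightarrow> \<ominus>\<^bsub>R\<^esub> x \<in> J" by (rule J.a_inv_closed)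
qed

lemma (in cring) primeidealI_elem:
  assumes "ideal p R" "\<one>\<^bsub>R\<^esub> \<notin> p"
    "\<And>a b. a \<in> carrier R \<Longrightarrow> b \<in> carrier R \<Longrightarrow> a \<otimes>\<^bsub>R\<^esub> b \<in> p \<Longrightarrow> b \<notin> p \<Longrightarrow> a \<in> p"
  shows "primeideal p R"
proof (rule primeidealI[OF assms(1)])
  show "cring R" by unfold_locales
  show "carrier R \<noteq> p" using assms(2) one_closed by blast
qed (use assms(3) in blast)

lemma (in cring) primeD:
  assumes "primeideal p R"
  shows "ideal p R" "\<one>\<^bsub>R\<^esub> \<notin> p"
    "a \<in> carrier R \<Longrightarrow> b \<in> carrier R \<Longrightarrow> a \<otimes>\<^bsub>R\<^esub> b \<in> p \<Longrightarrow> a \<in> p \<or> b \<in> p"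
proof -
  interpret primeideal p R by fact
  show "ideal p R" by unfold_locales
  show "\<one>\<^bsub>R\<^esub> \<notin> p" using I_notcarr one_imp_carrier by blast
  show "a \<in> carrier R \<Longrightarrow> b \<in> carrier R \<Longrightarrow> a \<otimes>\<^bsub>R\<^esub> b \<in> p \<Longrightarrow> a \<in> p \<or> b \<in> p" using I_prime .
qed

text \<open>
  An ideal that is maximal among those that contain \<open>J\<close> and miss \<open>S\<close> is prime: a multiple of each of two
  elements outside meets \<open>S\<close> modulo the ideal, and so does the product.
\<close>

lemma (in cring) prime_disjoint_from_multiplicative_set:
  assumes "noetherian_ring R" and J: "ideal J R" "J \<inter> S = {}"
    and S: "S \<subseteq> carrier R" "\<one>\<^bsub>R\<^esub> \<in> S" "\<And>a b. a \<in> S \<Longrightarrow> b \<in> S \<Longrightarrow> a \<otimes>\<^bsub>R\<^esub> b \<in> S"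
  shows "\<exists>q. primeideal q R \<and> J \<subseteq> q \<and> q \<inter> S = {}"
proof -
  define \<A> where "\<A> = {K. ideal K R \<and> J \<subseteq> K \<and> K \<inter> S = {}}"
  have "\<exists>q\<in>\<A>. \<forall>K\<in>\<A>. q \<subseteq> K \<longrightarrow> K = q"
    by (rule noetherian_ring.ideal_family_maximal[OF assms(1)]) (use J in \<open>auto simp: \<A>_def\<close>)
  then obtain q where q: "ideal q R" "J \<subseteq> q" "q \<inter> S = {}"
    and max: "\<And>K. ideal K R \<Longrightarrow> K \<inter> S = {} \<Longrightarrow> q \<subseteq> K \<Longrightarrow> K = q"
    unfolding \<A>_def by (smt (verit) mem_Collect_eq subset_trans)
  note qd = idealD[OF q(1)]
  have meet: "\<exists>m\<in>q. \<exists>r\<in>carrier R. m \<oplus>\<^bsub>R\<^esub> r \<otimes>\<^bsub>R\<^esub> a \<in> S" if a: "a \<in> carrier R" "a \<notin> q" for a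
  proof -
    let ?K = "{m \<oplus>\<^bsub>R\<^esub> r \<otimes>\<^bsub>R\<^esub> a | m r. m \<in> q \<and> r \<in> carrier R}"
    have K: "ideal ?K R"
    proof (rule idealI_simple)
      show "?K \<subseteq> carrier R" using qd(1) a by auto
      have "\<zero>\<^bsub>R\<^esub> = \<zero>\<^bsub>R\<^esub> \<oplus>\<^bsub>R\<^esub> \<zero>\<^bsub>R\<^esub> \<otimes>\<^bsub>R\<^esub> a" using a by simp
      then show "\<zero>\<^bsub>R\<^esub> \<in> ?K" using qd(2) zero_closed by blast
      fix x assume "x \<in> ?K"
      then obtain m r where x: "x = m \<oplus>\<^bsub>R\<^esub> r \<otimes>\<^bsub>R\<^esub> a" "m \<in> q" "r \<in> carrier R" by blast
      have mc: "m \<in> carrier R" using qd(1) x by blast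
      show "s \<otimes>\<^bsub>R\<^esub> x \<in> ?K" if "s \<in> carrier R" for s
      proof -
        have "s \<otimes>\<^bsub>R\<^esub> x = s \<otimes>\<^bsub>R\<^esub> m \<oplus>\<^bsub>R\<^esub> (s \<otimes>\<^bsub>R\<^esub> r) \<otimes>\<^bsub>R\<^esub> a"
          using x mc that a by (simp add: r_distr m_assoc)
        then show ?thesis using qd(4)[OF that x(2)] m_closed[OF that x(3)] by blast
      qed
      fix y assume "y \<in> ?K"
      then obtain n s where y: "y = n \<oplus>\<^bsub>R\<^esub> s \<otimes>\<^bsub>R\<^esub> a" "n \<in> q" "s \<in> carrier R" by blast
      have "n \<in> carrier R" using qd(1) y by blast
      then have "x \<oplus>\<^bsub>R\<^esub> y = (m \<oplus>\<^bsub>R\<^esub> n) \<oplus>\<^bsub>R\<^esub> (r \<oplus>\<^bsub>R\<^esub> s) \<otimes>\<^bsub>R\<^esub> a"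
        using x y mc a by (simp add: l_distr a_ac)
      then show "x \<oplus>\<^bsub>R\<^esub> y \<in> ?K" using qd(3)[OF x(2) y(2)] a_closed[OF x(3) y(3)] by blast
    qed
    have "q \<subseteq> ?K"
    proof
      fix m assume m: "m \<in> q"
      then have "m = m \<oplus>\<^bsub>R\<^esub> \<zero>\<^bsub>R\<^esub> \<otimes>\<^bsub>R\<^esub> a" using qd(1) a by auto
      then show "m \<in> ?K" using m zero_closed by blast
    qed
    moreover have "a \<in> ?K"
    proof -
      have "a = \<zero>\<^bsub>R\<^esub> \<oplus>\<^bsub>R\<^esub> \<one>\<^bsub>R\<^esub> \<otimes>\<^bsub>R\<^esub> a" using a by simp
      then show ?thesis using qd(2) one_closed by blast
    qed
    ultimately show ?thesis using max[OF K] a(2) by blast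
  qed
  have "primeideal q R"
  proof (rule primeidealI_elem[OF q(1)])
    show "\<one>\<^bsub>R\<^esub> \<notin> q" using S(2) q(3) by blast
    fix a b assume ab: "a \<in> carrier R" "b \<in> carrier R" "a \<otimes>\<^bsub>R\<^esub> b \<in> q" "b \<notin> q"
    show "a \<in> q"
    proof (rule ccontr)
      assume "a \<notin> q"
      then obtain m r where m: "m \<in> q" "r \<in> carrier R" "m \<oplus>\<^bsub>R\<^esub> r \<otimes>\<^bsub>R\<^esub> a \<in> S" using meet ab by blast
      obtain n s where n: "n \<in> q" "s \<in> carrier R" "n \<oplus>\<^bsub>R\<^esub> s \<otimes>\<^bsub>R\<^esub> b \<in> S" using meet ab by blast
      have c: "m \<in> carrier R" "n \<in> carrier R" using qd(1) m n by auto
      have "(m \<oplus>\<^bsub>R\<^esub> r \<otimes>\<^bsub>R\<^esub> a) \<otimes>\<^bsub>R\<^esub> (n \<oplus>\<^bsub>R\<^esub> s \<otimes>\<^bsub>R\<^esub> b) =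
          (n \<oplus>\<^bsub>R\<^esub> s \<otimes>\<^bsub>R\<^esub> b) \<otimes>\<^bsub>R\<^esub> m \<oplus>\<^bsub>R\<^esub> (r \<otimes>\<^bsub>R\<^esub> a) \<otimes>\<^bsub>R\<^esub> n \<oplus>\<^bsub>R\<^esub> (r \<otimes>\<^bsub>R\<^esub> s) \<otimes>\<^bsub>R\<^esub> (a \<otimes>\<^bsub>R\<^esub> b)"
        using m n c ab by (simp add: l_distr r_distr m_ac a_ac)
      also have "\<dots> \<in> q"
        using qd(3)[OF qd(3)[OF qd(4)[of "n \<oplus>\<^bsub>R\<^esub> s \<otimes>\<^bsub>R\<^esub> b" m] qd(4)[of "r \<otimes>\<^bsub>R\<^esub> a" n]]
            qd(4)[of "r \<otimes>\<^bsub>R\<^esub> s" "a \<otimes>\<^bsub>R\<^esub> b"]] m n c ab by simp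
      finally show False using S(3)[OF m(3) n(3)] q(3) by blast
    qed
  qed
  then show ?thesis using q by blast
qed

lemma (in cring) prime_avoidance_product:
  assumes "primeideal p R" "finite \<F>" "\<And>q. q \<in> \<F> \<Longrightarrow> ideal q R" "\<And>q. q \<in> \<F> \<Longrightarrow> \<not> q \<subseteq> p"
    and "ideal I R" "\<not> I \<subseteq> p"
  shows "\<exists>w\<in>I. w \<notin> p \<and> (\<forall>q\<in>\<F>. w \<in> q)"
  using assms(2-4)
proof (induction \<F> rule: finite_induct)
  case empty
  then show ?case using assms(6) by blast
next
  case (insert q \<F>)
  then obtain w where w: "w \<in> I" "w \<notin> p" "\<forall>q\<in>\<F>. w \<in> q" by blast
  obtain y where y: "y \<in> q" "y \<notin> p" using insert.prems by blast
  have c: "w \<in> carrier R" "y \<in> carrier R" using w y idealD(1) assms(5) insert.prems by blast+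
  have "y \<otimes>\<^bsub>R\<^esub> w \<in> I" "y \<otimes>\<^bsub>R\<^esub> w \<in> q" using idealD(4,5) w y c assms(5) insert.prems(1) by simp_all
  moreover have "\<forall>q\<in>\<F>. y \<otimes>\<^bsub>R\<^esub> w \<in> q" using idealD(4) w y c insert.prems(1) by simp
  moreover have "y \<otimes>\<^bsub>R\<^esub> w \<notin> p" using primeD(3)[OF assms(1) c(2,1)] w y by blast
  ultimately show ?case by blast
qed

text \<open>
  Only primes that are pairwise not contained in each other matter. If an element \<open>x\<close> of \<open>I\<close> avoids all of them
  except \<open>p\<close>, add an element of \<open>I\<close> that lies in all the others but not in \<open>p\<close>.
\<close>

lemma (in cring) prime_avoidance:
  assumes "finite \<F>" "\<And>p. p \<in> \<F> \<Longrightarrow> primeideal p R" "ideal I R" "\<And>p. p \<in> \<F> \<Longrightarrow> \<not> I \<subseteq> p"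
  shows "\<exists>x\<in>I. \<forall>p\<in>\<F>. x \<notin> p"
  using assms(1,2,4)
proof (induction "card \<F>" arbitrary: \<F> rule: less_induct)
  case less
  have smaller: "\<exists>x\<in>I. \<forall>q\<in>\<F> - {p}. x \<notin> q" if "p \<in> \<F>" for p
    using less.hyps[of "\<F> - {p}"] less.prems that card_Diff1_less[OF less.prems(1) that] by simp
  consider "\<F> = {}" | p q where "p \<in> \<F>" "q \<in> \<F>" "p \<noteq> q" "q \<subseteq> p"
    | p where "p \<in> \<F>" "\<And>q. q \<in> \<F> - {p} \<Longrightarrow> \<not> q \<subseteq> p" by blast
  then show ?case
  proof cases
    case 1
    then show ?thesis using idealD(2)[OF assms(3)] by blast
  next
    case 2
    then show ?thesis using smaller[of q] by blast
  next
    case (3 p)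
    obtain x where x: "x \<in> I" "\<forall>q\<in>\<F> - {p}. x \<notin> q" using smaller[OF 3(1)] by blast
    obtain w where w: "w \<in> I" "w \<notin> p" "\<forall>q\<in>\<F> - {p}. w \<in> q"
      using prime_avoidance_product[of p "\<F> - {p}" I] 3 less.prems assms(3) primeD(1) by auto
    have c: "x \<in> carrier R" "w \<in> carrier R" using x w idealD(1)[OF assms(3)] by auto
    have can: "b \<in> q" if "a \<in> q" "a \<oplus>\<^bsub>R\<^esub> b \<in> q" "ideal q R" "b \<in> carrier R" for a b q
    proof -
      have "a \<in> carrier R" using that idealD(1) by blast
      then have "\<ominus>\<^bsub>R\<^esub> a \<oplus>\<^bsub>R\<^esub> (a \<oplus>\<^bsub>R\<^esub> b) = b" using that(4) by (simp add: r_neg1)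
      then show ?thesis using idealD(3)[OF that(3) idealD(6)[OF that(3,1)] that(2)] by simp
    qed
    show ?thesis
    proof (cases "x \<in> p")
      case False
      then show ?thesis using x by blast
    next
      case True
      have "w \<oplus>\<^bsub>R\<^esub> x \<notin> q" if "q \<in> \<F>" for q
      proof (cases "q = p")
        case True
        then show ?thesis
          using can[of x p w] \<open>x \<in> p\<close> w(2) c a_comm primeD(1)[OF less.prems(2)[OF 3(1)]] by metis
      next
        case False
        then show ?thesis
          using can[of w q x] w(3) x(2) c that primeD(1)[OF less.prems(2)[OF that]] by blast
      qed
      then show ?thesis using idealD(3)[OF assms(3) w(1) x(1)] by blast
    qed
  qed
qed

text \<open>
  The annihilator of the class of \<open>y\<close> in \<open>M/T\<close>.
\<close>

definition colon :: "('a, 'r) ring_scheme \<Rightarrow> ('a, 'b, 'c) module_scheme \<Rightarrow> 'b set \<Rightarrow> 'b \<Rightarrow> 'a set" where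
  "colon R M T y = {r \<in> carrier R. r \<odot>\<^bsub>M\<^esub> y \<in> T}"

context module
begin

lemma smult_swap:
  "a \<in> carrier R \<Longrightarrow> b \<in> carrier R \<Longrightarrow> y \<in> carrier M \<Longrightarrow> a \<odot>\<^bsub>M\<^esub> (b \<odot>\<^bsub>M\<^esub> y) = b \<odot>\<^bsub>M\<^esub> (a \<odot>\<^bsub>M\<^esub> y)"
  using smult_assoc1[of a b y] smult_assoc1[of b a y] R.m_comm[of a b] by simp

lemma ideal_colon:
  assumes "submodule T R M" "y \<in> carrier M"
  shows "ideal (colon R M T y) R"
  by (rule R.idealI_simple)
    (use assms submoduleD[OF assms(1)] in \<open>auto simp: colon_def smult_l_distr smult_assoc1\<close>)

lemma annihilator_quot:
  assumes "submodule T R M" "y \<in> carrier M"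
  shows "annihilator R (quot_module R M T) (T +>\<^bsub>M\<^esub> y) = colon R M T y"
  unfolding annihilator_def colon_def quot_sel
  by (rule Collect_cong) (use quot_smult[OF assms(1) _ assms(2)] coset_mem_iff[OF assms(1)] assms(2) in \<open>simp cong: conj_cong\<close>)

lemma one_in_colon_iff: "y \<in> carrier M \<Longrightarrow> \<one>\<^bsub>R\<^esub> \<in> colon R M T y \<longleftrightarrow> y \<in> T"
  by (simp add: colon_def)

lemma colon_maximal:
  assumes "noetherian_ring R" "submodule T R M" "P y" "\<And>z. P z \<Longrightarrow> z \<in> carrier M"
  obtains z where "P z" "\<And>w. P w \<Longrightarrow> colon R M T z \<subseteq> colon R M T w \<Longrightarrow> colon R M T w = colon R M T z"
proof -
  have "\<exists>J\<in>colon R M T ` {z. P z}. \<forall>K\<in>colon R M T ` {z. P z}. J \<subseteq> K \<longrightarrow> K = J"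
    by (rule noetherian_ring.ideal_family_maximal[OF assms(1)]) (use assms(3,4) ideal_colon[OF assms(2)] in auto)
  then show thesis using that by auto
qed

text \<open>
  Among the annihilators of nonzero elements of \<open>M/T\<close> that contain \<open>x\<close>, a maximal one is prime.
\<close>

lemma zero_divisor_in_associated_prime:
  assumes "noetherian_ring R" and T: "submodule T R M" and y: "y \<in> carrier M" "y \<notin> T"
    and x: "x \<in> carrier R" "x \<odot>\<^bsub>M\<^esub> y \<in> T"
  shows "\<exists>p \<in> Ass R (quot_module R M T). x \<in> p"
proof -
  have xy: "x \<in> colon R M T y" using x by (simp add: colon_def)
  obtain z where z: "z \<in> carrier M \<and> z \<notin> T \<and> x \<in> colon R M T z"
    and max: "\<And>w. w \<in> carrier M \<and> w \<notin> T \<and> x \<in> colon R M T w \<Longrightarrow> colon R M T z \<subseteq> colon R M T w \<Longrightarrow>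
      colon R M T w = colon R M T z"
    by (rule colon_maximal[OF assms(1) T, of "\<lambda>z. z \<in> carrier M \<and> z \<notin> T \<and> x \<in> colon R M T z" y])
      (use y xy in auto)
  then have z: "z \<in> carrier M" "z \<notin> T" "x \<in> colon R M T z" by auto
  have "primeideal (colon R M T z) R"
  proof (rule R.primeidealI_elem[OF ideal_colon[OF T z(1)]])
    show "\<one>\<^bsub>R\<^esub> \<notin> colon R M T z" using one_in_colon_iff z by blast
    fix a b assume ab: "a \<in> carrier R" "b \<in> carrier R" "a \<otimes>\<^bsub>R\<^esub> b \<in> colon R M T z" "b \<notin> colon R M T z"
    have le: "colon R M T z \<subseteq> colon R M T (b \<odot>\<^bsub>M\<^esub> z)"
      using ab(2) z(1) submoduleD(5)[OF T ab(2)] smult_swap[OF _ ab(2) z(1)] by (auto simp: colon_def)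
    have "b \<odot>\<^bsub>M\<^esub> z \<notin> T" "b \<odot>\<^bsub>M\<^esub> z \<in> carrier M" using ab z by (auto simp: colon_def)
    then have "colon R M T (b \<odot>\<^bsub>M\<^esub> z) = colon R M T z" using max le z(3) by blast
    moreover have "a \<in> colon R M T (b \<odot>\<^bsub>M\<^esub> z)" using ab z(1) by (simp add: colon_def smult_assoc1)
    ultimately show "a \<in> colon R M T z" by blast
  qed
  moreover have "colon R M T z = annihilator R (quot_module R M T) (T +>\<^bsub>M\<^esub> z)"
    using annihilator_quot[OF T z(1)] by simp
  moreover have "T +>\<^bsub>M\<^esub> z \<in> carrier (quot_module R M T)" using z(1) by (auto simp: quot_carrier)
  ultimately show ?thesis using z(3) unfolding Ass_def by blast
qed

end

section \<open>Powers of an ideal\<close>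

abbreviation ideal_power :: "('a, 'r) ring_scheme \<Rightarrow> 'a set \<Rightarrow> nat \<Rightarrow> 'a set" where
  "ideal_power R I n \<equiv> I [^]\<^bsub>ideals_set R\<^esub> n"

lemma one_ideals_set [simp]: "\<one>\<^bsub>ideals_set R\<^esub> = carrier R"
  by (simp add: ideals_set_def)

lemma (in cring) ideal_power_0: "ideal_power R I 0 = carrier R"
  by (simp add: nat_pow_def ideals_set_def)

lemma (in cring) ideal_power_Suc: "ideal_power R I (Suc n) = ideal_prod R (ideal_power R I n) I"
  by (simp add: nat_pow_def ideals_set_def)

lemma (in cring) ideal_ideal_power:
  assumes "ideal I R"
  shows "ideal (ideal_power R I n) R"
proof (induction n)
  case (Suc n)
  then show ?case unfolding ideal_power_Suc by (rule ideal_prod_is_ideal[OF _ assms])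
qed (simp add: oneideal)

lemma (in cring) ideal_power_carrier:
  "ideal I R \<Longrightarrow> ideal_power R I n \<subseteq> carrier R"
  using idealD(1) ideal_ideal_power by blast

lemma (in cring) ideal_power_mono:
  assumes "ideal I R" "n \<le> m"
  shows "ideal_power R I m \<subseteq> ideal_power R I n"
  using assms(2)
proof (induction m rule: dec_induct)
  case (step m)
  then show ?case
    unfolding ideal_power_Suc using ideal_prod_inter[OF ideal_ideal_power[OF assms(1)] assms(1)] by blast
qed simp

lemma (in cring) pow_in_ideal_power:
  assumes "ideal I R" "x \<in> I"
  shows "x [^]\<^bsub>R\<^esub> n \<in> ideal_power R I n"
proof (induction n)
  case (Suc n)
  have "x [^]\<^bsub>R\<^esub> n \<otimes>\<^bsub>R\<^esub> x \<in> ideal_power R I (Suc n)"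
    unfolding ideal_power_Suc by (rule ideal_prod.prod[OF Suc assms(2)])
  then show ?case by simp
qed simp

lemma (in module) ideal_power_Suc_smult:
  assumes "submodule W R M" "ideal I R" "y \<in> carrier M"
    and "\<And>u x. u \<in> ideal_power R I n \<Longrightarrow> x \<in> I \<Longrightarrow> u \<odot>\<^bsub>M\<^esub> (x \<odot>\<^bsub>M\<^esub> y) \<in> W"
    and v: "v \<in> ideal_power R I (Suc n)"
  shows "v \<odot>\<^bsub>M\<^esub> y \<in> W"
proof -
  have "v \<in> carrier R \<and> v \<odot>\<^bsub>M\<^esub> y \<in> W" using v unfolding R.ideal_power_Suc
  proof (induction v rule: ideal_prod.induct)
    case (prod u x)
    have c: "u \<in> carrier R" "x \<in> carrier R"
      using prod R.ideal_power_carrier[OF assms(2)] R.idealD(1)[OF assms(2)] by blast+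
    show ?case using assms(4)[OF prod] smult_assoc1[OF c assms(3)] c by simp
  next
    case (sum a b)
    then show ?case using submoduleD(4)[OF assms(1)] smult_l_distr assms(3) by simp
  qed
  then show ?thesis ..
qed

lemma finite_uniform_bound:
  assumes "finite A" "\<And>x. x \<in> A \<Longrightarrow> \<exists>n::nat. P x n" "\<And>x n m. P x n \<Longrightarrow> n \<le> m \<Longrightarrow> P x m"
  shows "\<exists>n. \<forall>x\<in>A. P x n"
  using assms(1,2)
proof (induction A rule: finite_induct)
  case (insert x A)
  then obtain n m where "\<forall>y\<in>A. P y n" "P x m" by blast
  then have "P y (max n m)" if "y \<in> insert x A" for y
    using that assms(3)[of y n "max n m"] assms(3)[of y m "max n m"] by auto
  then show ?case by blast
qed simp

text \<open>
  One exponent \<open>n\<close> serves all of the finitely many generators of \<open>I\<close>, and then \<open>n + 1\<close> is an exponent for \<open>y\<close>.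
\<close>

lemma (in module) torsion_of_ideal_multiples:
  assumes "noetherian_ring R" "ideal I R" and W: "submodule W R M" and y: "y \<in> carrier M"
    and "\<And>x. x \<in> I \<Longrightarrow> \<exists>n. \<forall>u\<in>ideal_power R I n. u \<odot>\<^bsub>M\<^esub> (x \<odot>\<^bsub>M\<^esub> y) \<in> W"
  shows "\<exists>n. \<forall>u\<in>ideal_power R I n. u \<odot>\<^bsub>M\<^esub> y \<in> W"
proof -
  obtain A where A: "A \<subseteq> carrier R" "finite A" "I = Idl\<^bsub>R\<^esub> A"
    using noetherian_ring.finetely_gen[OF assms(1,2)] by blast
  have AI: "A \<subseteq> I" using A R.genideal_self by blast
  have "\<exists>n. \<forall>x\<in>A. \<forall>u\<in>ideal_power R I n. u \<odot>\<^bsub>M\<^esub> (x \<odot>\<^bsub>M\<^esub> y) \<in> W"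
    by (rule finite_uniform_bound[OF A(2)]) (use assms(5) AI R.ideal_power_mono[OF assms(2)] in blast)+
  then obtain n where n: "\<And>x u. x \<in> A \<Longrightarrow> u \<in> ideal_power R I n \<Longrightarrow> u \<odot>\<^bsub>M\<^esub> (x \<odot>\<^bsub>M\<^esub> y) \<in> W" by blast
  have "u \<odot>\<^bsub>M\<^esub> (x \<odot>\<^bsub>M\<^esub> y) \<in> W" if u: "u \<in> ideal_power R I n" and x: "x \<in> I" for u x
  proof -
    have uc: "u \<in> carrier R" using u R.ideal_power_carrier[OF assms(2)] by blast
    have "ideal (colon R M W (u \<odot>\<^bsub>M\<^esub> y)) R" using ideal_colon[OF W] uc y by blast
    moreover have "A \<subseteq> colon R M W (u \<odot>\<^bsub>M\<^esub> y)"
      using n[OF _ u] A(1) smult_swap[OF _ uc y] by (auto simp: colon_def)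
    ultimately have "I \<subseteq> colon R M W (u \<odot>\<^bsub>M\<^esub> y)" using R.genideal_minimal A(3) by blast
    moreover have "x \<in> carrier R" using x R.idealD(1)[OF assms(2)] by blast
    ultimately show ?thesis using x smult_swap[OF _ uc y] by (auto simp: colon_def)
  qed
  then show ?thesis using ideal_power_Suc_smult[OF W assms(2) y] by blast
qed

text \<open>
  Otherwise consider a counterexample \<open>z\<close> with maximal annihilator modulo \<open>W\<close>.
  For \<open>x \<in> I\<close> the annihilator of \<open>xz\<close> is strictly larger, since it contains the last power of \<open>x\<close> that does not
  annihilate \<open>z\<close>. Hence all \<open>xz\<close> are torsion, and so is \<open>z\<close>.
\<close>

lemma (in module) torsion_of_nilpotents:
  assumes "noetherian_ring R" "ideal I R" and W: "submodule W R M" and y: "y \<in> carrier M"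
    and nil: "\<And>x. x \<in> I \<Longrightarrow> \<exists>e::nat. (x [^]\<^bsub>R\<^esub> e) \<odot>\<^bsub>M\<^esub> y \<in> W"
  shows "\<exists>n. \<forall>u\<in>ideal_power R I n. u \<odot>\<^bsub>M\<^esub> y \<in> W"
proof (rule ccontr)
  let ?tors = "\<lambda>z. \<exists>n. \<forall>u\<in>ideal_power R I n. u \<odot>\<^bsub>M\<^esub> z \<in> W"
  assume neg: "\<not> ?tors y"
  let ?nil = "\<lambda>z. \<forall>x\<in>I. \<exists>e::nat. (x [^]\<^bsub>R\<^esub> e) \<odot>\<^bsub>M\<^esub> z \<in> W"
  obtain z where z': "z \<in> carrier M \<and> \<not> ?tors z \<and> ?nil z"
    and max: "\<And>w. w \<in> carrier M \<and> \<not> ?tors w \<and> ?nil w \<Longrightarrow> colon R M W z \<subseteq> colon R M W w \<Longrightarrow>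
      colon R M W w = colon R M W z"
  proof (rule colon_maximal[OF assms(1) W, of "\<lambda>z. z \<in> carrier M \<and> \<not> ?tors z \<and> ?nil z" y])
    show "y \<in> carrier M \<and> \<not> ?tors y \<and> ?nil y" using y neg nil by auto
  qed auto
  then have z: "z \<in> carrier M" "\<not> ?tors z" "\<And>x. x \<in> I \<Longrightarrow> \<exists>e::nat. (x [^]\<^bsub>R\<^esub> e) \<odot>\<^bsub>M\<^esub> z \<in> W" by auto
  have "?tors (x \<odot>\<^bsub>M\<^esub> z)" if x: "x \<in> I" for x
  proof (rule ccontr)
    assume nt: "\<not> ?tors (x \<odot>\<^bsub>M\<^esub> z)"
    have xc: "x \<in> carrier R" using x R.idealD(1)[OF assms(2)] by blast
    have le: "colon R M W z \<subseteq> colon R M W (x \<odot>\<^bsub>M\<^esub> z)"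
      using xc z(1) submoduleD(5)[OF W xc] smult_swap[OF _ xc z(1)] by (auto simp: colon_def)
    have nil': "\<exists>e::nat. (x' [^]\<^bsub>R\<^esub> e) \<odot>\<^bsub>M\<^esub> (x \<odot>\<^bsub>M\<^esub> z) \<in> W" if x': "x' \<in> I" for x'
    proof -
      have x'c: "x' \<in> carrier R" using x' R.idealD(1)[OF assms(2)] by blast
      obtain e :: nat where "(x' [^]\<^bsub>R\<^esub> e) \<odot>\<^bsub>M\<^esub> z \<in> W" using z(3)[OF x'] by blast
      then have "(x' [^]\<^bsub>R\<^esub> e) \<odot>\<^bsub>M\<^esub> (x \<odot>\<^bsub>M\<^esub> z) \<in> W"
        using submoduleD(5)[OF W xc] smult_swap[OF R.nat_pow_closed[OF x'c] xc z(1)] by simp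
      then show ?thesis by blast
    qed
    have eq: "colon R M W (x \<odot>\<^bsub>M\<^esub> z) = colon R M W z"
      by (rule max[OF _ le]) (use smult_closed[OF xc z(1)] nt nil' in blast)
    define e where "e = (LEAST e::nat. (x [^]\<^bsub>R\<^esub> e) \<odot>\<^bsub>M\<^esub> z \<in> W)"
    have e: "(x [^]\<^bsub>R\<^esub> e) \<odot>\<^bsub>M\<^esub> z \<in> W" using LeastI_ex[OF z(3)[OF x]] by (simp add: e_def)
    have "z \<notin> W"
    proof
      assume "z \<in> W"
      then have "\<forall>u\<in>ideal_power R I 0. u \<odot>\<^bsub>M\<^esub> z \<in> W" using submoduleD(5)[OF W] by simp
      then show False using z(2) by blast
    qed
    then have "e \<noteq> 0" using e z(1) by (cases e) auto
    then obtain k where k: "e = Suc k" by (cases e) auto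
    have "x [^]\<^bsub>R\<^esub> k \<notin> colon R M W z"
      using not_less_Least[of k "\<lambda>e. (x [^]\<^bsub>R\<^esub> e) \<odot>\<^bsub>M\<^esub> z \<in> W"] k by (simp add: e_def colon_def)
    moreover have "x [^]\<^bsub>R\<^esub> k \<in> colon R M W (x \<odot>\<^bsub>M\<^esub> z)"
      using e k xc z(1) by (simp add: colon_def smult_assoc1)
    ultimately show False using eq by blast
  qed
  then show False using torsion_of_ideal_multiples[OF assms(1,2) W z(1)] z(2) by blast
qed

text \<open>
  The preimage in \<open>M\<close> of the \<open>I\<close>-torsion submodule of \<open>M/L\<close>.
\<close>

definition saturation :: "('a, 'r) ring_scheme \<Rightarrow> 'a set \<Rightarrow> ('a, 'b, 'c) module_scheme \<Rightarrow> 'b set \<Rightarrow> 'b set" where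
  "saturation R I M L = {y \<in> carrier M. \<exists>n. \<forall>u\<in>ideal_power R I n. u \<odot>\<^bsub>M\<^esub> y \<in> L}"

lemma (in module) submodule_saturation:
  assumes "ideal I R" and L: "submodule L R M"
  shows "submodule (saturation R I M L) R M"
  unfolding submodule_iff
proof (intro conjI ballI subsetI)
  note l = submoduleD[OF L]
  have pc: "u \<in> carrier R" if "u \<in> ideal_power R I n" for u n
    using that R.ideal_power_carrier[OF assms(1)] by blast
  show "\<zero>\<^bsub>M\<^esub> \<in> saturation R I M L" using pc l(3) smult_r_null unfolding saturation_def by auto
  show "x \<in> carrier M" if "x \<in> saturation R I M L" for x using that by (simp add: saturation_def)
  fix x assume "x \<in> saturation R I M L"
  then obtain n where x: "x \<in> carrier M" "\<And>u. u \<in> ideal_power R I n \<Longrightarrow> u \<odot>\<^bsub>M\<^esub> x \<in> L"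
    by (auto simp: saturation_def)
  show "r \<odot>\<^bsub>M\<^esub> x \<in> saturation R I M L" if r: "r \<in> carrier R" for r
  proof -
    have "u \<odot>\<^bsub>M\<^esub> (r \<odot>\<^bsub>M\<^esub> x) \<in> L" if u: "u \<in> ideal_power R I n" for u
      using smult_swap[OF pc[OF u] r x(1)] l(5)[OF r x(2)[OF u]] by simp
    then show ?thesis using x(1) r unfolding saturation_def by blast
  qed
  fix y assume "y \<in> saturation R I M L"
  then obtain m where y: "y \<in> carrier M" "\<And>u. u \<in> ideal_power R I m \<Longrightarrow> u \<odot>\<^bsub>M\<^esub> y \<in> L"
    by (auto simp: saturation_def)
  have "u \<odot>\<^bsub>M\<^esub> (x \<oplus>\<^bsub>M\<^esub> y) \<in> L" if "u \<in> ideal_power R I (max n m)" for u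
  proof -
    have "u \<in> ideal_power R I n" "u \<in> ideal_power R I m"
      using that R.ideal_power_mono[OF assms(1), of n "max n m"] R.ideal_power_mono[OF assms(1), of m "max n m"]
      by auto
    then show ?thesis using x y l(4) pc smult_r_distr by simp
  qed
  then show "x \<oplus>\<^bsub>M\<^esub> y \<in> saturation R I M L" using x y unfolding saturation_def by blast
qed

lemma (in module) saturation_ge:
  assumes "submodule L R M" "ideal I R"
  shows "L \<subseteq> saturation R I M L"
proof
  fix y assume "y \<in> L"
  then have "\<forall>u\<in>ideal_power R I 0. u \<odot>\<^bsub>M\<^esub> y \<in> L" "y \<in> carrier M" using submoduleD[OF assms(1)] by auto
  then show "y \<in> saturation R I M L" unfolding saturation_def by blast
qed

lemma (in module) saturation_saturated:
  assumes "noetherian_ring R" "ideal I R" and L: "submodule L R M" and "y \<in> carrier M"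
    and "\<And>x. x \<in> I \<Longrightarrow> x \<odot>\<^bsub>M\<^esub> y \<in> saturation R I M L"
  shows "y \<in> saturation R I M L"
  using torsion_of_ideal_multiples[OF assms(1-4)] assms(4,5) unfolding saturation_def by blast

text \<open>
  An associated prime of \<open>M/T\<close> that contained \<open>I\<close> would be the annihilator of a nonzero torsion element. So \<open>I\<close> is
  not contained in any of them, and prime avoidance applies.
\<close>

lemma (in module) regular_element:
  assumes "noetherian_ring R" "ideal I R" and L: "submodule L R M"
    and fin: "finite (Ass R (quot_module R M (saturation R I M L)))"
  shows "\<exists>x\<in>I. \<forall>y\<in>carrier M. x \<odot>\<^bsub>M\<^esub> y \<in> saturation R I M L \<longrightarrow> y \<in> saturation R I M L"
proof -
  let ?T = "saturation R I M L"
  have T: "submodule ?T R M" using submodule_saturation assms by blast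
  have "\<exists>x\<in>I. \<forall>p\<in>Ass R (quot_module R M ?T). x \<notin> p"
  proof (rule R.prime_avoidance[OF fin _ assms(2)])
    fix p assume p: "p \<in> Ass R (quot_module R M ?T)"
    then show pp: "primeideal p R" by (simp add: Ass_def)
    obtain y where y: "y \<in> carrier M" "p = colon R M ?T y"
      using p annihilator_quot[OF T] by (auto simp: Ass_def quot_carrier)
    show "\<not> I \<subseteq> p"
    proof
      assume "I \<subseteq> p"
      have "y \<in> ?T"
      proof (rule saturation_saturated[OF assms(1-3) y(1)])
        show "x \<odot>\<^bsub>M\<^esub> y \<in> ?T" if "x \<in> I" for x using that \<open>I \<subseteq> p\<close> y(2) by (auto simp: colon_def)
      qed
      then show False using R.primeD(2)[OF pp] one_in_colon_iff y by blast
    qed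
  qed
  then show ?thesis
    using zero_divisor_in_associated_prime[OF assms(1) T] R.idealD(1)[OF assms(2)] by blast
qed


section \<open>Finitely generated modules and Artin--Rees\<close>

context module
begin

lemma gen_submodule_insert:
  assumes "E \<subseteq> carrier M" "x \<in> carrier M"
  shows "gen_submodule R M (insert x E) = {r \<odot>\<^bsub>M\<^esub> x \<oplus>\<^bsub>M\<^esub> m | r m. r \<in> carrier R \<and> m \<in> gen_submodule R M E}"
    (is "?L = ?K")
proof
  have E: "submodule (gen_submodule R M E) R M" using submodule_gen_submodule[OF assms(1)] .
  note e = submoduleD[OF E]
  have L: "submodule ?L R M" using submodule_gen_submodule assms by simp
  have "submodule ((\<lambda>r. r \<odot>\<^bsub>M\<^esub> x) ` carrier R) R M"
    unfolding submodule_iff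
  proof (intro conjI ballI)
    show "\<zero>\<^bsub>M\<^esub> \<in> (\<lambda>r. r \<odot>\<^bsub>M\<^esub> x) ` carrier R" using assms(2) by (metis R.zero_closed image_eqI smult_l_null)
  qed (use assms(2) in \<open>auto simp: smult_l_distr[symmetric] smult_assoc1[symmetric]\<close>)
  from submodule_sum[OF this E] have K: "submodule ?K R M"
    by (rule back_subst[of "\<lambda>S. submodule S R M"]) (unfold set_eq_iff set_add_iff, blast)
  have "E \<subseteq> ?K"
  proof
    fix m assume m: "m \<in> E"
    then have "m = \<zero>\<^bsub>R\<^esub> \<odot>\<^bsub>M\<^esub> x \<oplus>\<^bsub>M\<^esub> m" using assms by auto
    then show "m \<in> ?K" using m gen_submodule_ge[of E R M] R.zero_closed by blast
  qed
  moreover have "x \<in> ?K"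
  proof -
    have "x = \<one>\<^bsub>R\<^esub> \<odot>\<^bsub>M\<^esub> x \<oplus>\<^bsub>M\<^esub> \<zero>\<^bsub>M\<^esub>" using assms by simp
    then show ?thesis using e(3) R.one_closed by blast
  qed
  ultimately show "?L \<subseteq> ?K" unfolding gen_submodule_le_iff[OF K] by blast
  have "gen_submodule R M E \<subseteq> ?L" using gen_submodule_le_iff[OF L] gen_submodule_ge[of "insert x E" R M] by blast
  moreover have "x \<in> ?L" using gen_submodule_ge[of "insert x E" R M] by blast
  ultimately show "?K \<subseteq> ?L" using submoduleD[OF L] by blast
qed

text \<open>
  Induction on the number of generators. The coefficients of \<open>x\<close> in the elements of \<open>L\<close> form a finitely
  generated ideal; lifts of its generators to \<open>L\<close>, together with generators of the part of \<open>L\<close> without \<open>x\<close>,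
  generate \<open>L\<close>.
\<close>

lemma submodule_finitely_generated:
  assumes "noetherian_ring R" "finite E" "E \<subseteq> carrier M" "submodule L R M" "L \<subseteq> gen_submodule R M E"
  shows "\<exists>Y. finite Y \<and> Y \<subseteq> L \<and> gen_submodule R M Y = L"
  using assms(2-)
proof (induction E arbitrary: L rule: finite_induct)
  case empty
  have "gen_submodule R M {} \<subseteq> {\<zero>\<^bsub>M\<^esub>}" using gen_submodule_le_iff[OF submodule_zero, of "{}"] by simp
  then have L: "L \<subseteq> gen_submodule R M {}" "gen_submodule R M {} \<subseteq> L"
    using empty submoduleD(3)[OF empty(2)] by auto
  then have "gen_submodule R M {} = L" by simp
  then show ?case by (intro exI[of _ "{}"]) simp
next
  case (insert x E)
  note L = \<open>submodule L R M\<close>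
  note l = submoduleD[OF L]
  have x: "x \<in> carrier M" and E: "E \<subseteq> carrier M" using insert.prems by auto
  let ?G = "gen_submodule R M E"
  have G: "submodule ?G R M" using submodule_gen_submodule[OF E] .
  note g = submoduleD[OF G]
  obtain Y where Y: "finite Y" "Y \<subseteq> L \<inter> ?G" "gen_submodule R M Y = L \<inter> ?G"
    using insert.IH[OF E submodule_Int[OF L G]] by blast
  let ?J = "\<lambda>S. {r \<in> carrier R. \<exists>m\<in>?G. r \<odot>\<^bsub>M\<^esub> x \<oplus>\<^bsub>M\<^esub> m \<in> S}"
  have J: "ideal (?J S) R" if S: "submodule S R M" for S
  proof (rule R.idealI_simple)
    note s = submoduleD[OF S]
    show "\<zero>\<^bsub>R\<^esub> \<in> ?J S" using g(3) s(3) x by (auto intro!: bexI[of _ "\<zero>\<^bsub>M\<^esub>"])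
    fix a assume "a \<in> ?J S"
    then obtain m where a: "a \<in> carrier R" "m \<in> ?G" "a \<odot>\<^bsub>M\<^esub> x \<oplus>\<^bsub>M\<^esub> m \<in> S" by blast
    have "(r \<otimes>\<^bsub>R\<^esub> a) \<odot>\<^bsub>M\<^esub> x \<oplus>\<^bsub>M\<^esub> r \<odot>\<^bsub>M\<^esub> m = r \<odot>\<^bsub>M\<^esub> (a \<odot>\<^bsub>M\<^esub> x \<oplus>\<^bsub>M\<^esub> m)" if "r \<in> carrier R" for r
      using that a x g(2) by (simp add: smult_r_distr smult_assoc1)
    then show "r \<otimes>\<^bsub>R\<^esub> a \<in> ?J S" if "r \<in> carrier R" for r
      using s(5)[OF that a(3)] a that g(5)[OF that a(2)] R.m_closed by (metis (mono_tags, lifting) mem_Collect_eq)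
    fix b assume "b \<in> ?J S"
    then obtain n where b: "b \<in> carrier R" "n \<in> ?G" "b \<odot>\<^bsub>M\<^esub> x \<oplus>\<^bsub>M\<^esub> n \<in> S" by blast
    have "(a \<oplus>\<^bsub>R\<^esub> b) \<odot>\<^bsub>M\<^esub> x \<oplus>\<^bsub>M\<^esub> (m \<oplus>\<^bsub>M\<^esub> n) = (a \<odot>\<^bsub>M\<^esub> x \<oplus>\<^bsub>M\<^esub> m) \<oplus>\<^bsub>M\<^esub> (b \<odot>\<^bsub>M\<^esub> x \<oplus>\<^bsub>M\<^esub> n)"
      using a b x g(2)[OF a(2)] g(2)[OF b(2)] by (simp add: smult_l_distr add_swap4)
    then show "a \<oplus>\<^bsub>R\<^esub> b \<in> ?J S"
      using s(4)[OF a(3) b(3)] a b g(4)[OF a(2) b(2)] R.a_closed by (metis (mono_tags, lifting) mem_Collect_eq)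
  qed auto
  obtain A where A: "A \<subseteq> carrier R" "finite A" "?J L = Idl\<^bsub>R\<^esub> A"
    using noetherian_ring.finetely_gen[OF assms(1) J[OF L]] by blast
  have AJ: "A \<subseteq> ?J L" using A R.genideal_self by blast
  then have "\<forall>r\<in>A. \<exists>m\<in>?G. r \<odot>\<^bsub>M\<^esub> x \<oplus>\<^bsub>M\<^esub> m \<in> L" by blast
  then obtain m where m: "\<And>r. r \<in> A \<Longrightarrow> m r \<in> ?G \<and> r \<odot>\<^bsub>M\<^esub> x \<oplus>\<^bsub>M\<^esub> m r \<in> L" by metis
  define Y' where "Y' = Y \<union> (\<lambda>r. r \<odot>\<^bsub>M\<^esub> x \<oplus>\<^bsub>M\<^esub> m r) ` A"
  have Y'L: "Y' \<subseteq> L" using Y m by (auto simp: Y'_def)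
  have "Y' \<subseteq> carrier M" using Y'L l by blast
  then have Y': "submodule (gen_submodule R M Y') R M" by (rule submodule_gen_submodule)
  note y' = submoduleD[OF Y']
  have le: "gen_submodule R M Y' \<subseteq> L" using gen_submodule_le_iff[OF L] Y'L by blast
  have LG: "L \<inter> ?G \<subseteq> gen_submodule R M Y'"
    unfolding Y(3)[symmetric] gen_submodule_le_iff[OF Y'] using gen_submodule_ge[of Y' R M] by (auto simp: Y'_def)
  have "A \<subseteq> ?J (gen_submodule R M Y')"
    using m A(1) gen_submodule_ge[of Y' R M] unfolding Y'_def by blast
  then have JJ: "?J L \<subseteq> ?J (gen_submodule R M Y')"
    using R.genideal_minimal[OF J[OF Y']] A(3) by blast
  have "L \<subseteq> gen_submodule R M Y'"
  proof
    fix y assume y: "y \<in> L"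
    then have "y \<in> gen_submodule R M (insert x E)" using insert.prems by blast
    then obtain r n where rn: "r \<in> carrier R" "n \<in> ?G" "y = r \<odot>\<^bsub>M\<^esub> x \<oplus>\<^bsub>M\<^esub> n"
      unfolding gen_submodule_insert[OF E x] by blast
    then have "r \<in> ?J L" using y by blast
    then obtain n' where n': "n' \<in> ?G" "r \<odot>\<^bsub>M\<^esub> x \<oplus>\<^bsub>M\<^esub> n' \<in> gen_submodule R M Y'" using JJ by blast
    have c: "r \<odot>\<^bsub>M\<^esub> x \<in> carrier M" "n \<in> carrier M" "n' \<in> carrier M" using rn n' g(2) x by auto
    have eq: "y = (r \<odot>\<^bsub>M\<^esub> x \<oplus>\<^bsub>M\<^esub> n') \<oplus>\<^bsub>M\<^esub> (n \<ominus>\<^bsub>M\<^esub> n')"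
      using rn(3) c add_swap4[of "r \<odot>\<^bsub>M\<^esub> x" n' n "\<ominus>\<^bsub>M\<^esub> n'"] by (simp add: a_minus_def M.r_neg)
    then have "n \<ominus>\<^bsub>M\<^esub> n' \<in> L"
      using submodule_add_cancel[OF L, of "r \<odot>\<^bsub>M\<^esub> x \<oplus>\<^bsub>M\<^esub> n'" "n \<ominus>\<^bsub>M\<^esub> n'"] y n'(2) le c by auto
    then have "n \<ominus>\<^bsub>M\<^esub> n' \<in> gen_submodule R M Y'" using LG g(7)[OF rn(2) n'(1)] by blast
    then show "y \<in> gen_submodule R M Y'" unfolding eq using y'(4)[OF n'(2)] by blast
  qed
  then show ?case using le Y'L Y(1) A(2) by (intro exI[of _ Y']) (auto simp: Y'_def)
qed

lemma submodule_family_maximal: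
  assumes "noetherian_ring R" "finite E" "E \<subseteq> carrier M" "gen_submodule R M E = carrier M"
    and "\<A> \<noteq> {}" "\<And>L. L \<in> \<A> \<Longrightarrow> submodule L R M"
  shows "\<exists>L\<in>\<A>. \<forall>K\<in>\<A>. L \<subseteq> K \<longrightarrow> K = L"
proof (rule subset_Zorn_nonempty[OF assms(5)])
  fix \<C> assume C: "\<C> \<noteq> {}" "subset.chain \<A> \<C>"
  have CA: "\<C> \<subseteq> \<A>" and ch: "\<And>K L. K \<in> \<C> \<Longrightarrow> L \<in> \<C> \<Longrightarrow> K \<subseteq> L \<or> L \<subseteq> K"
    using C(2) unfolding pred_on.chain_def by auto
  have sub: "submodule K R M" if "K \<in> \<C>" for K using that CA assms(6) by blast
  have U: "submodule (\<Union>\<C>) R M"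
    unfolding submodule_iff
  proof (intro conjI ballI)
    show "\<Union>\<C> \<subseteq> carrier M" using sub submoduleD(1) by blast
    show "\<zero>\<^bsub>M\<^esub> \<in> \<Union>\<C>" using C(1) sub submoduleD(3) by blast
    fix x assume "x \<in> \<Union>\<C>"
    then obtain K where K: "K \<in> \<C>" "x \<in> K" by blast
    show "r \<odot>\<^bsub>M\<^esub> x \<in> \<Union>\<C>" if "r \<in> carrier R" for r using K submoduleD(5)[OF sub that] by blast
    fix y assume "y \<in> \<Union>\<C>"
    then obtain L where L: "L \<in> \<C>" "y \<in> L" by blast
    show "x \<oplus>\<^bsub>M\<^esub> y \<in> \<Union>\<C>"
      using ch[OF K(1) L(1)] K L submoduleD(4)[OF sub] by blast
  qed
  then have "\<Union>\<C> \<subseteq> gen_submodule R M E" using assms(4) submoduleD(1) by simp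
  then obtain Y where Y: "finite Y" "Y \<subseteq> \<Union>\<C>" "gen_submodule R M Y = \<Union>\<C>"
    using submodule_finitely_generated[OF assms(1-3) U] by blast
  have "\<exists>K\<in>\<C>. Y \<subseteq> K" using Y(1,2)
  proof (induction Y rule: finite_induct)
    case empty
    then show ?case using C(1) by blast
  next
    case (insert y Y)
    then obtain K L where "K \<in> \<C>" "Y \<subseteq> K" "L \<in> \<C>" "y \<in> L" by blast
    then show ?case using ch[of K L] by blast
  qed
  then obtain K where K: "K \<in> \<C>" "Y \<subseteq> K" by blast
  then have "\<Union>\<C> \<subseteq> K" using Y(3) gen_submodule_le_iff[OF sub[OF K(1)]] by blast
  then have "\<Union>\<C> = K" using K(1) by blast
  then show "\<Union>\<C> \<in> \<A>" using K(1) CA by blast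
qed

lemma submodule_smult_vimage:
  assumes V: "submodule V R M" and u: "u \<in> carrier R"
  shows "submodule {f \<in> carrier M. u \<odot>\<^bsub>M\<^esub> f \<in> V} R M"
  unfolding submodule_iff
proof (intro conjI ballI)
  note v = submoduleD[OF V]
  show "\<zero>\<^bsub>M\<^esub> \<in> {f \<in> carrier M. u \<odot>\<^bsub>M\<^esub> f \<in> V}" using v(3) u by simp
  fix y assume y: "y \<in> {f \<in> carrier M. u \<odot>\<^bsub>M\<^esub> f \<in> V}"
  show "r \<odot>\<^bsub>M\<^esub> y \<in> {f \<in> carrier M. u \<odot>\<^bsub>M\<^esub> f \<in> V}" if r: "r \<in> carrier R" for r
    using v(5)[OF r] smult_swap[OF u r] y r by simp
  show "y \<oplus>\<^bsub>M\<^esub> z \<in> {f \<in> carrier M. u \<odot>\<^bsub>M\<^esub> f \<in> V}" if "z \<in> {f \<in> carrier M. u \<odot>\<^bsub>M\<^esub> f \<in> V}" for z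
    using that y v(4) smult_r_distr[OF u] by simp
qed blast

text \<open>
  Let \<open>V\<close> be maximal among the submodules with \<open>V \<inter> Z = I\<^sup>kZ\<close>. For \<open>x \<in> I\<close> the submodules
  \<open>{f. x\<^sup>n f \<in> V}\<close> become stationary. For such an \<open>n\<close>, an element \<open>z = v + x\<^sup>n f\<close> of \<open>Z\<close> satisfies
  \<open>x\<^sup>k z \<in> I\<^sup>kZ \<subseteq> V\<close>, whence \<open>x\<^sup>k\<^sup>+\<^sup>n f \<in> V\<close>, \<open>x\<^sup>n f \<in> V\<close> and \<open>z \<in> V\<close>. By maximality \<open>x\<^sup>nM \<subseteq> V\<close>. As
  this holds for every \<open>x \<in> I\<close>, a power of \<open>I\<close> maps \<open>M\<close> into \<open>V\<close>.
\<close>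

lemma weak_artin_rees:
  assumes noeth: "noetherian_ring R" and I: "ideal I R"
    and fg: "finite E" "E \<subseteq> carrier M" "gen_submodule R M E = carrier M"
    and Z: "submodule Z R M"
  shows "\<exists>n. ideal_span R M (ideal_power R I n) (carrier M) \<inter> Z \<subseteq> ideal_span R M (ideal_power R I k) Z"
proof -
  let ?IZ = "ideal_span R M (ideal_power R I k) Z"
  have IZ: "submodule ?IZ R M"
    using submodule_ideal_span[OF R.ideal_power_carrier[OF I] submoduleD(1)[OF Z]] .
  have IZZ: "?IZ \<subseteq> Z"
    unfolding ideal_span_le_iff[OF Z] using submoduleD(5)[OF Z] R.ideal_power_carrier[OF I] by blast
  define \<A> where "\<A> = {V. submodule V R M \<and> V \<inter> Z = ?IZ}"
  have "\<exists>V\<in>\<A>. \<forall>W\<in>\<A>. V \<subseteq> W \<longrightarrow> W = V"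
    by (rule submodule_family_maximal[OF noeth fg]) (use IZ IZZ in \<open>auto simp: \<A>_def\<close>)
  then obtain V where V: "submodule V R M" "V \<inter> Z = ?IZ"
    and max: "\<And>W. submodule W R M \<Longrightarrow> W \<inter> Z = ?IZ \<Longrightarrow> V \<subseteq> W \<Longrightarrow> W = V"
    by (auto simp: \<A>_def)
  note v = submoduleD[OF V(1)]
  have nil: "\<exists>n::nat. \<forall>f\<in>carrier M. (x [^]\<^bsub>R\<^esub> n) \<odot>\<^bsub>M\<^esub> f \<in> V" if x: "x \<in> I" for x
  proof -
    have xc: "x \<in> carrier R" using x R.idealD(1)[OF I] by blast
    have pc: "x [^]\<^bsub>R\<^esub> (n::nat) \<in> carrier R" for n using xc by simp
    let ?C = "\<lambda>n::nat. {f \<in> carrier M. (x [^]\<^bsub>R\<^esub> n) \<odot>\<^bsub>M\<^esub> f \<in> V}"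
    have C: "submodule (?C n) R M" for n using submodule_smult_vimage[OF V(1) pc] .
    have "\<exists>D\<in>range ?C. \<forall>K\<in>range ?C. D \<subseteq> K \<longrightarrow> K = D"
      by (rule submodule_family_maximal[OF noeth fg]) (use C in auto)
    then obtain D n where D: "D = ?C n" "\<forall>K\<in>range ?C. D \<subseteq> K \<longrightarrow> K = D" by blast
    have n: "?C m = ?C n" if "?C n \<subseteq> ?C m" for m
      using D(2)[unfolded D(1), rule_format, OF rangeI that] .
    have add: "(x [^]\<^bsub>R\<^esub> (a + b)) \<odot>\<^bsub>M\<^esub> f = (x [^]\<^bsub>R\<^esub> a) \<odot>\<^bsub>M\<^esub> ((x [^]\<^bsub>R\<^esub> b) \<odot>\<^bsub>M\<^esub> f)" if "f \<in> carrier M" for a b :: nat and f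
      using smult_assoc1[OF pc pc that] R.nat_pow_mult[OF xc] by simp
    have stab: "(x [^]\<^bsub>R\<^esub> n) \<odot>\<^bsub>M\<^esub> f \<in> V" if f: "f \<in> carrier M" "(x [^]\<^bsub>R\<^esub> (k + n)) \<odot>\<^bsub>M\<^esub> f \<in> V" for f
    proof -
      have "?C n \<subseteq> ?C (k + n)" using add v(5) pc by auto
      from n[OF this] show ?thesis using f by blast
    qed
    let ?xF = "(\<lambda>f. (x [^]\<^bsub>R\<^esub> n) \<odot>\<^bsub>M\<^esub> f) ` carrier M"
    let ?W = "V <+>\<^bsub>M\<^esub> ?xF"
    have xF: "submodule ?xF R M" using submodule_smult_image[OF pc carrier_is_submodule] .
    have W: "submodule ?W R M" using submodule_sum[OF V(1) xF] .
    have VW: "V \<subseteq> ?W" using sum_ge(1)[OF V(1) xF] .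
    have "?W \<inter> Z \<subseteq> V"
    proof
      fix z assume z: "z \<in> ?W \<inter> Z"
      then have "z \<in> ?W" by blast
      then obtain a f where af: "a \<in> V" "f \<in> carrier M" "z = a \<oplus>\<^bsub>M\<^esub> (x [^]\<^bsub>R\<^esub> n) \<odot>\<^bsub>M\<^esub> f"
        by (auto elim: set_addE)
      have "(x [^]\<^bsub>R\<^esub> k) \<odot>\<^bsub>M\<^esub> z \<in> ?IZ"
        by (rule ideal_span_mem[OF R.pow_in_ideal_power[OF I x]]) (use z in blast)
      then have "(x [^]\<^bsub>R\<^esub> k) \<odot>\<^bsub>M\<^esub> z \<in> V" using V(2) by blast
      moreover have "(x [^]\<^bsub>R\<^esub> k) \<odot>\<^bsub>M\<^esub> z = (x [^]\<^bsub>R\<^esub> k) \<odot>\<^bsub>M\<^esub> a \<oplus>\<^bsub>M\<^esub> (x [^]\<^bsub>R\<^esub> (k + n)) \<odot>\<^bsub>M\<^esub> f"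
        unfolding af(3) add[OF af(2)] using af v(2) pc by (simp add: smult_r_distr)
      ultimately have "(x [^]\<^bsub>R\<^esub> (k + n)) \<odot>\<^bsub>M\<^esub> f \<in> V"
        using submodule_add_cancel[OF V(1) v(5)[OF pc af(1)]] af(2) pc by simp
      then have "(x [^]\<^bsub>R\<^esub> n) \<odot>\<^bsub>M\<^esub> f \<in> V" by (rule stab[OF af(2)])
      then show "z \<in> V" unfolding af(3) by (rule v(4)[OF af(1)])
    qed
    then have "?W \<inter> Z = ?IZ" using VW V(2) by blast
    then have "?W = V" using max[OF W] VW by blast
    then show ?thesis using sum_ge(2)[OF V(1) xF] by blast
  qed
  have "\<exists>n. \<forall>f\<in>E. \<forall>u\<in>ideal_power R I n. u \<odot>\<^bsub>M\<^esub> f \<in> V"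
  proof (rule finite_uniform_bound[OF fg(1)])
    fix f assume "f \<in> E"
    then show "\<exists>n. \<forall>u\<in>ideal_power R I n. u \<odot>\<^bsub>M\<^esub> f \<in> V"
      using torsion_of_nilpotents[OF noeth I V(1), of f] nil fg(2) by blast
  qed (use R.ideal_power_mono[OF I] in blast)
  then obtain n where n: "\<And>f u. f \<in> E \<Longrightarrow> u \<in> ideal_power R I n \<Longrightarrow> u \<odot>\<^bsub>M\<^esub> f \<in> V" by blast
  have "u \<odot>\<^bsub>M\<^esub> f \<in> V" if u: "u \<in> ideal_power R I n" and f: "f \<in> carrier M" for u f
  proof -
    have uc: "u \<in> carrier R" using u R.ideal_power_carrier[OF I] by blast
    have "submodule {f \<in> carrier M. u \<odot>\<^bsub>M\<^esub> f \<in> V} R M" using submodule_smult_vimage[OF V(1) uc] .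
    from gen_submodule_le_iff[OF this, of E] show ?thesis using n[OF _ u] fg f by blast
  qed
  then have "ideal_span R M (ideal_power R I n) (carrier M) \<subseteq> V"
    unfolding ideal_span_le_iff[OF V(1)] by blast
  then show ?thesis using V(2) by blast
qed

lemma torsion_of_finitely_generated:
  assumes "ideal I R" and fg: "finite E" "E \<subseteq> carrier M" "gen_submodule R M E = carrier M"
    and B: "module R B" and h: "h \<in> mod_hom R M B"
    and tors: "\<And>y. y \<in> carrier B \<Longrightarrow> \<exists>n. \<forall>u\<in>ideal_power R I n. u \<odot>\<^bsub>B\<^esub> y = \<zero>\<^bsub>B\<^esub>"
  shows "\<exists>n. \<forall>x\<in>ideal_span R M (ideal_power R I n) (carrier M). h x = \<zero>\<^bsub>B\<^esub>"
proof -
  interpret B: module R B by fact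
  have "\<exists>n. \<forall>f\<in>E. \<forall>u\<in>ideal_power R I n. u \<odot>\<^bsub>B\<^esub> h f = \<zero>\<^bsub>B\<^esub>"
    by (rule finite_uniform_bound[OF fg(1)])
      (use tors mod_hom_closed[OF h] fg(2) R.ideal_power_mono[OF assms(1)] in blast)+
  then obtain n where n: "\<And>f u. f \<in> E \<Longrightarrow> u \<in> ideal_power R I n \<Longrightarrow> u \<odot>\<^bsub>B\<^esub> h f = \<zero>\<^bsub>B\<^esub>" by blast
  have ker: "submodule {f \<in> carrier M. h f \<in> {\<zero>\<^bsub>B\<^esub>}} R M"
    by (rule submodule_vimage[OF module_axioms B h B.submodule_zero])
  have "u \<odot>\<^bsub>M\<^esub> f \<in> {f \<in> carrier M. h f \<in> {\<zero>\<^bsub>B\<^esub>}}" if u: "u \<in> ideal_power R I n" and f: "f \<in> carrier M" for u f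
  proof -
    have uc: "u \<in> carrier R" using u R.ideal_power_carrier[OF assms(1)] by blast
    have "submodule {f \<in> carrier M. u \<odot>\<^bsub>M\<^esub> f \<in> {f \<in> carrier M. h f \<in> {\<zero>\<^bsub>B\<^esub>}}} R M"
      using submodule_smult_vimage[OF ker uc] .
    from gen_submodule_le_iff[OF this, of E] show ?thesis
      using n[OF _ u] fg f uc mod_hom_smult[OF h uc] by auto
  qed
  then have "ideal_span R M (ideal_power R I n) (carrier M) \<subseteq> {f \<in> carrier M. h f \<in> {\<zero>\<^bsub>B\<^esub>}}"
    unfolding ideal_span_le_iff[OF ker] by blast
  then show ?thesis by blast
qed

end

section \<open>Sequential direct limits\<close>

text \<open>
  The transition maps are constrained only on the carriers, since the maps between Ext modules are not
  extensional functions.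
\<close>

locale directed_system =
  fixes R :: "('a, 'r) ring_scheme" and E :: "nat \<Rightarrow> ('a, 'b) module" and T :: "nat \<Rightarrow> nat \<Rightarrow> 'b \<Rightarrow> 'b"
  assumes cring_R: "cring R"
    and module_E: "module R (E n)"
    and T_closed: "n \<le> m \<Longrightarrow> x \<in> carrier (E n) \<Longrightarrow> T n m x \<in> carrier (E m)"
    and T_add: "n \<le> m \<Longrightarrow> x \<in> carrier (E n) \<Longrightarrow> y \<in> carrier (E n) \<Longrightarrow>
      T n m (x \<oplus>\<^bsub>E n\<^esub> y) = T n m x \<oplus>\<^bsub>E m\<^esub> T n m y"
    and T_smult: "n \<le> m \<Longrightarrow> r \<in> carrier R \<Longrightarrow> x \<in> carrier (E n) \<Longrightarrow>
      T n m (r \<odot>\<^bsub>E n\<^esub> x) = r \<odot>\<^bsub>E m\<^esub> T n m x"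
    and T_id: "x \<in> carrier (E n) \<Longrightarrow> T n n x = x"
    and T_trans: "n \<le> m \<Longrightarrow> m \<le> k \<Longrightarrow> x \<in> carrier (E n) \<Longrightarrow> T m k (T n m x) = T n k x"
begin

definition cls :: "nat \<Rightarrow> 'b \<Rightarrow> (nat \<times> 'b) set" where
  "cls n x = dir_lim_rel E T `` {(n, x)}"

abbreviation "D \<equiv> dir_lim E T"

lemma E_closed:
  "x \<in> carrier (E n) \<Longrightarrow> y \<in> carrier (E n) \<Longrightarrow> x \<oplus>\<^bsub>E n\<^esub> y \<in> carrier (E n)"
  "r \<in> carrier R \<Longrightarrow> x \<in> carrier (E n) \<Longrightarrow> r \<odot>\<^bsub>E n\<^esub> x \<in> carrier (E n)"
  "\<zero>\<^bsub>E n\<^esub> \<in> carrier (E n)"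
proof -
  interpret module R "E n" by (rule module_E)
  show "x \<in> carrier (E n) \<Longrightarrow> y \<in> carrier (E n) \<Longrightarrow> x \<oplus>\<^bsub>E n\<^esub> y \<in> carrier (E n)"
    "r \<in> carrier R \<Longrightarrow> x \<in> carrier (E n) \<Longrightarrow> r \<odot>\<^bsub>E n\<^esub> x \<in> carrier (E n)"
    "\<zero>\<^bsub>E n\<^esub> \<in> carrier (E n)" by auto
qed

lemma T_zero:
  assumes "n \<le> m"
  shows "T n m \<zero>\<^bsub>E n\<^esub> = \<zero>\<^bsub>E m\<^esub>"
proof -
  interpret n: module R "E n" by (rule module_E)
  interpret m: module R "E m" by (rule module_E)
  have "T n m (\<zero>\<^bsub>R\<^esub> \<odot>\<^bsub>E n\<^esub> \<zero>\<^bsub>E n\<^esub>) = \<zero>\<^bsub>R\<^esub> \<odot>\<^bsub>E m\<^esub> T n m \<zero>\<^bsub>E n\<^esub>"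
    by (rule T_smult[OF assms]) auto
  then show ?thesis using T_closed[OF assms n.zero_closed] by simp
qed

lemma rel_equiv: "equiv (SIGMA n:UNIV. carrier (E n)) (dir_lim_rel E T)"
proof (rule equivI)
  show "dir_lim_rel E T \<subseteq> (SIGMA n:UNIV. carrier (E n)) \<times> (SIGMA n:UNIV. carrier (E n))"
    by (auto simp: dir_lim_rel_def)
  show "refl_on (SIGMA n:UNIV. carrier (E n)) (dir_lim_rel E T)"
    by (auto simp: dir_lim_rel_def refl_on_def)
  show "sym (dir_lim_rel E T)"
    unfolding dir_lim_rel_def sym_def by auto
  show "trans (dir_lim_rel E T)"
  proof (rule transI)
    fix a b c assume ab: "(a, b) \<in> dir_lim_rel E T" and bc: "(b, c) \<in> dir_lim_rel E T"
    obtain n x where a: "a = (n, x)" by force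
    obtain m y where b: "b = (m, y)" by force
    obtain l z where c: "c = (l, z)" by force
    from ab obtain k where k: "x \<in> carrier (E n)" "y \<in> carrier (E m)" "n \<le> k" "m \<le> k" "T n k x = T m k y"
      by (auto simp: dir_lim_rel_def a b)
    from bc obtain k' where k': "z \<in> carrier (E l)" "m \<le> k'" "l \<le> k'" "T m k' y = T l k' z"
      by (auto simp: dir_lim_rel_def b c)
    let ?k = "max k k'"
    have "T n ?k x = T k ?k (T n k x)" by (rule T_trans[symmetric]) (use k in auto)
    also have "\<dots> = T m ?k y" unfolding k(5) by (rule T_trans) (use k in auto)
    also have "\<dots> = T k' ?k (T m k' y)" by (rule T_trans[symmetric]) (use k k' in auto)
    also have "\<dots> = T l ?k z" unfolding k'(4) by (rule T_trans) (use k' in auto)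
    finally show "(a, c) \<in> dir_lim_rel E T"
      using k k' by (auto simp: dir_lim_rel_def a c intro!: exI[of _ ?k])
  qed
qed

lemma cls_eq_iff:
  assumes "x \<in> carrier (E n)" "y \<in> carrier (E m)"
  shows "cls n x = cls m y \<longleftrightarrow> (\<exists>k. n \<le> k \<and> m \<le> k \<and> T n k x = T m k y)"
proof -
  have "cls n x = cls m y \<longleftrightarrow> ((n, x), (m, y)) \<in> dir_lim_rel E T"
    unfolding cls_def by (rule eq_equiv_class_iff[OF rel_equiv]) (use assms in auto)
  then show ?thesis using assms by (auto simp: dir_lim_rel_def)
qed

lemma cls_T: "n \<le> m \<Longrightarrow> x \<in> carrier (E n) \<Longrightarrow> cls m (T n m x) = cls n x"
  by (subst cls_eq_iff) (auto simp: T_closed T_id intro!: exI[of _ m])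

lemma cls_closed: "x \<in> carrier (E n) \<Longrightarrow> cls n x \<in> carrier D"
  by (auto simp: dir_lim_def cls_def intro!: quotientI)

lemma cls_cases:
  assumes "C \<in> carrier D"
  obtains n x where "x \<in> carrier (E n)" "C = cls n x"
  using assms by (auto simp: dir_lim_def cls_def elim!: quotientE)

lemma cls_cases_above:
  assumes "C \<in> carrier D"
  obtains n x where "m \<le> n" "x \<in> carrier (E n)" "C = cls n x"
proof -
  obtain n x where "x \<in> carrier (E n)" "C = cls n x" using cls_cases[OF assms] .
  then show thesis using that[of "max n m" "T n (max n m) x"] T_closed[of n "max n m" x] cls_T[of n "max n m" x]
    by simp
qed

lemma cls_cases2:
  assumes "C \<in> carrier D" "C' \<in> carrier D"
  obtains n x y where "x \<in> carrier (E n)" "y \<in> carrier (E n)" "C = cls n x" "C' = cls n y"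
proof -
  obtain n x where x: "x \<in> carrier (E n)" "C = cls n x" using cls_cases[OF assms(1)] .
  obtain m y where y: "n \<le> m" "y \<in> carrier (E m)" "C' = cls m y" using cls_cases_above[OF assms(2)] .
  show thesis using that[of "T n m x" m y] x y T_closed[of n m x] cls_T[of n m x] by simp
qed

lemma cls_cases3:
  assumes "C \<in> carrier D" "C' \<in> carrier D" "C'' \<in> carrier D"
  obtains n x y z where "x \<in> carrier (E n)" "y \<in> carrier (E n)" "z \<in> carrier (E n)"
    "C = cls n x" "C' = cls n y" "C'' = cls n z"
proof -
  obtain n x y where x: "x \<in> carrier (E n)" "y \<in> carrier (E n)" "C = cls n x" "C' = cls n y"
    using cls_cases2[OF assms(1,2)] .
  obtain m z where z: "n \<le> m" "z \<in> carrier (E m)" "C'' = cls m z" using cls_cases_above[OF assms(3)] .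
  show thesis using that[of "T n m x" m "T n m y" z] x z T_closed[of n m] cls_T[of n m] by simp
qed

lemma mem_cls:
  assumes "(m, y) \<in> cls n x"
  shows "y \<in> carrier (E m)" "cls m y = cls n x"
proof -
  have "((n, x), (m, y)) \<in> dir_lim_rel E T" using assms by (simp add: cls_def)
  then show "y \<in> carrier (E m)" "cls m y = cls n x"
    using equiv_class_eq[OF rel_equiv, of "(n, x)" "(m, y)"] by (auto simp: cls_def dir_lim_rel_def)
qed

lemma self_mem_cls: "x \<in> carrier (E n) \<Longrightarrow> (n, x) \<in> cls n x"
  by (auto simp: cls_def dir_lim_rel_def)

lemma cls_zero: "\<zero>\<^bsub>D\<^esub> = cls n \<zero>\<^bsub>E n\<^esub>"
proof -
  have "\<zero>\<^bsub>D\<^esub> = cls 0 \<zero>\<^bsub>E 0\<^esub>" by (simp add: dir_lim_def cls_def)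
  also have "\<dots> = cls n (T 0 n \<zero>\<^bsub>E 0\<^esub>)" using cls_T[of 0 n "\<zero>\<^bsub>E 0\<^esub>"] E_closed(3) by simp
  finally show ?thesis using T_zero by simp
qed

lemma cls_eq_zero_iff:
  assumes "x \<in> carrier (E n)"
  shows "cls n x = \<zero>\<^bsub>D\<^esub> \<longleftrightarrow> (\<exists>k\<ge>n. T n k x = \<zero>\<^bsub>E k\<^esub>)"
  unfolding cls_zero[of n] cls_eq_iff[OF assms E_closed(3)] by (auto simp: T_zero)

lemma cls_add:
  assumes x: "x \<in> carrier (E n)" and y: "y \<in> carrier (E n)"
  shows "cls n x \<oplus>\<^bsub>D\<^esub> cls n y = cls n (x \<oplus>\<^bsub>E n\<^esub> y)"
proof -
  have *: "cls (max p q) (T p (max p q) x' \<oplus>\<^bsub>E (max p q)\<^esub> T q (max p q) y') = cls n (x \<oplus>\<^bsub>E n\<^esub> y)"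
    if "(p, x') \<in> cls n x" "(q, y') \<in> cls n y" for p q x' y'
  proof -
    note x' = mem_cls[OF that(1)] and y' = mem_cls[OF that(2)]
    obtain k where k: "p \<le> k" "n \<le> k" "T p k x' = T n k x"
      using x'(2) unfolding cls_eq_iff[OF x'(1) x] by blast
    obtain l where l: "q \<le> l" "n \<le> l" "T q l y' = T n l y"
      using y'(2) unfolding cls_eq_iff[OF y'(1) y] by blast
    let ?m = "max p q" and ?k = "max k l"
    have le: "p \<le> ?m" "q \<le> ?m" "?m \<le> ?k" "k \<le> ?k" "l \<le> ?k" "n \<le> ?k" using k l by auto
    have X: "T ?m ?k (T p ?m x') = T n ?k x"
      unfolding T_trans[OF le(1,3) x'(1)]
      using T_trans[OF k(1) le(4) x'(1)] T_trans[OF k(2) le(4) x] k(3) by simp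
    have Y: "T ?m ?k (T q ?m y') = T n ?k y"
      unfolding T_trans[OF le(2,3) y'(1)]
      using T_trans[OF l(1) le(5) y'(1)] T_trans[OF l(2) le(5) y] l(3) by simp
    have "T ?m ?k (T p ?m x' \<oplus>\<^bsub>E ?m\<^esub> T q ?m y') = T n ?k (x \<oplus>\<^bsub>E n\<^esub> y)"
      using T_add[OF le(3) T_closed[OF le(1) x'(1)] T_closed[OF le(2) y'(1)]] T_add[OF le(6) x y] X Y by simp
    then show ?thesis
      using cls_eq_iff[OF E_closed(1)[OF T_closed[OF le(1) x'(1)] T_closed[OF le(2) y'(1)]] E_closed(1)[OF x y]] le
      by blast
  qed
  have "cls n x \<oplus>\<^bsub>D\<^esub> cls n y = (\<Union>(p, x')\<in>cls n x. \<Union>(q, y')\<in>cls n y.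
      cls (max p q) (T p (max p q) x' \<oplus>\<^bsub>E (max p q)\<^esub> T q (max p q) y'))"
    by (simp add: dir_lim_def cls_def)
  also have "\<dots> = (\<Union>(p, x')\<in>cls n x. \<Union>(q, y')\<in>cls n y. cls n (x \<oplus>\<^bsub>E n\<^esub> y))"
    using * by (intro SUP_cong refl) (auto split: prod.splits)
  also have "\<dots> = cls n (x \<oplus>\<^bsub>E n\<^esub> y)"
    using self_mem_cls[OF x] self_mem_cls[OF y] by auto
  finally show ?thesis .
qed

lemma cls_smult:
  assumes r: "r \<in> carrier R" and x: "x \<in> carrier (E n)"
  shows "r \<odot>\<^bsub>D\<^esub> cls n x = cls n (r \<odot>\<^bsub>E n\<^esub> x)"
proof -
  have *: "cls p (r \<odot>\<^bsub>E p\<^esub> x') = cls n (r \<odot>\<^bsub>E n\<^esub> x)" if "(p, x') \<in> cls n x" for p x'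
  proof -
    note x' = mem_cls[OF that]
    obtain k where k: "p \<le> k" "n \<le> k" "T p k x' = T n k x"
      using x'(2) unfolding cls_eq_iff[OF x'(1) x] by blast
    have "T p k (r \<odot>\<^bsub>E p\<^esub> x') = T n k (r \<odot>\<^bsub>E n\<^esub> x)"
      using T_smult[OF k(1) r x'(1)] T_smult[OF k(2) r x] k(3) by simp
    then show ?thesis using cls_eq_iff[OF E_closed(2)[OF r x'(1)] E_closed(2)[OF r x]] k by blast
  qed
  have "r \<odot>\<^bsub>D\<^esub> cls n x = (\<Union>(p, x')\<in>cls n x. cls p (r \<odot>\<^bsub>E p\<^esub> x'))"
    by (simp add: dir_lim_def cls_def)
  also have "\<dots> = (\<Union>(p, x')\<in>cls n x. cls n (r \<odot>\<^bsub>E n\<^esub> x))"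
    using * by (intro SUP_cong refl) (auto split: prod.splits)
  also have "\<dots> = cls n (r \<odot>\<^bsub>E n\<^esub> x)"
    using self_mem_cls[OF x] by auto
  finally show ?thesis .
qed

lemma module_dir_lim: "module R D"
proof -
  have ag: "abelian_group D"
  proof (rule abelian_groupI)
    fix C C' assume CC: "C \<in> carrier D" "C' \<in> carrier D"
    obtain n x y where x: "x \<in> carrier (E n)" "y \<in> carrier (E n)" "C = cls n x" "C' = cls n y"
      using cls_cases2[OF CC] .
    interpret E0: module R "E n" by (rule module_E)
    show "C \<oplus>\<^bsub>D\<^esub> C' \<in> carrier D" using x by (simp add: cls_add cls_closed)
    show "C \<oplus>\<^bsub>D\<^esub> C' = C' \<oplus>\<^bsub>D\<^esub> C" using x E0.M.a_comm[OF x(1,2)] by (simp add: cls_add)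
    fix C'' assume C'': "C'' \<in> carrier D"
    obtain n x y z where x: "x \<in> carrier (E n)" "y \<in> carrier (E n)" "z \<in> carrier (E n)"
      "C = cls n x" "C' = cls n y" "C'' = cls n z"
      using cls_cases3[OF CC C''] .
    interpret E1: module R "E n" by (rule module_E)
    show "C \<oplus>\<^bsub>D\<^esub> C' \<oplus>\<^bsub>D\<^esub> C'' = C \<oplus>\<^bsub>D\<^esub> (C' \<oplus>\<^bsub>D\<^esub> C'')"
      using x E1.M.a_assoc[OF x(1-3)] by (simp add: cls_add)
  next
    show "\<zero>\<^bsub>D\<^esub> \<in> carrier D" using cls_zero[of 0] cls_closed E_closed(3) by simp
  next
    fix C assume "C \<in> carrier D"
    then obtain n x where x: "x \<in> carrier (E n)" "C = cls n x" by (rule cls_cases)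
    interpret E2: module R "E n" by (rule module_E)
    show "\<zero>\<^bsub>D\<^esub> \<oplus>\<^bsub>D\<^esub> C = C" using x by (simp add: cls_zero[of n] cls_add)
    show "\<exists>C'\<in>carrier D. C' \<oplus>\<^bsub>D\<^esub> C = \<zero>\<^bsub>D\<^esub>"
      by (rule bexI[of _ "cls n (\<ominus>\<^bsub>E n\<^esub> x)"]) (use x in \<open>auto simp: cls_zero[of n] cls_add cls_closed E2.M.l_neg\<close>)
  qed
  show ?thesis
  proof (rule moduleI[OF cring_R ag])
    fix r C assume r: "r \<in> carrier R" and C: "C \<in> carrier D"
    then obtain n x where x: "x \<in> carrier (E n)" "C = cls n x" using cls_cases by blast
    interpret E3: module R "E n" by (rule module_E)
    show "r \<odot>\<^bsub>D\<^esub> C \<in> carrier D" using x r by (simp add: cls_smult cls_closed)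
    fix s assume s: "s \<in> carrier R"
    show "(r \<oplus>\<^bsub>R\<^esub> s) \<odot>\<^bsub>D\<^esub> C = r \<odot>\<^bsub>D\<^esub> C \<oplus>\<^bsub>D\<^esub> s \<odot>\<^bsub>D\<^esub> C"
      using x r s by (simp add: cls_smult cls_add E3.smult_l_distr)
    show "(r \<otimes>\<^bsub>R\<^esub> s) \<odot>\<^bsub>D\<^esub> C = r \<odot>\<^bsub>D\<^esub> (s \<odot>\<^bsub>D\<^esub> C)"
      using x r s by (simp add: cls_smult E3.smult_assoc1)
  next
    fix r C C' assume r: "r \<in> carrier R" and CC: "C \<in> carrier D" "C' \<in> carrier D"
    obtain n x y where x: "x \<in> carrier (E n)" "y \<in> carrier (E n)" "C = cls n x" "C' = cls n y"
      using cls_cases2[OF CC] .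
    interpret E4: module R "E n" by (rule module_E)
    show "r \<odot>\<^bsub>D\<^esub> (C \<oplus>\<^bsub>D\<^esub> C') = r \<odot>\<^bsub>D\<^esub> C \<oplus>\<^bsub>D\<^esub> r \<odot>\<^bsub>D\<^esub> C'"
      using x r by (simp add: cls_smult cls_add E4.smult_r_distr)
  next
    fix C assume C: "C \<in> carrier D"
    then obtain n x where x: "x \<in> carrier (E n)" "C = cls n x" using cls_cases by blast
    interpret E5: module R "E n" by (rule module_E)
    show "\<one>\<^bsub>R\<^esub> \<odot>\<^bsub>D\<^esub> C = C" using x by (simp add: cls_smult)
  qed
qed

definition lim_sub :: "(nat \<Rightarrow> 'b set) \<Rightarrow> (nat \<times> 'b) set set" where
  "lim_sub S = {cls n x | n x. x \<in> S n}"

lemma submodule_lim_sub: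
  assumes S: "\<And>n. submodule (S n) R (E n)"
    and TS: "\<And>n m x. n \<le> m \<Longrightarrow> x \<in> S n \<Longrightarrow> T n m x \<in> S m"
  shows "submodule (lim_sub S) R D"
proof -
  interpret D: module R D by (rule module_dir_lim)
  have s: "x \<in> S n \<Longrightarrow> x \<in> carrier (E n)" "\<zero>\<^bsub>E n\<^esub> \<in> S n" "x \<in> S n \<Longrightarrow> y \<in> S n \<Longrightarrow> x \<oplus>\<^bsub>E n\<^esub> y \<in> S n"
    "r \<in> carrier R \<Longrightarrow> x \<in> S n \<Longrightarrow> r \<odot>\<^bsub>E n\<^esub> x \<in> S n" for n x y r
    using module.submoduleD[OF module_E S] by blast+
  show ?thesis
    unfolding D.submodule_iff
  proof (intro conjI ballI subsetI)
    show "\<zero>\<^bsub>D\<^esub> \<in> lim_sub S" unfolding cls_zero[of 0] lim_sub_def using s(2) by blast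
    fix C assume "C \<in> lim_sub S"
    then obtain n x where x: "x \<in> S n" "C = cls n x" by (auto simp: lim_sub_def)
    show "C \<in> carrier D" using x s(1) cls_closed by simp
    show "r \<odot>\<^bsub>D\<^esub> C \<in> lim_sub S" if "r \<in> carrier R" for r
      using cls_smult[OF that s(1)[OF x(1)]] s(4)[OF that x(1)] x(2) by (auto simp: lim_sub_def)
    fix C' assume "C' \<in> lim_sub S"
    then obtain m y where y: "y \<in> S m" "C' = cls m y" by (auto simp: lim_sub_def)
    let ?k = "max n m"
    have "C = cls ?k (T n ?k x)" "C' = cls ?k (T m ?k y)" using x y s(1) by (simp_all add: cls_T)
    moreover have "T n ?k x \<in> S ?k" "T m ?k y \<in> S ?k" using TS x y by simp_all
    ultimately show "C \<oplus>\<^bsub>D\<^esub> C' \<in> lim_sub S"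
      using cls_add[OF s(1) s(1)] s(3) unfolding lim_sub_def by blast
  qed
qed

end

text \<open>
  A family of maps compatible with the transition maps induces a map of the limits. As the
  elements of a limit are equivalence classes, the value is read off from a chosen representative.
\<close>

definition lim_map ::
  "(nat \<Rightarrow> ('a, 'b) module) \<Rightarrow> (nat \<Rightarrow> nat \<Rightarrow> 'b \<Rightarrow> 'b) \<Rightarrow>
    (nat \<Rightarrow> ('a, 'c) module) \<Rightarrow> (nat \<Rightarrow> nat \<Rightarrow> 'c \<Rightarrow> 'c) \<Rightarrow> (nat \<Rightarrow> 'b \<Rightarrow> 'c) \<Rightarrow>
    (nat \<times> 'b) set \<Rightarrow> (nat \<times> 'c) set" where
  "lim_map E T E' T' f =
    (\<lambda>C\<in>carrier (dir_lim E T). case SOME p. p \<in> C of (n, x) \<Rightarrow> dir_lim_rel E' T' `` {(n, f n x)})"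

locale directed_system_map =
  A: directed_system R E T + B: directed_system R E' T'
  for R :: "('a, 'r) ring_scheme" and E :: "nat \<Rightarrow> ('a, 'b) module" and T
    and E' :: "nat \<Rightarrow> ('a, 'c) module" and T' +
  fixes f :: "nat \<Rightarrow> 'b \<Rightarrow> 'c"
  assumes f_closed: "x \<in> carrier (E n) \<Longrightarrow> f n x \<in> carrier (E' n)"
    and f_add: "x \<in> carrier (E n) \<Longrightarrow> y \<in> carrier (E n) \<Longrightarrow> f n (x \<oplus>\<^bsub>E n\<^esub> y) = f n x \<oplus>\<^bsub>E' n\<^esub> f n y"
    and f_smult: "r \<in> carrier R \<Longrightarrow> x \<in> carrier (E n) \<Longrightarrow> f n (r \<odot>\<^bsub>E n\<^esub> x) = r \<odot>\<^bsub>E' n\<^esub> f n x"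
    and f_T: "n \<le> m \<Longrightarrow> x \<in> carrier (E n) \<Longrightarrow> f m (T n m x) = T' n m (f n x)"
begin

lemma lim_map_cls:
  assumes x: "x \<in> carrier (E n)"
  shows "lim_map E T E' T' f (A.cls n x) = B.cls n (f n x)"
proof -
  obtain m y where my: "(SOME p. p \<in> A.cls n x) = (m, y)" by force
  have "(SOME p. p \<in> A.cls n x) \<in> A.cls n x" using someI[of "\<lambda>p. p \<in> A.cls n x"] A.self_mem_cls[OF x] by blast
  then have "(m, y) \<in> A.cls n x" unfolding my .
  note y = A.mem_cls[OF this]
  obtain k where k: "m \<le> k" "n \<le> k" "T m k y = T n k x"
    using y(2) unfolding A.cls_eq_iff[OF y(1) x] by blast
  have "T' m k (f m y) = T' n k (f n x)"
    using f_T[OF k(1) y(1)] f_T[OF k(2) x] k(3) by simp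
  then have "B.cls m (f m y) = B.cls n (f n x)"
    unfolding B.cls_eq_iff[OF f_closed[OF y(1)] f_closed[OF x]] using k by blast
  then show ?thesis using A.cls_closed[OF x] by (simp add: lim_map_def my B.cls_def)
qed

lemma lim_map_hom: "lim_map E T E' T' f \<in> mod_hom R (dir_lim E T) (dir_lim E' T')"
  unfolding mod_hom_def
proof (intro CollectI conjI ballI)
  show "lim_map E T E' T' f \<in> carrier A.D \<rightarrow>\<^sub>E carrier B.D"
  proof (rule PiE_I)
    fix C assume "C \<in> carrier A.D"
    then obtain n x where x: "x \<in> carrier (E n)" "C = A.cls n x" by (rule A.cls_cases)
    then show "lim_map E T E' T' f C \<in> carrier B.D"
      by (simp add: lim_map_cls B.cls_closed f_closed)
  qed (simp add: lim_map_def)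
next
  fix C C' assume "C \<in> carrier A.D" "C' \<in> carrier A.D"
  then obtain n x y where "x \<in> carrier (E n)" "y \<in> carrier (E n)" "C = A.cls n x" "C' = A.cls n y"
    by (rule A.cls_cases2)
  then show "lim_map E T E' T' f (C \<oplus>\<^bsub>A.D\<^esub> C') = lim_map E T E' T' f C \<oplus>\<^bsub>B.D\<^esub> lim_map E T E' T' f C'"
    by (simp add: lim_map_cls A.cls_add B.cls_add f_closed f_add A.E_closed)
next
  fix r C assume r: "r \<in> carrier R" and "C \<in> carrier A.D"
  then obtain n x where x: "x \<in> carrier (E n)" "C = A.cls n x" using A.cls_cases by blast
  then show "lim_map E T E' T' f (r \<odot>\<^bsub>A.D\<^esub> C) = r \<odot>\<^bsub>B.D\<^esub> lim_map E T E' T' f C"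
    using r by (simp add: lim_map_cls A.cls_smult B.cls_smult f_closed f_smult A.E_closed)
qed

end

section \<open>Lifting along projective complexes\<close>

lemma free_hom_eqI:
  assumes "cring R" "module R A" "h \<in> mod_hom R (free_module R I) A" "h' \<in> mod_hom R (free_module R I) A"
    and "\<And>s. s \<in> I \<Longrightarrow> h (free_basis R s) = h' (free_basis R s)"
    and "x \<in> carrier (free_module R I)"
  shows "h x = h' x"
  using assms(1,6)
proof (induction x rule: free_module_induct)
  have F: "module R (free_module R I)" using module_free_module[OF assms(1)] .
  case zero
  show ?case using mod_hom_zero[OF F assms(2,3)] mod_hom_zero[OF F assms(2,4)] by simp
next
  have F: "module R (free_module R I)" using module_free_module[OF assms(1)] .
  case (step r s f)
  note b = free_basis_closed[OF assms(1) step(2)]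
  show ?case
    unfolding mod_hom_linear[OF F assms(3) step(1) b step(3)] mod_hom_linear[OF F assms(4) step(1) b step(3)]
      step(4) assms(5)[OF step(2)] ..
qed

lemma lin_ext_in_submodule:
  assumes "module R A" "submodule V R A" "v \<in> I \<rightarrow> V" "x \<in> carrier (free_module R I)"
  shows "lin_ext R I A v x \<in> V"
proof -
  interpret A: module R A by fact
  have cr: "cring R" by unfold_locales
  have F: "module R (free_module R I)" using module_free_module[OF cr] .
  have v: "v \<in> I \<rightarrow> carrier A" using assms(3) A.submoduleD(1)[OF assms(2)] by blast
  note h = lin_ext_hom[OF assms(1) v]
  show ?thesis using cr assms(4)
  proof (induction x rule: free_module_induct)
    case zero
    show ?case using mod_hom_zero[OF F assms(1) h] A.submoduleD(3)[OF assms(2)] by simp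
  next
    case (step r s f)
    note b = free_basis_closed[OF cr step(2)]
    show ?case
      unfolding mod_hom_linear[OF F h step(1) b step(3)] lin_ext_basis[OF assms(1) v step(2)]
      using A.submoduleD(4,5)[OF assms(2)] step assms(3) by blast
  qed
qed

lemma free_lift:
  assumes "module R A" "module R B" "g \<in> mod_hom R A B" "f \<in> mod_hom R (free_module R I) B"
    and V: "submodule V R A" "\<And>s. s \<in> I \<Longrightarrow> f (free_basis R s) \<in> g ` V"
  shows "\<exists>h\<in>mod_hom R (free_module R I) A. \<forall>x\<in>carrier (free_module R I). h x \<in> V \<and> g (h x) = f x"
proof -
  interpret A: module R A by fact
  have cr: "cring R" by unfold_locales
  have F: "module R (free_module R I)" using module_free_module[OF cr] .
  obtain v where v: "\<And>s. s \<in> I \<Longrightarrow> v s \<in> V \<and> g (v s) = f (free_basis R s)"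
    using V(2) unfolding image_iff by metis
  have vV: "v \<in> I \<rightarrow> V" and vA: "v \<in> I \<rightarrow> carrier A" using v A.submoduleD(2)[OF V(1)] by blast+
  let ?h = "lin_ext R I A v"
  have h: "?h \<in> mod_hom R (free_module R I) A" using lin_ext_hom[OF assms(1) vA] .
  have "g (?h x) = f x" if x: "x \<in> carrier (free_module R I)" for x
  proof -
    have gh: "(\<lambda>x\<in>carrier (free_module R I). g (?h x)) \<in> mod_hom R (free_module R I) B"
      using mod_hom_compose[OF F h assms(3)] .
    have "(\<lambda>x\<in>carrier (free_module R I). g (?h x)) x = f x"
      by (rule free_hom_eqI[OF cr assms(2) gh assms(4) _ x])
        (simp add: free_basis_closed[OF cr] lin_ext_basis[OF assms(1) vA] v)
    then show ?thesis using x by simp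
  qed
  then show ?thesis using h lin_ext_in_submodule[OF assms(1) V(1) vV] by blast
qed

text \<open>A projective module is a retract of the free module on its elements.\<close>

lemma projective_lift:
  assumes P: "projective_module R P"
    and "module R A" "module R B" "g \<in> mod_hom R A B" "f \<in> mod_hom R P B"
    and V: "submodule V R A" "\<And>x. x \<in> carrier P \<Longrightarrow> f x \<in> g ` V"
  shows "\<exists>h\<in>mod_hom R P A. \<forall>x\<in>carrier P. h x \<in> V \<and> g (h x) = f x"
proof -
  have PM: "module R P" using P by (simp add: projective_module_def)
  interpret P: module R P by fact
  have cr: "cring R" by unfold_locales
  let ?F = "free_module R (carrier P)"
  let ?p = "lin_ext R (carrier P) P (\<lambda>x. x)"
  have F: "module R ?F" using module_free_module[OF cr] .
  have p: "?p \<in> mod_hom R ?F P" by (rule lin_ext_hom[OF PM]) auto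
  have pb: "?p (free_basis R x) = x" if "x \<in> carrier P" for x
    by (rule lin_ext_basis[OF PM _ that]) auto
  have "?p ` carrier ?F = carrier P"
  proof
    show "?p ` carrier ?F \<subseteq> carrier P" using mod_hom_closed[OF p] by blast
    show "carrier P \<subseteq> ?p ` carrier ?F" using pb free_basis_closed[OF cr] by (metis image_eqI subsetI)
  qed
  moreover have i: "(\<lambda>x\<in>carrier P. x) \<in> mod_hom R P P" by (rule mod_homI[OF _ _ _ PM]) auto
  ultimately obtain s where s: "s \<in> mod_hom R P ?F" "\<And>x. x \<in> carrier P \<Longrightarrow> ?p (s x) = (\<lambda>x\<in>carrier P. x) x"
    using P F PM p unfolding projective_module_def by blast
  have fp: "(\<lambda>x\<in>carrier ?F. f (?p x)) \<in> mod_hom R ?F B" using mod_hom_compose[OF F p assms(5)] .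
  obtain h where h: "h \<in> mod_hom R ?F A"
    "\<And>x. x \<in> carrier ?F \<Longrightarrow> h x \<in> V \<and> g (h x) = (\<lambda>x\<in>carrier ?F. f (?p x)) x"
    using free_lift[OF assms(2,3,4) fp V(1)] V(2) free_basis_closed[OF cr] pb by force
  have "(\<lambda>x\<in>carrier P. h (s x)) \<in> mod_hom R P A" using mod_hom_compose[OF PM s(1) h(1)] .
  moreover have "h (s x) \<in> V \<and> g (h (s x)) = f x" if "x \<in> carrier P" for x
    using h(2)[OF mod_hom_closed[OF s(1) that]] s(2)[OF that] mod_hom_closed[OF s(1) that] that by simp
  ultimately show ?thesis by (intro bexI[of _ "\<lambda>x\<in>carrier P. h (s x)"]) auto
qed

text \<open>
  A complex \<open>\<dots> \<rightarrow> F 1 \<rightarrow> F 0 \<rightarrow> A\<close> of modules. The augmentation is separate from the differentials because \<open>A\<close>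
  may have another type than the modules \<open>F i\<close>.
\<close>

definition aug_complex ::
  "('a, 'r) ring_scheme \<Rightarrow> ('a, 'm, 'k) module_scheme \<Rightarrow> (nat \<Rightarrow> ('a, 'p) module)
    \<Rightarrow> (nat \<Rightarrow> 'p \<Rightarrow> 'p) \<Rightarrow> ('p \<Rightarrow> 'm) \<Rightarrow> bool" where
  "aug_complex R A F d e \<longleftrightarrow> module R A \<and> (\<forall>i. module R (F i)) \<and> e \<in> mod_hom R (F 0) A \<and>
    (\<forall>i. d i \<in> mod_hom R (F (Suc i)) (F i)) \<and>
    (\<forall>x\<in>carrier (F (Suc 0)). e (d 0 x) = \<zero>\<^bsub>A\<^esub>) \<and>
    (\<forall>i. \<forall>x\<in>carrier (F (Suc (Suc i))). d i (d (Suc i) x) = \<zero>\<^bsub>F i\<^esub>)"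

definition aug_exact ::
  "('a, 'r) ring_scheme \<Rightarrow> ('a, 'm, 'k) module_scheme \<Rightarrow> (nat \<Rightarrow> ('a, 'p) module)
    \<Rightarrow> (nat \<Rightarrow> 'p \<Rightarrow> 'p) \<Rightarrow> ('p \<Rightarrow> 'm) \<Rightarrow> bool" where
  "aug_exact R A F d e \<longleftrightarrow> aug_complex R A F d e \<and> e ` carrier (F 0) = carrier A \<and>
    (\<forall>x\<in>carrier (F 0). e x = \<zero>\<^bsub>A\<^esub> \<longrightarrow> x \<in> d 0 ` carrier (F (Suc 0))) \<and>
    (\<forall>i. \<forall>x\<in>carrier (F (Suc i)). d i x = \<zero>\<^bsub>F i\<^esub> \<longrightarrow> x \<in> d (Suc i) ` carrier (F (Suc (Suc i))))"

definition chain_map ::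
  "('a, 'r) ring_scheme \<Rightarrow> (nat \<Rightarrow> ('a, 'p) module) \<Rightarrow> (nat \<Rightarrow> 'p \<Rightarrow> 'p) \<Rightarrow> ('p \<Rightarrow> 'm)
    \<Rightarrow> (nat \<Rightarrow> ('a, 'q) module) \<Rightarrow> (nat \<Rightarrow> 'q \<Rightarrow> 'q) \<Rightarrow> ('q \<Rightarrow> 'n) \<Rightarrow> ('m \<Rightarrow> 'n)
    \<Rightarrow> (nat \<Rightarrow> 'p \<Rightarrow> 'q) \<Rightarrow> bool" where
  "chain_map R F d e E \<delta> \<epsilon> f \<phi> \<longleftrightarrow> (\<forall>i. \<phi> i \<in> mod_hom R (F i) (E i)) \<and>
    (\<forall>x\<in>carrier (F 0). \<epsilon> (\<phi> 0 x) = f (e x)) \<and>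
    (\<forall>i. \<forall>x\<in>carrier (F (Suc i)). \<delta> i (\<phi> (Suc i) x) = \<phi> i (d i x))"

lemma aug_exact_of_resolution:
  assumes "module R M" "projective_resolution R M P d e"
  shows "aug_exact R M P d e"
proof -
  have P: "module R (P i)" for i using assms(2) by (simp add: projective_resolution_def projective_module_def)
  have im: "y \<in> d i ` carrier (P (Suc i)) \<Longrightarrow> y \<in> (if i = 0 then {x \<in> carrier (P 0). e x = \<zero>\<^bsub>M\<^esub>}
      else {x \<in> carrier (P i). d (i - 1) x = \<zero>\<^bsub>P (i - 1)\<^esub>})" for i y
    using assms(2) unfolding projective_resolution_def by (cases i) auto
  show ?thesis
    unfolding aug_exact_def aug_complex_def
  proof (intro conjI allI ballI impI)
    show "e (d 0 x) = \<zero>\<^bsub>M\<^esub>" if "x \<in> carrier (P (Suc 0))" for x using im[of "d 0 x" 0] that by auto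
    show "d i (d (Suc i) x) = \<zero>\<^bsub>P i\<^esub>" if "x \<in> carrier (P (Suc (Suc i)))" for i x
      using im[of "d (Suc i) x" "Suc i"] that by auto
  qed (use assms P in \<open>auto simp: projective_resolution_def\<close>)
qed

text \<open>
  The comparison theorem with control of the image. If the submodules \<open>V i\<close> satisfy the exactness conditions
  that the lifting uses, the chain map can be built inside them.
\<close>

lemma comparison:
  assumes F: "aug_complex R A F d e" and proj: "\<And>i. projective_module R (F i)"
    and E: "aug_complex R B E \<delta> \<epsilon>" and f: "f \<in> mod_hom R A B"
    and V: "\<And>i. submodule (V i) R (E i)"
    and V0: "\<And>x. x \<in> carrier (F 0) \<Longrightarrow> f (e x) \<in> \<epsilon> ` V 0"
    and V1: "\<And>x. x \<in> V 0 \<Longrightarrow> \<epsilon> x = \<zero>\<^bsub>B\<^esub> \<Longrightarrow> x \<in> \<delta> 0 ` V (Suc 0)"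
    and V2: "\<And>i x. x \<in> V (Suc i) \<Longrightarrow> \<delta> i x = \<zero>\<^bsub>E i\<^esub> \<Longrightarrow> x \<in> \<delta> (Suc i) ` V (Suc (Suc i))"
  shows "\<exists>\<phi>. chain_map R F d e E \<delta> \<epsilon> f \<phi> \<and> (\<forall>i. \<forall>x\<in>carrier (F i). \<phi> i x \<in> V i)"
proof -
  note F' = F[unfolded aug_complex_def] and E' = E[unfolded aug_complex_def]
  have mF: "module R (F i)" and mE: "module R (E i)" and dF: "d i \<in> mod_hom R (F (Suc i)) (F i)"
    and dE: "\<delta> i \<in> mod_hom R (E (Suc i)) (E i)" for i using F' E' by blast+
  have mA: "module R A" and mB: "module R B" and e: "e \<in> mod_hom R (F 0) A" and \<epsilon>: "\<epsilon> \<in> mod_hom R (E 0) B"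
    using F' E' by blast+
  define cyc where "cyc i x \<longleftrightarrow> (case i of 0 \<Rightarrow> \<epsilon> x = \<zero>\<^bsub>B\<^esub> | Suc k \<Rightarrow> \<delta> k x = \<zero>\<^bsub>E k\<^esub>)" for i x
  define P where "P i h \<longleftrightarrow> h \<in> mod_hom R (F i) (E i) \<and> (\<forall>x\<in>carrier (F i). h x \<in> V i) \<and>
    (i = 0 \<longrightarrow> (\<forall>x\<in>carrier (F 0). \<epsilon> (h x) = f (e x))) \<and> (\<forall>x\<in>carrier (F (Suc i)). cyc i (h (d i x)))" for i h
  define Q where "Q i h h' \<longleftrightarrow> (\<forall>x\<in>carrier (F (Suc i)). \<delta> i (h' x) = h (d i x))" for i h h'
  have "\<exists>\<phi>. \<forall>i. P i (\<phi> i) \<and> Q i (\<phi> i) (\<phi> (Suc i))"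
  proof (rule dependent_nat_choice)
    have fe: "(\<lambda>x\<in>carrier (F 0). f (e x)) \<in> mod_hom R (F 0) B" using mod_hom_compose[OF mF e f] .
    obtain h where h: "h \<in> mod_hom R (F 0) (E 0)"
      "\<And>x. x \<in> carrier (F 0) \<Longrightarrow> h x \<in> V 0 \<and> \<epsilon> (h x) = (\<lambda>x\<in>carrier (F 0). f (e x)) x"
      using projective_lift[OF proj mE mB \<epsilon> fe V] V0 by auto
    have "cyc 0 (h (d 0 x))" if x: "x \<in> carrier (F (Suc 0))" for x
      using h(2)[OF mod_hom_closed[OF dF x]] F' x mod_hom_closed[OF dF x] mod_hom_zero[OF mA mB f]
      by (simp add: cyc_def)
    then show "\<exists>h. P 0 h" using h unfolding P_def by auto
  next
    fix h i assume "P i h"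
    then have h: "h \<in> mod_hom R (F i) (E i)" "\<And>x. x \<in> carrier (F i) \<Longrightarrow> h x \<in> V i"
      "\<And>x. x \<in> carrier (F (Suc i)) \<Longrightarrow> cyc i (h (d i x))" by (auto simp: P_def)
    have hd: "(\<lambda>x\<in>carrier (F (Suc i)). h (d i x)) \<in> mod_hom R (F (Suc i)) (E i)"
      using mod_hom_compose[OF mF dF h(1)] .
    have "h (d i x) \<in> \<delta> i ` V (Suc i)" if x: "x \<in> carrier (F (Suc i))" for x
      using V1 V2 h(2)[OF mod_hom_closed[OF dF x]] h(3)[OF x] by (cases i) (auto simp: cyc_def)
    then obtain k where k: "k \<in> mod_hom R (F (Suc i)) (E (Suc i))"
      "\<And>x. x \<in> carrier (F (Suc i)) \<Longrightarrow> k x \<in> V (Suc i) \<and> \<delta> i (k x) = (\<lambda>x\<in>carrier (F (Suc i)). h (d i x)) x"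
      using projective_lift[OF proj mE mE dE hd V] by auto
    have "cyc (Suc i) (k (d (Suc i) x))" if x: "x \<in> carrier (F (Suc (Suc i)))" for x
      using k(2)[OF mod_hom_closed[OF dF x]] F' x mod_hom_closed[OF dF x] mod_hom_zero[OF mF mE h(1)]
      by (simp add: cyc_def)
    then show "\<exists>k. P (Suc i) k \<and> Q i h k" using k unfolding P_def Q_def by auto
  qed
  then obtain \<phi> where "\<And>i. P i (\<phi> i)" "\<And>i. Q i (\<phi> i) (\<phi> (Suc i))" by blast
  then show ?thesis unfolding P_def Q_def chain_map_def by (intro exI[of _ \<phi>]) auto
qed

lemma comparison_exact:
  assumes "aug_complex R A F d e" "\<And>i. projective_module R (F i)" "aug_exact R B E \<delta> \<epsilon>" "f \<in> mod_hom R A B"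
  shows "\<exists>\<phi>. chain_map R F d e E \<delta> \<epsilon> f \<phi>"
proof -
  have E: "aug_complex R B E \<delta> \<epsilon>" and mE: "module R (E i)" for i
    using assms(3) by (simp_all add: aug_exact_def aug_complex_def)
  have e: "e \<in> mod_hom R (F 0) A" using assms(1) by (simp add: aug_complex_def)
  have "\<exists>\<phi>. chain_map R F d e E \<delta> \<epsilon> f \<phi> \<and> (\<forall>i. \<forall>x\<in>carrier (F i). \<phi> i x \<in> carrier (E i))"
    by (rule comparison[OF assms(1,2) E assms(4)])
      (use assms(3) mod_hom_closed[OF assms(4)] mod_hom_closed[OF e] module.carrier_is_submodule[OF mE]
        in \<open>auto simp: aug_exact_def\<close>)
  then show ?thesis by blast
qed

lemma chain_map_compose:
  assumes "chain_map R F d e E \<delta> \<epsilon> f \<phi>" "chain_map R E \<delta> \<epsilon> G \<gamma> c g \<psi>" "\<And>i. module R (F i)"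
    and "\<And>i. d i \<in> mod_hom R (F (Suc i)) (F i)"
  shows "chain_map R F d e G \<gamma> c (\<lambda>x. g (f x)) (\<lambda>i. \<lambda>x\<in>carrier (F i). \<psi> i (\<phi> i x))"
proof -
  have \<phi>: "\<phi> i \<in> mod_hom R (F i) (E i)" and \<psi>: "\<psi> i \<in> mod_hom R (E i) (G i)" for i
    using assms(1,2) by (simp_all add: chain_map_def)
  show ?thesis
    unfolding chain_map_def
  proof (intro conjI allI ballI)
    show "(\<lambda>x\<in>carrier (F i). \<psi> i (\<phi> i x)) \<in> mod_hom R (F i) (G i)" for i
      using mod_hom_compose[OF assms(3) \<phi> \<psi>] .
  qed (use assms(1,2) mod_hom_closed[OF \<phi>] mod_hom_closed[OF assms(4)] in \<open>auto simp: chain_map_def\<close>)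
qed

lemma mod_hom_diff_fun:
  assumes "module R A" "module R B" "f \<in> mod_hom R A B" "g \<in> mod_hom R A B"
  shows "(\<lambda>x\<in>carrier A. f x \<ominus>\<^bsub>B\<^esub> g x) \<in> mod_hom R A B"
proof -
  interpret B: module R B by fact
  note c = mod_hom_closed[OF assms(3)] mod_hom_closed[OF assms(4)]
  show ?thesis
    by (rule mod_homI[OF _ _ _ assms(1)])
      (simp_all add: c mod_hom_add[OF assms(3)] mod_hom_add[OF assms(4)] mod_hom_smult[OF assms(3)]
        mod_hom_smult[OF assms(4)] a_minus_def B.M.minus_add B.add_swap4 B.smult_r_distr B.smult_r_minus)
qed

text \<open>
  The homotopy is built degree by degree. The invariant \<open>\<delta> s d = \<theta> d\<close> in degree \<open>i\<close> makes
  \<open>\<theta> - s d\<close> a cycle in degree \<open>i + 1\<close>, which lifts by exactness.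
\<close>

lemma null_homotopy:
  assumes F: "aug_complex R A F d e" and proj: "\<And>i. projective_module R (F i)"
    and E: "aug_exact R B E \<delta> \<epsilon>" and \<theta>: "chain_map R F d e E \<delta> \<epsilon> (\<lambda>x. \<zero>\<^bsub>B\<^esub>) \<theta>"
  shows "\<exists>s. (\<forall>i. s i \<in> mod_hom R (F i) (E (Suc i))) \<and> (\<forall>x\<in>carrier (F 0). \<theta> 0 x = \<delta> 0 (s 0 x)) \<and>
    (\<forall>i. \<forall>x\<in>carrier (F (Suc i)). \<theta> (Suc i) x = \<delta> (Suc i) (s (Suc i) x) \<oplus>\<^bsub>E (Suc i)\<^esub> s i (d i x))"
proof -
  have E0: "aug_complex R B E \<delta> \<epsilon>" using E by (simp add: aug_exact_def)
  note F' = F[unfolded aug_complex_def] and E' = E0[unfolded aug_complex_def]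
  have mF: "module R (F i)" and mE: "module R (E i)" and dF: "d i \<in> mod_hom R (F (Suc i)) (F i)"
    and dE: "\<delta> i \<in> mod_hom R (E (Suc i)) (E i)" for i using F' E' by blast+
  have th: "\<theta> i \<in> mod_hom R (F i) (E i)" "x \<in> carrier (F 0) \<Longrightarrow> \<epsilon> (\<theta> 0 x) = \<zero>\<^bsub>B\<^esub>"
    "x \<in> carrier (F (Suc i)) \<Longrightarrow> \<delta> i (\<theta> (Suc i) x) = \<theta> i (d i x)" for i x
    using \<theta> by (auto simp: chain_map_def)
  have dc: "x \<in> carrier (F (Suc i)) \<Longrightarrow> d i x \<in> carrier (F i)" for i x using mod_hom_closed[OF dF] .
  define P where "P i s \<longleftrightarrow> s \<in> mod_hom R (F i) (E (Suc i)) \<and> (i = 0 \<longrightarrow> (\<forall>x\<in>carrier (F 0). \<theta> 0 x = \<delta> 0 (s x))) \<and>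
    (\<forall>x\<in>carrier (F (Suc i)). \<delta> i (s (d i x)) = \<theta> i (d i x))" for i s
  define Q where "Q i s s' \<longleftrightarrow> (\<forall>x\<in>carrier (F (Suc i)). \<theta> (Suc i) x = \<delta> (Suc i) (s' x) \<oplus>\<^bsub>E (Suc i)\<^esub> s (d i x))"
    for i s s'
  have "\<exists>s. \<forall>i. P i (s i) \<and> Q i (s i) (s (Suc i))"
  proof (rule dependent_nat_choice)
    have "\<theta> 0 x \<in> \<delta> 0 ` carrier (E (Suc 0))" if "x \<in> carrier (F 0)" for x
      using E th(2)[OF that] mod_hom_closed[OF th(1) that] by (auto simp: aug_exact_def)
    then obtain s where s: "s \<in> mod_hom R (F 0) (E (Suc 0))"
      "\<And>x. x \<in> carrier (F 0) \<Longrightarrow> \<delta> 0 (s x) = \<theta> 0 x"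
      using projective_lift[OF proj mE mE dE th(1) module.carrier_is_submodule[OF mE]] by blast
    then show "\<exists>s. P 0 s" using dc unfolding P_def by auto
  next
    fix s i assume "P i s"
    then have s: "s \<in> mod_hom R (F i) (E (Suc i))"
      "\<And>x. x \<in> carrier (F (Suc i)) \<Longrightarrow> \<delta> i (s (d i x)) = \<theta> i (d i x)" by (auto simp: P_def)
    interpret E1: module R "E (Suc i)" by (rule mE)
    interpret Ei: module R "E i" by (rule mE)
    have sd: "(\<lambda>x\<in>carrier (F (Suc i)). s (d i x)) \<in> mod_hom R (F (Suc i)) (E (Suc i))"
      using mod_hom_compose[OF mF dF s(1)] .
    let ?g = "\<lambda>x\<in>carrier (F (Suc i)). \<theta> (Suc i) x \<ominus>\<^bsub>E (Suc i)\<^esub> (\<lambda>x\<in>carrier (F (Suc i)). s (d i x)) x"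
    have g: "?g \<in> mod_hom R (F (Suc i)) (E (Suc i))" using mod_hom_diff_fun[OF mF mE th(1) sd] .
    have gx: "?g x = \<theta> (Suc i) x \<ominus>\<^bsub>E (Suc i)\<^esub> s (d i x)" "\<theta> (Suc i) x \<in> carrier (E (Suc i))"
      "s (d i x) \<in> carrier (E (Suc i))" if "x \<in> carrier (F (Suc i))" for x
      using that mod_hom_closed[OF th(1) that] mod_hom_closed[OF s(1) dc[OF that]] by simp_all
    have "?g x \<in> \<delta> (Suc i) ` carrier (E (Suc (Suc i)))" if x: "x \<in> carrier (F (Suc i))" for x
    proof -
      have "\<delta> i (?g x) = \<theta> i (d i x) \<ominus>\<^bsub>E i\<^esub> \<theta> i (d i x)"
        unfolding gx(1)[OF x] mod_hom_diff[OF mE mE dE gx(2,3)[OF x]] th(3)[OF x] s(2)[OF x] ..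
      also have "\<dots> = \<zero>\<^bsub>E i\<^esub>" using mod_hom_closed[OF th(1) dc[OF x]] by (simp add: a_minus_def Ei.M.r_neg)
      finally show ?thesis using E mod_hom_closed[OF g x] unfolding aug_exact_def by blast
    qed
    then obtain k where k: "k \<in> mod_hom R (F (Suc i)) (E (Suc (Suc i)))"
      "\<And>x. x \<in> carrier (F (Suc i)) \<Longrightarrow> \<delta> (Suc i) (k x) = ?g x"
      using projective_lift[OF proj mE mE dE g module.carrier_is_submodule[OF mE]] by blast
    have Q: "\<theta> (Suc i) x = \<delta> (Suc i) (k x) \<oplus>\<^bsub>E (Suc i)\<^esub> s (d i x)" if x: "x \<in> carrier (F (Suc i))" for x
      unfolding k(2)[OF x] gx(1)[OF x] using gx(2,3)[OF x] by (simp add: a_minus_def E1.M.a_assoc E1.M.l_neg)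
    have "\<delta> (Suc i) (k (d (Suc i) x)) = \<theta> (Suc i) (d (Suc i) x)" if x: "x \<in> carrier (F (Suc (Suc i)))" for x
    proof -
      have "d i (d (Suc i) x) = \<zero>\<^bsub>F i\<^esub>" using F' x by blast
      then have "s (d i (d (Suc i) x)) = \<zero>\<^bsub>E (Suc i)\<^esub>" using mod_hom_zero[OF mF mE s(1)] by simp
      then show ?thesis
        using Q[OF dc[OF x]] mod_hom_closed[OF dE mod_hom_closed[OF k(1) dc[OF x]]] by simp
    qed
    then show "\<exists>k. P (Suc i) k \<and> Q i s k" using k(1) Q unfolding P_def Q_def by auto
  qed
  then obtain s where "\<And>i. P i (s i)" "\<And>i. Q i (s i) (s (Suc i))" by blast
  then show ?thesis unfolding P_def Q_def by (intro exI[of _ s]) auto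
qed

lemma homotopy:
  assumes F: "aug_complex R A F d e" and proj: "\<And>i. projective_module R (F i)"
    and E: "aug_exact R B E \<delta> \<epsilon>"
    and \<phi>: "chain_map R F d e E \<delta> \<epsilon> f \<phi>" and \<psi>: "chain_map R F d e E \<delta> \<epsilon> g \<psi>"
    and fg: "\<And>x. x \<in> carrier A \<Longrightarrow> f x = g x"
  shows "\<exists>s. (\<forall>i. s i \<in> mod_hom R (F i) (E (Suc i))) \<and>
    (\<forall>x\<in>carrier (F 0). \<phi> 0 x = \<psi> 0 x \<oplus>\<^bsub>E 0\<^esub> \<delta> 0 (s 0 x)) \<and>
    (\<forall>i. \<forall>x\<in>carrier (F (Suc i)). \<phi> (Suc i) x =
      \<psi> (Suc i) x \<oplus>\<^bsub>E (Suc i)\<^esub> (\<delta> (Suc i) (s (Suc i) x) \<oplus>\<^bsub>E (Suc i)\<^esub> s i (d i x)))"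
proof -
  have E0: "aug_complex R B E \<delta> \<epsilon>" using E by (simp add: aug_exact_def)
  have mF: "module R (F i)" and mE: "module R (E i)" and dF: "d i \<in> mod_hom R (F (Suc i)) (F i)"
    and dE: "\<delta> i \<in> mod_hom R (E (Suc i)) (E i)" for i using F E0 by (simp_all add: aug_complex_def)
  have mB: "module R B" and e: "e \<in> mod_hom R (F 0) A" and \<epsilon>: "\<epsilon> \<in> mod_hom R (E 0) B"
    using F E0 by (simp_all add: aug_complex_def)
  have h: "\<phi> i \<in> mod_hom R (F i) (E i)" "\<psi> i \<in> mod_hom R (F i) (E i)" for i
    using \<phi> \<psi> by (simp_all add: chain_map_def)
  let ?\<theta> = "\<lambda>i. \<lambda>x\<in>carrier (F i). \<phi> i x \<ominus>\<^bsub>E i\<^esub> \<psi> i x"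
  have "chain_map R F d e E \<delta> \<epsilon> (\<lambda>x. \<zero>\<^bsub>B\<^esub>) ?\<theta>"
    unfolding chain_map_def
  proof (intro conjI allI ballI)
    show "?\<theta> i \<in> mod_hom R (F i) (E i)" for i using mod_hom_diff_fun[OF mF mE h] .
    fix x assume x: "x \<in> carrier (F 0)"
    interpret B: module R B by fact
    show "\<epsilon> (?\<theta> 0 x) = \<zero>\<^bsub>B\<^esub>"
      using x \<phi> \<psi> fg mod_hom_closed[OF e x] mod_hom_closed[OF \<epsilon> mod_hom_closed[OF h(2) x]]
        mod_hom_diff[OF mE mB \<epsilon> mod_hom_closed[OF h(1) x] mod_hom_closed[OF h(2) x]]
      by (simp add: chain_map_def a_minus_def B.M.r_neg)
  next
    fix i x assume x: "x \<in> carrier (F (Suc i))"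
    show "\<delta> i (?\<theta> (Suc i) x) = ?\<theta> i (d i x)"
      using x \<phi> \<psi> mod_hom_closed[OF dF x]
        mod_hom_diff[OF mE mE dE mod_hom_closed[OF h(1) x] mod_hom_closed[OF h(2) x]]
      by (simp add: chain_map_def)
  qed
  from null_homotopy[OF F proj E this] obtain s where
    s: "\<And>i. s i \<in> mod_hom R (F i) (E (Suc i))" and
    s0: "\<And>x. x \<in> carrier (F 0) \<Longrightarrow> ?\<theta> 0 x = \<delta> 0 (s 0 x)" and
    s1: "\<And>i x. x \<in> carrier (F (Suc i)) \<Longrightarrow>
      ?\<theta> (Suc i) x = \<delta> (Suc i) (s (Suc i) x) \<oplus>\<^bsub>E (Suc i)\<^esub> s i (d i x)" by blast
  have add: "\<phi> i x = \<psi> i x \<oplus>\<^bsub>E i\<^esub> y" if x: "x \<in> carrier (F i)" and y: "?\<theta> i x = y" for i x y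
  proof -
    interpret Ei: module R "E i" by (rule mE)
    have "\<psi> i x \<oplus>\<^bsub>E i\<^esub> (\<phi> i x \<ominus>\<^bsub>E i\<^esub> \<psi> i x) = \<phi> i x"
      unfolding a_minus_def
      using mod_hom_closed[OF h(1) x] mod_hom_closed[OF h(2) x]
      by (metis Ei.M.a_comm Ei.M.a_inv_closed Ei.M.r_neg2 )
    then show ?thesis using x y by simp
  qed
  show ?thesis using s add[OF _ s0] add[OF _ s1] by (intro exI[of _ s]) simp
qed


section \<open>Finitely generated free resolutions\<close>

lemma free_module_finitely_generated:
  assumes "cring R" "finite I"
  shows "finite (free_basis R ` I)" "free_basis R ` I \<subseteq> carrier (free_module R I)"
    "gen_submodule R (free_module R I) (free_basis R ` I) = carrier (free_module R I)"
proof -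
  let ?F = "free_module R I"
  interpret F: module R ?F using module_free_module[OF assms(1)] .
  show "finite (free_basis R ` I)" using assms(2) by simp
  show b: "free_basis R ` I \<subseteq> carrier ?F" by (intro image_subsetI free_basis_closed[OF assms(1)])
  note G = F.submodule_gen_submodule[OF b]
  have "x \<in> gen_submodule R ?F (free_basis R ` I)" if "x \<in> carrier ?F" for x
    using assms(1) that
  proof (induction x rule: free_module_induct)
    case zero
    show ?case using F.submoduleD(3)[OF G] .
  next
    case (step r s f)
    have "free_basis R s \<in> gen_submodule R ?F (free_basis R ` I)"
      by (rule subsetD[OF gen_submodule_ge]) (use step(2) in blast)
    then show ?case by (intro F.submoduleD(4)[OF G] F.submoduleD(5)[OF G] step(1,4))
  qed
  then show "gen_submodule R ?F (free_basis R ` I) = carrier ?F" using F.submoduleD(1)[OF G] by blast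
qed

lemma finite_free_cover:
  assumes "noetherian_ring R" "module R A" "finite E" "E \<subseteq> carrier A" "gen_submodule R A E = carrier A"
    and Z: "submodule Z R A"
  shows "\<exists>k h. h \<in> mod_hom R (free_module R {..<k::nat}) A \<and> h ` carrier (free_module R {..<k}) = Z"
proof -
  interpret A: module R A by fact
  have cr: "cring R" by unfold_locales
  obtain Y where Y: "finite Y" "Y \<subseteq> Z" "gen_submodule R A Y = Z"
    using A.submodule_finitely_generated[OF assms(1,3,4) Z] assms(5) A.submoduleD(1)[OF Z] by auto
  obtain xs where xs: "set xs = Y" using finite_list[OF Y(1)] by blast
  let ?I = "{..<length xs}"
  let ?h = "lin_ext R ?I A ((!) xs)"
  have v: "(!) xs \<in> ?I \<rightarrow> Z" using xs Y(2) by (auto simp: set_conv_nth)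
  then have vA: "(!) xs \<in> ?I \<rightarrow> carrier A" using A.submoduleD(1)[OF Z] by blast
  have h: "?h \<in> mod_hom R (free_module R ?I) A" using lin_ext_hom[OF assms(2) vA] .
  have F: "module R (free_module R ?I)" using module_free_module[OF cr] .
  have "?h ` carrier (free_module R ?I) \<subseteq> Z" using lin_ext_in_submodule[OF assms(2) Z v] by blast
  moreover have "Z \<subseteq> ?h ` carrier (free_module R ?I)"
  proof -
    have S: "submodule (?h ` carrier (free_module R ?I)) R A"
      using submodule_image[OF F assms(2) h module.carrier_is_submodule[OF F]] .
    have "y \<in> ?h ` carrier (free_module R ?I)" if "y \<in> Y" for y
    proof -
      have "y \<in> set xs" using that xs by simp
      then have "\<exists>i<length xs. xs ! i = y" by (simp add: in_set_conv_nth)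
      then obtain i where i: "i \<in> ?I" "xs ! i = y" by blast
      then have "?h (free_basis R i) = y" using lin_ext_basis[OF assms(2) vA] by simp
      then show ?thesis using free_basis_closed[OF cr i(1)] by (metis imageI)
    qed
    then show ?thesis using gen_submodule_le_iff[OF S, of Y] Y(3) by blast
  qed
  ultimately show ?thesis using h by (intro exI[of _ "length xs"] exI[of _ ?h]) simp
qed

lemma finite_free_resolution:
  fixes M :: "('a, 'm, 'k) module_scheme"
  assumes noeth: "noetherian_ring R" and M: "module R M"
    and fg: "finite E" "E \<subseteq> carrier M" "gen_submodule R M E = carrier M"
  shows "\<exists>(k :: nat \<Rightarrow> nat) d e. aug_exact R M (\<lambda>i. free_module R {..<k i}) d e"
proof -
  interpret M: module R M by fact
  have cr: "cring R" by unfold_locales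
  let ?F = "\<lambda>k::nat. free_module R {..<k}"
  have F: "module R (?F k)" for k using module_free_module[OF cr] .
  note Ffg = free_module_finitely_generated[OF cr finite_lessThan]
  obtain k0 e where e: "e \<in> mod_hom R (?F k0) M" "e ` carrier (?F k0) = carrier M"
    using finite_free_cover[OF noeth M fg M.carrier_is_submodule] by blast
  have kerS: "submodule {x \<in> carrier (?F k). h x = \<zero>\<^bsub>B\<^esub>} R (?F k)"
    if "module R B" "h \<in> mod_hom R (?F k) B" for h k and B :: "('a, 'x, 'y) module_scheme"
    using submodule_vimage[OF F that module.submodule_zero[OF that(1)]] by simp
  define P where "P i = (\<lambda>(k, k', d). d \<in> mod_hom R (?F k') (?F k) \<and>
    (i = 0 \<longrightarrow> k = k0 \<and> d ` carrier (?F k') = {x \<in> carrier (?F k). e x = \<zero>\<^bsub>M\<^esub>}))" for i :: nat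
  define Q where "Q i = (\<lambda>(k, k', d) (l, l', d'). l = k' \<and>
    d' ` carrier (?F l') = {x \<in> carrier (?F k'). d x = \<zero>\<^bsub>?F k\<^esub>})" for i :: nat
  have "\<exists>s. \<forall>i. P i (s i) \<and> Q i (s i) (s (Suc i))"
  proof (rule dependent_nat_choice)
    obtain k d where "d \<in> mod_hom R (?F k) (?F k0)" "d ` carrier (?F k) = {x \<in> carrier (?F k0). e x = \<zero>\<^bsub>M\<^esub>}"
      using finite_free_cover[OF noeth F Ffg kerS[OF M e(1)]] by blast
    then show "\<exists>s. P 0 s" by (auto simp: P_def)
  next
    fix s i assume s: "P i s"
    obtain k k' d where skd: "s = (k, k', d)" by (cases s) auto
    then have d: "d \<in> mod_hom R (?F k') (?F k)" using s by (simp add: P_def)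
    obtain l d' where "d' \<in> mod_hom R (?F l) (?F k')" "d' ` carrier (?F l) = {x \<in> carrier (?F k'). d x = \<zero>\<^bsub>?F k\<^esub>}"
      using finite_free_cover[OF noeth F Ffg kerS[OF F d]] by blast
    then show "\<exists>s'. P (Suc i) s' \<and> Q i s s'"
      by (intro exI[of _ "(k', l, d')"]) (auto simp: P_def Q_def skd)
  qed
  then obtain s where s: "\<And>i. P i (s i)" "\<And>i. Q i (s i) (s (Suc i))" by blast
  define k where "k i = fst (s i)" for i
  define d where "d i = snd (snd (s i))" for i
  have k': "fst (snd (s i)) = k (Suc i)" for i using s(2)[of i] by (auto simp: Q_def k_def split: prod.splits)
  have d: "d i \<in> mod_hom R (?F (k (Suc i))) (?F (k i))" for i
    using s(1)[of i] k'[of i] by (auto simp: P_def k_def d_def split: prod.splits)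
  have 0: "k 0 = k0" "d 0 ` carrier (?F (k (Suc 0))) = {x \<in> carrier (?F (k 0)). e x = \<zero>\<^bsub>M\<^esub>}"
    using s(1)[of 0] k'[of 0] by (auto simp: P_def k_def d_def split: prod.splits)
  have ex: "d (Suc i) ` carrier (?F (k (Suc (Suc i)))) = {x \<in> carrier (?F (k (Suc i))). d i x = \<zero>\<^bsub>?F (k i)\<^esub>}" for i
  proof -
    have si: "s i = (k i, k (Suc i), d i)" for i using k'[of i] by (simp add: k_def d_def prod_eq_iff)
    have "Q i (k i, k (Suc i), d i) (k (Suc i), k (Suc (Suc i)), d (Suc i))" using s(2)[of i] unfolding si .
    then show ?thesis unfolding Q_def prod.case by (rule conjunct2)
  qed
  have "aug_exact R M (\<lambda>i. ?F (k i)) d e"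
    unfolding aug_exact_def aug_complex_def
  proof (intro conjI allI ballI impI)
    show "e (d 0 x) = \<zero>\<^bsub>M\<^esub>" if "x \<in> carrier (?F (k (Suc 0)))" for x
      using imageI[of x _ "d 0", OF that] unfolding 0(2) by simp
    show "d i (d (Suc i) x) = \<zero>\<^bsub>?F (k i)\<^esub>" if "x \<in> carrier (?F (k (Suc (Suc i))))" for i x
      using imageI[of x _ "d (Suc i)", OF that] unfolding ex by simp
    show "x \<in> d 0 ` carrier (?F (k (Suc 0)))" if "x \<in> carrier (?F (k 0))" "e x = \<zero>\<^bsub>M\<^esub>" for x
      using that unfolding 0(2) by simp
    show "x \<in> d (Suc i) ` carrier (?F (k (Suc (Suc i))))"
      if "x \<in> carrier (?F (k (Suc i)))" "d i x = \<zero>\<^bsub>?F (k i)\<^esub>" for i x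
      using that unfolding ex by simp
  qed (use M F d e 0(1) in auto)
  then show ?thesis by blast
qed

section \<open>Mapping cones\<close>

definition prod_module :: "('a, 'b, 'c) module_scheme \<Rightarrow> ('a, 'd, 'e) module_scheme \<Rightarrow> ('a, 'b \<times> 'd) module" where
  "prod_module A B =
    \<lparr>carrier = carrier A \<times> carrier B, monoid.mult = undefined, one = undefined, ring.zero = (\<zero>\<^bsub>A\<^esub>, \<zero>\<^bsub>B\<^esub>),
     add = (\<lambda>x y. (fst x \<oplus>\<^bsub>A\<^esub> fst y, snd x \<oplus>\<^bsub>B\<^esub> snd y)),
     smult = (\<lambda>r x. (r \<odot>\<^bsub>A\<^esub> fst x, r \<odot>\<^bsub>B\<^esub> snd x))\<rparr>"

lemma prod_module_sel [simp]:
  "carrier (prod_module A B) = carrier A \<times> carrier B"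
  "\<zero>\<^bsub>prod_module A B\<^esub> = (\<zero>\<^bsub>A\<^esub>, \<zero>\<^bsub>B\<^esub>)"
  "x \<oplus>\<^bsub>prod_module A B\<^esub> y = (fst x \<oplus>\<^bsub>A\<^esub> fst y, snd x \<oplus>\<^bsub>B\<^esub> snd y)"
  "r \<odot>\<^bsub>prod_module A B\<^esub> x = (r \<odot>\<^bsub>A\<^esub> fst x, r \<odot>\<^bsub>B\<^esub> snd x)"
  by (simp_all add: prod_module_def)

lemma module_prod_module:
  assumes "module R A" "module R B"
  shows "module R (prod_module A B)"
proof -
  interpret A: module R A by fact
  interpret B: module R B by fact
  have ag: "abelian_group (prod_module A B)"
  proof (rule abelian_groupI)
    fix x assume x: "x \<in> carrier (prod_module A B)"
    show "\<exists>y\<in>carrier (prod_module A B). y \<oplus>\<^bsub>prod_module A B\<^esub> x = \<zero>\<^bsub>prod_module A B\<^esub>"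
      by (rule bexI[of _ "(\<ominus>\<^bsub>A\<^esub> fst x, \<ominus>\<^bsub>B\<^esub> snd x)"]) (use x in \<open>auto simp: A.M.l_neg B.M.l_neg\<close>)
  qed (auto simp: A.M.a_ac B.M.a_ac)
  show ?thesis
  proof (rule moduleI[OF _ ag])
    show "cring R" by unfold_locales
  qed (auto simp: A.smult_l_distr A.smult_r_distr A.smult_assoc1 B.smult_l_distr B.smult_r_distr B.smult_assoc1)
qed

lemma projective_prod_module:
  assumes "projective_module R A" "projective_module R B"
  shows "projective_module R (prod_module A B)"
  unfolding projective_module_def
proof (intro conjI allI impI)
  have mA: "module R A" and mB: "module R B" using assms by (simp_all add: projective_module_def)
  interpret A: module R A by fact
  interpret B: module R B by fact
  let ?P = "prod_module A B"
  show mP: "module R ?P" using module_prod_module[OF mA mB] .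
  fix C :: "('a, 'c \<times> 'd \<Rightarrow> 'a) module" and D :: "('a, 'c \<times> 'd) module" and g f
  assume H: "module R C \<and> module R D \<and> g \<in> mod_hom R C D \<and> g ` carrier C = carrier D \<and> f \<in> mod_hom R ?P D"
  then have C: "module R C" and D: "module R D" and g: "g \<in> mod_hom R C D" "g ` carrier C = carrier D"
    and f: "f \<in> mod_hom R ?P D" by blast+
  interpret C: module R C by fact
  note add = mod_hom_add[OF f] and sm = mod_hom_smult[OF f]
  have fA: "(\<lambda>x\<in>carrier A. f (x, \<zero>\<^bsub>B\<^esub>)) \<in> mod_hom R A D"
  proof (rule mod_homI[OF _ _ _ mA])
    show "f (x \<oplus>\<^bsub>A\<^esub> y, \<zero>\<^bsub>B\<^esub>) = f (x, \<zero>\<^bsub>B\<^esub>) \<oplus>\<^bsub>D\<^esub> f (y, \<zero>\<^bsub>B\<^esub>)" if "x \<in> carrier A" "y \<in> carrier A" for x y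
      using add[of "(x, \<zero>\<^bsub>B\<^esub>)" "(y, \<zero>\<^bsub>B\<^esub>)"] that by simp
    show "f (r \<odot>\<^bsub>A\<^esub> x, \<zero>\<^bsub>B\<^esub>) = r \<odot>\<^bsub>D\<^esub> f (x, \<zero>\<^bsub>B\<^esub>)" if "r \<in> carrier R" "x \<in> carrier A" for r x
      using sm[of r "(x, \<zero>\<^bsub>B\<^esub>)"] that by simp
  qed (simp add: mod_hom_closed[OF f])
  have fB: "(\<lambda>x\<in>carrier B. f (\<zero>\<^bsub>A\<^esub>, x)) \<in> mod_hom R B D"
  proof (rule mod_homI[OF _ _ _ mB])
    show "f (\<zero>\<^bsub>A\<^esub>, x \<oplus>\<^bsub>B\<^esub> y) = f (\<zero>\<^bsub>A\<^esub>, x) \<oplus>\<^bsub>D\<^esub> f (\<zero>\<^bsub>A\<^esub>, y)" if "x \<in> carrier B" "y \<in> carrier B" for x y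
      using add[of "(\<zero>\<^bsub>A\<^esub>, x)" "(\<zero>\<^bsub>A\<^esub>, y)"] that by simp
    show "f (\<zero>\<^bsub>A\<^esub>, r \<odot>\<^bsub>B\<^esub> x) = r \<odot>\<^bsub>D\<^esub> f (\<zero>\<^bsub>A\<^esub>, x)" if "r \<in> carrier R" "x \<in> carrier B" for r x
      using sm[of r "(\<zero>\<^bsub>A\<^esub>, x)"] that by simp
  qed (simp add: mod_hom_closed[OF f])
  obtain hA where hA: "hA \<in> mod_hom R A C" "\<And>x. x \<in> carrier A \<Longrightarrow> g (hA x) = f (x, \<zero>\<^bsub>B\<^esub>)"
    using projective_lift[OF assms(1) C D g(1) fA C.carrier_is_submodule] g(2) mod_hom_closed[OF fA] by auto
  obtain hB where hB: "hB \<in> mod_hom R B C" "\<And>x. x \<in> carrier B \<Longrightarrow> g (hB x) = f (\<zero>\<^bsub>A\<^esub>, x)"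
    using projective_lift[OF assms(2) C D g(1) fB C.carrier_is_submodule] g(2) mod_hom_closed[OF fB] by auto
  note cl = mod_hom_closed[OF hA(1)] mod_hom_closed[OF hB(1)]
  let ?h = "\<lambda>x\<in>carrier ?P. hA (fst x) \<oplus>\<^bsub>C\<^esub> hB (snd x)"
  have "?h \<in> mod_hom R ?P C"
    by (rule mod_homI[OF _ _ _ mP])
      (auto simp: cl mod_hom_add[OF hA(1)] mod_hom_add[OF hB(1)] mod_hom_smult[OF hA(1)]
        mod_hom_smult[OF hB(1)] C.add_swap4 C.smult_r_distr)
  moreover have "g (?h x) = f x" if x: "x \<in> carrier ?P" for x
  proof -
    obtain a b where ab: "x = (a, b)" "a \<in> carrier A" "b \<in> carrier B" using x by auto
    have "g (?h x) = f (a, \<zero>\<^bsub>B\<^esub>) \<oplus>\<^bsub>D\<^esub> f (\<zero>\<^bsub>A\<^esub>, b)"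
      using ab mod_hom_add[OF g(1) cl(1)[OF ab(2)] cl(2)[OF ab(3)]] hA(2) hB(2) by simp
    also have "\<dots> = f x" using add[of "(a, \<zero>\<^bsub>B\<^esub>)" "(\<zero>\<^bsub>A\<^esub>, b)"] ab by simp
    finally show ?thesis .
  qed
  ultimately show "\<exists>h\<in>mod_hom R ?P C. \<forall>x\<in>carrier ?P. g (h x) = f x" by blast
qed

definition zero_module_of :: "('a, 'b) module \<Rightarrow> ('a, 'b) module" where
  "zero_module_of A = A\<lparr>carrier := {\<zero>\<^bsub>A\<^esub>}\<rparr>"

lemma zero_module_of_sel [simp]:
  "carrier (zero_module_of A) = {\<zero>\<^bsub>A\<^esub>}" "\<zero>\<^bsub>zero_module_of A\<^esub> = \<zero>\<^bsub>A\<^esub>"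
  "x \<oplus>\<^bsub>zero_module_of A\<^esub> y = x \<oplus>\<^bsub>A\<^esub> y" "r \<odot>\<^bsub>zero_module_of A\<^esub> x = r \<odot>\<^bsub>A\<^esub> x"
  by (simp_all add: zero_module_of_def)

lemma module_zero_module_of: "module R A \<Longrightarrow> module R (zero_module_of A)"
  unfolding zero_module_of_def by (intro module_restrict module.submodule_zero)

lemma projective_zero_module_of:
  assumes "module R A"
  shows "projective_module R (zero_module_of A)"
  unfolding projective_module_def
proof (intro conjI allI impI)
  let ?Z = "zero_module_of A"
  show mZ: "module R ?Z" using module_zero_module_of[OF assms] .
  fix C :: "('a, 'c \<Rightarrow> 'a) module" and D :: "('a, 'c) module" and g f
  assume H: "module R C \<and> module R D \<and> g \<in> mod_hom R C D \<and> g ` carrier C = carrier D \<and> f \<in> mod_hom R ?Z D"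
  then have C: "module R C" and D: "module R D" and g: "g \<in> mod_hom R C D" and f: "f \<in> mod_hom R ?Z D" by blast+
  interpret C: module R C by fact
  have "(\<lambda>x\<in>carrier ?Z. \<zero>\<^bsub>C\<^esub>) \<in> mod_hom R ?Z C" by (rule mod_homI[OF _ _ _ mZ]) auto
  moreover have "f \<zero>\<^bsub>A\<^esub> = \<zero>\<^bsub>D\<^esub>" using mod_hom_zero[OF mZ D f] by simp
  ultimately show "\<exists>h\<in>mod_hom R ?Z C. \<forall>x\<in>carrier ?Z. g (h x) = f x"
    using mod_hom_zero[OF C D g] by (intro bexI[of _ "\<lambda>x\<in>carrier ?Z. \<zero>\<^bsub>C\<^esub>"]) auto
qed

text \<open>
  The mapping cone of a chain map \<open>\<iota>\<close> from \<open>Y\<close> to \<open>P\<close> is \<open>P i \<oplus> Y (i - 1)\<close> in degree \<open>i\<close>, with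
  differential \<open>(p, y) \<mapsto> (d p + \<iota> y, - d y)\<close>. In degree \<open>0\<close> the zero submodule of \<open>Y 0\<close> stands in for
  the missing second summand.
\<close>

definition cone :: "(nat \<Rightarrow> ('a, 'p) module) \<Rightarrow> (nat \<Rightarrow> ('a, 'x) module) \<Rightarrow> nat \<Rightarrow> ('a, 'p \<times> 'x) module" where
  "cone P Y i = prod_module (P i) (case i of 0 \<Rightarrow> zero_module_of (Y 0) | Suc j \<Rightarrow> Y j)"

definition cone_diff ::
  "(nat \<Rightarrow> ('a, 'p) module) \<Rightarrow> (nat \<Rightarrow> 'p \<Rightarrow> 'p) \<Rightarrow> (nat \<Rightarrow> ('a, 'x) module) \<Rightarrow> (nat \<Rightarrow> 'x \<Rightarrow> 'x)
    \<Rightarrow> (nat \<Rightarrow> 'x \<Rightarrow> 'p) \<Rightarrow> nat \<Rightarrow> 'p \<times> 'x \<Rightarrow> 'p \<times> 'x" where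
  "cone_diff P dP Y dY \<iota> i = (\<lambda>z\<in>carrier (cone P Y (Suc i)).
    (dP i (fst z) \<oplus>\<^bsub>P i\<^esub> \<iota> i (snd z), case i of 0 \<Rightarrow> \<zero>\<^bsub>Y 0\<^esub> | Suc j \<Rightarrow> \<ominus>\<^bsub>Y j\<^esub> dY j (snd z)))"

definition cone_aug ::
  "('a, 'm, 'k) module_scheme \<Rightarrow> 'm set \<Rightarrow> (nat \<Rightarrow> ('a, 'p) module) \<Rightarrow> ('p \<Rightarrow> 'm) \<Rightarrow> (nat \<Rightarrow> ('a, 'x) module)
    \<Rightarrow> 'p \<times> 'x \<Rightarrow> 'm set" where
  "cone_aug M Z P e Y = (\<lambda>z\<in>carrier (cone P Y 0). Z +>\<^bsub>M\<^esub> e (fst z))"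

lemma cone_simps [simp]:
  "carrier (cone P Y 0) = carrier (P 0) \<times> {\<zero>\<^bsub>Y 0\<^esub>}"
  "carrier (cone P Y (Suc j)) = carrier (P (Suc j)) \<times> carrier (Y j)"
  "\<zero>\<^bsub>cone P Y 0\<^esub> = (\<zero>\<^bsub>P 0\<^esub>, \<zero>\<^bsub>Y 0\<^esub>)"
  "\<zero>\<^bsub>cone P Y (Suc j)\<^esub> = (\<zero>\<^bsub>P (Suc j)\<^esub>, \<zero>\<^bsub>Y j\<^esub>)"
  "x \<oplus>\<^bsub>cone P Y 0\<^esub> y = (fst x \<oplus>\<^bsub>P 0\<^esub> fst y, snd x \<oplus>\<^bsub>Y 0\<^esub> snd y)"
  "x \<oplus>\<^bsub>cone P Y (Suc j)\<^esub> y = (fst x \<oplus>\<^bsub>P (Suc j)\<^esub> fst y, snd x \<oplus>\<^bsub>Y j\<^esub> snd y)"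
  "r \<odot>\<^bsub>cone P Y 0\<^esub> x = (r \<odot>\<^bsub>P 0\<^esub> fst x, r \<odot>\<^bsub>Y 0\<^esub> snd x)"
  "r \<odot>\<^bsub>cone P Y (Suc j)\<^esub> x = (r \<odot>\<^bsub>P (Suc j)\<^esub> fst x, r \<odot>\<^bsub>Y j\<^esub> snd x)"
  by (simp_all add: cone_def)

lemma module_cone:
  assumes "\<And>i. module R (P i)" "\<And>i. module R (Y i)"
  shows "module R (cone P Y i)"
  by (cases i) (simp_all add: cone_def module_prod_module module_zero_module_of assms)

lemma projective_cone:
  assumes "\<And>i. projective_module R (P i)" "\<And>i. projective_module R (Y i)"
  shows "projective_module R (cone P Y i)"
proof -
  have "module R (Y 0)" using assms(2) by (simp add: projective_module_def)
  then show ?thesis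
    by (cases i) (simp_all add: cone_def projective_prod_module projective_zero_module_of assms)
qed

lemma (in module) a_inv_zero: "\<ominus>\<^bsub>M\<^esub> \<zero>\<^bsub>M\<^esub> = \<zero>\<^bsub>M\<^esub>"
  using M.add.inv_one by simp

lemma (in module) set_add_coset:
  assumes Z: "submodule Z R M" and Z': "submodule Z' R M" "Z' \<subseteq> Z" and x: "x \<in> carrier M"
  shows "Z <+>\<^bsub>M\<^esub> (Z' +>\<^bsub>M\<^esub> x) = Z +>\<^bsub>M\<^esub> x"
proof (rule Set.set_eqI)
  note z = submoduleD[OF Z] and z' = submoduleD[OF Z'(1)]
  fix w
  show "w \<in> Z <+>\<^bsub>M\<^esub> (Z' +>\<^bsub>M\<^esub> x) \<longleftrightarrow> w \<in> Z +>\<^bsub>M\<^esub> x"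
  proof
    assume "w \<in> Z <+>\<^bsub>M\<^esub> (Z' +>\<^bsub>M\<^esub> x)"
    then obtain a b where "a \<in> Z" "b \<in> Z' +>\<^bsub>M\<^esub> x" "w = a \<oplus>\<^bsub>M\<^esub> b" by (rule set_addE)
    then obtain a b where ab: "a \<in> Z" "b \<in> Z'" "w = a \<oplus>\<^bsub>M\<^esub> (b \<oplus>\<^bsub>M\<^esub> x)" by (auto simp: a_r_coset_def')
    then have "w = (a \<oplus>\<^bsub>M\<^esub> b) \<oplus>\<^bsub>M\<^esub> x" using M.a_assoc[OF z(2) z'(2) x] by simp
    moreover have "a \<oplus>\<^bsub>M\<^esub> b \<in> Z" using z(4)[OF ab(1)] ab(2) Z'(2) by blast
    ultimately show "w \<in> Z +>\<^bsub>M\<^esub> x" by (auto simp: a_r_coset_def')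
  next
    assume "w \<in> Z +>\<^bsub>M\<^esub> x"
    then obtain a where a: "a \<in> Z" "w = a \<oplus>\<^bsub>M\<^esub> x" by (auto simp: a_r_coset_def')
    have "\<zero>\<^bsub>M\<^esub> \<oplus>\<^bsub>M\<^esub> x \<in> Z' +>\<^bsub>M\<^esub> x" using z'(3) unfolding a_r_coset_def' by blast
    then have "x \<in> Z' +>\<^bsub>M\<^esub> x" using x by simp
    then show "w \<in> Z <+>\<^bsub>M\<^esub> (Z' +>\<^bsub>M\<^esub> x)" unfolding a(2) by (rule set_addI[OF a(1)])
  qed
qed

text \<open>
  The cone of a lift of the inclusion of \<open>Z\<close> in \<open>M\<close> resolves \<open>M/Z\<close>.
\<close>

lemma cone_exact:
  assumes P: "aug_exact R M P dP eP" and Z: "submodule Z R M"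
    and Y: "aug_exact R (M\<lparr>carrier := Z\<rparr>) Y dY eY"
    and \<iota>: "chain_map R Y dY eY P dP eP (\<lambda>x. x) \<iota>"
  shows "aug_exact R (quot_module R M Z) (cone P Y) (cone_diff P dP Y dY \<iota>) (cone_aug M Z P eP Y)"
proof -
  note P' = P[unfolded aug_exact_def aug_complex_def] and Y' = Y[unfolded aug_exact_def aug_complex_def]
    and \<iota>' = \<iota>[unfolded chain_map_def]
  have M: "module R M" using P' by simp
  interpret M: module R M by fact
  have mP: "module R (P i)" and mY: "module R (Y i)" for i using P' Y' by simp_all
  have eP: "eP \<in> mod_hom R (P 0) M" and eY: "eY \<in> mod_hom R (Y 0) (M\<lparr>carrier := Z\<rparr>)" using P' Y' by simp_all
  have dP: "dP i \<in> mod_hom R (P (Suc i)) (P i)" and dY: "dY i \<in> mod_hom R (Y (Suc i)) (Y i)"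
    and io: "\<iota> i \<in> mod_hom R (Y i) (P i)" for i using P' Y' \<iota>' by simp_all
  have P1: "x \<in> carrier (P (Suc 0)) \<Longrightarrow> eP (dP 0 x) = \<zero>\<^bsub>M\<^esub>"
    and P2: "x \<in> carrier (P (Suc (Suc i))) \<Longrightarrow> dP i (dP (Suc i) x) = \<zero>\<^bsub>P i\<^esub>"
    and P3: "x \<in> carrier (P 0) \<Longrightarrow> eP x = \<zero>\<^bsub>M\<^esub> \<Longrightarrow> x \<in> dP 0 ` carrier (P (Suc 0))"
    and P4: "x \<in> carrier (P (Suc i)) \<Longrightarrow> dP i x = \<zero>\<^bsub>P i\<^esub> \<Longrightarrow> x \<in> dP (Suc i) ` carrier (P (Suc (Suc i)))"
    and P5: "eP ` carrier (P 0) = carrier M" for x i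
    using P' by simp_all
  have Y2: "x \<in> carrier (Y (Suc (Suc i))) \<Longrightarrow> dY i (dY (Suc i) x) = \<zero>\<^bsub>Y i\<^esub>"
    and Y3: "x \<in> carrier (Y 0) \<Longrightarrow> eY x = \<zero>\<^bsub>M\<^esub> \<Longrightarrow> x \<in> dY 0 ` carrier (Y (Suc 0))"
    and Y4: "x \<in> carrier (Y (Suc i)) \<Longrightarrow> dY i x = \<zero>\<^bsub>Y i\<^esub> \<Longrightarrow> x \<in> dY (Suc i) ` carrier (Y (Suc (Suc i)))"
    and Y5: "eY ` carrier (Y 0) = Z" for x i
    using Y' by simp_all
  have i0: "x \<in> carrier (Y 0) \<Longrightarrow> eP (\<iota> 0 x) = eY x"
    and i1: "x \<in> carrier (Y (Suc i)) \<Longrightarrow> dP i (\<iota> (Suc i) x) = \<iota> i (dY i x)" for i x using \<iota>' by blast+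
  have cl: "x \<in> carrier (P (Suc i)) \<Longrightarrow> dP i x \<in> carrier (P i)" "y \<in> carrier (Y (Suc i)) \<Longrightarrow> dY i y \<in> carrier (Y i)"
    "y \<in> carrier (Y i) \<Longrightarrow> \<iota> i y \<in> carrier (P i)" "z \<in> carrier (P 0) \<Longrightarrow> eP z \<in> carrier M" for i x y z
    using mod_hom_closed[OF dP] mod_hom_closed[OF dY] mod_hom_closed[OF io] mod_hom_closed[OF eP] by blast+
  have mC: "module R (cone P Y i)" for i
    using module_cone[OF mP mY] .
  let ?D = "cone_diff P dP Y dY \<iota>" and ?e = "cone_aug M Z P eP Y"
  have D: "?D i \<in> mod_hom R (cone P Y (Suc i)) (cone P Y i)" for i
    unfolding cone_diff_def
  proof (rule mod_homI[OF _ _ _ mC])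
    interpret Pi: module R "P i" by (rule mP)
    interpret Yi: module R "Y (i - 1)" by (rule mY)
    fix z assume z: "z \<in> carrier (cone P Y (Suc i))"
    then obtain p y where py: "z = (p, y)" "p \<in> carrier (P (Suc i))" "y \<in> carrier (Y i)" by auto
    show "(dP i (fst z) \<oplus>\<^bsub>P i\<^esub> \<iota> i (snd z), case i of 0 \<Rightarrow> \<zero>\<^bsub>Y 0\<^esub> | Suc j \<Rightarrow> \<ominus>\<^bsub>Y j\<^esub> dY j (snd z)) \<in> carrier (cone P Y i)"
      using py cl Yi.M.a_inv_closed Pi.M.a_closed by (cases i) auto
    show "(dP i (fst (r \<odot>\<^bsub>cone P Y (Suc i)\<^esub> z)) \<oplus>\<^bsub>P i\<^esub> \<iota> i (snd (r \<odot>\<^bsub>cone P Y (Suc i)\<^esub> z)),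
          case i of 0 \<Rightarrow> \<zero>\<^bsub>Y 0\<^esub> | Suc j \<Rightarrow> \<ominus>\<^bsub>Y j\<^esub> dY j (snd (r \<odot>\<^bsub>cone P Y (Suc i)\<^esub> z))) =
        r \<odot>\<^bsub>cone P Y i\<^esub> (dP i (fst z) \<oplus>\<^bsub>P i\<^esub> \<iota> i (snd z), case i of 0 \<Rightarrow> \<zero>\<^bsub>Y 0\<^esub> | Suc j \<Rightarrow> \<ominus>\<^bsub>Y j\<^esub> dY j (snd z))"
      if r: "r \<in> carrier R" for r
      using py r cl mod_hom_smult[OF dP r] mod_hom_smult[OF dY r] mod_hom_smult[OF io r] Pi.smult_r_distr[OF r]
        Yi.smult_r_minus[OF r] module.smult_r_null[OF mY r]
      by (cases i) auto
    fix z' assume z': "z' \<in> carrier (cone P Y (Suc i))"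
    then obtain q w where qw: "z' = (q, w)" "q \<in> carrier (P (Suc i))" "w \<in> carrier (Y i)" by auto
    have "(dP i p \<oplus>\<^bsub>P i\<^esub> dP i q) \<oplus>\<^bsub>P i\<^esub> (\<iota> i y \<oplus>\<^bsub>P i\<^esub> \<iota> i w) = (dP i p \<oplus>\<^bsub>P i\<^esub> \<iota> i y) \<oplus>\<^bsub>P i\<^esub> (dP i q \<oplus>\<^bsub>P i\<^esub> \<iota> i w)"
      using py qw cl by (intro Pi.add_swap4) auto
    then show "(dP i (fst (z \<oplus>\<^bsub>cone P Y (Suc i)\<^esub> z')) \<oplus>\<^bsub>P i\<^esub> \<iota> i (snd (z \<oplus>\<^bsub>cone P Y (Suc i)\<^esub> z')),
          case i of 0 \<Rightarrow> \<zero>\<^bsub>Y 0\<^esub> | Suc j \<Rightarrow> \<ominus>\<^bsub>Y j\<^esub> dY j (snd (z \<oplus>\<^bsub>cone P Y (Suc i)\<^esub> z'))) =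
        (dP i (fst z) \<oplus>\<^bsub>P i\<^esub> \<iota> i (snd z), case i of 0 \<Rightarrow> \<zero>\<^bsub>Y 0\<^esub> | Suc j \<Rightarrow> \<ominus>\<^bsub>Y j\<^esub> dY j (snd z)) \<oplus>\<^bsub>cone P Y i\<^esub>
        (dP i (fst z') \<oplus>\<^bsub>P i\<^esub> \<iota> i (snd z'), case i of 0 \<Rightarrow> \<zero>\<^bsub>Y 0\<^esub> | Suc j \<Rightarrow> \<ominus>\<^bsub>Y j\<^esub> dY j (snd z'))"
      using py qw cl mod_hom_add[OF dP] mod_hom_add[OF dY] mod_hom_add[OF io] Yi.M.minus_add Yi.M.r_zero[OF Yi.M.zero_closed]
      by (cases i) auto
  qed
  have Dx: "?D i (p, y) = (dP i p \<oplus>\<^bsub>P i\<^esub> \<iota> i y, case i of 0 \<Rightarrow> \<zero>\<^bsub>Y 0\<^esub> | Suc j \<Rightarrow> \<ominus>\<^bsub>Y j\<^esub> dY j y)"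
    if "p \<in> carrier (P (Suc i))" "y \<in> carrier (Y i)" for i p y
    using that by (simp add: cone_diff_def split: nat.splits)
  have ex: "?e (p, \<zero>\<^bsub>Y 0\<^esub>) = Z +>\<^bsub>M\<^esub> eP p" if "p \<in> carrier (P 0)" for p
    using that by (simp add: cone_aug_def)
  have mQ: "module R (quot_module R M Z)" using M.module_quot_module[OF Z] .
  have e: "?e \<in> mod_hom R (cone P Y 0) (quot_module R M Z)"
    unfolding cone_aug_def
    by (rule mod_homI[OF _ _ _ mC])
      (auto simp: cl M.quot_carrier M.quot_add[OF Z] M.quot_smult[OF Z] mod_hom_add[OF eP] mod_hom_smult[OF eP])
  have eY_Z: "eY x \<in> Z" if "x \<in> carrier (Y 0)" for x using mod_hom_closed[OF eY that] by simp
  show ?thesis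
    unfolding aug_exact_def aug_complex_def
  proof (intro conjI allI ballI impI)
    show "module R (quot_module R M Z)" "?e \<in> mod_hom R (cone P Y 0) (quot_module R M Z)"
      "\<And>i. module R (cone P Y i)" "\<And>i. ?D i \<in> mod_hom R (cone P Y (Suc i)) (cone P Y i)"
      using mQ e mC D by simp_all
    show "?e ` carrier (cone P Y 0) = carrier (quot_module R M Z)"
    proof
      show "?e ` carrier (cone P Y 0) \<subseteq> carrier (quot_module R M Z)" using mod_hom_closed[OF e] by (intro image_subsetI)
      show "carrier (quot_module R M Z) \<subseteq> ?e ` carrier (cone P Y 0)"
      proof
        fix C assume "C \<in> carrier (quot_module R M Z)"
        then obtain m where m: "m \<in> carrier M" "C = Z +>\<^bsub>M\<^esub> m" by (auto simp: M.quot_carrier)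
        then have "m \<in> eP ` carrier (P 0)" using P5 by simp
        then obtain p where p: "p \<in> carrier (P 0)" "eP p = m" by auto
        have "C = ?e (p, \<zero>\<^bsub>Y 0\<^esub>)" using ex[OF p(1)] p(2) m(2) by simp
        then show "C \<in> ?e ` carrier (cone P Y 0)" using p(1) by (intro image_eqI[of _ _ "(p, \<zero>\<^bsub>Y 0\<^esub>)"]) auto
      qed
    qed
    show "?e (?D 0 z) = \<zero>\<^bsub>quot_module R M Z\<^esub>" if z: "z \<in> carrier (cone P Y (Suc 0))" for z
    proof -
      interpret P0: module R "P 0" by (rule mP)
      obtain p y where py: "z = (p, y)" "p \<in> carrier (P (Suc 0))" "y \<in> carrier (Y 0)" using z by auto
      have "?e (?D 0 z) = Z +>\<^bsub>M\<^esub> eP (dP 0 p \<oplus>\<^bsub>P 0\<^esub> \<iota> 0 y)"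
        unfolding py(1) Dx[OF py(2,3)] using ex cl py by simp
      also have "eP (dP 0 p \<oplus>\<^bsub>P 0\<^esub> \<iota> 0 y) = eY y"
        using mod_hom_add[OF eP] cl py P1 i0 M.submoduleD(2)[OF Z eY_Z] by simp
      also have "Z +>\<^bsub>M\<^esub> eY y = Z" using M.coset_mem_iff[OF Z M.submoduleD(2)[OF Z eY_Z]] eY_Z py by blast
      finally show ?thesis by simp
    qed
    show "?D i (?D (Suc i) z) = \<zero>\<^bsub>cone P Y i\<^esub>" if z: "z \<in> carrier (cone P Y (Suc (Suc i)))" for i z
    proof -
      interpret Pi: module R "P i" by (rule mP)
      interpret Yi: module R "Y i" by (rule mY)
      obtain p y where py: "z = (p, y)" "p \<in> carrier (P (Suc (Suc i)))" "y \<in> carrier (Y (Suc i))" using z by auto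
      let ?p = "dP (Suc i) p \<oplus>\<^bsub>P (Suc i)\<^esub> \<iota> (Suc i) y" and ?y = "\<ominus>\<^bsub>Y i\<^esub> dY i y"
      have c: "?p \<in> carrier (P (Suc i))" "?y \<in> carrier (Y i)"
        using py cl module.axioms(2)[OF mP[of "Suc i"]] abelian_group.axioms(1)
        by (auto intro!: abelian_monoid.a_closed)
      have 1: "dP i ?p = \<iota> i (dY i y)"
        using mod_hom_add[OF dP cl(1)[OF py(2)] cl(3)[OF py(3)]] P2[OF py(2)] i1[OF py(3)] cl(3)[OF cl(2)[OF py(3)]]
        by simp
      have 2: "\<iota> i ?y = \<ominus>\<^bsub>P i\<^esub> \<iota> i (dY i y)" using mod_hom_minus[OF mY mP io cl(2)[OF py(3)]] .
      have 3: "dY j ?y = \<zero>\<^bsub>Y j\<^esub>" if "i = Suc j" for j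
        using mod_hom_minus[OF mY mY dY, of "dY i y" j] cl(2)[OF py(3)] Y2[of y j] py(3) that
          module.a_inv_zero[OF mY] by simp
      have "?D i (?D (Suc i) z) = (dP i ?p \<oplus>\<^bsub>P i\<^esub> \<iota> i ?y, case i of 0 \<Rightarrow> \<zero>\<^bsub>Y 0\<^esub> | Suc j \<Rightarrow> \<ominus>\<^bsub>Y j\<^esub> dY j ?y)"
        unfolding py(1) Dx[OF py(2,3)] using Dx[OF c] by simp
      then show ?thesis
        unfolding 1 2 using 3 Pi.M.r_neg[OF cl(3)[OF cl(2)[OF py(3)]]] module.a_inv_zero[OF mY]
        by (cases i) auto
    qed
    show "z \<in> ?D 0 ` carrier (cone P Y (Suc 0))"
      if z: "z \<in> carrier (cone P Y 0)" "?e z = \<zero>\<^bsub>quot_module R M Z\<^esub>" for z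
    proof -
      interpret P0: module R "P 0" by (rule mP)
      obtain p where p: "z = (p, \<zero>\<^bsub>Y 0\<^esub>)" "p \<in> carrier (P 0)" using z by auto
      have "Z +>\<^bsub>M\<^esub> eP p = Z" using z(2) ex[OF p(2)] p(1) by simp
      then have "eP p \<in> Z" using M.coset_mem_iff[OF Z cl(4)[OF p(2)]] by blast
      then have "eP p \<in> eY ` carrier (Y 0)" using Y5 by simp
      then obtain y where y: "y \<in> carrier (Y 0)" "eP p = eY y" by auto
      have "eP (p \<ominus>\<^bsub>P 0\<^esub> \<iota> 0 y) = \<zero>\<^bsub>M\<^esub>"
        using mod_hom_diff[OF mP M eP p(2) cl(3)[OF y(1)]] y i0[OF y(1)] cl(4)[OF p(2)]
        by (simp add: a_minus_def M.M.r_neg)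
      then obtain q where q: "q \<in> carrier (P (Suc 0))" "p \<ominus>\<^bsub>P 0\<^esub> \<iota> 0 y = dP 0 q"
        using P3[of "p \<ominus>\<^bsub>P 0\<^esub> \<iota> 0 y"] p(2) cl(3)[OF y(1)] by auto
      have "dP 0 q \<oplus>\<^bsub>P 0\<^esub> \<iota> 0 y = p"
        unfolding q(2)[symmetric] a_minus_def using p(2) cl(3)[OF y(1)] by (simp add: P0.M.a_assoc P0.M.l_neg)
      then have "z = ?D 0 (q, y)" using Dx[OF q(1) y(1)] p by simp
      then show ?thesis using q(1) y(1) by (intro image_eqI[of _ _ "(q, y)"]) auto
    qed
    show "z \<in> ?D (Suc i) ` carrier (cone P Y (Suc (Suc i)))"
      if z: "z \<in> carrier (cone P Y (Suc i))" "?D i z = \<zero>\<^bsub>cone P Y i\<^esub>" for i z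
    proof -
      interpret Pi: module R "P i" by (rule mP)
      interpret P1: module R "P (Suc i)" by (rule mP)
      interpret Yi: module R "Y i" by (rule mY)
      obtain p y where py: "z = (p, y)" "p \<in> carrier (P (Suc i))" "y \<in> carrier (Y i)" using z by auto
      have 1: "dP i p \<oplus>\<^bsub>P i\<^esub> \<iota> i y = \<zero>\<^bsub>P i\<^esub>"
        using z(2) unfolding py(1) Dx[OF py(2,3)] by (cases i) auto
      have "\<exists>w\<in>carrier (Y (Suc i)). dY i w = y"
      proof (cases i)
        case 0
        have "eP (dP 0 p \<oplus>\<^bsub>P 0\<^esub> \<iota> 0 y) = \<zero>\<^bsub>M\<^esub>" using 1 0 mod_hom_zero[OF mP M eP] by simp
        then have "eY y = \<zero>\<^bsub>M\<^esub>"
          using mod_hom_add[OF eP cl(1) cl(3), of p y] py 0 P1 i0 M.submoduleD(2)[OF Z eY_Z] by simp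
        then show ?thesis using Y3[of y] py(3) 0 by auto
      next
        case (Suc j)
        interpret Yj: module R "Y j" by (rule mY)
        have yj: "dY j y \<in> carrier (Y j)" using cl(2) py(3) Suc by simp
        have "\<ominus>\<^bsub>Y j\<^esub> dY j y = \<zero>\<^bsub>Y j\<^esub>" using z(2) unfolding py(1) Dx[OF py(2,3)] by (simp add: Suc)
        then have "dY j y = \<zero>\<^bsub>Y j\<^esub>" using yj Yj.M.minus_minus[OF yj] Yj.a_inv_zero by simp
        then show ?thesis using Y4[of y j] py(3) Suc by auto
      qed
      then obtain w where w: "w \<in> carrier (Y (Suc i))" "dY i w = y" by blast
      let ?w = "\<ominus>\<^bsub>Y (Suc i)\<^esub> w"
      have mw: "?w \<in> carrier (Y (Suc i))" using abelian_group.a_inv_closed[OF module.axioms(2)[OF mY] w(1)] .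
      have dw: "dY i ?w = \<ominus>\<^bsub>Y i\<^esub> y" using mod_hom_minus[OF mY mY dY w(1)] w(2) by simp
      have iw: "\<iota> i (dY i ?w) = \<ominus>\<^bsub>P i\<^esub> \<iota> i y" unfolding dw using mod_hom_minus[OF mY mP io py(3)] .
      have "dP i (p \<ominus>\<^bsub>P (Suc i)\<^esub> \<iota> (Suc i) ?w) = \<zero>\<^bsub>P i\<^esub>"
        unfolding mod_hom_diff[OF mP mP dP py(2) cl(3)[OF mw]] i1[OF mw] iw
        using 1 cl(3)[OF py(3)] by (simp add: a_minus_def)
      then obtain q where q: "q \<in> carrier (P (Suc (Suc i)))" "p \<ominus>\<^bsub>P (Suc i)\<^esub> \<iota> (Suc i) ?w = dP (Suc i) q"
        using P4[of "p \<ominus>\<^bsub>P (Suc i)\<^esub> \<iota> (Suc i) ?w" i] py(2) cl(3)[OF mw] by auto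
      have "dP (Suc i) q \<oplus>\<^bsub>P (Suc i)\<^esub> \<iota> (Suc i) ?w = p"
        unfolding q(2)[symmetric] a_minus_def using py(2) cl(3)[OF mw] by (simp add: P1.M.a_assoc P1.M.l_neg)
      then have "z = ?D (Suc i) (q, ?w)" using Dx[OF q(1) mw] py dw by simp
      then show ?thesis using q(1) mw by (intro image_eqI[of _ _ "(q, ?w)"]) auto
    qed
  qed
qed

text \<open>
  The map of cones that is the identity on \<open>P\<close> and \<open>\<chi>\<close> on the second summand. It commutes with the
  differentials if the source is the cone of \<open>\<iota> \<chi>\<close> and the target that of \<open>\<iota>\<close>.
\<close>

definition cone_map ::
  "(nat \<Rightarrow> ('a, 'p) module) \<Rightarrow> (nat \<Rightarrow> ('a, 'x) module) \<Rightarrow> (nat \<Rightarrow> ('a, 'y) module) \<Rightarrow> (nat \<Rightarrow> 'x \<Rightarrow> 'y)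
    \<Rightarrow> nat \<Rightarrow> 'p \<times> 'x \<Rightarrow> 'p \<times> 'y" where
  "cone_map P Y Y' \<chi> i = (\<lambda>z\<in>carrier (cone P Y i). (fst z, case i of 0 \<Rightarrow> \<zero>\<^bsub>Y' 0\<^esub> | Suc j \<Rightarrow> \<chi> j (snd z)))"

lemma chain_map_cone_map:
  assumes P: "aug_exact R M P dP eP"
    and Z: "submodule Z R M" and Z': "submodule Z' R M" "Z' \<subseteq> Z"
    and Y: "aug_complex R (M\<lparr>carrier := Z'\<rparr>) Y dY eY" and Y': "aug_complex R (M\<lparr>carrier := Z\<rparr>) Y' dY' eY'"
    and \<chi>: "chain_map R Y dY eY Y' dY' eY' (\<lambda>x. x) \<chi>"
    and \<iota>: "\<And>i. \<iota> i \<in> mod_hom R (Y' i) (P i)"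
  shows "chain_map R (cone P Y) (cone_diff P dP Y dY (\<lambda>i. \<lambda>x\<in>carrier (Y i). \<iota> i (\<chi> i x))) (cone_aug M Z' P eP Y)
    (cone P Y') (cone_diff P dP Y' dY' \<iota>) (cone_aug M Z P eP Y') (\<lambda>C. Z <+>\<^bsub>M\<^esub> C) (cone_map P Y Y' \<chi>)"
proof -
  have M: "module R M" using P by (simp add: aug_exact_def aug_complex_def)
  interpret M: module R M by fact
  have mP: "module R (P i)" and mY: "module R (Y i)" and mY': "module R (Y' i)"
    and dP: "dP i \<in> mod_hom R (P (Suc i)) (P i)" and dY: "dY i \<in> mod_hom R (Y (Suc i)) (Y i)"
    and ch: "\<chi> i \<in> mod_hom R (Y i) (Y' i)" for i
    using P Y Y' \<chi> by (simp_all add: aug_exact_def aug_complex_def chain_map_def)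
  have eP: "eP \<in> mod_hom R (P 0) M" using P by (simp add: aug_exact_def aug_complex_def)
  have cl: "x \<in> carrier (P (Suc i)) \<Longrightarrow> dP i x \<in> carrier (P i)" "y \<in> carrier (Y (Suc i)) \<Longrightarrow> dY i y \<in> carrier (Y i)"
    "y \<in> carrier (Y i) \<Longrightarrow> \<chi> i y \<in> carrier (Y' i)" "w \<in> carrier (Y' i) \<Longrightarrow> \<iota> i w \<in> carrier (P i)" for i x y w
    using mod_hom_closed[OF dP] mod_hom_closed[OF dY] mod_hom_closed[OF ch] mod_hom_closed[OF \<iota>] by blast+
  have comm: "x \<in> carrier (Y (Suc i)) \<Longrightarrow> dY' i (\<chi> (Suc i) x) = \<chi> i (dY i x)" for i x
    using \<chi> by (simp add: chain_map_def)
  have mC: "module R (cone P Y i)" for i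
    using module_cone[OF mP mY] .
  have zz: "\<zero>\<^bsub>Y' 0\<^esub> \<oplus>\<^bsub>Y' 0\<^esub> \<zero>\<^bsub>Y' 0\<^esub> = \<zero>\<^bsub>Y' 0\<^esub>" "r \<in> carrier R \<Longrightarrow> r \<odot>\<^bsub>Y' 0\<^esub> \<zero>\<^bsub>Y' 0\<^esub> = \<zero>\<^bsub>Y' 0\<^esub>" for r
  proof -
    interpret Y0: module R "Y' 0" by (rule mY')
    show "\<zero>\<^bsub>Y' 0\<^esub> \<oplus>\<^bsub>Y' 0\<^esub> \<zero>\<^bsub>Y' 0\<^esub> = \<zero>\<^bsub>Y' 0\<^esub>" "r \<in> carrier R \<Longrightarrow> r \<odot>\<^bsub>Y' 0\<^esub> \<zero>\<^bsub>Y' 0\<^esub> = \<zero>\<^bsub>Y' 0\<^esub>" by simp_all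
  qed
  have hom: "cone_map P Y Y' \<chi> i \<in> mod_hom R (cone P Y i) (cone P Y' i)" for i
    unfolding cone_map_def
    by (rule mod_homI[OF _ _ _ mC]; cases i)
      (auto simp: cl mod_hom_add[OF ch] mod_hom_smult[OF ch] zz)
  show ?thesis
    unfolding chain_map_def
  proof (intro conjI allI ballI)
    show "cone_map P Y Y' \<chi> i \<in> mod_hom R (cone P Y i) (cone P Y' i)" for i by (rule hom)
    show "cone_aug M Z P eP Y' (cone_map P Y Y' \<chi> 0 z) = Z <+>\<^bsub>M\<^esub> cone_aug M Z' P eP Y z"
      if "z \<in> carrier (cone P Y 0)" for z
      using that M.set_add_coset[OF Z Z' mod_hom_closed[OF eP]] by (auto simp: cone_map_def cone_aug_def)
    show "cone_diff P dP Y' dY' \<iota> i (cone_map P Y Y' \<chi> (Suc i) z) =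
        cone_map P Y Y' \<chi> i (cone_diff P dP Y dY (\<lambda>i. \<lambda>x\<in>carrier (Y i). \<iota> i (\<chi> i x)) i z)"
      if z: "z \<in> carrier (cone P Y (Suc i))" for i z
    proof -
      obtain p y where py: "z = (p, y)" "p \<in> carrier (P (Suc i))" "y \<in> carrier (Y i)" using z by auto
      interpret Pi: module R "P i" by (rule mP)
      show ?thesis
      proof (cases i)
        case 0
        then show ?thesis using py cl Pi.M.a_closed by (simp add: cone_map_def cone_diff_def)
      next
        case (Suc j)
        interpret Yj: module R "Y j" by (rule mY)
        have "\<chi> j (\<ominus>\<^bsub>Y j\<^esub> dY j y) = \<ominus>\<^bsub>Y' j\<^esub> \<chi> j (dY j y)"
          using mod_hom_minus[OF mY mY' ch] cl(2) py(3) Suc by simp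
        then show ?thesis using py cl Pi.M.a_closed comm Suc by (simp add: cone_map_def cone_diff_def)
      qed
    qed
  qed
qed

section \<open>Functoriality of the standard resolution\<close>

lemma list_comb_map:
  assumes cr: "cring R" and g: "\<And>s. s \<in> I \<Longrightarrow> g s \<in> I'" and l: "set l \<subseteq> I \<times> carrier R"
  shows "lin_ext R I (free_module R I') (\<lambda>s. free_basis R (g s)) (list_comb R l) =
    list_comb R (map (map_prod g id) l)"
  using l
proof (induction l)
  have F: "module R (free_module R I)" "module R (free_module R I')" by (rule module_free_module[OF cr])+
  have v: "(\<lambda>s. free_basis R (g s)) \<in> I \<rightarrow> carrier (free_module R I')" using g by (intro Pi_I free_basis_closed[OF cr])
  note h = lin_ext_hom[OF F(2) v]
  {
    case Nil
    show ?case using mod_hom_zero[OF F h] by simp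
  next
    case (Cons t l)
    obtain s r where t: "t = (s, r)" by force
    have r: "r \<in> carrier R" and s: "s \<in> I" and l: "set l \<subseteq> I \<times> carrier R" using Cons.prems t by auto
    have map: "map (map_prod g id) (t # l) = (g s, r) # map (map_prod g id) l" by (simp add: t)
    show ?case
      unfolding map unfolding t list_comb_Cons_eq[OF cr r, where I = I] list_comb_Cons_eq[OF cr r, where I = I']
        mod_hom_linear[OF F(1) h r free_basis_closed[OF cr s] list_comb_closed[OF cr l]]
        lin_ext_basis[OF F(2) v s] Cons.IH[OF l] ..
  }
qed

text \<open>
  A basis element of degree \<open>i + 1\<close> is a list of coefficients of a cycle in degree \<open>i\<close>. Relabelling the entries of
  the list amounts to applying the map in degree \<open>i\<close> to that cycle, which yields a cycle again.
\<close>

lemma syzygy_map_step: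
  assumes cr: "cring R" and gI: "\<And>s. s \<in> I \<Longrightarrow> map_syz id f s \<in> I'"
    and J: "J = {Rel l | l. set l \<subseteq> I \<times> carrier R \<and> h (list_comb R l) = z}"
    and J': "J' = {Rel l | l. set l \<subseteq> I' \<times> carrier R \<and> h' (list_comb R l) = z'}"
    and hh': "\<And>x. x \<in> carrier (free_module R I) \<Longrightarrow> h x = z \<Longrightarrow>
      h' (lin_ext R I (free_module R I') (\<lambda>s. free_basis R (map_syz id f s)) x) = z'"
  shows "s \<in> J \<Longrightarrow> map_syz id f s \<in> J'"
    and "x \<in> carrier (free_module R J) \<Longrightarrow>
      lin_ext R J' (free_module R I') (\<lambda>s. list_comb R (rel_val s))
        (lin_ext R J (free_module R J') (\<lambda>s. free_basis R (map_syz id f s)) x) =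
      lin_ext R I (free_module R I') (\<lambda>s. free_basis R (map_syz id f s))
        (lin_ext R J (free_module R I) (\<lambda>s. list_comb R (rel_val s)) x)"
proof -
  let ?g = "map_syz id f"
  have rel: "?g (Rel l) = Rel (map (map_prod ?g id) l)" for l by simp
  have setg: "set (map (map_prod ?g id) l) \<subseteq> I' \<times> carrier R" if "set l \<subseteq> I \<times> carrier R" for l
    using that gI by force
  have lc: "lin_ext R I (free_module R I') (\<lambda>s. free_basis R (?g s)) (list_comb R l) =
      list_comb R (map (map_prod ?g id) l)" if "set l \<subseteq> I \<times> carrier R" for l
    by (rule list_comb_map[OF cr gI that])
  have gJ: "?g s \<in> J'" if s: "s \<in> J" for s
  proof -
    obtain l where l: "s = Rel l" "set l \<subseteq> I \<times> carrier R" "h (list_comb R l) = z" using s J by blast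
    have "h' (list_comb R (map (map_prod ?g id) l)) = z'"
      using hh'[OF list_comb_closed[OF cr l(2)] l(3)] lc[OF l(2)] by simp
    then show ?thesis unfolding l(1) rel J' using setg[OF l(2)] by blast
  qed
  then show "s \<in> J \<Longrightarrow> ?g s \<in> J'" by blast
  have F: "module R (free_module R I)" "module R (free_module R I')" "module R (free_module R J)"
    "module R (free_module R J')" by (rule module_free_module[OF cr])+
  have v: "(\<lambda>s. free_basis R (?g s)) \<in> I \<rightarrow> carrier (free_module R I')"
    "(\<lambda>s. free_basis R (?g s)) \<in> J \<rightarrow> carrier (free_module R J')"
    by (intro Pi_I free_basis_closed[OF cr] gI gJ; assumption)+
  have w: "(\<lambda>s. list_comb R (rel_val s)) \<in> J \<rightarrow> carrier (free_module R I)"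
    "(\<lambda>s. list_comb R (rel_val s)) \<in> J' \<rightarrow> carrier (free_module R I')"
    using list_comb_closed[OF cr] by (auto simp: J J')
  note hom = lin_ext_hom[OF F(2) v(1)] lin_ext_hom[OF F(4) v(2)] lin_ext_hom[OF F(1) w(1)] lin_ext_hom[OF F(2) w(2)]
  let ?L = "\<lambda>x\<in>carrier (free_module R J). lin_ext R J' (free_module R I') (\<lambda>s. list_comb R (rel_val s))
        (lin_ext R J (free_module R J') (\<lambda>s. free_basis R (?g s)) x)"
  let ?R = "\<lambda>x\<in>carrier (free_module R J). lin_ext R I (free_module R I') (\<lambda>s. free_basis R (?g s))
        (lin_ext R J (free_module R I) (\<lambda>s. list_comb R (rel_val s)) x)"
  assume x: "x \<in> carrier (free_module R J)"
  have "?L x = ?R x"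
  proof (rule free_hom_eqI[OF cr F(2) _ _ _ x])
    show "?L \<in> mod_hom R (free_module R J) (free_module R I')" using mod_hom_compose[OF F(3) hom(2,4)] .
    show "?R \<in> mod_hom R (free_module R J) (free_module R I')" using mod_hom_compose[OF F(3) hom(3,1)] .
    fix s assume s: "s \<in> J"
    obtain l where l: "s = Rel l" "set l \<subseteq> I \<times> carrier R" using s J by blast
    show "?L (free_basis R s) = ?R (free_basis R s)"
      using free_basis_closed[OF cr s] lin_ext_basis[OF F(4) v(2) s] lin_ext_basis[OF F(2) w(2) gJ[OF s]]
        lin_ext_basis[OF F(1) w(1) s] lc[OF l(2)] l(1) by simp
  qed
  then show "lin_ext R J' (free_module R I') (\<lambda>s. list_comb R (rel_val s))
        (lin_ext R J (free_module R J') (\<lambda>s. free_basis R (?g s)) x) =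
      lin_ext R I (free_module R I') (\<lambda>s. free_basis R (?g s))
        (lin_ext R J (free_module R I) (\<lambda>s. list_comb R (rel_val s)) x)" using x by simp
qed

lemma syz_basis_1: "syz_basis R M (Suc 0) = {Rel l | l. set l \<subseteq> syz_basis R M 0 \<times> carrier R \<and>
    free_res_aug R M (list_comb R l) = \<zero>\<^bsub>M\<^esub>}"
  by (simp add: free_res_aug_def)

lemma syz_basis_2: "syz_basis R M (Suc (Suc i)) = {Rel l | l. set l \<subseteq> syz_basis R M (Suc i) \<times> carrier R \<and>
    free_res_diff R M i (list_comb R l) = \<zero>\<^bsub>free_res R M i\<^esub>}"
  by (simp add: free_res_diff_def free_res_def)

lemma module_free_res: "cring R \<Longrightarrow> module R (free_res R M i)"
  unfolding free_res_def by (rule module_free_module)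

lemmas free_res_hom_eqI = free_hom_eqI[of R A h "syz_basis R M i", folded free_res_def] for R A h M i

lemma lin_ext_zero:
  assumes "module R A"
  shows "lin_ext R I A v (\<lambda>s. \<zero>\<^bsub>R\<^esub>) = \<zero>\<^bsub>A\<^esub>"
proof -
  interpret A: module R A by fact
  show ?thesis by (auto simp: lin_ext_def free_module_carrier)
qed

text \<open>
  The two claims are proved together, as in each degree the relabelled basis elements belong to the basis of the
  target only because the map one degree below commutes with the differentials.
\<close>

lemma free_res_map_basis:
  assumes M: "module R M" and M': "module R M'" and f: "(\<lambda>x\<in>carrier M. f x) \<in> mod_hom R M M'"
  shows "(\<forall>s\<in>syz_basis R M i. map_syz id f s \<in> syz_basis R M' i) \<and>
    (i = 0 \<longrightarrow> (\<forall>x\<in>carrier (free_res R M 0).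
      free_res_aug R M' (free_res_map R M M' f 0 x) = f (free_res_aug R M x))) \<and>
    (\<forall>k. i = Suc k \<longrightarrow> (\<forall>x\<in>carrier (free_res R M i).
      free_res_diff R M' k (free_res_map R M M' f i x) = free_res_map R M M' f k (free_res_diff R M k x)))"
    (is "?P i")
proof (induction i)
  have fc: "x \<in> carrier M \<Longrightarrow> f x \<in> carrier M'" for x using mod_hom_closed[OF f] by fastforce
  have cr: "cring R" using M by (simp add: module_def)
  note mF = module_free_res[OF cr]
  have v: "gen_val \<in> syz_basis R M 0 \<rightarrow> carrier M" "gen_val \<in> syz_basis R M' 0 \<rightarrow> carrier M'" by auto
  note aug = lin_ext_hom[OF M v(1), folded free_res_aug_def free_res_def]
    lin_ext_hom[OF M' v(2), folded free_res_aug_def free_res_def]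
  have diff: "free_res_diff R M k \<in> mod_hom R (free_res R M (Suc k)) (free_res R M k)"
    "free_res_diff R M' k \<in> mod_hom R (free_res R M' (Suc k)) (free_res R M' k)" for k
    using projective_resolution_free_res[OF M] projective_resolution_free_res[OF M']
    by (simp_all add: projective_resolution_def)
  {
    case 0
    let ?\<phi> = "free_res_map R M M' f 0"
    have g: "map_syz id f s \<in> syz_basis R M' 0" if "s \<in> syz_basis R M 0" for s using that fc by auto
    have w: "(\<lambda>s. free_basis R (map_syz id f s)) \<in> syz_basis R M 0 \<rightarrow> carrier (free_res R M' 0)"
      unfolding free_res_def by (intro Pi_I free_basis_closed[OF cr] g)
    have \<phi>: "?\<phi> \<in> mod_hom R (free_res R M 0) (free_res R M' 0)"
      using lin_ext_hom[OF mF w] by (simp add: free_res_map_def free_res_def)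
    have "free_res_aug R M' (?\<phi> x) = f (free_res_aug R M x)" if x: "x \<in> carrier (free_res R M 0)" for x
    proof -
      have "(\<lambda>x\<in>carrier (free_res R M 0). free_res_aug R M' (?\<phi> x)) x =
          (\<lambda>x\<in>carrier (free_res R M 0). (\<lambda>x\<in>carrier M. f x) (free_res_aug R M x)) x"
      proof (rule free_res_hom_eqI[OF cr M' _ _ _ x])
        show "(\<lambda>x\<in>carrier (free_res R M 0). free_res_aug R M' (?\<phi> x)) \<in> mod_hom R (free_res R M 0) M'"
          using mod_hom_compose[OF mF \<phi> aug(2)] .
        show "(\<lambda>x\<in>carrier (free_res R M 0). (\<lambda>x\<in>carrier M. f x) (free_res_aug R M x)) \<in> mod_hom R (free_res R M 0) M'"
          using mod_hom_compose[OF mF aug(1) f] .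
        fix s assume s: "s \<in> syz_basis R M 0"
        have b: "free_basis R s \<in> carrier (free_res R M 0)" unfolding free_res_def using free_basis_closed[OF cr s] .
        have 1: "?\<phi> (free_basis R s) = free_basis R (map_syz id f s)"
          unfolding free_res_map_def by (rule lin_ext_basis[OF mF w s])
        have 2: "free_res_aug R M (free_basis R s) = gen_val s"
          unfolding free_res_aug_def by (rule lin_ext_basis[OF M v(1) s])
        have 3: "free_res_aug R M' (free_basis R (map_syz id f s)) = gen_val (map_syz id f s)"
          unfolding free_res_aug_def by (rule lin_ext_basis[OF M' v(2) g[OF s]])
        show "(\<lambda>x\<in>carrier (free_res R M 0). free_res_aug R M' (?\<phi> x)) (free_basis R s) =
          (\<lambda>x\<in>carrier (free_res R M 0). (\<lambda>x\<in>carrier M. f x) (free_res_aug R M x)) (free_basis R s)"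
          using b 1 2 3 s by auto
      qed
      then show ?thesis using x mod_hom_closed[OF aug(1) x] by simp
    qed
    then show ?case using g by blast
  next
    case (Suc i)
    have f0: "f \<zero>\<^bsub>M\<^esub> = \<zero>\<^bsub>M'\<^esub>"
      using mod_hom_zero[OF M M' f] abelian_monoid.zero_closed[OF abelian_group.axioms(1)[OF module.axioms(2)[OF M]]]
      by simp
    from Suc have gI: "\<And>s. s \<in> syz_basis R M i \<Longrightarrow> map_syz id f s \<in> syz_basis R M' i" by blast
    define z where "z = (case i of 0 \<Rightarrow> \<lambda>x. free_res_aug R M x = \<zero>\<^bsub>M\<^esub> | Suc k \<Rightarrow> \<lambda>x. free_res_diff R M k x = \<zero>\<^bsub>free_res R M k\<^esub>)"
    define z' where "z' = (case i of 0 \<Rightarrow> \<lambda>x. free_res_aug R M' x = \<zero>\<^bsub>M'\<^esub> | Suc k \<Rightarrow> \<lambda>x. free_res_diff R M' k x = \<zero>\<^bsub>free_res R M' k\<^esub>)"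
    have B: "syz_basis R M (Suc i) = {Rel l | l. set l \<subseteq> syz_basis R M i \<times> carrier R \<and> z (list_comb R l) = True}"
      "syz_basis R M' (Suc i) = {Rel l | l. set l \<subseteq> syz_basis R M' i \<times> carrier R \<and> z' (list_comb R l) = True}"
      by (cases i; simp only: z_def z'_def nat.case syz_basis_1 syz_basis_2 eq_True)+
    have zz: "z' (lin_ext R (syz_basis R M i) (free_module R (syz_basis R M' i))
        (\<lambda>s. free_basis R (map_syz id f s)) x) = True"
      if "x \<in> carrier (free_module R (syz_basis R M i))" "z x = True" for x
    proof -
      have x: "x \<in> carrier (free_res R M i)" "z x" using that by (simp_all add: free_res_def)
      have "z' (free_res_map R M M' f i x)"
      proof (cases i)
        case 0
        then show ?thesis
          using Suc.IH x f0 by (simp add: z_def z'_def)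
      next
        case (Suc k)
        then show ?thesis
          using Suc.IH x lin_ext_zero[OF mF, of "syz_basis R M k"]
          by (simp add: z_def z'_def free_res_map_def free_res_def)
      qed
      then show ?thesis by (simp add: free_res_map_def free_res_def)
    qed
    have step1: "map_syz id f s \<in> syz_basis R M' (Suc i)" if s: "s \<in> syz_basis R M (Suc i)" for s
      by (rule syzygy_map_step(1)[OF cr _ B _ s]) (fact gI, fact zz)
    show ?case
    proof (intro conjI ballI allI impI)
      fix s assume "s \<in> syz_basis R M (Suc i)"
      then show "map_syz id f s \<in> syz_basis R M' (Suc i)" by (rule step1)
    next
      fix k x assume k: "Suc i = Suc k" and x: "x \<in> carrier (free_res R M (Suc i))"
      show "free_res_diff R M' k (free_res_map R M M' f (Suc i) x) = free_res_map R M M' f k (free_res_diff R M k x)"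
      proof -
        have "k = i" using k by simp
        show ?thesis
          unfolding \<open>k = i\<close> free_res_map_def free_res_diff_def free_res_def
          by (rule syzygy_map_step(2)[OF cr _ B _ x[unfolded free_res_def]]) (fact gI, fact zz)
      qed
    qed blast
  }
qed


lemma free_res_map_hom:
  assumes M: "module R M" and M': "module R M'" and f: "(\<lambda>x\<in>carrier M. f x) \<in> mod_hom R M M'"
  shows "free_res_map R M M' f i \<in> mod_hom R (free_res R M i) (free_res R M' i)"
    and "s \<in> syz_basis R M i \<Longrightarrow> free_res_map R M M' f i (free_basis R s) = free_basis R (map_syz id f s)"
proof -
  have cr: "cring R" using M by (simp add: module_def)
  have v: "(\<lambda>s. free_basis R (map_syz id f s)) \<in> syz_basis R M i \<rightarrow> carrier (free_res R M' i)"
    unfolding free_res_def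
    by (intro Pi_I free_basis_closed[OF cr]) (use free_res_map_basis[OF M M' f, of i] in blast)
  show "free_res_map R M M' f i \<in> mod_hom R (free_res R M i) (free_res R M' i)"
    unfolding free_res_map_def using lin_ext_hom[OF module_free_res[OF cr] v] by (simp add: free_res_def)
  show "s \<in> syz_basis R M i \<Longrightarrow> free_res_map R M M' f i (free_basis R s) = free_basis R (map_syz id f s)"
    unfolding free_res_map_def by (rule lin_ext_basis[OF module_free_res[OF cr] v])
qed

lemma chain_map_free_res_map:
  assumes M: "module R M" and M': "module R M'" and f: "(\<lambda>x\<in>carrier M. f x) \<in> mod_hom R M M'"
  shows "chain_map R (free_res R M) (free_res_diff R M) (free_res_aug R M)
    (free_res R M') (free_res_diff R M') (free_res_aug R M') f (free_res_map R M M' f)"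
  unfolding chain_map_def using free_res_map_hom(1)[OF assms] free_res_map_basis[OF assms] by blast

text \<open>
  As a consequence \<open>free_res_map\<close> depends only on the values of the map on the carrier. This matters because
  the maps between the \<open>M/I\<^sup>nM\<close> compose only there.
\<close>

lemma syz_basis_entries: "s \<in> syz_basis R M i \<Longrightarrow> set2_syz s \<subseteq> carrier M"
proof (induction i arbitrary: s rule: nat.induct)
  case (Suc i)
  have "\<exists>l. s = Rel l \<and> set l \<subseteq> syz_basis R M i \<times> carrier R" using Suc.prems by (cases i) auto
  then obtain l where l: "s = Rel l" "set l \<subseteq> syz_basis R M i \<times> carrier R" by blast
  show ?case
  proof
    fix x assume "x \<in> set2_syz s"
    then obtain p where p: "p \<in> set l" "x \<in> set2_syz (fst p)"
      unfolding l(1) by (auto simp: Basic_BNFs.fsts.simps)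
    then have "fst p \<in> syz_basis R M i" using l(2) by auto
    then show "x \<in> carrier M" using Suc.IH p(2) by blast
  qed
qed auto

lemma free_res_map_comp:
  assumes M: "module R M" and M': "module R M'" and M'': "module R M''"
    and f: "(\<lambda>x\<in>carrier M. f x) \<in> mod_hom R M M'" and g: "(\<lambda>x\<in>carrier M'. g x) \<in> mod_hom R M' M''"
    and h: "(\<lambda>x\<in>carrier M. h x) \<in> mod_hom R M M''" and gf: "\<And>x. x \<in> carrier M \<Longrightarrow> g (f x) = h x"
    and x: "x \<in> carrier (free_res R M i)"
  shows "free_res_map R M' M'' g i (free_res_map R M M' f i x) = free_res_map R M M'' h i x"
proof -
  have cr: "cring R" using M by (simp add: module_def)
  note mF = module_free_res[OF cr]
  note hf = free_res_map_hom[OF M M' f] and hg = free_res_map_hom[OF M' M'' g] and hh = free_res_map_hom[OF M M'' h]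
  let ?c = "\<lambda>x\<in>carrier (free_res R M i). free_res_map R M' M'' g i (free_res_map R M M' f i x)"
  have c: "?c \<in> mod_hom R (free_res R M i) (free_res R M'' i)" using mod_hom_compose[OF mF hf(1) hg(1)] .
  have "?c x = free_res_map R M M'' h i x"
  proof (rule free_res_hom_eqI[OF cr mF c hh(1) _ x])
    fix s assume s: "s \<in> syz_basis R M i"
    have s': "map_syz id f s \<in> syz_basis R M' i" using free_res_map_basis[OF M M' f, of i] s by blast
    have "map_syz id g (map_syz id f s) = map_syz (id \<circ> id) (g \<circ> f) s" by (rule syz.map_comp)
    also have "\<dots> = map_syz id h s"
      by (rule syz.map_cong) (use gf syz_basis_entries[OF s] in auto)
    finally have "map_syz id g (map_syz id f s) = map_syz id h s" .
    moreover have "free_basis R s \<in> carrier (free_res R M i)" unfolding free_res_def using free_basis_closed[OF cr s] .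
    ultimately show "?c (free_basis R s) = free_res_map R M M'' h i (free_basis R s)"
      using hf(2)[OF s] hg(2)[OF s'] hh(2)[OF s] by (simp add: free_res_def)
  qed
  then show ?thesis using x by simp
qed

lemma free_res_map_id:
  assumes M: "module R M" and f: "\<And>x. x \<in> carrier M \<Longrightarrow> f x = x" and x: "x \<in> carrier (free_res R M i)"
  shows "free_res_map R M M f i x = x"
proof -
  have cr: "cring R" using M by (simp add: module_def)
  note mF = module_free_res[OF cr]
  have fh: "(\<lambda>x\<in>carrier M. f x) \<in> mod_hom R M M" by (rule mod_homI[OF _ _ _ M]) (auto simp: f)
  note h = free_res_map_hom[OF M M fh]
  let ?i = "\<lambda>x\<in>carrier (free_res R M i). x"
  have i: "?i \<in> mod_hom R (free_res R M i) (free_res R M i)" by (rule mod_homI[OF _ _ _ mF]) auto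
  have "free_res_map R M M f i x = ?i x"
  proof (rule free_res_hom_eqI[OF cr mF h(1) i _ x])
    fix s assume s: "s \<in> syz_basis R M i"
    have "map_syz id f s = map_syz id id s"
      by (rule syz.map_cong) (use f syz_basis_entries[OF s] in auto)
    then have "map_syz id f s = s" by (simp add: syz.map_id)
    moreover have "free_basis R s \<in> carrier (free_res R M i)" unfolding free_res_def using free_basis_closed[OF cr s] .
    ultimately show "free_res_map R M M f i (free_basis R s) = ?i (free_basis R s)"
      using h(2)[OF s] by (simp add: free_res_def)
  qed
  then show ?thesis using x by simp
qed

section \<open>Vanishing for torsion coefficients\<close>

lemma chain_map_cong:
  assumes "chain_map R F d e E \<delta> \<epsilon> f \<phi>" "\<And>x. x \<in> carrier (F 0) \<Longrightarrow> f (e x) = f' (e x)"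
  shows "chain_map R F d e E \<delta> \<epsilon> f' \<phi>"
  using assms by (simp add: chain_map_def)

lemma (in module) ideal_span_mono:
  assumes "I \<subseteq> I'" "Y \<subseteq> Y'" "I' \<subseteq> carrier R" "Y' \<subseteq> carrier M"
  shows "ideal_span R M I Y \<subseteq> ideal_span R M I' Y'"
  unfolding ideal_span_le_iff[OF submodule_ideal_span[OF assms(3,4)]]
  by (intro ballI ideal_span_mem) (use assms(1,2) in blast)+

lemma ideal_span_image:
  assumes "module R A" "module R B" "h \<in> mod_hom R A B" "I \<subseteq> carrier R" "Y \<subseteq> carrier A"
  shows "ideal_span R B I (h ` Y) \<subseteq> h ` ideal_span R A I Y"
proof -
  interpret A: module R A by fact
  interpret B: module R B by fact
  have S: "submodule (h ` ideal_span R A I Y) R B"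
    by (rule submodule_image[OF assms(1-3) A.submodule_ideal_span[OF assms(4,5)]])
  show ?thesis
    unfolding ideal_span_le_iff[OF S]
  proof (intro ballI)
    fix r y assume r: "r \<in> I" and "y \<in> h ` Y"
    then obtain x where x: "x \<in> Y" "y = h x" by blast
    have "r \<odot>\<^bsub>B\<^esub> y = h (r \<odot>\<^bsub>A\<^esub> x)"
      unfolding x(2) by (rule mod_hom_smult[OF assms(3), symmetric]) (use r x assms(4,5) in auto)
    then show "r \<odot>\<^bsub>B\<^esub> y \<in> h ` ideal_span R A I Y"
      using ideal_span_mem[OF r x(1), where R = R and M = A] by simp
  qed
qed

lemma (in module) finitely_generated_restrict:
  assumes Z: "submodule Z R M" and Y: "Y \<subseteq> Z" "gen_submodule R M Y = Z"
  shows "gen_submodule R (M\<lparr>carrier := Z\<rparr>) Y = carrier (M\<lparr>carrier := Z\<rparr>)"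
proof -
  interpret Z: module R "M\<lparr>carrier := Z\<rparr>" using module_restrict[OF module_axioms Z] .
  have "submodule (gen_submodule R (M\<lparr>carrier := Z\<rparr>) Y) R (M\<lparr>carrier := Z\<rparr>)"
    by (rule Z.submodule_gen_submodule) (use Y in simp)
  then have G: "submodule (gen_submodule R (M\<lparr>carrier := Z\<rparr>) Y) R M" "gen_submodule R (M\<lparr>carrier := Z\<rparr>) Y \<subseteq> Z"
    unfolding submodule_restrict_iff[OF module_axioms Z] by auto
  have "gen_submodule R M Y \<subseteq> gen_submodule R (M\<lparr>carrier := Z\<rparr>) Y"
    unfolding gen_submodule_le_iff[OF G(1)] by (rule gen_submodule_ge)
  then show ?thesis using G(2) Y(2) by simp
qed

text \<open>
  The exponents are chosen from degree \<open>i\<close> downwards: each application of Artin--Rees, to the image of the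
  differential, determines the exponent one degree below.
\<close>

lemma artin_rees_sequence:
  assumes noeth: "noetherian_ring R" and I: "ideal I R"
    and ex: "aug_exact R A (\<lambda>i. free_module R {..<k i :: nat}) d e"
  shows "\<exists>\<kappa>. \<kappa> i = c \<and> (\<forall>l<i.
    ideal_span R (free_module R {..<k l}) (ideal_power R I (\<kappa> l)) (carrier (free_module R {..<k l})) \<inter>
      d l ` carrier (free_module R {..<k (Suc l)}) \<subseteq>
    d l ` ideal_span R (free_module R {..<k (Suc l)}) (ideal_power R I (\<kappa> (Suc l))) (carrier (free_module R {..<k (Suc l)})))"
proof (induction i arbitrary: c)
  case 0
  show ?case by (intro exI[of _ "\<lambda>_. c"]) simp
next
  case (Suc i)
  have A: "module R A" using ex by (simp add: aug_exact_def aug_complex_def)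
  then have cr: "cring R" by (simp add: module_def)
  let ?F = "\<lambda>i. free_module R {..<k i}"
  have F: "module R (?F i)" for i using module_free_module[OF cr] .
  have d: "d i \<in> mod_hom R (?F (Suc i)) (?F i)" using ex by (simp add: aug_exact_def aug_complex_def)
  let ?Z = "d i ` carrier (?F (Suc i))"
  have Z: "submodule ?Z R (?F i)" using submodule_image[OF F F d module.carrier_is_submodule[OF F]] .
  note Ffg = free_module_finitely_generated[OF cr finite_lessThan]
  obtain n where n: "ideal_span R (?F i) (ideal_power R I n) (carrier (?F i)) \<inter> ?Z \<subseteq> ideal_span R (?F i) (ideal_power R I c) ?Z"
    using module.weak_artin_rees[OF F noeth I Ffg Z, of c] by blast
  have "ideal_span R (?F i) (ideal_power R I c) ?Z \<subseteq> d i ` ideal_span R (?F (Suc i)) (ideal_power R I c) (carrier (?F (Suc i)))"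
    by (rule ideal_span_image[OF F F d cring.ideal_power_carrier[OF cr I] order_refl])
  with n have n': "ideal_span R (?F i) (ideal_power R I n) (carrier (?F i)) \<inter> ?Z \<subseteq>
      d i ` ideal_span R (?F (Suc i)) (ideal_power R I c) (carrier (?F (Suc i)))" by (rule order_trans)
  obtain \<kappa> where \<kappa>: "\<kappa> i = n" "\<forall>l<i. ideal_span R (?F l) (ideal_power R I (\<kappa> l)) (carrier (?F l)) \<inter>
      d l ` carrier (?F (Suc l)) \<subseteq> d l ` ideal_span R (?F (Suc l)) (ideal_power R I (\<kappa> (Suc l))) (carrier (?F (Suc l)))"
    using Suc.IH[of n] by blast
  show ?case
  proof (intro exI[of _ "\<kappa>(Suc i := c)"] conjI allI impI)
    fix l assume l: "l < Suc i"
    show "ideal_span R (?F l) (ideal_power R I ((\<kappa>(Suc i := c)) l)) (carrier (?F l)) \<inter> d l ` carrier (?F (Suc l)) \<subseteq>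
        d l ` ideal_span R (?F (Suc l)) (ideal_power R I ((\<kappa>(Suc i := c)) (Suc l))) (carrier (?F (Suc l)))"
    proof (cases "l = i")
      case True
      then show ?thesis using n' \<kappa>(1) by simp
    next
      case False
      then show ?thesis using \<kappa>(2) l by simp
    qed
  qed simp
qed

text \<open>
  In this context \<open>IM n\<close> is \<open>I\<^sup>nM\<close>, \<open>Q n\<close> is \<open>M/I\<^sup>nM\<close>, and \<open>q n\<close> is the natural map from any
  \<open>Q m\<close> with \<open>n \<le> m\<close> to \<open>Q n\<close>.
\<close>

locale adic_quotients =
  fixes R :: "('a, 'r) ring_scheme" and I :: "'a set" and M :: "('a, 'm, 'k) module_scheme"
  assumes noeth: "noetherian_ring R" and I: "ideal I R" and M: "module R M" and fgM: "fin_gen_module R M"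
begin

sublocale M: module R M by (rule M)

abbreviation (input) "IM n \<equiv> ideal_power_smult R I n M"
abbreviation (input) "Q n \<equiv> quot_module R M (IM n)"
abbreviation (input) "q n \<equiv> (\<lambda>C. IM n <+>\<^bsub>M\<^esub> C)"

lemma IM_eq: "IM n = ideal_span R M (ideal_power R I n) (carrier M)"
  by (simp add: ideal_power_smult_def ideal_smult_eq_span)

lemma submodule_IM: "submodule (IM n) R M"
  unfolding IM_eq by (rule M.submodule_ideal_span[OF M.R.ideal_power_carrier[OF I] order_refl])

lemma IM_antimono: "n \<le> m \<Longrightarrow> IM m \<subseteq> IM n"
  unfolding IM_eq
  by (rule M.ideal_span_mono[OF M.R.ideal_power_mono[OF I] order_refl M.R.ideal_power_carrier[OF I] order_refl])

lemma module_Q: "module R (Q n)"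
  by (rule M.module_quot_module[OF submodule_IM])

lemma q_coset: "n \<le> m \<Longrightarrow> x \<in> carrier M \<Longrightarrow> q n (IM m +>\<^bsub>M\<^esub> x) = IM n +>\<^bsub>M\<^esub> x"
  by (rule M.set_add_coset[OF submodule_IM submodule_IM IM_antimono])

lemma q_hom: "n \<le> m \<Longrightarrow> (\<lambda>C\<in>carrier (Q m). q n C) \<in> mod_hom R (Q m) (Q n)"
  by (rule mod_homI[OF _ _ _ module_Q])
    (auto simp: M.quot_carrier q_coset M.quot_add[OF submodule_IM] M.quot_smult[OF submodule_IM])

lemma finite_free_resolution_IM:
  "\<exists>(k :: nat \<Rightarrow> nat) d e. aug_exact R (M\<lparr>carrier := IM n\<rparr>) (\<lambda>i. free_module R {..<k i}) d e"
proof -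
  obtain E where E: "finite E" "E \<subseteq> carrier M" "gen_submodule R M E = carrier M"
    using fgM by (auto simp: fin_gen_module_def)
  have "IM n \<subseteq> gen_submodule R M E" using M.submoduleD(1)[OF submodule_IM] E(3) by simp
  from M.submodule_finitely_generated[OF noeth E(1,2) submodule_IM this]
  obtain Y where Y: "finite Y" "Y \<subseteq> IM n" "gen_submodule R M Y = IM n" by blast
  have "Y \<subseteq> carrier (M\<lparr>carrier := IM n\<rparr>)" using Y(2) by simp
  from finite_free_resolution[OF noeth module_restrict[OF M submodule_IM] Y(1) this
      M.finitely_generated_restrict[OF submodule_IM Y(2,3)]]
  show ?thesis .
qed

lemma inclusion_hom: "Z \<subseteq> Z' \<Longrightarrow> submodule Z R M \<Longrightarrow>
    (\<lambda>x\<in>Z. x) \<in> mod_hom R (M\<lparr>carrier := Z\<rparr>) (M\<lparr>carrier := Z'\<rparr>)"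
  using mod_homI[of "M\<lparr>carrier := Z\<rparr>" "\<lambda>x. x" "M\<lparr>carrier := Z'\<rparr>" R] module_restrict[OF M] by auto

text \<open>
  The chain map is a composite \<open>F (Q m) \<rightarrow> cone m \<rightarrow> cone n \<rightarrow> F (Q n)\<close>, where \<open>cone n\<close> is the mapping cone of a
  lift to resolutions of the inclusion of \<open>I\<^sup>nM\<close> in \<open>M\<close>. In degree \<open>j\<close> only the second summand
  of the cones is left, which is \<open>0\<close> for \<open>j = 0\<close>.
\<close>

lemma killing_chain_map:
  fixes P :: "nat \<Rightarrow> ('a, 'p) module" and T :: "('a, 'n, 'l) module_scheme"
  assumes P: "projective_resolution R M P dP eP" and Pj: "carrier (P j) = {\<zero>\<^bsub>P j\<^esub>}"
    and T: "module R T"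
    and tors: "\<And>y. y \<in> carrier T \<Longrightarrow> \<exists>c. \<forall>u\<in>ideal_power R I c. u \<odot>\<^bsub>T\<^esub> y = \<zero>\<^bsub>T\<^esub>"
    and h: "h \<in> mod_hom R (free_res R (Q n) j) T"
  shows "\<exists>m\<ge>n. \<exists>\<phi>. chain_map R (free_res R (Q m)) (free_res_diff R (Q m)) (free_res_aug R (Q m))
    (free_res R (Q n)) (free_res_diff R (Q n)) (free_res_aug R (Q n)) (q n) \<phi> \<and>
    (\<forall>x\<in>carrier (free_res R (Q m) j). h (\<phi> j x) = \<zero>\<^bsub>T\<^esub>)"
proof -
  have cr: "cring R" using M by (simp add: module_def)
  note P' = aug_exact_of_resolution[OF M P]
  have Pc: "aug_complex R M P dP eP" and projP: "projective_module R (P i)" for i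
    using P' P by (simp_all add: aug_exact_def projective_resolution_def)
  have mP: "module R (P i)" for i using projP by (simp add: projective_module_def)
  obtain k :: "nat \<Rightarrow> nat" and dY eY where Y: "aug_exact R (M\<lparr>carrier := IM n\<rparr>) (\<lambda>i. free_module R {..<k i}) dY eY"
    using finite_free_resolution_IM by blast
  let ?Y = "\<lambda>i. free_module R {..<k i}"
  have Yc: "aug_complex R (M\<lparr>carrier := IM n\<rparr>) ?Y dY eY" using Y by (simp add: aug_exact_def)
  note Ycomp = Yc[unfolded aug_complex_def]
  have mY: "module R (?Y i)" for i using module_free_module[OF cr] .
  have eY: "eY \<in> mod_hom R (?Y 0) (M\<lparr>carrier := IM n\<rparr>)" and dY: "dY i \<in> mod_hom R (?Y (Suc i)) (?Y i)" for i
    using Ycomp by simp_all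
  have projY: "projective_module R (?Y i)" for i using projective_free_module[OF cr] .
  have "M\<lparr>carrier := carrier M\<rparr> = M" by simp
  then have inc: "(\<lambda>x\<in>IM n. x) \<in> mod_hom R (M\<lparr>carrier := IM n\<rparr>) M"
    using inclusion_hom[OF M.submoduleD(1)[OF submodule_IM] submodule_IM] by simp
  obtain \<iota> where "chain_map R ?Y dY eY P dP eP (\<lambda>x\<in>IM n. x) \<iota>"
    using comparison_exact[OF Yc projY P' inc] by blast
  then have \<iota>: "chain_map R ?Y dY eY P dP eP (\<lambda>x. x) \<iota>"
    by (rule chain_map_cong) (use mod_hom_closed[OF eY] in auto)
  have \<iota>h: "\<iota> i \<in> mod_hom R (?Y i) (P i)" for i using \<iota> by (simp add: chain_map_def)
  note En = cone_exact[OF P' submodule_IM Y \<iota>]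
  have Enc: "aug_complex R (Q n) (cone P ?Y) (cone_diff P dP ?Y dY \<iota>) (cone_aug M (IM n) P eP ?Y)"
    using En by (simp add: aug_exact_def)
  have projE: "projective_module R (cone P ?Y i)" for i using projective_cone[OF projP projY] .
  note Fn = aug_exact_of_resolution[OF module_Q projective_resolution_free_res[OF module_Q]]
  have idQ: "(\<lambda>C\<in>carrier (Q n). C) \<in> mod_hom R (Q n) (Q n)" for n
    by (rule mod_homI[OF _ _ _ module_Q]) auto
  obtain \<beta> where \<beta>: "chain_map R (cone P ?Y) (cone_diff P dP ?Y dY \<iota>) (cone_aug M (IM n) P eP ?Y)
      (free_res R (Q n)) (free_res_diff R (Q n)) (free_res_aug R (Q n)) (\<lambda>C\<in>carrier (Q n). C) \<beta>"
    using comparison_exact[OF Enc projE Fn idQ] by blast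
  have \<beta>h: "\<beta> i \<in> mod_hom R (cone P ?Y i) (free_res R (Q n) i)" for i using \<beta> by (simp add: chain_map_def)
  have mF: "module R (free_res R (Q n) i)" for n i using module_free_res[OF cr] .
  have mCn: "module R (cone P ?Y i)" for i using module_cone[OF mP mY] .
  \<comment> \<open>The module \<open>Y (j - 1)\<close> is finitely generated and \<open>T\<close> is torsion.\<close>
  have "\<exists>c. \<forall>i. j = Suc i \<longrightarrow> (\<forall>x\<in>ideal_span R (?Y i) (ideal_power R I c) (carrier (?Y i)).
      h (\<beta> j (\<zero>\<^bsub>P j\<^esub>, x)) = \<zero>\<^bsub>T\<^esub>)"
  proof (cases j)
    case 0
    then show ?thesis by simp
  next
    case (Suc i)
    interpret Pj: module R "P j" by (rule mP)
    let ?f = "\<lambda>x\<in>carrier (?Y i). h (\<beta> j (\<zero>\<^bsub>P j\<^esub>, x))"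
    have "(\<lambda>x\<in>carrier (?Y i). (\<zero>\<^bsub>P j\<^esub>, x)) \<in> mod_hom R (?Y i) (cone P ?Y j)"
      by (rule mod_homI[OF _ _ _ mY])
        (use Pj.M.zero_closed Pj.M.l_zero[OF Pj.M.zero_closed] Pj.smult_r_null in \<open>auto simp: Suc\<close>)
    from mod_hom_compose[OF mY mod_hom_compose[OF mY this \<beta>h] h]
    have f: "?f \<in> mod_hom R (?Y i) T" by (rule back_subst[of "\<lambda>f. f \<in> mod_hom R (?Y i) T"]) (auto intro!: restrict_ext)
    from module.torsion_of_finitely_generated[OF mY I free_module_finitely_generated[OF cr finite_lessThan] T f tors]
    obtain c where c: "\<And>x. x \<in> ideal_span R (?Y i) (ideal_power R I c) (carrier (?Y i)) \<Longrightarrow> ?f x = \<zero>\<^bsub>T\<^esub>" by blast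
    have "ideal_span R (?Y i) (ideal_power R I c) (carrier (?Y i)) \<subseteq> carrier (?Y i)"
      using module.submoduleD(1)[OF mY module.submodule_ideal_span[OF mY M.R.ideal_power_carrier[OF I] order_refl]] .
    then have "h (\<beta> j (\<zero>\<^bsub>P j\<^esub>, x)) = \<zero>\<^bsub>T\<^esub>" if "x \<in> ideal_span R (?Y i) (ideal_power R I c) (carrier (?Y i))" for x
      using c[OF that] that by (simp add: subset_iff)
    then show ?thesis using Suc by (intro exI[of _ c]) simp
  qed
  then obtain c where c: "\<And>i x. j = Suc i \<Longrightarrow> x \<in> ideal_span R (?Y i) (ideal_power R I c) (carrier (?Y i)) \<Longrightarrow>
      h (\<beta> j (\<zero>\<^bsub>P j\<^esub>, x)) = \<zero>\<^bsub>T\<^esub>" by blast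
  obtain \<kappa> where \<kappa>: "\<kappa> (j - 1) = c" "\<And>l. l < j - 1 \<Longrightarrow>
      ideal_span R (?Y l) (ideal_power R I (\<kappa> l)) (carrier (?Y l)) \<inter> dY l ` carrier (?Y (Suc l)) \<subseteq>
      dY l ` ideal_span R (?Y (Suc l)) (ideal_power R I (\<kappa> (Suc l))) (carrier (?Y (Suc l)))"
    using artin_rees_sequence[OF noeth I Y, of "j - 1" c] by blast
  define V where "V l = (if l \<le> j - 1 then ideal_span R (?Y l) (ideal_power R I (\<kappa> l)) (carrier (?Y l)) else carrier (?Y l))" for l
  have V: "submodule (V l) R (?Y l)" for l
    unfolding V_def using module.submodule_ideal_span[OF mY M.R.ideal_power_carrier[OF I] order_refl]
      module.carrier_is_submodule[OF mY] by simp
  have VY: "V l \<subseteq> carrier (?Y l)" for l using module.submoduleD(1)[OF mY V] .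
  have Vd: "V l \<inter> dY l ` carrier (?Y (Suc l)) \<subseteq> dY l ` V (Suc l)" for l
    using \<kappa>(2)[of l] by (auto simp: V_def)
  \<comment> \<open>Artin--Rees in \<open>M\<close> itself provides the start \<open>I\<^sup>mM \<subseteq> eY (V 0)\<close> of the lift into the \<open>V i\<close>.\<close>
  obtain E where E: "finite E" "E \<subseteq> carrier M" "gen_submodule R M E = carrier M"
    using fgM by (auto simp: fin_gen_module_def)
  obtain m0 where m0: "ideal_span R M (ideal_power R I m0) (carrier M) \<inter> IM n \<subseteq> ideal_span R M (ideal_power R I (\<kappa> 0)) (IM n)"
    using M.weak_artin_rees[OF noeth I E submodule_IM] by blast
  define m where "m = max m0 n"
  have nm: "n \<le> m" by (simp add: m_def)
  have IMm: "IM m \<subseteq> eY ` V 0"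
  proof -
    have "IM m \<subseteq> ideal_span R M (ideal_power R I (\<kappa> 0)) (IM n)"
      using m0 IM_antimono[of m0 m] IM_antimono[OF nm] unfolding IM_eq[of m0] by (auto simp: m_def)
    also have "\<dots> \<subseteq> eY ` V 0"
    proof -
      have "submodule (eY ` V 0) R (M\<lparr>carrier := IM n\<rparr>)"
        using submodule_image[OF mY module_restrict[OF M submodule_IM] eY V] .
      then have S: "submodule (eY ` V 0) R M" unfolding submodule_restrict_iff[OF M submodule_IM] by blast
      show ?thesis
        unfolding ideal_span_le_iff[OF S]
      proof (intro ballI)
        fix r y assume r: "r \<in> ideal_power R I (\<kappa> 0)" and y: "y \<in> IM n"
        have "eY ` carrier (?Y 0) = IM n" using Y by (simp add: aug_exact_def)
        then obtain x where x: "x \<in> carrier (?Y 0)" "y = eY x" using y by blast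
        have rc: "r \<in> carrier R" using r M.R.ideal_power_carrier[OF I] by blast
        have "r \<odot>\<^bsub>M\<^esub> y = eY (r \<odot>\<^bsub>?Y 0\<^esub> x)" using mod_hom_smult[OF eY rc x(1)] x(2) by simp
        moreover have "r \<odot>\<^bsub>?Y 0\<^esub> x \<in> V 0" unfolding V_def using ideal_span_mem[OF r x(1), where R = R and M = "?Y 0"] by simp
        ultimately show "r \<odot>\<^bsub>M\<^esub> y \<in> eY ` V 0" by simp
      qed
    qed
    finally show ?thesis .
  qed
  obtain k' :: "nat \<Rightarrow> nat" and dZ eZ where Z: "aug_exact R (M\<lparr>carrier := IM m\<rparr>) (\<lambda>i. free_module R {..<k' i}) dZ eZ"
    using finite_free_resolution_IM by blast
  let ?Z = "\<lambda>i. free_module R {..<k' i}"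
  have Zc: "aug_complex R (M\<lparr>carrier := IM m\<rparr>) ?Z dZ eZ" using Z by (simp add: aug_exact_def)
  have mZ: "module R (?Z i)" for i using module_free_module[OF cr] .
  have projZ: "projective_module R (?Z i)" for i using projective_free_module[OF cr] .
  have eZ: "eZ \<in> mod_hom R (?Z 0) (M\<lparr>carrier := IM m\<rparr>)" and dZ: "dZ i \<in> mod_hom R (?Z (Suc i)) (?Z i)" for i
    using Zc by (simp_all add: aug_complex_def)
  have eZm: "eZ x \<in> IM m" if "x \<in> carrier (?Z 0)" for x using mod_hom_closed[OF eZ that] by simp
  have "\<exists>\<chi>. chain_map R ?Z dZ eZ ?Y dY eY (\<lambda>x\<in>IM m. x) \<chi> \<and> (\<forall>i. \<forall>x\<in>carrier (?Z i). \<chi> i x \<in> V i)"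
  proof (rule comparison[OF Zc projZ Yc inclusion_hom[OF IM_antimono[OF nm] submodule_IM] V])
    show "(\<lambda>x\<in>IM m. x) (eZ x) \<in> eY ` V 0" if "x \<in> carrier (?Z 0)" for x using eZm[OF that] IMm by auto
    show "x \<in> dY 0 ` V (Suc 0)" if "x \<in> V 0" "eY x = \<zero>\<^bsub>M\<lparr>carrier := IM n\<rparr>\<^esub>" for x
    proof -
      have "x \<in> dY 0 ` carrier (?Y (Suc 0))" using Y that VY[of 0] by (auto simp: aug_exact_def)
      then show ?thesis using Vd[of 0] that(1) by blast
    qed
    show "x \<in> dY (Suc i) ` V (Suc (Suc i))" if "x \<in> V (Suc i)" "dY i x = \<zero>\<^bsub>?Y i\<^esub>" for i x
    proof -
      have "x \<in> carrier (?Y (Suc i))" using VY that(1) by blast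
      then have "x \<in> dY (Suc i) ` carrier (?Y (Suc (Suc i)))" using Y that(2) unfolding aug_exact_def by blast
      then show ?thesis using Vd[of "Suc i"] that(1) by blast
    qed
  qed
  then obtain \<chi> where \<chi>0: "chain_map R ?Z dZ eZ ?Y dY eY (\<lambda>x\<in>IM m. x) \<chi>"
    and \<chi>V: "\<And>i x. x \<in> carrier (?Z i) \<Longrightarrow> \<chi> i x \<in> V i" by blast
  have \<chi>: "chain_map R ?Z dZ eZ ?Y dY eY (\<lambda>x. x) \<chi>" by (rule chain_map_cong[OF \<chi>0]) (use eZm in simp)
  let ?\<iota>' = "\<lambda>i. \<lambda>x\<in>carrier (?Z i). \<iota> i (\<chi> i x)"
  have \<iota>': "chain_map R ?Z dZ eZ P dP eP (\<lambda>x. x) ?\<iota>'" using chain_map_compose[OF \<chi> \<iota> mZ dZ] .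
  note Em = cone_exact[OF P' submodule_IM Z \<iota>']
  note \<psi> = chain_map_cone_map[OF P' submodule_IM submodule_IM IM_antimono[OF nm] Zc Yc \<chi> \<iota>h]
  have Fmc: "aug_complex R (Q m) (free_res R (Q m)) (free_res_diff R (Q m)) (free_res_aug R (Q m))"
    using Fn by (simp add: aug_exact_def)
  have projF: "projective_module R (free_res R (Q m) i)" for i
    unfolding free_res_def using projective_free_module[OF cr] .
  obtain \<alpha> where \<alpha>: "chain_map R (free_res R (Q m)) (free_res_diff R (Q m)) (free_res_aug R (Q m))
      (cone P ?Z) (cone_diff P dP ?Z dZ ?\<iota>') (cone_aug M (IM m) P eP ?Z) (\<lambda>C\<in>carrier (Q m). C) \<alpha>"
    using comparison_exact[OF Fmc projF Em idQ] by blast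
  have dF: "free_res_diff R (Q m) i \<in> mod_hom R (free_res R (Q m) (Suc i)) (free_res R (Q m) i)" for i
    using Fmc by (simp add: aug_complex_def)
  have eF: "free_res_aug R (Q m) \<in> mod_hom R (free_res R (Q m) 0) (Q m)"
    using Fmc by (simp add: aug_complex_def)
  have \<alpha>h: "\<alpha> i \<in> mod_hom R (free_res R (Q m) i) (cone P ?Z i)" for i using \<alpha> by (simp add: chain_map_def)
  let ?\<phi> = "\<lambda>i. \<lambda>x\<in>carrier (free_res R (Q m) i). \<beta> i ((\<lambda>x\<in>carrier (free_res R (Q m) i). cone_map P ?Z ?Y \<chi> i (\<alpha> i x)) x)"
  have "chain_map R (free_res R (Q m)) (free_res_diff R (Q m)) (free_res_aug R (Q m))
      (free_res R (Q n)) (free_res_diff R (Q n)) (free_res_aug R (Q n)) (q n) ?\<phi>"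
    by (rule chain_map_cong[OF chain_map_compose[OF chain_map_compose[OF \<alpha> \<psi> mF dF] \<beta> mF dF]])
      (use mod_hom_closed[OF eF] mod_hom_closed[OF q_hom[OF nm]] in auto)
  moreover have "h (?\<phi> j x) = \<zero>\<^bsub>T\<^esub>" if x: "x \<in> carrier (free_res R (Q m) j)" for x
  proof -
    have ax: "\<alpha> j x \<in> carrier (cone P ?Z j)" using mod_hom_closed[OF \<alpha>h x] .
    have "h (\<beta> j (cone_map P ?Z ?Y \<chi> j (\<alpha> j x))) = \<zero>\<^bsub>T\<^esub>"
    proof (cases j)
      case 0
      have "\<alpha> j x = (\<zero>\<^bsub>P 0\<^esub>, \<zero>\<^bsub>?Z 0\<^esub>)" using ax Pj by (auto simp: 0)
      then have "cone_map P ?Z ?Y \<chi> j (\<alpha> j x) = \<zero>\<^bsub>cone P ?Y j\<^esub>"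
        using ax by (simp add: cone_map_def 0)
      then show ?thesis using mod_hom_zero[OF mCn mF \<beta>h] mod_hom_zero[OF mF T h] by simp
    next
      case (Suc i)
      obtain z where z: "\<alpha> j x = (\<zero>\<^bsub>P j\<^esub>, z)" "z \<in> carrier (?Z i)"
        using ax Pj by (auto simp: Suc)
      have "cone_map P ?Z ?Y \<chi> j (\<alpha> j x) = (\<zero>\<^bsub>P j\<^esub>, \<chi> i z)"
        using ax unfolding z(1) by (simp add: cone_map_def Suc)
      moreover have "\<chi> i z \<in> ideal_span R (?Y i) (ideal_power R I c) (carrier (?Y i))"
        using \<chi>V[OF z(2)] \<kappa>(1) by (simp add: V_def Suc)
      ultimately show ?thesis using c[OF Suc] by simp
    qed
    then show ?thesis using x by simp
  qed
  ultimately show ?thesis using nm by blast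
qed

text \<open>
  The natural chain map is homotopic to one that composes to zero with \<open>h\<close> in degree \<open>j\<close>, and the homotopy exhibits
  its composite with \<open>h\<close> as a coboundary. For \<open>j = 0\<close> there are no coboundaries but \<open>0\<close>.
\<close>

lemma ext_limit_vanishes:
  fixes P :: "nat \<Rightarrow> ('a, 'p) module" and T :: "('a, 'n, 'l) module_scheme"
  assumes P: "projective_resolution R M P dP eP" and Pj: "carrier (P j) = {\<zero>\<^bsub>P j\<^esub>}"
    and T: "module R T"
    and tors: "\<And>y. y \<in> carrier T \<Longrightarrow> \<exists>c. \<forall>u\<in>ideal_power R I c. u \<odot>\<^bsub>T\<^esub> y = \<zero>\<^bsub>T\<^esub>"
    and h: "h \<in> mod_hom R (free_res R (Q n) j) T"
    and cocycle: "\<And>x. x \<in> carrier (free_res R (Q n) (Suc j)) \<Longrightarrow> h (free_res_diff R (Q n) j x) = \<zero>\<^bsub>T\<^esub>"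
  shows "\<exists>m\<ge>n. (j = 0 \<longrightarrow> (\<forall>x\<in>carrier (free_res R (Q m) j). h (free_res_map R (Q m) (Q n) (q n) j x) = \<zero>\<^bsub>T\<^esub>)) \<and>
    (\<forall>i. j = Suc i \<longrightarrow> (\<exists>u\<in>mod_hom R (free_res R (Q m) i) T. \<forall>x\<in>carrier (free_res R (Q m) j).
      h (free_res_map R (Q m) (Q n) (q n) j x) = u (free_res_diff R (Q m) i x)))"
proof -
  have cr: "cring R" using M by (simp add: module_def)
  interpret T: module R T by (rule T)
  obtain m \<phi> where nm: "n \<le> m"
    and \<phi>: "chain_map R (free_res R (Q m)) (free_res_diff R (Q m)) (free_res_aug R (Q m))
      (free_res R (Q n)) (free_res_diff R (Q n)) (free_res_aug R (Q n)) (q n) \<phi>"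
    and kill: "\<And>x. x \<in> carrier (free_res R (Q m) j) \<Longrightarrow> h (\<phi> j x) = \<zero>\<^bsub>T\<^esub>"
    using killing_chain_map[OF P Pj T tors h] by blast
  note F = aug_exact_of_resolution[OF module_Q projective_resolution_free_res[OF module_Q]]
  have Fc: "aug_complex R (Q m) (free_res R (Q m)) (free_res_diff R (Q m)) (free_res_aug R (Q m))" for m
    using F by (simp add: aug_exact_def)
  have dF: "free_res_diff R (Q m) i \<in> mod_hom R (free_res R (Q m) (Suc i)) (free_res R (Q m) i)" for m i
    using Fc by (simp add: aug_complex_def)
  have mF: "module R (free_res R (Q n) i)" for n i using module_free_res[OF cr] .
  have projF: "projective_module R (free_res R (Q m) i)" for i
    unfolding free_res_def using projective_free_module[OF cr] .
  obtain s where s: "\<And>i. s i \<in> mod_hom R (free_res R (Q m) i) (free_res R (Q n) (Suc i))"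
    and s0: "\<And>x. x \<in> carrier (free_res R (Q m) 0) \<Longrightarrow> free_res_map R (Q m) (Q n) (q n) 0 x =
      \<phi> 0 x \<oplus>\<^bsub>free_res R (Q n) 0\<^esub> free_res_diff R (Q n) 0 (s 0 x)"
    and s1: "\<And>i x. x \<in> carrier (free_res R (Q m) (Suc i)) \<Longrightarrow> free_res_map R (Q m) (Q n) (q n) (Suc i) x =
      \<phi> (Suc i) x \<oplus>\<^bsub>free_res R (Q n) (Suc i)\<^esub> (free_res_diff R (Q n) (Suc i) (s (Suc i) x)
        \<oplus>\<^bsub>free_res R (Q n) (Suc i)\<^esub> s i (free_res_diff R (Q m) i x))"
    using homotopy[OF Fc projF F chain_map_free_res_map[OF module_Q module_Q q_hom[OF nm]] \<phi>] by blast
  have \<phi>h: "\<phi> i \<in> mod_hom R (free_res R (Q m) i) (free_res R (Q n) i)" for i using \<phi> by (simp add: chain_map_def)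
  note cl = mod_hom_closed[OF s] mod_hom_closed[OF \<phi>h] mod_hom_closed[OF dF] mod_hom_closed[OF h]
  note addF = module.axioms(2)[OF mF, THEN abelian_group.axioms(1), THEN abelian_monoid.a_closed]
  show ?thesis
  proof (intro exI[of _ m] conjI allI impI)
    show "n \<le> m" by (rule nm)
    show "\<forall>x\<in>carrier (free_res R (Q m) j). h (free_res_map R (Q m) (Q n) (q n) j x) = \<zero>\<^bsub>T\<^esub>" if j: "j = 0"
    proof
      fix x assume x: "x \<in> carrier (free_res R (Q m) j)"
      show "h (free_res_map R (Q m) (Q n) (q n) j x) = \<zero>\<^bsub>T\<^esub>"
        using x s0 kill[OF x] cocycle[of "s 0 x"] mod_hom_add[OF h, of "\<phi> 0 x" "free_res_diff R (Q n) 0 (s 0 x)"] cl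
        by (simp add: j)
    qed
    fix i assume j: "j = Suc i"
    let ?u = "\<lambda>x\<in>carrier (free_res R (Q m) i). h (s i x)"
    have "?u \<in> mod_hom R (free_res R (Q m) i) T"
      using mod_hom_compose[OF mF s h[unfolded j]] by (simp add: j)
    moreover have "h (free_res_map R (Q m) (Q n) (q n) j x) = ?u (free_res_diff R (Q m) i x)"
      if x: "x \<in> carrier (free_res R (Q m) j)" for x
    proof -
      have x': "x \<in> carrier (free_res R (Q m) (Suc i))" using x j by simp
      have c: "\<phi> j x \<in> carrier (free_res R (Q n) j)" "free_res_diff R (Q n) j (s j x) \<in> carrier (free_res R (Q n) j)"
        "s i (free_res_diff R (Q m) i x) \<in> carrier (free_res R (Q n) j)"
        using cl x x' by (simp_all add: j)
      have "h (free_res_map R (Q m) (Q n) (q n) j x) = h (\<phi> j x) \<oplus>\<^bsub>T\<^esub>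
          (h (free_res_diff R (Q n) j (s j x)) \<oplus>\<^bsub>T\<^esub> h (s i (free_res_diff R (Q m) i x)))"
        unfolding s1[OF x', folded j] mod_hom_add[OF h c(1) addF[OF c(2,3)]] mod_hom_add[OF h c(2,3)] ..
      then show ?thesis
        using kill[OF x] cocycle[of "s j x"] cl(1)[of x j] x cl(4)[OF c(3)] cl(3)[OF x'] by simp
    qed
    ultimately show "\<exists>u\<in>mod_hom R (free_res R (Q m) i) T. \<forall>x\<in>carrier (free_res R (Q m) j).
        h (free_res_map R (Q m) (Q n) (q n) j x) = u (free_res_diff R (Q m) i x)" by blast
  qed
qed

end

section \<open>The induction on the dimension\<close>

lemma dcc_trivial: "B \<subseteq> A \<Longrightarrow> dcc R M A B"
  unfolding dcc_def by (metis subset_antisym subset_trans)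

text \<open>
  The prime \<open>p\<close> belongs to the support of \<open>N/L\<close>.
\<close>

definition supported_at ::
  "('a, 'r) ring_scheme \<Rightarrow> ('a, 'b, 'c) module_scheme \<Rightarrow> 'b set \<Rightarrow> 'a set \<Rightarrow> bool" where
  "supported_at R N L p \<longleftrightarrow> primeideal p R \<and> (\<exists>y\<in>carrier N. colon R N L y \<subseteq> p)"

definition prime_chain ::
  "('a, 'r) ring_scheme \<Rightarrow> ('a, 'b, 'c) module_scheme \<Rightarrow> 'b set \<Rightarrow> nat \<Rightarrow> bool" where
  "prime_chain R N L n \<longleftrightarrow>
    (\<exists>c :: nat \<Rightarrow> 'a set. (\<forall>i\<le>n. supported_at R N L (c i)) \<and> (\<forall>i<n. c i \<subset> c (Suc i)))"

lemma (in module) no_support_imp_top: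
  assumes "noetherian_ring R" "submodule L R M" "\<not> prime_chain R M L 0"
  shows "L = carrier M"
proof (rule ccontr)
  assume "L \<noteq> carrier M"
  then obtain y where y: "y \<in> carrier M" "y \<notin> L" using submoduleD(1)[OF assms(2)] by blast
  have "\<exists>q. primeideal q R \<and> colon R M L y \<subseteq> q \<and> q \<inter> {\<one>\<^bsub>R\<^esub>} = {}"
    by (rule R.prime_disjoint_from_multiplicative_set[OF assms(1) ideal_colon[OF assms(2) y(1)]])
      (use one_in_colon_iff[OF y(1), of L] y(2) in auto)
  then obtain q where "primeideal q R" "colon R M L y \<subseteq> q" by blast
  then have "supported_at R M L q" using y(1) unfolding supported_at_def by blast
  then have "prime_chain R M L 0" unfolding prime_chain_def by (intro exI[of _ "\<lambda>_. q"]) simp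
  then show False using assms(3) by blast
qed

text \<open>
  Below a prime of the support of \<open>M/(T + xM)\<close> lies a strictly smaller prime of the support of
  \<open>M/T\<close>, if \<open>x\<close> is regular on \<open>M/T\<close>: the annihilator of a nonzero element of the localization of
  \<open>M/T\<close> does not meet the multiplicative set generated by \<open>x\<close> and the complement of the prime.
\<close>

lemma (in module) smaller_prime_in_support:
  assumes noeth: "noetherian_ring R" and T: "submodule T R M" and x: "x \<in> carrier R"
    and reg: "\<And>y. y \<in> carrier M \<Longrightarrow> x \<odot>\<^bsub>M\<^esub> y \<in> T \<Longrightarrow> y \<in> T"
    and p: "supported_at R M (T <+>\<^bsub>M\<^esub> (\<lambda>y. x \<odot>\<^bsub>M\<^esub> y) ` carrier M) p"
  shows "\<exists>q. supported_at R M T q \<and> q \<subset> p"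
proof -
  let ?L = "T <+>\<^bsub>M\<^esub> (\<lambda>y. x \<odot>\<^bsub>M\<^esub> y) ` carrier M"
  have xM: "submodule ((\<lambda>y. x \<odot>\<^bsub>M\<^esub> y) ` carrier M) R M" by (rule submodule_smult_image[OF x carrier_is_submodule])
  obtain y where y: "y \<in> carrier M" "colon R M ?L y \<subseteq> p" and pp: "primeideal p R"
    using p by (auto simp: supported_at_def)
  note pd = R.primeD[OF pp]
  have xp: "x \<in> p" using y x sum_ge(2)[OF T xM] by (auto simp: colon_def)
  have yT: "colon R M T y \<subseteq> p" using y(2) sum_ge(1)[OF T xM] by (auto simp: colon_def)
  define S where "S = {(x [^]\<^bsub>R\<^esub> n) \<otimes>\<^bsub>R\<^esub> s | n s. (n::nat) \<in> UNIV \<and> s \<in> carrier R - p}"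
  have powT: "z \<in> T" if "z \<in> carrier M" "(x [^]\<^bsub>R\<^esub> n) \<odot>\<^bsub>M\<^esub> z \<in> T" for z and n :: nat
    using that
  proof (induction n arbitrary: z)
    case (Suc n)
    have "(x [^]\<^bsub>R\<^esub> n) \<odot>\<^bsub>M\<^esub> (x \<odot>\<^bsub>M\<^esub> z) \<in> T"
      using Suc.prems x by (simp add: smult_assoc1[symmetric])
    then have "x \<odot>\<^bsub>M\<^esub> z \<in> T" by (rule Suc.IH[OF smult_closed[OF x Suc.prems(1)]])
    then show ?case by (rule reg[OF Suc.prems(1)])
  qed simp
  have "\<exists>q. primeideal q R \<and> colon R M T y \<subseteq> q \<and> q \<inter> S = {}"
  proof (rule R.prime_disjoint_from_multiplicative_set[OF noeth ideal_colon[OF T y(1)]])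
    show "colon R M T y \<inter> S = {}"
    proof (rule ccontr)
      assume "colon R M T y \<inter> S \<noteq> {}"
      then obtain n :: nat and s where s: "s \<in> carrier R" "s \<notin> p" "((x [^]\<^bsub>R\<^esub> n) \<otimes>\<^bsub>R\<^esub> s) \<odot>\<^bsub>M\<^esub> y \<in> T"
        by (auto simp: S_def colon_def)
      then have "(x [^]\<^bsub>R\<^esub> n) \<odot>\<^bsub>M\<^esub> (s \<odot>\<^bsub>M\<^esub> y) \<in> T" using x y(1) by (simp add: smult_assoc1)
      then have "s \<odot>\<^bsub>M\<^esub> y \<in> T" using powT[of "s \<odot>\<^bsub>M\<^esub> y" n] s(1) y(1) by simp
      then have "s \<in> colon R M T y" using s(1) by (simp add: colon_def)
      then show False using yT s(2) by blast
    qed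
    show "S \<subseteq> carrier R" using x by (auto simp: S_def)
    have "\<one>\<^bsub>R\<^esub> = (x [^]\<^bsub>R\<^esub> (0::nat)) \<otimes>\<^bsub>R\<^esub> \<one>\<^bsub>R\<^esub>" by simp
    then show "\<one>\<^bsub>R\<^esub> \<in> S" using pd(2) unfolding S_def by blast
    fix a b assume "a \<in> S" "b \<in> S"
    then obtain n m :: nat and s u where ab: "a = (x [^]\<^bsub>R\<^esub> n) \<otimes>\<^bsub>R\<^esub> s" "b = (x [^]\<^bsub>R\<^esub> m) \<otimes>\<^bsub>R\<^esub> u"
      "s \<in> carrier R" "s \<notin> p" "u \<in> carrier R" "u \<notin> p" by (auto simp: S_def)
    have "a \<otimes>\<^bsub>R\<^esub> b = (x [^]\<^bsub>R\<^esub> (n + m)) \<otimes>\<^bsub>R\<^esub> (s \<otimes>\<^bsub>R\<^esub> u)"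
      unfolding ab R.nat_pow_mult[OF x, symmetric] using ab x by (simp add: R.m_ac)
    moreover have "s \<otimes>\<^bsub>R\<^esub> u \<in> carrier R - p" using pd(3)[of s u] ab by auto
    ultimately show "a \<otimes>\<^bsub>R\<^esub> b \<in> S" unfolding S_def by blast
  qed
  then obtain q where q: "primeideal q R" "colon R M T y \<subseteq> q" "q \<inter> S = {}" by blast
  have qc: "q \<subseteq> carrier R" using R.idealD(1)[OF R.primeD(1)[OF q(1)]] .
  have "q \<subseteq> p"
  proof
    fix s assume s: "s \<in> q"
    have "s = (x [^]\<^bsub>R\<^esub> (0::nat)) \<otimes>\<^bsub>R\<^esub> s" using s qc by auto
    then have "s \<notin> p \<Longrightarrow> s \<in> S" unfolding S_def using s qc by (intro CollectI exI[of _ 0] exI[of _ s]) auto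
    then show "s \<in> p" using s q(3) by blast
  qed
  moreover have "x \<notin> q"
  proof -
    have "x = (x [^]\<^bsub>R\<^esub> (1::nat)) \<otimes>\<^bsub>R\<^esub> \<one>\<^bsub>R\<^esub>" using x by simp
    then have "x \<in> S" using pd(2) unfolding S_def by blast
    then show ?thesis using q(3) by blast
  qed
  ultimately have "q \<subset> p" using xp by blast
  then show ?thesis using q(1,2) y(1) unfolding supported_at_def by blast
qed

text \<open>
  A complex \<open>G\<close> with a subcomplex \<open>C L\<close> for each submodule \<open>L\<close> of \<open>N\<close>. The conditions on multiplication by \<open>x\<close>
  say that \<open>C\<close> takes \<open>T + xN\<close> to \<open>C T + xG\<close> and preserves regularity of \<open>x\<close>; the last condition is the
  vanishing of the cohomology of \<open>C T/C L\<close> in degrees \<open>\<ge> t\<close> for \<open>I\<close>-torsion modules \<open>T/L\<close>.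
\<close>

locale filtered_complex =
  fixes R :: "('a, 'r) ring_scheme" and I :: "'a set" and N :: "('a, 'n, 'l) module_scheme"
    and G :: "nat \<Rightarrow> ('a, 'g) module" and d :: "nat \<Rightarrow> 'g \<Rightarrow> 'g" and C :: "nat \<Rightarrow> 'n set \<Rightarrow> 'g set" and t :: nat
  assumes noeth: "noetherian_ring R" and I: "ideal I R" and N: "module R N" and G: "module R (G i)"
    and d_hom: "d i \<in> mod_hom R (G i) (G (Suc i))"
    and dd: "g \<in> carrier (G i) \<Longrightarrow> d (Suc i) (d i g) = \<zero>\<^bsub>G (Suc (Suc i))\<^esub>"
    and C_sub: "submodule L R N \<Longrightarrow> submodule (C i L) R (G i)"
    and C_mono: "L \<subseteq> L' \<Longrightarrow> C i L \<subseteq> C i L'"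
    and C_top: "C i (carrier N) = carrier (G i)"
    and d_C: "submodule L R N \<Longrightarrow> g \<in> C i L \<Longrightarrow> d i g \<in> C (Suc i) L"
    and C_smult: "x \<in> carrier R \<Longrightarrow> submodule T R N \<Longrightarrow> g \<in> carrier (G i) \<Longrightarrow>
      x \<odot>\<^bsub>G i\<^esub> g \<in> C i (T <+>\<^bsub>N\<^esub> (\<lambda>y. x \<odot>\<^bsub>N\<^esub> y) ` carrier N)"
    and C_sum: "x \<in> carrier R \<Longrightarrow> submodule T R N \<Longrightarrow> g \<in> C i (T <+>\<^bsub>N\<^esub> (\<lambda>y. x \<odot>\<^bsub>N\<^esub> y) ` carrier N) \<Longrightarrow>
      \<exists>g'\<in>carrier (G i). \<exists>c\<in>C i T. g = x \<odot>\<^bsub>G i\<^esub> g' \<oplus>\<^bsub>G i\<^esub> c"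
    and C_div: "x \<in> carrier R \<Longrightarrow> submodule T R N \<Longrightarrow>
      (\<And>y. y \<in> carrier N \<Longrightarrow> x \<odot>\<^bsub>N\<^esub> y \<in> T \<Longrightarrow> y \<in> T) \<Longrightarrow>
      g \<in> carrier (G i) \<Longrightarrow> x \<odot>\<^bsub>G i\<^esub> g \<in> C i T \<Longrightarrow> g \<in> C i T"
    and torsion_exact: "submodule L R N \<Longrightarrow> submodule T R N \<Longrightarrow> L \<subseteq> T \<Longrightarrow> T \<subseteq> saturation R I N L \<Longrightarrow> t \<le> i \<Longrightarrow>
      g \<in> C i T \<Longrightarrow> d i g \<in> C (Suc i) L \<Longrightarrow>
      g \<in> (case i of 0 \<Rightarrow> {\<zero>\<^bsub>G 0\<^esub>} | Suc k \<Rightarrow> d k ` C k T) <+>\<^bsub>G i\<^esub> C i L"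
begin

sublocale N: module R N by (rule N)

text \<open>The cocycles and coboundaries relative to \<open>L\<close>, whose quotient is the cohomology with coefficients in \<open>N/L\<close>.\<close>

definition cocycles :: "nat \<Rightarrow> 'n set \<Rightarrow> 'g set" where
  "cocycles i L = {g \<in> carrier (G i). d i g \<in> C (Suc i) L}"

definition d_image :: "nat \<Rightarrow> 'n set \<Rightarrow> 'g set" where
  "d_image i L = (case i of 0 \<Rightarrow> {\<zero>\<^bsub>G 0\<^esub>} | Suc k \<Rightarrow> d k ` C k L)"

definition coboundaries :: "nat \<Rightarrow> 'n set \<Rightarrow> 'g set" where
  "coboundaries i L = d_image i (carrier N) <+>\<^bsub>G i\<^esub> C i L"

lemma submodule_cocycles: "submodule L R N \<Longrightarrow> submodule (cocycles i L) R (G i)"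
  unfolding cocycles_def by (rule submodule_vimage[OF G G d_hom C_sub])

lemma submodule_d_image: "submodule L R N \<Longrightarrow> submodule (d_image i L) R (G i)"
  unfolding d_image_def
  by (cases i) (simp_all add: module.submodule_zero[OF G] submodule_image[OF G G d_hom C_sub])

lemma submodule_coboundaries: "submodule L R N \<Longrightarrow> submodule (coboundaries i L) R (G i)"
  unfolding coboundaries_def
  by (rule module.submodule_sum[OF G submodule_d_image[OF N.carrier_is_submodule] C_sub])

lemma d_image_closed: "submodule L R N \<Longrightarrow> b \<in> d_image i L \<Longrightarrow> b \<in> carrier (G i)"
  by (rule module.submoduleD(2)[OF G submodule_d_image])

lemma C_closed: "submodule L R N \<Longrightarrow> c \<in> C i L \<Longrightarrow> c \<in> carrier (G i)"
  by (rule module.submoduleD(2)[OF G C_sub])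

lemma d_image_mono: "L \<subseteq> L' \<Longrightarrow> d_image i L \<subseteq> d_image i L'"
  unfolding d_image_def using C_mono by (cases i) (simp_all add: image_mono)

lemma d_image_cycle:
  assumes "submodule L R N" "b \<in> d_image i L"
  shows "d i b = \<zero>\<^bsub>G (Suc i)\<^esub>"
  using assms(2) dd C_closed[OF assms(1)] mod_hom_zero[OF G G d_hom]
  by (cases i) (auto simp: d_image_def)

lemma coboundaries_ge:
  assumes "submodule L R N"
  shows "d_image i (carrier N) \<subseteq> coboundaries i L" "C i L \<subseteq> coboundaries i L"
  unfolding coboundaries_def
  using module.sum_ge[OF G submodule_d_image[OF N.carrier_is_submodule] C_sub[OF assms]] .

lemma d_add: "g \<in> carrier (G i) \<Longrightarrow> h \<in> carrier (G i) \<Longrightarrow> d i (g \<oplus>\<^bsub>G i\<^esub> h) = d i g \<oplus>\<^bsub>G (Suc i)\<^esub> d i h"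
  by (rule mod_hom_add[OF d_hom])

lemma d_smult: "r \<in> carrier R \<Longrightarrow> g \<in> carrier (G i) \<Longrightarrow> d i (r \<odot>\<^bsub>G i\<^esub> g) = r \<odot>\<^bsub>G (Suc i)\<^esub> d i g"
  by (rule mod_hom_smult[OF d_hom])

lemma d_closed: "g \<in> carrier (G i) \<Longrightarrow> d i g \<in> carrier (G (Suc i))"
  by (rule mod_hom_closed[OF d_hom])

lemma coboundaries_cocycles:
  assumes L: "submodule L R N"
  shows "coboundaries i L \<subseteq> cocycles i L"
  unfolding coboundaries_def
proof (rule module.sum_least[OF G submodule_cocycles[OF L]])
  show "d_image i (carrier N) \<subseteq> cocycles i L"
    using d_image_cycle[OF N.carrier_is_submodule] d_image_closed[OF N.carrier_is_submodule]
      module.submoduleD(3)[OF G C_sub[OF L]] by (auto simp: cocycles_def)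
  show "C i L \<subseteq> cocycles i L" using d_C[OF L] C_closed[OF L] by (auto simp: cocycles_def)
qed

lemma coboundaries_mono: "L \<subseteq> L' \<Longrightarrow> coboundaries i L \<subseteq> coboundaries i L'"
  unfolding coboundaries_def by (rule set_add_mono[OF order_refl C_mono])

lemma cocycles_mono: "L \<subseteq> L' \<Longrightarrow> cocycles i L \<subseteq> cocycles i L'"
  unfolding cocycles_def using C_mono by blast

text \<open>The implication that the induction proves, for the coefficient module \<open>N/L\<close>.\<close>

definition artinian_top_quotient :: "'n set \<Rightarrow> bool" where
  "artinian_top_quotient L \<longleftrightarrow>
    ((\<forall>j>t. dcc R (G j) (coboundaries j L) (cocycles j L)) \<longrightarrow>
      dcc R (G t) (coboundaries t L <+>\<^bsub>G t\<^esub> ideal_span R (G t) I (cocycles t L)) (cocycles t L))"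

abbreviation "IZ i L \<equiv> ideal_span R (G i) I (cocycles i L)"

lemma submodule_IZ: "submodule L R N \<Longrightarrow> submodule (IZ i L) R (G i)"
  by (rule module.submodule_ideal_span[OF G N.R.idealD(1)[OF I] module.submoduleD(1)[OF G submodule_cocycles]])

lemma IZ_cocycles:
  assumes L: "submodule L R N"
  shows "IZ i L \<subseteq> cocycles i L"
  unfolding ideal_span_le_iff[OF submodule_cocycles[OF L]]
  using module.submoduleD(5)[OF G submodule_cocycles[OF L]] N.R.idealD(1)[OF I] by auto

text \<open>
  As \<open>C T/C L\<close> is exact in degrees \<open>\<ge> t\<close>, the cohomology relative to \<open>L\<close> agrees with that relative to \<open>T\<close>.
  Surjectivity uses the exactness at \<open>d g\<close> for a cocycle \<open>g\<close> relative to \<open>T\<close>, and injectivity the exactness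
  at the part in \<open>C T\<close> of a coboundary.
\<close>

lemma modulo_torsion:
  assumes L: "submodule L R N" and T: "submodule T R N" and LT: "L \<subseteq> T" "T \<subseteq> saturation R I N L" and i: "t \<le> i"
  shows "cocycles i T = coboundaries i T <+>\<^bsub>G i\<^esub> cocycles i L"
    and "coboundaries i T \<inter> cocycles i L = coboundaries i L"
proof -
  interpret Gi: module R "G i" by (rule G)
  interpret G1: module R "G (Suc i)" by (rule G)
  note BT = submodule_coboundaries[OF T] and ZL = submodule_cocycles[OF L] and ZT = submodule_cocycles[OF T]
  have exact: "g \<in> d_image j T <+>\<^bsub>G j\<^esub> C j L" if "t \<le> j" "g \<in> C j T" "d j g \<in> C (Suc j) L" for j g
    using torsion_exact[OF L T LT that] by (simp add: d_image_def)
  show "cocycles i T = coboundaries i T <+>\<^bsub>G i\<^esub> cocycles i L"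
  proof
    show "coboundaries i T <+>\<^bsub>G i\<^esub> cocycles i L \<subseteq> cocycles i T"
      by (rule Gi.sum_least[OF ZT coboundaries_cocycles[OF T] cocycles_mono[OF LT(1)]])
    show "cocycles i T \<subseteq> coboundaries i T <+>\<^bsub>G i\<^esub> cocycles i L"
    proof
      fix g assume g: "g \<in> cocycles i T"
      then have gc: "g \<in> carrier (G i)" and dg: "d i g \<in> C (Suc i) T" by (auto simp: cocycles_def)
      have "d (Suc i) (d i g) \<in> C (Suc (Suc i)) L"
        using dd[OF gc] module.submoduleD(3)[OF G C_sub[OF L]] by simp
      then have "d i g \<in> d_image (Suc i) T <+>\<^bsub>G (Suc i)\<^esub> C (Suc i) L" using exact[of "Suc i"] dg i by simp
      then obtain b l where bl: "b \<in> d_image (Suc i) T" "l \<in> C (Suc i) L" "d i g = b \<oplus>\<^bsub>G (Suc i)\<^esub> l"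
        by (rule set_addE)
      then obtain u where u: "u \<in> C i T" "b = d i u" by (auto simp: d_image_def)
      have uc: "u \<in> carrier (G i)" and lc: "l \<in> carrier (G (Suc i))" using C_closed[OF T u(1)] C_closed[OF L bl(2)] .
      have "d i (g \<ominus>\<^bsub>G i\<^esub> u) = (d i u \<oplus>\<^bsub>G (Suc i)\<^esub> l) \<ominus>\<^bsub>G (Suc i)\<^esub> d i u"
        using mod_hom_diff[OF G G d_hom gc uc] bl(3) u(2) by simp
      also have "\<dots> = l" using d_closed[OF uc] lc
        by (simp add: a_minus_def G1.M.a_comm[of "d i u" l] G1.M.a_assoc G1.M.r_neg)
      finally have "g \<ominus>\<^bsub>G i\<^esub> u \<in> cocycles i L" using bl(2) gc uc by (simp add: cocycles_def)
      moreover have "g = u \<oplus>\<^bsub>G i\<^esub> (g \<ominus>\<^bsub>G i\<^esub> u)"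
        using gc uc by (simp add: a_minus_def Gi.M.a_comm[of g] Gi.M.r_neg2)
      ultimately show "g \<in> coboundaries i T <+>\<^bsub>G i\<^esub> cocycles i L"
        using set_addI[of u "coboundaries i T" "g \<ominus>\<^bsub>G i\<^esub> u" "cocycles i L" "G i"] coboundaries_ge(2)[OF T] u(1) by auto
    qed
  qed
  show "coboundaries i T \<inter> cocycles i L = coboundaries i L"
  proof
    show "coboundaries i L \<subseteq> coboundaries i T \<inter> cocycles i L"
      using coboundaries_mono[OF LT(1)] coboundaries_cocycles[OF L] by blast
    show "coboundaries i T \<inter> cocycles i L \<subseteq> coboundaries i L"
    proof
      fix g assume g: "g \<in> coboundaries i T \<inter> cocycles i L"
      then obtain b c where bc: "b \<in> d_image i (carrier N)" "c \<in> C i T" "g = b \<oplus>\<^bsub>G i\<^esub> c"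
        unfolding coboundaries_def by (auto elim: set_addE)
      have bcl: "b \<in> carrier (G i)" and cc: "c \<in> carrier (G i)"
        using d_image_closed[OF N.carrier_is_submodule bc(1)] C_closed[OF T bc(2)] .
      have "d i g = d i c"
        using bc(3) d_add[OF bcl cc] d_image_cycle[OF N.carrier_is_submodule bc(1)] d_closed[OF cc] by simp
      then have "d i c \<in> C (Suc i) L" using g by (simp add: cocycles_def)
      from exact[OF i bc(2) this] obtain b' l where bl: "b' \<in> d_image i T" "l \<in> C i L" "c = b' \<oplus>\<^bsub>G i\<^esub> l"
        by (rule set_addE)
      have b': "b' \<in> d_image i (carrier N)" using bl(1) d_image_mono[OF N.submoduleD(1)[OF T]] by blast
      have "g = (b \<oplus>\<^bsub>G i\<^esub> b') \<oplus>\<^bsub>G i\<^esub> l"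
        unfolding bc(3) bl(3) using bcl d_image_closed[OF T bl(1)] C_closed[OF L bl(2)] by (simp add: Gi.M.a_assoc)
      then show "g \<in> coboundaries i L"
        unfolding coboundaries_def
        using set_addI[OF Gi.submoduleD(4)[OF submodule_d_image[OF N.carrier_is_submodule] bc(1) b'] bl(2)] by simp
    qed
  qed
qed

lemma artinian_top_quotient_modulo_torsion:
  assumes L: "submodule L R N" and T: "submodule T R N" and LT: "L \<subseteq> T" "T \<subseteq> saturation R I N L"
    and "artinian_top_quotient T"
  shows "artinian_top_quotient L"
  unfolding artinian_top_quotient_def
proof
  interpret Gt: module R "G t" by (rule G)
  note iso = modulo_torsion[OF L T LT]
  assume dL: "\<forall>j>t. dcc R (G j) (coboundaries j L) (cocycles j L)"
  have "dcc R (G j) (coboundaries j T) (cocycles j T)" if "j > t" for j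
    using module.dcc_second_iso1[OF G submodule_coboundaries[OF T] submodule_cocycles[OF L], of j] dL that
      iso[of j] by simp
  then have dT: "dcc R (G t) (coboundaries t T <+>\<^bsub>G t\<^esub> IZ t T) (cocycles t T)"
    using assms(5) by (simp add: artinian_top_quotient_def)
  note BT = submodule_coboundaries[OF T, of t] and BL = submodule_coboundaries[OF L, of t]
    and ZL = submodule_cocycles[OF L, of t] and ZT = submodule_cocycles[OF T, of t]
    and IL = submodule_IZ[OF L, of t] and IT = submodule_IZ[OF T, of t]
  let ?W = "coboundaries t T <+>\<^bsub>G t\<^esub> IZ t L"
  have W: "submodule ?W R (G t)" using Gt.submodule_sum[OF BT IL] .
  have "IZ t T \<subseteq> ?W"
    unfolding ideal_span_le_iff[OF W]
  proof (intro ballI)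
    fix r z assume r: "r \<in> I" and "z \<in> cocycles t T"
    then obtain b y where bs: "b \<in> coboundaries t T" "y \<in> cocycles t L" "z = b \<oplus>\<^bsub>G t\<^esub> y"
      unfolding iso(1)[OF order_refl] by (auto elim: set_addE)
    have rc: "r \<in> carrier R" using r N.R.idealD(1)[OF I] by blast
    have "r \<odot>\<^bsub>G t\<^esub> z = r \<odot>\<^bsub>G t\<^esub> b \<oplus>\<^bsub>G t\<^esub> r \<odot>\<^bsub>G t\<^esub> y"
      using bs Gt.smult_r_distr[OF rc Gt.submoduleD(2)[OF BT] Gt.submoduleD(2)[OF ZL]] by simp
    then show "r \<odot>\<^bsub>G t\<^esub> z \<in> ?W"
      using set_addI[OF Gt.submoduleD(5)[OF BT rc bs(1)] ideal_span_mem[OF r bs(2)]] by simp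
  qed
  then have "coboundaries t T <+>\<^bsub>G t\<^esub> IZ t T \<subseteq> ?W"
    using Gt.sum_least[OF W Gt.sum_ge(1)[OF BT IL]] by simp
  moreover have "?W <+>\<^bsub>G t\<^esub> cocycles t L \<subseteq> cocycles t T"
    using Gt.sum_least[OF ZT Gt.sum_least[OF ZT coboundaries_cocycles[OF T]] cocycles_mono[OF LT(1)]]
      IZ_cocycles[OF L, of t] cocycles_mono[OF LT(1), of t] by simp
  ultimately have "dcc R (G t) ?W (?W <+>\<^bsub>G t\<^esub> cocycles t L)" using dcc_subinterval[OF dT] by blast
  then have "dcc R (G t) (?W \<inter> cocycles t L) (cocycles t L)" by (rule Gt.dcc_second_iso2[OF W ZL])
  moreover have "?W \<inter> cocycles t L \<subseteq> coboundaries t L <+>\<^bsub>G t\<^esub> IZ t L"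
  proof
    fix w assume w: "w \<in> ?W \<inter> cocycles t L"
    then obtain b s where bs: "b \<in> coboundaries t T" "s \<in> IZ t L" "w = b \<oplus>\<^bsub>G t\<^esub> s" by (auto elim: set_addE)
    have sZ: "s \<in> cocycles t L" using bs(2) IZ_cocycles[OF L] by blast
    have "s \<oplus>\<^bsub>G t\<^esub> b \<in> cocycles t L"
      using w bs(3) Gt.M.a_comm[OF Gt.submoduleD(2)[OF BT bs(1)] Gt.submoduleD(2)[OF ZL sZ]] by simp
    then have "b \<in> cocycles t L" using Gt.submodule_add_cancel[OF ZL sZ Gt.submoduleD(2)[OF BT bs(1)]] by blast
    then have "b \<in> coboundaries t L" using bs(1) iso(2)[OF order_refl] by blast
    then show "w \<in> coboundaries t L <+>\<^bsub>G t\<^esub> IZ t L" using bs(2,3) set_addI by simp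
  qed
  ultimately show "dcc R (G t) (coboundaries t L <+>\<^bsub>G t\<^esub> IZ t L) (cocycles t L)"
    using dcc_subinterval by blast
qed

context
  fixes T x
  assumes T: "submodule T R N" and x: "x \<in> carrier R"
    and reg: "\<And>y. y \<in> carrier N \<Longrightarrow> x \<odot>\<^bsub>N\<^esub> y \<in> T \<Longrightarrow> y \<in> T"
begin

abbreviation "TX \<equiv> T <+>\<^bsub>N\<^esub> (\<lambda>y. x \<odot>\<^bsub>N\<^esub> y) ` carrier N"

lemma submodule_TX: "submodule TX R N"
  by (rule N.submodule_sum[OF T N.submodule_smult_image[OF x N.carrier_is_submodule]])

lemma T_le_TX: "T \<subseteq> TX"
  by (rule N.sum_ge(1)[OF T N.submodule_smult_image[OF x N.carrier_is_submodule]])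

lemma regular_cocycle:
  assumes "g \<in> carrier (G i)" "x \<odot>\<^bsub>G (Suc i)\<^esub> d i g \<in> C (Suc i) T"
  shows "g \<in> cocycles i T"
  using C_div[OF x T reg d_closed[OF assms(1)] assms(2)] assms(1) by (simp add: cocycles_def)

text \<open>
  The connecting homomorphism of multiplication by \<open>x\<close> on \<open>N/T\<close> relates a cocycle \<open>g\<close> modulo
  \<open>T + xN\<close> to every \<open>g'\<close> with \<open>d g \<in> x g' + C T\<close>. Its kernel consists of the cocycles that lift.
\<close>

lemma dcc_cokernel_of_lift:
  assumes "dcc R (G (Suc i)) (coboundaries (Suc i) T) (cocycles (Suc i) T)"
  shows "dcc R (G i) (coboundaries i TX <+>\<^bsub>G i\<^esub> cocycles i T) (cocycles i TX)"
proof -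
  interpret Gi: module R "G i" by (rule G)
  interpret G1: module R "G (Suc i)" by (rule G)
  let ?B1 = "coboundaries (Suc i) T" and ?Z1 = "cocycles (Suc i) T"
  have B1: "submodule ?B1 R (G (Suc i))" using submodule_coboundaries[OF T] .
  have Z1: "submodule ?Z1 R (G (Suc i))" using submodule_cocycles[OF T] .
  have CT: "submodule (C (Suc i) T) R (G (Suc i))" using C_sub[OF T] .
  note ct = G1.submoduleD[OF CT]
  have BX: "submodule (coboundaries i TX) R (G i)" using submodule_coboundaries[OF submodule_TX] .
  have ZT: "submodule (cocycles i T) R (G i)" using submodule_cocycles[OF T] .
  define D where "D S = {g' \<in> carrier (G (Suc i)). \<exists>g\<in>S. \<exists>c\<in>C (Suc i) T. d i g = x \<odot>\<^bsub>G (Suc i)\<^esub> g' \<oplus>\<^bsub>G (Suc i)\<^esub> c}" for S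
  have D: "submodule (D S) R (G (Suc i))" if S: "submodule S R (G i)" for S
    unfolding G1.submodule_iff
  proof (intro conjI ballI)
    note s = Gi.submoduleD[OF S]
    have "d i \<zero>\<^bsub>G i\<^esub> = x \<odot>\<^bsub>G (Suc i)\<^esub> \<zero>\<^bsub>G (Suc i)\<^esub> \<oplus>\<^bsub>G (Suc i)\<^esub> \<zero>\<^bsub>G (Suc i)\<^esub>"
      using mod_hom_zero[OF G G d_hom] x by simp
    then show "\<zero>\<^bsub>G (Suc i)\<^esub> \<in> D S" unfolding D_def using s(3) ct(3) by blast
    show "D S \<subseteq> carrier (G (Suc i))" by (auto simp: D_def)
    fix g' assume "g' \<in> D S"
    then obtain g c where g: "g' \<in> carrier (G (Suc i))" "g \<in> S" "c \<in> C (Suc i) T" "d i g = x \<odot>\<^bsub>G (Suc i)\<^esub> g' \<oplus>\<^bsub>G (Suc i)\<^esub> c"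
      by (auto simp: D_def)
    show "r \<odot>\<^bsub>G (Suc i)\<^esub> g' \<in> D S" if r: "r \<in> carrier R" for r
    proof -
      have "d i (r \<odot>\<^bsub>G i\<^esub> g) = x \<odot>\<^bsub>G (Suc i)\<^esub> (r \<odot>\<^bsub>G (Suc i)\<^esub> g') \<oplus>\<^bsub>G (Suc i)\<^esub> r \<odot>\<^bsub>G (Suc i)\<^esub> c"
        unfolding d_smult[OF r s(2)[OF g(2)]] g(4) using r x g(1) ct(2)[OF g(3)]
        by (simp add: G1.smult_r_distr G1.smult_swap[OF r x])
      then show ?thesis unfolding D_def using s(5)[OF r g(2)] ct(5)[OF r g(3)] r g(1) by blast
    qed
    fix h' assume "h' \<in> D S"
    then obtain h e where h: "h' \<in> carrier (G (Suc i))" "h \<in> S" "e \<in> C (Suc i) T" "d i h = x \<odot>\<^bsub>G (Suc i)\<^esub> h' \<oplus>\<^bsub>G (Suc i)\<^esub> e"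
      by (auto simp: D_def)
    have "d i (g \<oplus>\<^bsub>G i\<^esub> h) = x \<odot>\<^bsub>G (Suc i)\<^esub> (g' \<oplus>\<^bsub>G (Suc i)\<^esub> h') \<oplus>\<^bsub>G (Suc i)\<^esub> (c \<oplus>\<^bsub>G (Suc i)\<^esub> e)"
      unfolding d_add[OF s(2)[OF g(2)] s(2)[OF h(2)]] g(4) h(4) using x g(1) h(1) ct(2)[OF g(3)] ct(2)[OF h(3)]
      by (simp add: G1.smult_r_distr G1.add_swap4)
    then show "g' \<oplus>\<^bsub>G (Suc i)\<^esub> h' \<in> D S"
      unfolding D_def using s(4)[OF g(2) h(2)] ct(4)[OF g(3) h(3)] g(1) h(1) by blast
  qed
  have DZ: "D S \<subseteq> ?Z1" if S: "S \<subseteq> carrier (G i)" for S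
  proof
    fix g' assume "g' \<in> D S"
    then obtain g c where g: "g' \<in> carrier (G (Suc i))" "g \<in> S" "c \<in> C (Suc i) T" "d i g = x \<odot>\<^bsub>G (Suc i)\<^esub> g' \<oplus>\<^bsub>G (Suc i)\<^esub> c"
      by (auto simp: D_def)
    interpret G2: module R "G (Suc (Suc i))" by (rule G)
    have gc: "g \<in> carrier (G i)" using S g(2) by blast
    have dc: "d (Suc i) c \<in> C (Suc (Suc i)) T" using d_C[OF T g(3)] .
    have xd: "x \<odot>\<^bsub>G (Suc (Suc i))\<^esub> d (Suc i) g' \<in> carrier (G (Suc (Suc i)))" using x d_closed[OF g(1)] by simp
    have "d (Suc i) (x \<odot>\<^bsub>G (Suc i)\<^esub> g' \<oplus>\<^bsub>G (Suc i)\<^esub> c) = x \<odot>\<^bsub>G (Suc (Suc i))\<^esub> d (Suc i) g' \<oplus>\<^bsub>G (Suc (Suc i))\<^esub> d (Suc i) c"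
      using d_add[of "x \<odot>\<^bsub>G (Suc i)\<^esub> g'" "Suc i" c] d_smult[OF x g(1)] x g(1) ct(2)[OF g(3)] by simp
    then have "d (Suc i) c \<oplus>\<^bsub>G (Suc (Suc i))\<^esub> x \<odot>\<^bsub>G (Suc (Suc i))\<^esub> d (Suc i) g' = \<zero>\<^bsub>G (Suc (Suc i))\<^esub>"
      using dd[OF gc] g(4) G2.M.a_comm[OF d_closed[OF ct(2)[OF g(3)]] xd] by simp
    then have "x \<odot>\<^bsub>G (Suc (Suc i))\<^esub> d (Suc i) g' \<in> C (Suc (Suc i)) T"
      using G2.submodule_add_cancel[OF C_sub[OF T] dc xd] G2.submoduleD(3)[OF C_sub[OF T]] by simp
    then show "g' \<in> ?Z1" by (rule regular_cocycle[OF g(1)])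
  qed
  show ?thesis
  proof (rule dcc_transfer[OF assms, of _ _ _ _ "\<lambda>S. ?B1 <+>\<^bsub>G (Suc i)\<^esub> D S"])
    fix S assume S: "submodule S R (G i)"
    show "submodule (?B1 <+>\<^bsub>G (Suc i)\<^esub> D S) R (G (Suc i)) \<and> ?B1 \<subseteq> ?B1 <+>\<^bsub>G (Suc i)\<^esub> D S \<and>
        ?B1 <+>\<^bsub>G (Suc i)\<^esub> D S \<subseteq> ?Z1"
      using G1.submodule_sum[OF B1 D[OF S]] G1.sum_ge(1)[OF B1 D[OF S]]
        G1.sum_least[OF Z1 coboundaries_cocycles[OF T] DZ[OF Gi.submoduleD(1)[OF S]]] by simp
  next
    fix S S' :: "'g set" assume "S \<subseteq> S'"
    then have "D S \<subseteq> D S'" unfolding D_def by blast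
    then show "?B1 <+>\<^bsub>G (Suc i)\<^esub> D S \<subseteq> ?B1 <+>\<^bsub>G (Suc i)\<^esub> D S'" by (rule set_add_mono[OF order_refl])
  next
    fix S S' assume S: "submodule S R (G i)" "coboundaries i TX <+>\<^bsub>G i\<^esub> cocycles i T \<subseteq> S" "S' \<subseteq> cocycles i TX"
      "submodule S' R (G i)" "S \<subseteq> S'" and eq: "?B1 <+>\<^bsub>G (Suc i)\<^esub> D S = ?B1 <+>\<^bsub>G (Suc i)\<^esub> D S'"
    note s = Gi.submoduleD[OF S(1)]
    have BS: "coboundaries i TX \<subseteq> S" "cocycles i T \<subseteq> S" using Gi.sum_ge[OF BX ZT] S(2) by auto
    show "S' \<subseteq> S"
    proof
      fix g assume g: "g \<in> S'"
      then have gc: "g \<in> carrier (G i)" and "d i g \<in> C (Suc i) TX" using S(3) by (auto simp: cocycles_def)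
      from C_sum[OF x T this(2)] obtain g' c where g': "g' \<in> carrier (G (Suc i))" "c \<in> C (Suc i) T"
        "d i g = x \<odot>\<^bsub>G (Suc i)\<^esub> g' \<oplus>\<^bsub>G (Suc i)\<^esub> c" by blast
      then have "g' \<in> D S'" using g unfolding D_def by blast
      then have "g' \<in> ?B1 <+>\<^bsub>G (Suc i)\<^esub> D S" unfolding eq using G1.sum_ge(2)[OF B1 D[OF S(4)]] by blast
      then obtain b h' where b: "b \<in> ?B1" "h' \<in> D S" "g' = b \<oplus>\<^bsub>G (Suc i)\<^esub> h'" by (rule set_addE)
      obtain h e where h: "h' \<in> carrier (G (Suc i))" "h \<in> S" "e \<in> C (Suc i) T" "d i h = x \<odot>\<^bsub>G (Suc i)\<^esub> h' \<oplus>\<^bsub>G (Suc i)\<^esub> e"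
        using b(2) by (auto simp: D_def)
      obtain b0 f where b0: "b0 \<in> d_image (Suc i) (carrier N)" "f \<in> C (Suc i) T" "b = b0 \<oplus>\<^bsub>G (Suc i)\<^esub> f"
        using b(1) unfolding coboundaries_def by (rule set_addE)
      obtain w where w: "w \<in> carrier (G i)" "b0 = d i w" using b0(1) by (auto simp: d_image_def C_top)
      have hc: "h \<in> carrier (G i)" using s(2)[OF h(2)] .
      let ?k = "h \<oplus>\<^bsub>G i\<^esub> x \<odot>\<^bsub>G i\<^esub> w"
      have kc: "?k \<in> carrier (G i)" using hc x w(1) by simp
      note cc = ct(2)[OF g'(2)] ct(2)[OF h(3)] ct(2)[OF b0(2)] d_closed[OF w(1)] h(1)
      have kS: "?k \<in> S"
        using s(4)[OF h(2)] BS(1) coboundaries_ge(2)[OF submodule_TX] C_smult[OF x T w(1)] by blast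
      let ?r = "(c \<oplus>\<^bsub>G (Suc i)\<^esub> x \<odot>\<^bsub>G (Suc i)\<^esub> f) \<ominus>\<^bsub>G (Suc i)\<^esub> e"
      have r: "?r \<in> C (Suc i) T" using ct(7)[OF ct(4)[OF g'(2) ct(5)[OF x b0(2)]] h(3)] .
      have "d i g = d i ?k \<oplus>\<^bsub>G (Suc i)\<^esub> ?r"
      proof -
        have "d i ?k = (x \<odot>\<^bsub>G (Suc i)\<^esub> h' \<oplus>\<^bsub>G (Suc i)\<^esub> e) \<oplus>\<^bsub>G (Suc i)\<^esub> x \<odot>\<^bsub>G (Suc i)\<^esub> d i w"
          using d_add[OF hc, of "x \<odot>\<^bsub>G i\<^esub> w"] d_smult[OF x w(1)] h(4) x w(1) by simp
        moreover have "d i g = ((x \<odot>\<^bsub>G (Suc i)\<^esub> d i w \<oplus>\<^bsub>G (Suc i)\<^esub> x \<odot>\<^bsub>G (Suc i)\<^esub> f) \<oplus>\<^bsub>G (Suc i)\<^esub> x \<odot>\<^bsub>G (Suc i)\<^esub> h') \<oplus>\<^bsub>G (Suc i)\<^esub> c"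
          unfolding g'(3) b(3) b0(3) w(2) using x cc by (simp add: G1.smult_r_distr)
        ultimately show ?thesis
          using x cc by (simp add: a_minus_def G1.M.a_ac G1.M.r_neg2 G1.M.r_neg1 G1.M.r_neg)
      qed
      then have "d i (g \<ominus>\<^bsub>G i\<^esub> ?k) = (?r \<oplus>\<^bsub>G (Suc i)\<^esub> d i ?k) \<ominus>\<^bsub>G (Suc i)\<^esub> d i ?k"
        using mod_hom_diff[OF G G d_hom gc kc] G1.M.a_comm[OF d_closed[OF kc] ct(2)[OF r]] by simp
      also have "\<dots> = ?r"
        using ct(2)[OF r] d_closed[OF kc] unfolding a_minus_def[of _ "?r \<oplus>\<^bsub>G (Suc i)\<^esub> d i ?k"]
        by (simp add: G1.M.a_assoc G1.M.r_neg)
      finally have "g \<ominus>\<^bsub>G i\<^esub> ?k \<in> cocycles i T" using r gc kc by (simp add: cocycles_def)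
      then have "?k \<oplus>\<^bsub>G i\<^esub> (g \<ominus>\<^bsub>G i\<^esub> ?k) \<in> S" using BS(2) s(4)[OF kS] by blast
      moreover have "?k \<oplus>\<^bsub>G i\<^esub> (g \<ominus>\<^bsub>G i\<^esub> ?k) = g"
        unfolding a_minus_def using gc kc Gi.M.a_comm[OF gc Gi.M.a_inv_closed[OF kc]] Gi.M.r_neg2[OF kc gc] by simp
      ultimately show "g \<in> S" by simp
    qed
  qed
qed

text \<open>
  The connecting homomorphism embeds the cokernel of \<open>H\<^sup>j(N/T) \<rightarrow> H\<^sup>j(N/(T + xN))\<close> in
  \<open>H\<^sup>j\<^sup>+\<^sup>1(N/T)\<close>. For \<open>j > t\<close> this makes \<open>H\<^sup>j(N/(T + xN))\<close> Artinian. For \<open>j = t\<close> the filtration of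
  \<open>dcc_smult_finite\<close> applies to the cokernel; it leads from the conclusion for \<open>T + xN\<close> to the chain condition
  above \<open>W = d G + C (T + xN) + I Z\<close>, with \<open>Z\<close> the cocycles relative to \<open>T\<close>. Finally \<open>W \<inter> Z\<close> is
  \<open>d G + C T + I Z\<close>, since the kernel of \<open>H\<^sup>t(N/T) \<rightarrow> H\<^sup>t(N/(T + xN))\<close> is \<open>x H\<^sup>t(N/T)\<close> and \<open>x \<in> I\<close>.
\<close>

lemma artinian_top_quotient_regular:
  assumes xI: "x \<in> I" and "artinian_top_quotient TX"
  shows "artinian_top_quotient T"
  unfolding artinian_top_quotient_def
proof
  interpret Gt: module R "G t" by (rule G)
  assume dT: "\<forall>j>t. dcc R (G j) (coboundaries j T) (cocycles j T)"
  have BX: "submodule (coboundaries j TX) R (G j)" and ZX: "submodule (cocycles j TX) R (G j)"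
    and ZT: "submodule (cocycles j T) R (G j)" and BT: "submodule (coboundaries j T) R (G j)" for j
    using submodule_coboundaries submodule_cocycles submodule_TX T by simp_all
  have U: "submodule (coboundaries j TX <+>\<^bsub>G j\<^esub> cocycles j T) R (G j)" for j
    using module.submodule_sum[OF G BX ZT] .
  have UX: "coboundaries j TX <+>\<^bsub>G j\<^esub> cocycles j T \<subseteq> cocycles j TX" for j
    by (rule module.sum_least[OF G ZX coboundaries_cocycles[OF submodule_TX] cocycles_mono[OF T_le_TX]])
  have "dcc R (G j) (coboundaries j TX) (cocycles j TX)" if j: "j > t" for j
  proof (rule module.dcc_trans[OF G U module.sum_ge(1)[OF G BX ZT] UX _ _ ZX])
    have "coboundaries j T \<subseteq> coboundaries j TX \<inter> cocycles j T"
      using coboundaries_mono[OF T_le_TX] coboundaries_cocycles[OF T] by simp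
    then have "dcc R (G j) (coboundaries j TX \<inter> cocycles j T) (cocycles j T)"
      using dcc_subinterval[OF _ _ order_refl] dT j by blast
    then show "dcc R (G j) (coboundaries j TX) (coboundaries j TX <+>\<^bsub>G j\<^esub> cocycles j T)"
      by (rule module.dcc_second_iso1[OF G BX ZT])
    show "dcc R (G j) (coboundaries j TX <+>\<^bsub>G j\<^esub> cocycles j T) (cocycles j TX)"
      by (rule dcc_cokernel_of_lift) (use dT j in simp)
  qed
  then have dX: "dcc R (G t) (coboundaries t TX <+>\<^bsub>G t\<^esub> IZ t TX) (cocycles t TX)"
    using assms(2) by (simp add: artinian_top_quotient_def)
  have dU: "dcc R (G t) (coboundaries t TX <+>\<^bsub>G t\<^esub> cocycles t T) (cocycles t TX)"
    by (rule dcc_cokernel_of_lift) (use dT in simp)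
  note IT = submodule_IZ[OF T, of t] and IX = submodule_IZ[OF submodule_TX, of t]
  let ?W = "coboundaries t TX <+>\<^bsub>G t\<^esub> IZ t T" and ?V = "coboundaries t TX <+>\<^bsub>G t\<^esub> IZ t TX"
  have W: "submodule ?W R (G t)" and V: "submodule ?V R (G t)"
    using Gt.submodule_sum[OF BX IT] Gt.submodule_sum[OF BX IX] .
  obtain A where A: "A \<subseteq> carrier R" "finite A" "I = Idl\<^bsub>R\<^esub> A"
    using noetherian_ring.finetely_gen[OF noeth I] by blast
  have AI: "A \<subseteq> I" using A N.R.genideal_self by blast
  have AU: "a \<odot>\<^bsub>G t\<^esub> u \<in> ?W" if a: "a \<in> A" and u: "u \<in> coboundaries t TX <+>\<^bsub>G t\<^esub> cocycles t T" for a u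
  proof -
    obtain b z where bz: "b \<in> coboundaries t TX" "z \<in> cocycles t T" "u = b \<oplus>\<^bsub>G t\<^esub> z" using u by (rule set_addE)
    have ac: "a \<in> carrier R" "a \<in> I" using a A(1) AI by auto
    have "a \<odot>\<^bsub>G t\<^esub> u = a \<odot>\<^bsub>G t\<^esub> b \<oplus>\<^bsub>G t\<^esub> a \<odot>\<^bsub>G t\<^esub> z"
      unfolding bz(3) by (rule Gt.smult_r_distr[OF ac(1) Gt.submoduleD(2)[OF BX bz(1)] Gt.submoduleD(2)[OF ZT bz(2)]])
    then show ?thesis
      using set_addI[OF Gt.submoduleD(5)[OF BX ac(1) bz(1)] ideal_span_mem[OF ac(2) bz(2)]] by simp
  qed
  obtain W' where W': "submodule W' R (G t)" "?W \<subseteq> W'" "\<forall>a\<in>A. \<forall>b\<in>cocycles t TX. a \<odot>\<^bsub>G t\<^esub> b \<in> W'" "dcc R (G t) ?W W'"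
    using Gt.dcc_smult_finite[OF A(2,1) U ZX UX dU W AU] by blast
  have "IZ t TX \<subseteq> W'"
    unfolding ideal_span_le_iff[OF W'(1)]
  proof (intro ballI)
    fix r b assume r: "r \<in> I" and b: "b \<in> cocycles t TX"
    have "ideal (colon R (G t) W' b) R" by (rule Gt.ideal_colon[OF W'(1) Gt.submoduleD(2)[OF ZX b]])
    moreover have "A \<subseteq> colon R (G t) W' b" using W'(3) b A(1) by (auto simp: colon_def)
    ultimately have "I \<subseteq> colon R (G t) W' b" using N.R.genideal_minimal A(3) by simp
    then show "r \<odot>\<^bsub>G t\<^esub> b \<in> W'" using r by (auto simp: colon_def)
  qed
  then have VW': "?V \<subseteq> W'"
    using Gt.sum_least[OF W'(1)] Gt.sum_ge(1)[OF BX IT] W'(2) by (meson subset_trans)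
  have WV: "?W \<subseteq> ?V"
  proof (rule set_add_mono[OF order_refl])
    show "IZ t T \<subseteq> IZ t TX"
      by (rule Gt.ideal_span_mono[OF order_refl cocycles_mono[OF T_le_TX] N.R.idealD(1)[OF I] Gt.submoduleD(1)[OF ZX]])
  qed
  have VZ: "?V \<subseteq> cocycles t TX"
    by (rule Gt.sum_least[OF ZX coboundaries_cocycles[OF submodule_TX] IZ_cocycles[OF submodule_TX]])
  have "dcc R (G t) ?W (cocycles t TX)"
    by (rule Gt.dcc_trans[OF V WV VZ dcc_subinterval[OF W'(4) order_refl VW'] dX ZX])
  moreover have "?W <+>\<^bsub>G t\<^esub> cocycles t T \<subseteq> cocycles t TX"
    by (rule Gt.sum_least[OF ZX order_trans[OF WV VZ] cocycles_mono[OF T_le_TX]])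
  ultimately have "dcc R (G t) ?W (?W <+>\<^bsub>G t\<^esub> cocycles t T)" by (rule dcc_subinterval[OF _ order_refl])
  then have "dcc R (G t) (?W \<inter> cocycles t T) (cocycles t T)" by (rule Gt.dcc_second_iso2[OF W ZT])
  moreover have "?W \<inter> cocycles t T \<subseteq> coboundaries t T <+>\<^bsub>G t\<^esub> IZ t T"
  proof
    interpret G1: module R "G (Suc t)" by (rule G)
    fix w assume w: "w \<in> ?W \<inter> cocycles t T"
    then obtain b s where bs: "b \<in> coboundaries t TX" "s \<in> IZ t T" "w = b \<oplus>\<^bsub>G t\<^esub> s" by (auto elim: set_addE)
    have sZ: "s \<in> cocycles t T" using bs(2) IZ_cocycles[OF T] by blast
    have sc: "s \<in> carrier (G t)" and bc: "b \<in> carrier (G t)"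
      using Gt.submoduleD(2)[OF ZT sZ] Gt.submoduleD(2)[OF BX bs(1)] .
    have "s \<oplus>\<^bsub>G t\<^esub> b \<in> cocycles t T" using w bs(3) Gt.M.a_comm[OF bc sc] by simp
    then have bZ: "b \<in> cocycles t T" using Gt.submodule_add_cancel[OF ZT sZ bc] by blast
    obtain b0 c where b0: "b0 \<in> d_image t (carrier N)" "c \<in> C t TX" "b = b0 \<oplus>\<^bsub>G t\<^esub> c"
      using bs(1) unfolding coboundaries_def by (rule set_addE)
    obtain g e where g: "g \<in> carrier (G t)" "e \<in> C t T" "c = x \<odot>\<^bsub>G t\<^esub> g \<oplus>\<^bsub>G t\<^esub> e" using C_sum[OF x T b0(2)] by blast
    have cl: "b0 \<in> carrier (G t)" "e \<in> carrier (G t)" "x \<odot>\<^bsub>G t\<^esub> g \<in> carrier (G t)"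
      using d_image_closed[OF N.carrier_is_submodule b0(1)] C_closed[OF T g(2)] x g(1) by auto
    have beq: "b = (b0 \<oplus>\<^bsub>G t\<^esub> e) \<oplus>\<^bsub>G t\<^esub> x \<odot>\<^bsub>G t\<^esub> g"
      unfolding b0(3) g(3) using cl by (simp add: Gt.M.a_ac)
    have bT: "b0 \<oplus>\<^bsub>G t\<^esub> e \<in> coboundaries t T" unfolding coboundaries_def by (rule set_addI[OF b0(1) g(2)])
    then have "b0 \<oplus>\<^bsub>G t\<^esub> e \<in> cocycles t T" using coboundaries_cocycles[OF T] by blast
    then have "x \<odot>\<^bsub>G t\<^esub> g \<in> cocycles t T" using Gt.submodule_add_cancel[OF ZT _ cl(3)] bZ beq by simp
    then have "x \<odot>\<^bsub>G (Suc t)\<^esub> d t g \<in> C (Suc t) T" using d_smult[OF x g(1)] by (simp add: cocycles_def)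
    then have "g \<in> cocycles t T" by (rule regular_cocycle[OF g(1)])
    then have "x \<odot>\<^bsub>G t\<^esub> g \<in> IZ t T" by (rule ideal_span_mem[OF xI])
    then have "x \<odot>\<^bsub>G t\<^esub> g \<oplus>\<^bsub>G t\<^esub> s \<in> IZ t T" using Gt.submoduleD(4)[OF IT] bs(2) by blast
    moreover have "w = (b0 \<oplus>\<^bsub>G t\<^esub> e) \<oplus>\<^bsub>G t\<^esub> (x \<odot>\<^bsub>G t\<^esub> g \<oplus>\<^bsub>G t\<^esub> s)"
      unfolding bs(3) beq using cl sc by (simp add: Gt.M.a_assoc)
    ultimately show "w \<in> coboundaries t T <+>\<^bsub>G t\<^esub> IZ t T" using set_addI[OF bT] by simp
  qed
  ultimately show "dcc R (G t) (coboundaries t T <+>\<^bsub>G t\<^esub> IZ t T) (cocycles t T)"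
    by (rule dcc_subinterval[OF _ _ order_refl])
qed

end

text \<open>
  Induction on the bound \<open>n\<close> for the length of chains of primes in the support. For \<open>n = 0\<close> the support
  is empty and \<open>N/L = 0\<close>.
\<close>

theorem artinian_top_quotient_of_finite_dimension:
  assumes fin: "\<And>L. submodule L R N \<Longrightarrow> finite (Ass R (quot_module R N L))"
    and "submodule L R N" "\<not> prime_chain R N L n"
  shows "artinian_top_quotient L"
  using assms(2,3)
proof (induction n arbitrary: L)
  case 0
  then have L: "L = carrier N" using N.no_support_imp_top[OF noeth] by blast
  have "cocycles t L \<subseteq> coboundaries t L <+>\<^bsub>G t\<^esub> IZ t L"
    using module.sum_ge(1)[OF G submodule_coboundaries[OF 0(1)] submodule_IZ[OF 0(1)], of t]
      coboundaries_ge(2)[OF 0(1), of t] C_top[of t] by (auto simp: cocycles_def L)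
  then show ?case unfolding artinian_top_quotient_def using dcc_trivial by blast
next
  case (Suc n)
  let ?T = "saturation R I N L"
  note L = Suc.prems(1)
  have T: "submodule ?T R N" by (rule N.submodule_saturation[OF I L])
  have LT: "L \<subseteq> ?T" by (rule N.saturation_ge[OF L I])
  obtain x where x: "x \<in> I" "\<And>y. y \<in> carrier N \<Longrightarrow> x \<odot>\<^bsub>N\<^esub> y \<in> ?T \<Longrightarrow> y \<in> ?T"
    using N.regular_element[OF noeth I L fin[OF T]] by blast
  have xc: "x \<in> carrier R" using x(1) N.R.idealD(1)[OF I] by blast
  let ?TX = "?T <+>\<^bsub>N\<^esub> (\<lambda>y. x \<odot>\<^bsub>N\<^esub> y) ` carrier N"
  have TX: "submodule ?TX R N" by (rule submodule_TX[OF T xc x(2)])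
  have "\<not> prime_chain R N ?TX n"
  proof
    assume "prime_chain R N ?TX n"
    then obtain c where c: "\<And>i. i \<le> n \<Longrightarrow> supported_at R N ?TX (c i)" "\<And>i. i < n \<Longrightarrow> c i \<subset> c (Suc i)"
      unfolding prime_chain_def by blast
    obtain q where q: "supported_at R N ?T q" "q \<subset> c 0"
      using N.smaller_prime_in_support[OF noeth T xc x(2) c(1)[of 0]] by blast
    have mono: "supported_at R N L p" if "supported_at R N K p" "L \<subseteq> K" for K p
      using that unfolding supported_at_def colon_def by blast
    have LTX: "L \<subseteq> ?TX" using LT T_le_TX[OF T xc x(2)] by simp
    have "prime_chain R N L (Suc n)"
      unfolding prime_chain_def
    proof (intro exI[of _ "\<lambda>i. case i of 0 \<Rightarrow> q | Suc k \<Rightarrow> c k"] conjI allI impI)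
      fix i
      show "supported_at R N L (case i of 0 \<Rightarrow> q | Suc k \<Rightarrow> c k)" if "i \<le> Suc n"
        using that mono[OF q(1) LT] mono[OF c(1) LTX] by (cases i) simp_all
      show "(case i of 0 \<Rightarrow> q | Suc k \<Rightarrow> c k) \<subset> (case Suc i of 0 \<Rightarrow> q | Suc k \<Rightarrow> c k)" if "i < Suc n"
        using that q(2) c(2) by (cases i) simp_all
    qed
    then show False using Suc.prems(2) by blast
  qed
  then have "artinian_top_quotient ?TX" by (rule Suc.IH[OF TX])
  from artinian_top_quotient_regular[OF T xc x(2) x(1) this] have "artinian_top_quotient ?T" by simp
  then show ?case by (rule artinian_top_quotient_modulo_torsion[OF L T LT order_refl])
qed

end

section \<open>The limit complex\<close>

lemma dcc_kernel_of_surjection: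
  assumes A: "module R A" and B: "module R B" and \<theta>: "\<theta> \<in> mod_hom R A B" "\<theta> ` carrier A = carrier B"
    and "artinian_module R B"
  shows "dcc R A {x \<in> carrier A. \<theta> x = \<zero>\<^bsub>B\<^esub>} (carrier A)"
proof (rule dcc_transfer[of R B "{\<zero>\<^bsub>B\<^esub>}" "carrier B" _ _ _ _ "\<lambda>S. \<theta> ` S"])
  interpret A: module R A by fact
  interpret B: module R B by fact
  show "dcc R B {\<zero>\<^bsub>B\<^esub>} (carrier B)" using assms(5) artinian_iff_dcc[OF B] by simp
  show "submodule (\<theta> ` S) R B \<and> {\<zero>\<^bsub>B\<^esub>} \<subseteq> \<theta> ` S \<and> \<theta> ` S \<subseteq> carrier B" if S: "submodule S R A" for S
    using submodule_image[OF A B \<theta>(1) S] B.submoduleD(1,3)[OF submodule_image[OF A B \<theta>(1) S]] by simp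
  show "\<theta> ` S \<subseteq> \<theta> ` S'" if "S \<subseteq> S'" for S S' using that by blast
  fix S S' assume S: "submodule S R A" "{x \<in> carrier A. \<theta> x = \<zero>\<^bsub>B\<^esub>} \<subseteq> S" "S' \<subseteq> carrier A" "submodule S' R A"
    "\<theta> ` S = \<theta> ` S'"
  show "S' \<subseteq> S"
  proof
    fix x assume x: "x \<in> S'"
    then have "\<theta> x \<in> \<theta> ` S" using S(5) by simp
    then obtain y where y: "y \<in> S" "\<theta> x = \<theta> y" by (elim imageE)
    have c: "x \<in> carrier A" "y \<in> carrier A" using x S(3) A.submoduleD(2)[OF S(1) y(1)] by auto
    have "\<theta> (x \<ominus>\<^bsub>A\<^esub> y) = \<zero>\<^bsub>B\<^esub>"
      using mod_hom_diff[OF A B \<theta>(1) c] y(2) mod_hom_closed[OF \<theta>(1) c(2)] by (simp add: a_minus_def B.M.r_neg)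
    then have "x \<ominus>\<^bsub>A\<^esub> y \<in> S" using S(2) c by auto
    then have "y \<oplus>\<^bsub>A\<^esub> (x \<ominus>\<^bsub>A\<^esub> y) \<in> S" by (rule A.submoduleD(4)[OF S(1) y(1)])
    then show "x \<in> S" unfolding a_minus_def using c A.M.a_comm[OF c(1) A.M.a_inv_closed[OF c(2)]] A.M.r_neg2 by simp
  qed
qed

lemma artinian_of_surjection:
  assumes A: "module R A" and B: "module R B" and \<theta>: "\<theta> \<in> mod_hom R A B" "\<theta> ` carrier A = carrier B"
    and "dcc R A {x \<in> carrier A. \<theta> x = \<zero>\<^bsub>B\<^esub>} (carrier A)"
  shows "artinian_module R B"
  unfolding artinian_iff_dcc[OF B]
proof (rule dcc_transfer[OF assms(5), of _ _ _ _ "\<lambda>S. {x \<in> carrier A. \<theta> x \<in> S}"])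
  show "submodule {x \<in> carrier A. \<theta> x \<in> S} R A \<and> {x \<in> carrier A. \<theta> x = \<zero>\<^bsub>B\<^esub>} \<subseteq> {x \<in> carrier A. \<theta> x \<in> S} \<and>
      {x \<in> carrier A. \<theta> x \<in> S} \<subseteq> carrier A" if "submodule S R B" "{\<zero>\<^bsub>B\<^esub>} \<subseteq> S" for S
    using submodule_vimage[OF A B \<theta>(1) that(1)] that(2) by auto
  fix S S' assume S: "S' \<subseteq> carrier B" "{x \<in> carrier A. \<theta> x \<in> S} = {x \<in> carrier A. \<theta> x \<in> S'}"
  show "S' \<subseteq> S"
  proof
    fix y assume y: "y \<in> S'"
    then have "y \<in> \<theta> ` carrier A" using S(1) \<theta>(2) by blast
    then obtain x where x: "x \<in> carrier A" "\<theta> x = y" by blast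
    then have "x \<in> {x \<in> carrier A. \<theta> x \<in> S}" unfolding S(2) using y by simp
    then show "y \<in> S" using x(2) by simp
  qed
qed auto

lemma dcc_restrict_iff:
  assumes "module R A" "submodule Z R A"
  shows "dcc R (A\<lparr>carrier := Z\<rparr>) K Z \<longleftrightarrow> dcc R A K Z"
proof -
  have "submodule L R (A\<lparr>carrier := Z\<rparr>) \<and> K \<subseteq> L \<and> L \<subseteq> Z \<longleftrightarrow> submodule L R A \<and> K \<subseteq> L \<and> L \<subseteq> Z" for L
    using submodule_restrict_iff[OF assms] by blast
  then show ?thesis unfolding dcc_def by simp
qed

locale generalized_local_cohomology = adic_quotients R I M
  for R :: "('a, 'r) ring_scheme" and I and M :: "('a, 'm, 'k) module_scheme" +
  fixes N :: "('a, 'n, 'l) module_scheme"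
  assumes N: "module R N"
begin

sublocale N: module R N by (rule N)

abbreviation (input) "F n i \<equiv> free_res R (Q n) i"
abbreviation (input) "dF n i \<equiv> free_res_diff R (Q n) i"
abbreviation (input) "\<phi> n m i \<equiv> free_res_map R (Q m) (Q n) (q n) i"

definition hom_sys :: "nat \<Rightarrow> nat \<Rightarrow> ('a, (('a, 'm set) syz \<Rightarrow> 'a) \<Rightarrow> 'n) module" where
  "hom_sys i n = hom_module R (F n i) N"

definition transition :: "nat \<Rightarrow> nat \<Rightarrow> nat \<Rightarrow> ((('a, 'm set) syz \<Rightarrow> 'a) \<Rightarrow> 'n) \<Rightarrow> (('a, 'm set) syz \<Rightarrow> 'a) \<Rightarrow> 'n" where
  "transition i n m h = (\<lambda>x\<in>carrier (F m i). h (\<phi> n m i x))"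

definition diff :: "nat \<Rightarrow> nat \<Rightarrow> ((('a, 'm set) syz \<Rightarrow> 'a) \<Rightarrow> 'n) \<Rightarrow> (('a, 'm set) syz \<Rightarrow> 'a) \<Rightarrow> 'n" where
  "diff i n h = (\<lambda>x\<in>carrier (F n (Suc i)). h (dF n i x))"

lemma hom_sys_sel [simp]:
  "carrier (hom_sys i n) = mod_hom R (F n i) N"
  "\<zero>\<^bsub>hom_sys i n\<^esub> = (\<lambda>x\<in>carrier (F n i). \<zero>\<^bsub>N\<^esub>)"
  "f \<oplus>\<^bsub>hom_sys i n\<^esub> g = (\<lambda>x\<in>carrier (F n i). f x \<oplus>\<^bsub>N\<^esub> g x)"
  "r \<odot>\<^bsub>hom_sys i n\<^esub> f = (\<lambda>x\<in>carrier (F n i). r \<odot>\<^bsub>N\<^esub> f x)"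
  by (simp_all add: hom_sys_def)

lemma cr: "cring R" by unfold_locales

lemma mF: "module R (F n i)" by (rule module_free_res[OF cr])

lemma module_hom_sys: "module R (hom_sys i n)"
  unfolding hom_sys_def by (rule module_hom_module[OF mF N])

lemma F_complex: "aug_complex R (Q n) (free_res R (Q n)) (free_res_diff R (Q n)) (free_res_aug R (Q n))"
  using aug_exact_of_resolution[OF module_Q projective_resolution_free_res[OF module_Q]] by (simp add: aug_exact_def)

lemma dF_hom: "dF n i \<in> mod_hom R (F n (Suc i)) (F n i)"
  using F_complex by (simp add: aug_complex_def)

lemma dF_closed: "x \<in> carrier (F n (Suc i)) \<Longrightarrow> dF n i x \<in> carrier (F n i)"
  by (rule mod_hom_closed[OF dF_hom])

lemma dF_dF: "x \<in> carrier (F n (Suc (Suc i))) \<Longrightarrow> dF n i (dF n (Suc i) x) = \<zero>\<^bsub>F n i\<^esub>"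
  using F_complex by (simp add: aug_complex_def)

lemma \<phi>_hom: "n \<le> m \<Longrightarrow> \<phi> n m i \<in> mod_hom R (F m i) (F n i)"
  by (rule free_res_map_hom[OF module_Q module_Q q_hom])

lemma \<phi>_closed: "n \<le> m \<Longrightarrow> x \<in> carrier (F m i) \<Longrightarrow> \<phi> n m i x \<in> carrier (F n i)"
  by (rule mod_hom_closed[OF \<phi>_hom])

lemma \<phi>_dF: "n \<le> m \<Longrightarrow> x \<in> carrier (F m (Suc i)) \<Longrightarrow> dF n i (\<phi> n m (Suc i) x) = \<phi> n m i (dF m i x)"
  using chain_map_free_res_map[OF module_Q module_Q q_hom] by (simp add: chain_map_def)

lemma transition_hom: "n \<le> m \<Longrightarrow> h \<in> mod_hom R (F n i) N \<Longrightarrow> transition i n m h \<in> mod_hom R (F m i) N"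
  unfolding transition_def by (rule mod_hom_compose[OF mF \<phi>_hom])

lemma diff_hom: "h \<in> mod_hom R (F n i) N \<Longrightarrow> diff i n h \<in> mod_hom R (F n (Suc i)) N"
  unfolding diff_def by (rule mod_hom_compose[OF mF dF_hom])

lemma q_id: "C \<in> carrier (Q n) \<Longrightarrow> q n C = C"
  by (auto simp: M.quot_carrier q_coset)

lemma q_comp: "n \<le> m \<Longrightarrow> m \<le> k \<Longrightarrow> C \<in> carrier (Q k) \<Longrightarrow> q n (q m C) = q n C"
  by (auto simp: M.quot_carrier q_coset)

lemma hom_system: "directed_system R (hom_sys i) (transition i)"
proof (rule directed_system.intro)
  show "cring R" by (rule cr)
  show "module R (hom_sys i n)" for n by (rule module_hom_sys)
  fix n m :: nat assume nm: "n \<le> m"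
  fix h assume h: "h \<in> carrier (hom_sys i n)"
  show "transition i n m h \<in> carrier (hom_sys i m)" using transition_hom[OF nm] h by simp
  show "transition i n m (h \<oplus>\<^bsub>hom_sys i n\<^esub> h') = transition i n m h \<oplus>\<^bsub>hom_sys i m\<^esub> transition i n m h'" for h'
    using \<phi>_closed[OF nm] by (auto simp: transition_def intro!: restrict_ext)
  show "transition i n m (r \<odot>\<^bsub>hom_sys i n\<^esub> h) = r \<odot>\<^bsub>hom_sys i m\<^esub> transition i n m h" for r
    using \<phi>_closed[OF nm] by (auto simp: transition_def intro!: restrict_ext)
  fix k assume mk: "m \<le> k"
  show "transition i m k (transition i n m h) = transition i n k h"
    unfolding transition_def
    using \<phi>_closed[OF mk] free_res_map_comp[OF module_Q module_Q module_Q q_hom[OF mk] q_hom[OF nm]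
        q_hom[OF order_trans[OF nm mk]] q_comp[OF nm mk]]
    by (auto intro!: restrict_ext)
next
  fix h n assume h: "h \<in> carrier (hom_sys i n)"
  have h': "h \<in> mod_hom R (F n i) N" using h by simp
  show "transition i n n h = h"
    by (rule mod_hom_eqI[OF transition_hom[OF order_refl h'] h'])
      (simp add: transition_def free_res_map_id[OF module_Q q_id])
qed

abbreviation "cls i \<equiv> directed_system.cls (hom_sys i) (transition i)"
abbreviation "G i \<equiv> dir_lim (hom_sys i) (transition i)"

lemmas cls_eq_iff = directed_system.cls_eq_iff[OF hom_system, simplified]
lemmas cls_transition = directed_system.cls_T[OF hom_system, simplified]
lemmas cls_closed = directed_system.cls_closed[OF hom_system, simplified]
lemmas cls_cases = directed_system.cls_cases[OF hom_system, simplified]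
lemmas cls_add = directed_system.cls_add[OF hom_system, simplified]
lemmas cls_smult = directed_system.cls_smult[OF hom_system, simplified]
lemmas cls_eq_zero_iff = directed_system.cls_eq_zero_iff[OF hom_system, simplified]
lemmas cls_zero = directed_system.cls_zero[OF hom_system, simplified]
lemmas module_G = directed_system.module_dir_lim[OF hom_system]
lemmas transition_transition = directed_system.T_trans[OF hom_system, simplified]

lemma transition_diff:
  assumes "n \<le> m" "h \<in> mod_hom R (F n i) N"
  shows "transition (Suc i) n m (diff i n h) = diff i m (transition i n m h)"
  unfolding transition_def diff_def
  using \<phi>_dF[OF assms(1)] \<phi>_closed[OF assms(1)] dF_closed by (auto intro!: restrict_ext)

lemma diff_system: "directed_system_map R (hom_sys i) (transition i) (hom_sys (Suc i)) (transition (Suc i)) (diff i)"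
proof (intro directed_system_map.intro hom_system directed_system_map_axioms.intro)
  fix n h assume h: "h \<in> carrier (hom_sys i n)"
  show "diff i n h \<in> carrier (hom_sys (Suc i) n)" using diff_hom h by simp
  show "diff i n (h \<oplus>\<^bsub>hom_sys i n\<^esub> h') = diff i n h \<oplus>\<^bsub>hom_sys (Suc i) n\<^esub> diff i n h'" for h'
    using dF_closed by (auto simp: diff_def intro!: restrict_ext)
  show "diff i n (r \<odot>\<^bsub>hom_sys i n\<^esub> h) = r \<odot>\<^bsub>hom_sys (Suc i) n\<^esub> diff i n h" for r
    using dF_closed by (auto simp: diff_def intro!: restrict_ext)
  show "diff i m (transition i n m h) = transition (Suc i) n m (diff i n h)" if "n \<le> m" for m
    using transition_diff[OF that] h by simp
qed

definition lim_diff where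
  "lim_diff i = lim_map (hom_sys i) (transition i) (hom_sys (Suc i)) (transition (Suc i)) (diff i)"

lemma lim_diff_cls: "h \<in> mod_hom R (F n i) N \<Longrightarrow> lim_diff i (cls i n h) = cls (Suc i) n (diff i n h)"
  using directed_system_map.lim_map_cls[OF diff_system, of h i n] by (simp add: lim_diff_def)

lemma lim_diff_hom: "lim_diff i \<in> mod_hom R (G i) (G (Suc i))"
  unfolding lim_diff_def by (rule directed_system_map.lim_map_hom[OF diff_system])

lemma diff_diff:
  assumes "h \<in> mod_hom R (F n i) N"
  shows "diff (Suc i) n (diff i n h) = \<zero>\<^bsub>hom_sys (Suc (Suc i)) n\<^esub>"
  unfolding diff_def using dF_closed dF_dF mod_hom_zero[OF mF N assms] by (auto intro!: restrict_ext)

lemma lim_diff_lim_diff: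
  assumes "g \<in> carrier (G i)"
  shows "lim_diff (Suc i) (lim_diff i g) = \<zero>\<^bsub>G (Suc (Suc i))\<^esub>"
proof -
  obtain n h where h: "h \<in> mod_hom R (F n i) N" "g = cls i n h" using cls_cases[OF assms] .
  show ?thesis using h diff_diff[OF h(1)] by (simp add: lim_diff_cls diff_hom cls_zero[of _ n])
qed

text \<open>The subcomplex of the classes of homomorphisms with values in \<open>L\<close>.\<close>

definition hom_into :: "nat \<Rightarrow> 'n set \<Rightarrow> nat \<Rightarrow> ((('a, 'm set) syz \<Rightarrow> 'a) \<Rightarrow> 'n) set" where
  "hom_into i L n = {h \<in> mod_hom R (F n i) N. \<forall>x\<in>carrier (F n i). h x \<in> L}"

definition lim_into where
  "lim_into i L = directed_system.lim_sub (hom_sys i) (transition i) (hom_into i L)"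

lemma hom_into_trans: "n \<le> m \<Longrightarrow> h \<in> hom_into i L n \<Longrightarrow> transition i n m h \<in> hom_into i L m"
  using transition_hom[of n m h i] \<phi>_closed[of n m] by (simp add: hom_into_def) (simp add: transition_def)

lemma hom_into_diff: "h \<in> hom_into i L n \<Longrightarrow> diff i n h \<in> hom_into (Suc i) L n"
  using diff_hom[of h n i] dF_closed by (simp add: hom_into_def) (simp add: diff_def)

lemma submodule_hom_into:
  assumes L: "submodule L R N"
  shows "submodule (hom_into i L n) R (hom_sys i n)"
proof -
  interpret H: module R "hom_sys i n" by (rule module_hom_sys)
  note c = H.M.zero_closed H.M.a_closed H.smult_closed
  show ?thesis
    unfolding H.submodule_iff
  proof (intro conjI ballI)
    show "hom_into i L n \<subseteq> carrier (hom_sys i n)" by (auto simp: hom_into_def)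
    show "\<zero>\<^bsub>hom_sys i n\<^esub> \<in> hom_into i L n" using c(1) N.submoduleD(3)[OF L] by (simp add: hom_into_def)
    fix f assume f: "f \<in> hom_into i L n"
    show "r \<odot>\<^bsub>hom_sys i n\<^esub> f \<in> hom_into i L n" if "r \<in> carrier R" for r
      using c(3)[of r f] f N.submoduleD(5)[OF L] that by (simp add: hom_into_def)
    fix g assume g: "g \<in> hom_into i L n"
    show "f \<oplus>\<^bsub>hom_sys i n\<^esub> g \<in> hom_into i L n"
      using c(2)[of f g] f g N.submoduleD(4)[OF L] by (simp add: hom_into_def)
  qed
qed

lemma submodule_lim_into: "submodule L R N \<Longrightarrow> submodule (lim_into i L) R (G i)"
  unfolding lim_into_def
  by (rule directed_system.submodule_lim_sub[OF hom_system submodule_hom_into hom_into_trans])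

lemma lim_intoI: "h \<in> hom_into i L n \<Longrightarrow> cls i n h \<in> lim_into i L"
  unfolding lim_into_def directed_system.lim_sub_def[OF hom_system] by blast

lemma lim_into_cases:
  assumes "g \<in> lim_into i L"
  obtains n h where "h \<in> hom_into i L n" "g = cls i n h"
  using assms unfolding lim_into_def directed_system.lim_sub_def[OF hom_system] by blast

lemma cls_in_lim_into:
  assumes h: "h \<in> mod_hom R (F n i) N" and "cls i n h \<in> lim_into i L"
  shows "\<exists>k\<ge>n. transition i n k h \<in> hom_into i L k"
proof -
  obtain m h' where h': "h' \<in> hom_into i L m" "cls i n h = cls i m h'" using lim_into_cases[OF assms(2)] .
  have "h' \<in> mod_hom R (F m i) N" using h'(1) by (simp add: hom_into_def)
  then obtain k where "n \<le> k" "m \<le> k" "transition i n k h = transition i m k h'" using cls_eq_iff[OF h] h'(2) by blast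
  then show ?thesis using hom_into_trans[OF _ h'(1)] by (intro exI[of _ k]) simp
qed

text \<open>
  A homomorphism from a free module with values in \<open>T + xN\<close> is decomposed on the basis.
\<close>

lemma hom_into_sum:
  assumes T: "submodule T R N" and x: "x \<in> carrier R"
    and h: "h \<in> hom_into i (T <+>\<^bsub>N\<^esub> (\<lambda>y. x \<odot>\<^bsub>N\<^esub> y) ` carrier N) n"
  shows "\<exists>h'\<in>mod_hom R (F n i) N. \<exists>c\<in>hom_into i T n. h = x \<odot>\<^bsub>hom_sys i n\<^esub> h' \<oplus>\<^bsub>hom_sys i n\<^esub> c"
proof -
  let ?B = "syz_basis R (Q n) i"
  have b: "free_basis R s \<in> carrier (F n i)" if "s \<in> ?B" for s
    unfolding free_res_def using free_basis_closed[OF cr that] .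
  have hh: "h \<in> mod_hom R (F n i) N" using h by (simp add: hom_into_def)
  have "\<exists>y c. y \<in> carrier N \<and> c \<in> T \<and> h (free_basis R s) = x \<odot>\<^bsub>N\<^esub> y \<oplus>\<^bsub>N\<^esub> c" if s: "s \<in> ?B" for s
  proof -
    have "h (free_basis R s) \<in> T <+>\<^bsub>N\<^esub> (\<lambda>y. x \<odot>\<^bsub>N\<^esub> y) ` carrier N" using h b[OF s] by (simp add: hom_into_def)
    then obtain c z where c: "c \<in> T" "z \<in> (\<lambda>y. x \<odot>\<^bsub>N\<^esub> y) ` carrier N" "h (free_basis R s) = c \<oplus>\<^bsub>N\<^esub> z" by (rule set_addE)
    then obtain y where y: "y \<in> carrier N" "z = x \<odot>\<^bsub>N\<^esub> y" by blast
    have "c \<oplus>\<^bsub>N\<^esub> z = x \<odot>\<^bsub>N\<^esub> y \<oplus>\<^bsub>N\<^esub> c" using N.M.a_comm[of c z] N.submoduleD(2)[OF T c(1)] y x by simp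
    then show ?thesis using c y by auto
  qed
  then obtain y c where yc: "\<And>s. s \<in> ?B \<Longrightarrow> y s \<in> carrier N \<and> c s \<in> T \<and> h (free_basis R s) = x \<odot>\<^bsub>N\<^esub> y s \<oplus>\<^bsub>N\<^esub> c s"
    by metis
  have y: "y \<in> ?B \<rightarrow> carrier N" and c: "c \<in> ?B \<rightarrow> T" "c \<in> ?B \<rightarrow> carrier N"
    using yc N.submoduleD(2)[OF T] by auto
  let ?y = "lin_ext R ?B N y" and ?c = "lin_ext R ?B N c"
  have yh: "?y \<in> mod_hom R (F n i) N" and ch: "?c \<in> mod_hom R (F n i) N"
    using lin_ext_hom[OF N y] lin_ext_hom[OF N c(2)] by (simp_all add: free_res_def)
  have cT: "?c \<in> hom_into i T n"
    using ch lin_ext_in_submodule[OF N T c(1)] by (simp add: hom_into_def free_res_def)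
  interpret H: module R "hom_sys i n" by (rule module_hom_sys)
  have s: "x \<odot>\<^bsub>hom_sys i n\<^esub> ?y \<oplus>\<^bsub>hom_sys i n\<^esub> ?c \<in> mod_hom R (F n i) N"
    using H.M.a_closed[OF H.smult_closed[OF x]] yh ch by simp
  have "h = x \<odot>\<^bsub>hom_sys i n\<^esub> ?y \<oplus>\<^bsub>hom_sys i n\<^esub> ?c"
  proof (rule mod_hom_eqI[OF hh s])
    show "h z = (x \<odot>\<^bsub>hom_sys i n\<^esub> ?y \<oplus>\<^bsub>hom_sys i n\<^esub> ?c) z" if "z \<in> carrier (F n i)" for z
    proof (rule free_res_hom_eqI[OF cr N hh s _ that])
      fix s assume s: "s \<in> ?B"
      show "h (free_basis R s) = (x \<odot>\<^bsub>hom_sys i n\<^esub> ?y \<oplus>\<^bsub>hom_sys i n\<^esub> ?c) (free_basis R s)"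
        using yc[OF s] b[OF s] lin_ext_basis[OF N y s] lin_ext_basis[OF N c(2) s] by simp
    qed
  qed
  then show ?thesis using yh cT by blast
qed

text \<open>
  At some stage \<open>g\<close> is a homomorphism to \<open>T\<close> that is a cocycle modulo \<open>L\<close>. By the vanishing for the torsion module
  \<open>T/L\<close> it becomes a coboundary modulo \<open>L\<close> at a later stage, and the cochain that it bounds lifts from \<open>T/L\<close> to
  \<open>T\<close> because the modules of the resolution are free.
\<close>

lemma torsion_exact:
  fixes P :: "nat \<Rightarrow> ('a, 'p) module"
  assumes P: "projective_resolution R M P dP eP" and Pi: "carrier (P i) = {\<zero>\<^bsub>P i\<^esub>}"
    and L: "submodule L R N" and T: "submodule T R N" and LT: "L \<subseteq> T" "T \<subseteq> saturation R I N L"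
    and g: "g \<in> lim_into i T" and dg: "lim_diff i g \<in> lim_into (Suc i) L"
  shows "g \<in> (case i of 0 \<Rightarrow> {\<zero>\<^bsub>G 0\<^esub>} | Suc p \<Rightarrow> lim_diff p ` lim_into p T) <+>\<^bsub>G i\<^esub> lim_into i L"
proof -
  obtain n h0 where h0: "h0 \<in> hom_into i T n" "g = cls i n h0" using lim_into_cases[OF g] .
  have h0h: "h0 \<in> mod_hom R (F n i) N" using h0(1) by (simp add: hom_into_def)
  obtain k where k: "n \<le> k" "transition (Suc i) n k (diff i n h0) \<in> hom_into (Suc i) L k"
    using cls_in_lim_into[OF diff_hom[OF h0h]] dg h0 h0h by (auto simp: lim_diff_cls)
  define h where "h = transition i n k h0"
  have hT: "h \<in> hom_into i T k" unfolding h_def using hom_into_trans[OF k(1) h0(1)] .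
  have hh: "h \<in> mod_hom R (F k i) N" and hTx: "\<And>x. x \<in> carrier (F k i) \<Longrightarrow> h x \<in> T" using hT by (auto simp: hom_into_def)
  have gh: "g = cls i k h" unfolding h_def h0(2) using cls_transition[OF k(1) h0h] by simp
  have dhL: "h (dF k i x) \<in> L" if "x \<in> carrier (F k (Suc i))" for x
    using k(2) that unfolding transition_diff[OF k(1) h0h] h_def[symmetric] by (auto simp: hom_into_def diff_def)
  let ?NT = "N\<lparr>carrier := T\<rparr>"
  have NT: "module R ?NT" by (rule module_restrict[OF N T])
  interpret NT: module R ?NT by (rule NT)
  have L': "submodule L R ?NT" using submodule_restrict_iff[OF N T] L LT(1) by blast
  let ?Q = "quot_module R ?NT L"
  have mQ: "module R ?Q" by (rule NT.module_quot_module[OF L'])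
  define \<pi> where "\<pi> = (\<lambda>y\<in>carrier ?NT. L +>\<^bsub>?NT\<^esub> y)"
  have \<pi>: "\<pi> \<in> mod_hom R ?NT ?Q" unfolding \<pi>_def by (rule NT.quot_map_hom[OF L'])
  have \<pi>0: "\<pi> y = \<zero>\<^bsub>?Q\<^esub> \<longleftrightarrow> y \<in> L" if "y \<in> T" for y
    using NT.coset_mem_iff[OF L'] that by (simp add: \<pi>_def)
  have hNT: "h \<in> mod_hom R (F k i) ?NT" using hh hTx by (auto simp: mod_hom_def)
  let ?h = "\<lambda>x\<in>carrier (F k i). \<pi> (h x)"
  have hQ: "?h \<in> mod_hom R (F k i) ?Q" by (rule mod_hom_compose[OF mF hNT \<pi>])
  have coc: "?h (dF k i x) = \<zero>\<^bsub>?Q\<^esub>" if "x \<in> carrier (F k (Suc i))" for x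
    using dF_closed[OF that] \<pi>0[OF hTx] dhL[OF that] by simp
  have tors: "\<exists>c. \<forall>u\<in>ideal_power R I c. u \<odot>\<^bsub>?Q\<^esub> y = \<zero>\<^bsub>?Q\<^esub>" if y: "y \<in> carrier ?Q" for y
  proof -
    obtain z where z: "z \<in> T" "y = L +>\<^bsub>?NT\<^esub> z" using y by (auto simp: NT.quot_carrier)
    have "z \<in> saturation R I N L" using z(1) LT(2) by blast
    then obtain c where c: "\<And>u. u \<in> ideal_power R I c \<Longrightarrow> u \<odot>\<^bsub>N\<^esub> z \<in> L" unfolding saturation_def by blast
    have "u \<odot>\<^bsub>?Q\<^esub> y = \<zero>\<^bsub>?Q\<^esub>" if u: "u \<in> ideal_power R I c" for u
    proof -
      have uc: "u \<in> carrier R" using u M.R.ideal_power_carrier[OF I] by blast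
      have "u \<odot>\<^bsub>?Q\<^esub> y = L +>\<^bsub>?NT\<^esub> (u \<odot>\<^bsub>N\<^esub> z)" using NT.quot_smult[OF L' uc] z by simp
      then show ?thesis using NT.coset_mem_iff[OF L'] c[OF u] LT(1) by auto
    qed
    then show ?thesis by blast
  qed
  from ext_limit_vanishes[OF P Pi mQ tors hQ coc]
  obtain m where m: "k \<le> m" "i = 0 \<longrightarrow> (\<forall>x\<in>carrier (F m i). ?h (\<phi> k m i x) = \<zero>\<^bsub>?Q\<^esub>)"
    "\<forall>p. i = Suc p \<longrightarrow> (\<exists>u\<in>mod_hom R (F m p) ?Q. \<forall>x\<in>carrier (F m i). ?h (\<phi> k m i x) = u (dF m p x))" by blast
  have gm: "g = cls i m (transition i k m h)" unfolding gh using cls_transition[OF m(1) hh] by simp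
  have th: "transition i k m h \<in> mod_hom R (F m i) N" using transition_hom[OF m(1) hh] .
  interpret Gi: module R "G i" by (rule module_G)
  show ?thesis
  proof (cases i)
    case 0
    have "transition i k m h x \<in> L" if x: "x \<in> carrier (F m i)" for x
    proof -
      note c = \<phi>_closed[OF m(1) x]
      have "?h (\<phi> k m i x) = \<zero>\<^bsub>?Q\<^esub>" using m(2) x 0 by blast
      then have "\<pi> (h (\<phi> k m i x)) = \<zero>\<^bsub>?Q\<^esub>" using c by simp
      then have "h (\<phi> k m i x) \<in> L" using \<pi>0[OF hTx[OF c]] by blast
      then show ?thesis using x by (simp add: transition_def)
    qed
    then have "g \<in> lim_into i L" unfolding gm using th by (intro lim_intoI) (simp add: hom_into_def)
    then have "\<zero>\<^bsub>G i\<^esub> \<oplus>\<^bsub>G i\<^esub> g \<in> {\<zero>\<^bsub>G i\<^esub>} <+>\<^bsub>G i\<^esub> lim_into i L" by (intro set_addI) simp_all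
    moreover have "g \<in> carrier (G i)" unfolding gm by (rule cls_closed[OF th])
    ultimately have "g \<in> {\<zero>\<^bsub>G i\<^esub>} <+>\<^bsub>G i\<^esub> lim_into i L" using Gi.M.l_zero[of g] by simp
    then show ?thesis by (simp add: 0)
  next
    case (Suc p)
    obtain u0 where u0: "u0 \<in> mod_hom R (F m p) ?Q" "\<And>x. x \<in> carrier (F m i) \<Longrightarrow> ?h (\<phi> k m i x) = u0 (dF m p x)"
      using m(3)[rule_format, OF Suc] by (elim bexE) simp
    have "\<exists>u\<in>mod_hom R (F m p) ?NT. \<forall>x\<in>carrier (F m p). u x \<in> carrier ?NT \<and> \<pi> (u x) = u0 x"
    proof (rule projective_lift[OF _ NT mQ \<pi> u0(1) NT.carrier_is_submodule])
      show "projective_module R (F m p)" unfolding free_res_def by (rule projective_free_module[OF cr])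
      have surj: "\<pi> ` carrier ?NT = carrier ?Q" unfolding NT.quot_carrier \<pi>_def by simp
      show "u0 x \<in> \<pi> ` carrier ?NT" if "x \<in> carrier (F m p)" for x
        unfolding surj by (rule mod_hom_closed[OF u0(1) that])
    qed
    then obtain u where u: "u \<in> mod_hom R (F m p) ?NT" "\<And>x. x \<in> carrier (F m p) \<Longrightarrow> \<pi> (u x) = u0 x" by blast
    have uT: "u x \<in> T" if "x \<in> carrier (F m p)" for x using mod_hom_closed[OF u(1) that] by simp
    have uN: "u \<in> mod_hom R (F m p) N" using u(1) N.submoduleD(1)[OF T] by (auto simp: mod_hom_def)
    have uin: "u \<in> hom_into p T m" using uN uT by (simp add: hom_into_def)
    have thT: "transition i k m h \<in> hom_into i T m" by (rule hom_into_trans[OF m(1) hT])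
    have a: "transition i k m h \<in> mod_hom R (F m i) ?NT" using thT by (auto simp: hom_into_def mod_hom_def)
    have dT: "diff p m u \<in> hom_into i T m" using hom_into_diff[OF uin] Suc by simp
    then have b: "diff p m u \<in> mod_hom R (F m i) ?NT" by (auto simp: hom_into_def mod_hom_def)
    let ?l = "\<lambda>x\<in>carrier (F m i). transition i k m h x \<ominus>\<^bsub>?NT\<^esub> diff p m u x"
    have l: "?l \<in> mod_hom R (F m i) ?NT" by (rule mod_hom_diff_fun[OF mF NT a b])
    have lN: "?l \<in> mod_hom R (F m i) N" using l N.submoduleD(1)[OF T] by (auto simp: mod_hom_def)
    have lL: "?l x \<in> L" if x: "x \<in> carrier (F m i)" for x
    proof -
      have x': "x \<in> carrier (F m (Suc p))" using x Suc by simp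
      have ab: "transition i k m h x \<in> carrier ?NT" "diff p m u x \<in> carrier ?NT"
        using mod_hom_closed[OF a x] mod_hom_closed[OF b x] .
      have "\<pi> (transition i k m h x) = \<pi> (diff p m u x)"
        using u0(2)[OF x] u(2)[OF dF_closed[OF x']] x x' \<phi>_closed[OF m(1) x] by (simp add: transition_def diff_def)
      then have "L +>\<^bsub>?NT\<^esub> transition i k m h x = L +>\<^bsub>?NT\<^esub> diff p m u x" using ab by (simp add: \<pi>_def)
      then show ?thesis using NT.coset_eq_iff[OF L' ab] x by simp
    qed
    have lin: "?l \<in> hom_into i L m" using lN lL by (simp add: hom_into_def)
    have dN: "diff p m u \<in> mod_hom R (F m i) N" using dT by (simp add: hom_into_def)
    have eq: "transition i k m h = diff p m u \<oplus>\<^bsub>hom_sys i m\<^esub> ?l"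
    proof (rule mod_hom_eqI[OF th])
      show "diff p m u \<oplus>\<^bsub>hom_sys i m\<^esub> ?l \<in> mod_hom R (F m i) N"
        using abelian_monoid.a_closed[OF abelian_group.axioms(1)[OF module.axioms(2)[OF module_hom_sys]], of "diff p m u" i m ?l]
          dN lN by simp
      fix x assume x: "x \<in> carrier (F m i)"
      have ab: "transition i k m h x \<in> carrier ?NT" "diff p m u x \<in> carrier ?NT"
        using mod_hom_closed[OF a x] mod_hom_closed[OF b x] .
      have "diff p m u x \<oplus>\<^bsub>?NT\<^esub> (transition i k m h x \<ominus>\<^bsub>?NT\<^esub> diff p m u x) = transition i k m h x"
        unfolding a_minus_def
        using ab NT.M.a_comm[OF ab(1) NT.M.a_inv_closed[OF ab(2)]] NT.M.r_neg2[OF ab(2,1)] by simp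
      then show "transition i k m h x = (diff p m u \<oplus>\<^bsub>hom_sys i m\<^esub> ?l) x" using x by simp
    qed
    have "g = cls i m (diff p m u) \<oplus>\<^bsub>G i\<^esub> cls i m ?l"
      unfolding gm using eq cls_add[OF dN lN] by simp
    moreover have "cls i m (diff p m u) = lim_diff p (cls p m u)" using lim_diff_cls[OF uN] Suc by simp
    ultimately have "g \<in> lim_diff p ` lim_into p T <+>\<^bsub>G i\<^esub> lim_into i L"
      using set_addI[OF imageI[OF lim_intoI[OF uin], of "lim_diff p"] lim_intoI[OF lin], of "G i"] by simp
    then show ?thesis using Suc by simp
  qed
qed

lemma filtered_complex_lim:
  fixes P :: "nat \<Rightarrow> ('a, 'p) module"
  assumes P: "projective_resolution R M P dP eP" and Pi: "\<And>i. t \<le> i \<Longrightarrow> carrier (P i) = {\<zero>\<^bsub>P i\<^esub>}"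
  shows "filtered_complex R I N G lim_diff lim_into t"
proof (rule filtered_complex.intro)
  show "noetherian_ring R" "ideal I R" "module R N" using noeth I N by simp_all
  show "module R (G i)" for i by (rule module_G)
  show "lim_diff i \<in> mod_hom R (G i) (G (Suc i))" for i by (rule lim_diff_hom)
  show "lim_diff (Suc i) (lim_diff i g) = \<zero>\<^bsub>G (Suc (Suc i))\<^esub>" if "g \<in> carrier (G i)" for g i
    by (rule lim_diff_lim_diff[OF that])
  show "submodule (lim_into i L) R (G i)" if "submodule L R N" for L i by (rule submodule_lim_into[OF that])
  show "lim_into i L \<subseteq> lim_into i L'" if "L \<subseteq> L'" for L L' i
  proof
    fix g assume "g \<in> lim_into i L"
    then obtain n h where h: "h \<in> hom_into i L n" "g = cls i n h" by (rule lim_into_cases)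
    then have "h \<in> hom_into i L' n" using that by (auto simp: hom_into_def)
    then show "g \<in> lim_into i L'" unfolding h(2) by (rule lim_intoI)
  qed
  show "lim_into i (carrier N) = carrier (G i)" for i
  proof
    show "lim_into i (carrier N) \<subseteq> carrier (G i)"
      by (rule module.submoduleD(1)[OF module_G submodule_lim_into[OF N.carrier_is_submodule]])
    show "carrier (G i) \<subseteq> lim_into i (carrier N)"
    proof
      fix g assume "g \<in> carrier (G i)"
      then obtain n h where h: "h \<in> mod_hom R (F n i) N" "g = cls i n h" by (rule cls_cases)
      then have "h \<in> hom_into i (carrier N) n" using mod_hom_closed[OF h(1)] by (simp add: hom_into_def)
      then show "g \<in> lim_into i (carrier N)" unfolding h(2) by (rule lim_intoI)
    qed
  qed
  show "lim_diff i g \<in> lim_into (Suc i) L" if g: "g \<in> lim_into i L" for g i L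
  proof -
    obtain n h where h: "h \<in> hom_into i L n" "g = cls i n h" using lim_into_cases[OF g] .
    have hh: "h \<in> mod_hom R (F n i) N" using h(1) by (simp add: hom_into_def)
    show ?thesis unfolding h(2) lim_diff_cls[OF hh] by (intro lim_intoI hom_into_diff h(1))
  qed
next
  fix x T g i assume x: "x \<in> carrier R" and T: "submodule T R N" and g: "g \<in> carrier (G i)"
  let ?TX = "T <+>\<^bsub>N\<^esub> (\<lambda>y. x \<odot>\<^bsub>N\<^esub> y) ` carrier N"
  obtain n h where h: "h \<in> mod_hom R (F n i) N" "g = cls i n h" using cls_cases[OF g] .
  interpret H: module R "hom_sys i n" by (rule module_hom_sys)
  have xh: "x \<odot>\<^bsub>hom_sys i n\<^esub> h \<in> mod_hom R (F n i) N" using H.smult_closed[OF x, of h] h(1) by simp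
  have xg: "x \<odot>\<^bsub>G i\<^esub> g = cls i n (x \<odot>\<^bsub>hom_sys i n\<^esub> h)" unfolding h(2) using cls_smult[OF x h(1)] by simp
  have "x \<odot>\<^bsub>hom_sys i n\<^esub> h \<in> hom_into i ?TX n"
    using xh N.sum_ge(2)[OF T N.submodule_smult_image[OF x N.carrier_is_submodule]] mod_hom_closed[OF h(1)]
    by (auto simp: hom_into_def)
  then show "x \<odot>\<^bsub>G i\<^esub> g \<in> lim_into i ?TX" unfolding xg by (rule lim_intoI)
  assume reg: "\<And>y. y \<in> carrier N \<Longrightarrow> x \<odot>\<^bsub>N\<^esub> y \<in> T \<Longrightarrow> y \<in> T" and xgT: "x \<odot>\<^bsub>G i\<^esub> g \<in> lim_into i T"
  obtain k where k: "n \<le> k" "transition i n k (x \<odot>\<^bsub>hom_sys i n\<^esub> h) \<in> hom_into i T k"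
    using cls_in_lim_into[OF xh] xgT unfolding xg by blast
  have "transition i n k h y \<in> T" if y: "y \<in> carrier (F k i)" for y
  proof (rule reg)
    show "transition i n k h y \<in> carrier N" using mod_hom_closed[OF transition_hom[OF k(1) h(1)] y] .
    show "x \<odot>\<^bsub>N\<^esub> transition i n k h y \<in> T"
      using k(2) y \<phi>_closed[OF k(1) y] by (auto simp: hom_into_def transition_def)
  qed
  then have "transition i n k h \<in> hom_into i T k" using transition_hom[OF k(1) h(1)] by (simp add: hom_into_def)
  from lim_intoI[OF this] show "g \<in> lim_into i T" unfolding h(2) using cls_transition[OF k(1) h(1)] by simp
next
  fix x T g i assume x: "x \<in> carrier R" and T: "submodule T R N"
    and g: "g \<in> lim_into i (T <+>\<^bsub>N\<^esub> (\<lambda>y. x \<odot>\<^bsub>N\<^esub> y) ` carrier N)"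
  obtain n h where h: "h \<in> hom_into i (T <+>\<^bsub>N\<^esub> (\<lambda>y. x \<odot>\<^bsub>N\<^esub> y) ` carrier N) n" "g = cls i n h"
    using lim_into_cases[OF g] .
  obtain h' c where hc: "h' \<in> mod_hom R (F n i) N" "c \<in> hom_into i T n"
    "h = x \<odot>\<^bsub>hom_sys i n\<^esub> h' \<oplus>\<^bsub>hom_sys i n\<^esub> c" using hom_into_sum[OF T x h(1)] by blast
  interpret H: module R "hom_sys i n" by (rule module_hom_sys)
  have xh: "x \<odot>\<^bsub>hom_sys i n\<^esub> h' \<in> mod_hom R (F n i) N" using H.smult_closed[OF x, of h'] hc(1) by simp
  have ch: "c \<in> mod_hom R (F n i) N" using hc(2) by (simp add: hom_into_def)
  have "g = x \<odot>\<^bsub>G i\<^esub> cls i n h' \<oplus>\<^bsub>G i\<^esub> cls i n c"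
    unfolding h(2) using hc(3) cls_smult[OF x hc(1)] cls_add[OF xh ch] by simp
  then show "\<exists>g'\<in>carrier (G i). \<exists>c\<in>lim_into i T. g = x \<odot>\<^bsub>G i\<^esub> g' \<oplus>\<^bsub>G i\<^esub> c"
    using cls_closed[OF hc(1)] lim_intoI[OF hc(2)] by blast
next
  fix L T i g assume "submodule L R N" "submodule T R N" "L \<subseteq> T" "T \<subseteq> saturation R I N L" "t \<le> i"
    "g \<in> lim_into i T" "lim_diff i g \<in> lim_into (Suc i) L"
  then show "g \<in> (case i of 0 \<Rightarrow> {\<zero>\<^bsub>G 0\<^esub>} | Suc k \<Rightarrow> lim_diff k ` lim_into k T) <+>\<^bsub>G i\<^esub> lim_into i L"
    using torsion_exact[OF P Pi] by blast
qed


section \<open>Comparison with generalized local cohomology\<close>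

abbreviation (input) "coc i n \<equiv> ext_cocycles R i (Q n) N"
abbreviation (input) "cob i n \<equiv> ext_coboundaries R i (Q n) N"

lemma diff_linear: "(\<lambda>h\<in>carrier (hom_sys i n). diff i n h) \<in> mod_hom R (hom_sys i n) (hom_sys (Suc i) n)"
proof (rule mod_homI[OF _ _ _ module_hom_sys])
  fix h assume h: "h \<in> carrier (hom_sys i n)"
  show "diff i n h \<in> carrier (hom_sys (Suc i) n)" by (rule directed_system_map.f_closed[OF diff_system h])
  show "diff i n (h \<oplus>\<^bsub>hom_sys i n\<^esub> h') = diff i n h \<oplus>\<^bsub>hom_sys (Suc i) n\<^esub> diff i n h'" if "h' \<in> carrier (hom_sys i n)" for h'
    by (rule directed_system_map.f_add[OF diff_system h that])
  show "diff i n (r \<odot>\<^bsub>hom_sys i n\<^esub> h) = r \<odot>\<^bsub>hom_sys (Suc i) n\<^esub> diff i n h" if "r \<in> carrier R" for r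
    by (rule directed_system_map.f_smult[OF diff_system that h])
qed

lemma coc_iff: "h \<in> coc i n \<longleftrightarrow> h \<in> mod_hom R (F n i) N \<and> diff i n h = \<zero>\<^bsub>hom_sys (Suc i) n\<^esub>"
  by (auto simp: ext_cocycles_def diff_def restrict_def fun_eq_iff)

lemma cob_0: "cob 0 n = {\<zero>\<^bsub>hom_sys 0 n\<^esub>}"
  by (simp add: hom_sys_def)

lemma cob_Suc: "cob (Suc p) n = diff p n ` mod_hom R (F n p) N"
  by (simp add: diff_def)

lemma submodule_coc: "submodule (coc i n) R (hom_sys i n)"
proof -
  have "coc i n = {h \<in> carrier (hom_sys i n). (\<lambda>h\<in>carrier (hom_sys i n). diff i n h) h \<in> {\<zero>\<^bsub>hom_sys (Suc i) n\<^esub>}}"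
    using coc_iff by auto
  then show ?thesis
    using submodule_vimage[OF module_hom_sys module_hom_sys diff_linear module.submodule_zero[OF module_hom_sys]] by simp
qed

lemma submodule_cob: "submodule (cob i n) R (hom_sys i n)"
proof (cases i)
  case 0
  then show ?thesis using cob_0 module.submodule_zero[OF module_hom_sys] by simp
next
  case (Suc p)
  have "cob (Suc p) n = (\<lambda>h\<in>carrier (hom_sys p n). diff p n h) ` carrier (hom_sys p n)"
    unfolding cob_Suc by simp
  then show ?thesis
    using submodule_image[OF module_hom_sys module_hom_sys diff_linear module.carrier_is_submodule[OF module_hom_sys]] Suc
    by simp
qed

lemma cob_coc: "cob i n \<subseteq> coc i n"
proof (cases i)
  case 0
  then show ?thesis using cob_0 module.submoduleD(3)[OF module_hom_sys submodule_coc] by simp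
next
  case (Suc p)
  show ?thesis unfolding Suc cob_Suc using diff_hom diff_diff by (auto simp: coc_iff)
qed

lemma zero_transition: "n \<le> m \<Longrightarrow> transition i n m \<zero>\<^bsub>hom_sys i n\<^esub> = \<zero>\<^bsub>hom_sys i m\<^esub>"
  by (rule directed_system.T_zero[OF hom_system])

lemma coc_transition:
  assumes "n \<le> m" "h \<in> coc i n"
  shows "transition i n m h \<in> coc i m"
proof -
  have h: "h \<in> mod_hom R (F n i) N" "diff i n h = \<zero>\<^bsub>hom_sys (Suc i) n\<^esub>" using assms(2) by (auto simp: coc_iff)
  then show ?thesis
    using transition_hom[OF assms(1) h(1)] transition_diff[OF assms(1) h(1)] zero_transition[OF assms(1), of "Suc i"]
    by (simp add: coc_iff)
qed

lemma cob_transition: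
  assumes "n \<le> m" "h \<in> cob i n"
  shows "transition i n m h \<in> cob i m"
proof (cases i)
  case 0
  then show ?thesis using assms(2) zero_transition[OF assms(1)] by (simp only: 0 cob_0 singleton_iff)
next
  case (Suc p)
  then obtain u where u: "u \<in> mod_hom R (F n p) N" "h = diff p n u" using assms(2) cob_Suc by auto
  then show ?thesis unfolding Suc cob_Suc using transition_diff[OF assms(1) u(1)] transition_hom[OF assms(1) u(1)] by auto
qed

abbreviation (input) "ext i n \<equiv> ext_module R i (Q n) N"
abbreviation (input) "ext_trans i n m \<equiv> ext_map R i (Q m) (Q n) N (q n)"

definition coc_module where "coc_module i n = hom_sys i n\<lparr>carrier := coc i n\<rparr>"

definition ext_class where "ext_class i n h = cob i n +>\<^bsub>coc_module i n\<^esub> h"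

lemma module_coc_module: "module R (coc_module i n)"
  unfolding coc_module_def by (rule module_restrict[OF module_hom_sys submodule_coc])

lemma coc_module_sel [simp]:
  "carrier (coc_module i n) = coc i n" "\<zero>\<^bsub>coc_module i n\<^esub> = \<zero>\<^bsub>hom_sys i n\<^esub>"
  "f \<oplus>\<^bsub>coc_module i n\<^esub> g = f \<oplus>\<^bsub>hom_sys i n\<^esub> g"
  "r \<odot>\<^bsub>coc_module i n\<^esub> f = r \<odot>\<^bsub>hom_sys i n\<^esub> f"
  by (simp_all add: coc_module_def)

lemma submodule_cob_coc: "submodule (cob i n) R (coc_module i n)"
  unfolding coc_module_def using submodule_restrict_iff[OF module_hom_sys submodule_coc] submodule_cob cob_coc by blast

lemma ext_eq: "ext i n = quot_module R (coc_module i n) (cob i n)"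
  by (simp add: ext_module_def coc_module_def hom_sys_def)

lemma module_ext: "module R (ext i n)"
  unfolding ext_eq by (rule module.module_quot_module[OF module_coc_module submodule_cob_coc])

lemma ext_carrier: "carrier (ext i n) = ext_class i n ` coc i n"
  unfolding ext_eq module.quot_carrier[OF module_coc_module] ext_class_def by simp

lemma ext_class_add:
  "h \<in> coc i n \<Longrightarrow> h' \<in> coc i n \<Longrightarrow> ext_class i n h \<oplus>\<^bsub>ext i n\<^esub> ext_class i n h' = ext_class i n (h \<oplus>\<^bsub>hom_sys i n\<^esub> h')"
  unfolding ext_eq ext_class_def using module.quot_add[OF module_coc_module submodule_cob_coc, of h i n h'] by (simp only: coc_module_sel)

lemma ext_class_smult:
  "r \<in> carrier R \<Longrightarrow> h \<in> coc i n \<Longrightarrow> r \<odot>\<^bsub>ext i n\<^esub> ext_class i n h = ext_class i n (r \<odot>\<^bsub>hom_sys i n\<^esub> h)"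
  unfolding ext_eq ext_class_def using module.quot_smult[OF module_coc_module submodule_cob_coc, of r h i n] by (simp only: coc_module_sel)

lemma ext_class_eq_zero_iff: "h \<in> coc i n \<Longrightarrow> ext_class i n h = \<zero>\<^bsub>ext i n\<^esub> \<longleftrightarrow> h \<in> cob i n"
  unfolding ext_eq ext_class_def module.quot_sel[OF module_coc_module]
  using module.coset_mem_iff[OF module_coc_module submodule_cob_coc, of h i n] by (simp only: coc_module_sel)

lemma coc_closed:
  "h \<in> coc i n \<Longrightarrow> h' \<in> coc i n \<Longrightarrow> h \<oplus>\<^bsub>hom_sys i n\<^esub> h' \<in> coc i n"
  "r \<in> carrier R \<Longrightarrow> h \<in> coc i n \<Longrightarrow> r \<odot>\<^bsub>hom_sys i n\<^esub> h \<in> coc i n"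
  "h \<in> coc i n \<Longrightarrow> h \<in> mod_hom R (F n i) N"
  using module.submoduleD(4,5)[OF module_hom_sys submodule_coc] by (simp_all only: coc_iff)

lemma transition_add:
  "n \<le> m \<Longrightarrow> h \<in> mod_hom R (F n i) N \<Longrightarrow> h' \<in> mod_hom R (F n i) N \<Longrightarrow>
    transition i n m (h \<oplus>\<^bsub>hom_sys i n\<^esub> h') = transition i n m h \<oplus>\<^bsub>hom_sys i m\<^esub> transition i n m h'"
  using directed_system.T_add[OF hom_system, of n m h i h'] by (simp only: hom_sys_sel(1))

lemma transition_smult:
  "n \<le> m \<Longrightarrow> r \<in> carrier R \<Longrightarrow> h \<in> mod_hom R (F n i) N \<Longrightarrow>
    transition i n m (r \<odot>\<^bsub>hom_sys i n\<^esub> h) = r \<odot>\<^bsub>hom_sys i m\<^esub> transition i n m h"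
  using directed_system.T_smult[OF hom_system, of n m r h i] by (simp only: hom_sys_sel(1))

lemma ext_trans_class:
  assumes nm: "n \<le> m" and h: "h \<in> coc i n"
  shows "ext_trans i n m (ext_class i n h) = ext_class i m (transition i n m h)"
proof -
  interpret H: module R "hom_sys i m" by (rule module_hom_sys)
  note b = H.submoduleD[OF submodule_cob[of i m]]
  have bh: "b \<in> mod_hom R (F n i) N" if "b \<in> cob i n" for b using that cob_coc coc_closed(3) by blast
  have th: "transition i n m h \<in> carrier (hom_sys i m)" using transition_hom[OF nm coc_closed(3)[OF h]] by simp
  have mem: "z \<in> ext_class i n h \<longleftrightarrow> (\<exists>b\<in>cob i n. z = b \<oplus>\<^bsub>hom_sys i n\<^esub> h)" for z n h
    unfolding ext_class_def a_r_coset_def' coc_module_sel by blast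
  have "ext_trans i n m (ext_class i n h) = cob i m <+>\<^bsub>hom_sys i m\<^esub> transition i n m ` ext_class i n h"
    unfolding ext_map_def transition_def hom_sys_def ..
  also have "\<dots> = ext_class i m (transition i n m h)"
  proof (rule Set.set_eqI)
    fix z
    show "z \<in> cob i m <+>\<^bsub>hom_sys i m\<^esub> transition i n m ` ext_class i n h \<longleftrightarrow> z \<in> ext_class i m (transition i n m h)"
    proof
      assume "z \<in> cob i m <+>\<^bsub>hom_sys i m\<^esub> transition i n m ` ext_class i n h"
      then obtain a w where a: "a \<in> cob i m" "w \<in> transition i n m ` ext_class i n h" "z = a \<oplus>\<^bsub>hom_sys i m\<^esub> w"
        by (rule set_addE)
      then obtain v where v: "v \<in> ext_class i n h" "w = transition i n m v" by blast
      then obtain c where c: "c \<in> cob i n" "v = c \<oplus>\<^bsub>hom_sys i n\<^esub> h" unfolding mem by blast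
      have tc: "transition i n m c \<in> cob i m" by (rule cob_transition[OF nm c(1)])
      have "z = (a \<oplus>\<^bsub>hom_sys i m\<^esub> transition i n m c) \<oplus>\<^bsub>hom_sys i m\<^esub> transition i n m h"
        unfolding a(3) v(2) c(2) transition_add[OF nm bh[OF c(1)] coc_closed(3)[OF h]]
        by (rule H.M.a_assoc[symmetric, OF b(2)[OF a(1)] b(2)[OF tc] th])
      then show "z \<in> ext_class i m (transition i n m h)" unfolding mem using b(4)[OF a(1) tc] by blast
    next
      assume "z \<in> ext_class i m (transition i n m h)"
      then obtain a where a: "a \<in> cob i m" "z = a \<oplus>\<^bsub>hom_sys i m\<^esub> transition i n m h" unfolding mem by blast
      have "\<zero>\<^bsub>hom_sys i n\<^esub> \<oplus>\<^bsub>hom_sys i n\<^esub> h \<in> ext_class i n h"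
        unfolding mem using module.submoduleD(3)[OF module_hom_sys submodule_cob[of i n]] by blast
      moreover have "\<zero>\<^bsub>hom_sys i n\<^esub> \<oplus>\<^bsub>hom_sys i n\<^esub> h = h"
        by (rule abelian_monoid.l_zero[OF abelian_group.axioms(1)[OF module.axioms(2)[OF module_hom_sys]]])
          (use coc_closed(3)[OF h] in simp)
      ultimately have "h \<in> ext_class i n h" by (simp only:)
      then show "z \<in> cob i m <+>\<^bsub>hom_sys i m\<^esub> transition i n m ` ext_class i n h"
        unfolding a(2) by (intro set_addI a(1) imageI)
    qed
  qed
  finally show ?thesis .
qed

lemma ext_system: "directed_system R (ext i) (ext_trans i)"
proof (rule directed_system.intro)
  show "cring R" by (rule cr)
  show "module R (ext i n)" for n by (rule module_ext)
  fix n m x assume nm: "n \<le> m" and x: "x \<in> carrier (ext i n)"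
  obtain h where h: "h \<in> coc i n" "x = ext_class i n h" using x unfolding ext_carrier by blast
  note hh = coc_closed(3)[OF h(1)]
  show "ext_trans i n m x \<in> carrier (ext i m)"
    unfolding h(2) ext_trans_class[OF nm h(1)] ext_carrier by (rule imageI[OF coc_transition[OF nm h(1)]])
  show "ext_trans i n m (r \<odot>\<^bsub>ext i n\<^esub> x) = r \<odot>\<^bsub>ext i m\<^esub> ext_trans i n m x" if r: "r \<in> carrier R" for r
    unfolding h(2) ext_class_smult[OF r h(1)] ext_trans_class[OF nm h(1)] ext_trans_class[OF nm coc_closed(2)[OF r h(1)]]
      ext_class_smult[OF r coc_transition[OF nm h(1)]] transition_smult[OF nm r hh] ..
  show "ext_trans i n m (x \<oplus>\<^bsub>ext i n\<^esub> y) = ext_trans i n m x \<oplus>\<^bsub>ext i m\<^esub> ext_trans i n m y" if y: "y \<in> carrier (ext i n)" for y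
  proof -
    obtain h' where h': "h' \<in> coc i n" "y = ext_class i n h'" using y unfolding ext_carrier by blast
    show ?thesis
      unfolding h(2) h'(2) ext_class_add[OF h(1) h'(1)] ext_trans_class[OF nm h(1)] ext_trans_class[OF nm h'(1)]
        ext_trans_class[OF nm coc_closed(1)[OF h(1) h'(1)]]
        ext_class_add[OF coc_transition[OF nm h(1)] coc_transition[OF nm h'(1)]]
        transition_add[OF nm hh coc_closed(3)[OF h'(1)]] ..
  qed
  show "ext_trans i m k (ext_trans i n m x) = ext_trans i n k x" if mk: "m \<le> k" for k
    unfolding h(2) ext_trans_class[OF nm h(1)] ext_trans_class[OF mk coc_transition[OF nm h(1)]]
      ext_trans_class[OF order_trans[OF nm mk] h(1)] transition_transition[OF nm mk hh] ..
next
  fix x n assume "x \<in> carrier (ext i n)"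
  then obtain h where h: "h \<in> coc i n" "x = ext_class i n h" unfolding ext_carrier by blast
  have "transition i n n h = h" using directed_system.T_id[OF hom_system, of h i n] coc_closed(3)[OF h(1)] by simp
  then show "ext_trans i n n x = x" unfolding h(2) ext_trans_class[OF order_refl h(1)] by (simp only:)
qed

abbreviation (input) "H i \<equiv> gen_loc_coh R I i M N"

lemma H_eq: "H i = dir_lim (ext i) (ext_trans i)"
  by (simp add: gen_loc_coh_def Let_def)

abbreviation "ecls i \<equiv> directed_system.cls (ext i) (ext_trans i)"

lemma module_H: "module R (H i)"
  unfolding H_eq by (rule directed_system.module_dir_lim[OF ext_system])

lemma ext_class_closed: "h \<in> coc i n \<Longrightarrow> ext_class i n h \<in> carrier (ext i n)"
  unfolding ext_carrier by (rule imageI)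

lemma H_cases:
  assumes "c \<in> carrier (H i)"
  obtains n h where "h \<in> coc i n" "c = ecls i n (ext_class i n h)"
proof -
  obtain n x where x: "x \<in> carrier (ext i n)" "c = ecls i n x"
    using directed_system.cls_cases[OF ext_system assms[unfolded H_eq]] .
  then obtain h where "h \<in> coc i n" "x = ext_class i n h" unfolding ext_carrier by blast
  then show thesis using that x(2) by blast
qed

lemma ecls_transition: "n \<le> m \<Longrightarrow> h \<in> coc i n \<Longrightarrow> ecls i m (ext_class i m (transition i n m h)) = ecls i n (ext_class i n h)"
  using directed_system.cls_T[OF ext_system _ ext_class_closed] ext_trans_class by simp

lemma ecls_eq_zero_iff:
  assumes h: "h \<in> coc i n"
  shows "ecls i n (ext_class i n h) = \<zero>\<^bsub>H i\<^esub> \<longleftrightarrow> (\<exists>k\<ge>n. transition i n k h \<in> cob i k)"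
proof -
  have "ext_trans i n k (ext_class i n h) = \<zero>\<^bsub>ext i k\<^esub> \<longleftrightarrow> transition i n k h \<in> cob i k" if "k \<ge> n" for k
    unfolding ext_trans_class[OF that h] by (rule ext_class_eq_zero_iff[OF coc_transition[OF that h]])
  then show ?thesis
    unfolding H_eq directed_system.cls_eq_zero_iff[OF ext_system ext_class_closed[OF h]] by blast
qed

definition lim_coc where "lim_coc i = {g \<in> carrier (G i). lim_diff i g = \<zero>\<^bsub>G (Suc i)\<^esub>}"

lemma submodule_lim_coc: "submodule (lim_coc i) R (G i)"
  unfolding lim_coc_def
  using submodule_vimage[OF module_G module_G lim_diff_hom module.submodule_zero[OF module_G]] by simp

lemma cls_in_lim_coc: "h \<in> coc i n \<Longrightarrow> cls i n h \<in> lim_coc i"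
  using cls_closed[of h n i] lim_diff_cls[of h n i] cls_zero[of "Suc i" n] by (simp add: lim_coc_def coc_iff)

lemma lim_coc_cases:
  assumes "g \<in> lim_coc i"
  obtains n h where "h \<in> coc i n" "g = cls i n h"
proof -
  have g: "g \<in> carrier (G i)" "lim_diff i g = \<zero>\<^bsub>G (Suc i)\<^esub>" using assms by (auto simp: lim_coc_def)
  obtain n h where h: "h \<in> mod_hom R (F n i) N" "g = cls i n h" using cls_cases[OF g(1)] .
  then obtain k where k: "n \<le> k" "transition (Suc i) n k (diff i n h) = \<zero>\<^bsub>hom_sys (Suc i) k\<^esub>"
    using g(2) cls_eq_zero_iff[OF diff_hom[OF h(1)]] by (auto simp: lim_diff_cls)
  have "transition i n k h \<in> coc i k"
    using k transition_diff[OF k(1) h(1)] transition_hom[OF k(1) h(1)] by (simp add: coc_iff)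
  moreover have "g = cls i k (transition i n k h)" using cls_transition[OF k(1) h(1)] h(2) by simp
  ultimately show thesis using that by blast
qed

text \<open>
  This map identifies the cohomology of the limit of the complexes with the limit of their cohomology. Different
  representatives of a cocycle of the limit complex agree at a later stage, so that the choice is immaterial.
\<close>

definition coh_class where
  "coh_class i = (\<lambda>g\<in>lim_coc i. SOME c. \<exists>n h. h \<in> coc i n \<and> g = cls i n h \<and> c = ecls i n (ext_class i n h))"

lemma coh_class_cls:
  assumes h: "h \<in> coc i n"
  shows "coh_class i (cls i n h) = ecls i n (ext_class i n h)"
proof -
  have "\<exists>m h'. h' \<in> coc i m \<and> cls i n h = cls i m h' \<and> coh_class i (cls i n h) = ecls i m (ext_class i m h')"
    unfolding coh_class_def using cls_in_lim_coc[OF h] someI_ex[of "\<lambda>c. \<exists>m h'. h' \<in> coc i m \<and> cls i n h = cls i m h' \<and> c = ecls i m (ext_class i m h')"] h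
    by auto
  then obtain m h' where h': "h' \<in> coc i m" "cls i n h = cls i m h'" "coh_class i (cls i n h) = ecls i m (ext_class i m h')" by blast
  obtain k where k: "n \<le> k" "m \<le> k" "transition i n k h = transition i m k h'"
    using h'(2) cls_eq_iff[OF coc_closed(3)[OF h] coc_closed(3)[OF h'(1)]] by blast
  show ?thesis
    unfolding h'(3) using ecls_transition[OF k(1) h] ecls_transition[OF k(2) h'(1)] k(3) by simp
qed

lemma coh_class_hom: "coh_class i \<in> mod_hom R (G i\<lparr>carrier := lim_coc i\<rparr>) (H i)"
  unfolding mod_hom_def
proof (intro CollectI conjI ballI)
  have closed: "coh_class i g \<in> carrier (H i)" if g: "g \<in> lim_coc i" for g
  proof -
    obtain n h where h: "h \<in> coc i n" "g = cls i n h" using lim_coc_cases[OF g] .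
    show ?thesis unfolding h(2) coh_class_cls[OF h(1)] H_eq
      by (rule directed_system.cls_closed[OF ext_system ext_class_closed[OF h(1)]])
  qed
  then show "coh_class i \<in> carrier (G i\<lparr>carrier := lim_coc i\<rparr>) \<rightarrow>\<^sub>E carrier (H i)"
    by (auto simp: coh_class_def)
next
  fix g g' assume gg: "g \<in> carrier (G i\<lparr>carrier := lim_coc i\<rparr>)" "g' \<in> carrier (G i\<lparr>carrier := lim_coc i\<rparr>)"
  have gZ: "g \<in> lim_coc i" "g' \<in> lim_coc i" using gg by simp_all
  obtain n h where h: "h \<in> coc i n" "g = cls i n h" using lim_coc_cases[OF gZ(1)] .
  obtain m h' where h': "h' \<in> coc i m" "g' = cls i m h'" using lim_coc_cases[OF gZ(2)] .
  let ?k = "max n m" and ?h = "transition i n (max n m) h" and ?h' = "transition i m (max n m) h'"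
  have k: "n \<le> ?k" "m \<le> ?k" by auto
  note t = coc_transition[OF k(1) h(1)] coc_transition[OF k(2) h'(1)]
  have g: "g = cls i ?k ?h" "g' = cls i ?k ?h'"
    using h h' cls_transition[OF k(1) coc_closed(3)[OF h(1)]] cls_transition[OF k(2) coc_closed(3)[OF h'(1)]] by simp_all
  have "g \<oplus>\<^bsub>G i\<^esub> g' = cls i ?k (?h \<oplus>\<^bsub>hom_sys i ?k\<^esub> ?h')"
    unfolding g using cls_add[OF coc_closed(3)[OF t(1)] coc_closed(3)[OF t(2)]] by simp
  then have "coh_class i (g \<oplus>\<^bsub>G i\<^esub> g') = ecls i ?k (ext_class i ?k (?h \<oplus>\<^bsub>hom_sys i ?k\<^esub> ?h'))"
    using coh_class_cls[OF coc_closed(1)[OF t]] by (simp only:)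
  also have "\<dots> = ecls i ?k (ext_class i ?k ?h) \<oplus>\<^bsub>H i\<^esub> ecls i ?k (ext_class i ?k ?h')"
    unfolding ext_class_add[OF t, symmetric] H_eq
    by (rule directed_system.cls_add[OF ext_system ext_class_closed[OF t(1)] ext_class_closed[OF t(2)], symmetric])
  finally show "coh_class i (g \<oplus>\<^bsub>G i\<lparr>carrier := lim_coc i\<rparr>\<^esub> g') = coh_class i g \<oplus>\<^bsub>H i\<^esub> coh_class i g'"
    unfolding g coh_class_cls[OF t(1)] coh_class_cls[OF t(2)] by simp
next
  fix r g assume r: "r \<in> carrier R" and g: "g \<in> carrier (G i\<lparr>carrier := lim_coc i\<rparr>)"
  have gZ: "g \<in> lim_coc i" using g by simp
  obtain n h where h: "h \<in> coc i n" "g = cls i n h" using lim_coc_cases[OF gZ] .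
  have "r \<odot>\<^bsub>G i\<^esub> g = cls i n (r \<odot>\<^bsub>hom_sys i n\<^esub> h)" unfolding h(2) using cls_smult[OF r coc_closed(3)[OF h(1)]] by simp
  then have "coh_class i (r \<odot>\<^bsub>G i\<^esub> g) = ecls i n (ext_class i n (r \<odot>\<^bsub>hom_sys i n\<^esub> h))"
    using coh_class_cls[OF coc_closed(2)[OF r h(1)]] by (simp only:)
  also have "\<dots> = r \<odot>\<^bsub>H i\<^esub> ecls i n (ext_class i n h)"
    unfolding ext_class_smult[OF r h(1), symmetric] H_eq
    by (rule directed_system.cls_smult[OF ext_system r ext_class_closed[OF h(1)], symmetric])
  finally show "coh_class i (r \<odot>\<^bsub>G i\<lparr>carrier := lim_coc i\<rparr>\<^esub> g) = r \<odot>\<^bsub>H i\<^esub> coh_class i g"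
    unfolding h(2) coh_class_cls[OF h(1)] by simp
qed

lemma coh_class_surj: "coh_class i ` lim_coc i = carrier (H i)"
proof
  show "coh_class i ` lim_coc i \<subseteq> carrier (H i)" using mod_hom_closed[OF coh_class_hom] by auto
  show "carrier (H i) \<subseteq> coh_class i ` lim_coc i"
  proof
    fix c assume "c \<in> carrier (H i)"
    then obtain n h where h: "h \<in> coc i n" "c = ecls i n (ext_class i n h)" by (rule H_cases)
    show "c \<in> coh_class i ` lim_coc i"
      unfolding h(2) coh_class_cls[OF h(1), symmetric] by (rule imageI[OF cls_in_lim_coc[OF h(1)]])
  qed
qed

definition lim_cob where "lim_cob i = (case i of 0 \<Rightarrow> {\<zero>\<^bsub>G 0\<^esub>} | Suc p \<Rightarrow> lim_diff p ` carrier (G p))"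

lemma coh_class_kernel: "{g \<in> lim_coc i. coh_class i g = \<zero>\<^bsub>H i\<^esub>} = lim_cob i"
proof
  show "{g \<in> lim_coc i. coh_class i g = \<zero>\<^bsub>H i\<^esub>} \<subseteq> lim_cob i"
  proof
    fix g assume "g \<in> {g \<in> lim_coc i. coh_class i g = \<zero>\<^bsub>H i\<^esub>}"
    then have g: "g \<in> lim_coc i" "coh_class i g = \<zero>\<^bsub>H i\<^esub>" by auto
    obtain n h where h: "h \<in> coc i n" "g = cls i n h" using lim_coc_cases[OF g(1)] .
    obtain k where k: "n \<le> k" "transition i n k h \<in> cob i k"
      using g(2) unfolding h(2) coh_class_cls[OF h(1)] ecls_eq_zero_iff[OF h(1)] by blast
    have gk: "g = cls i k (transition i n k h)" unfolding h(2) using cls_transition[OF k(1) coc_closed(3)[OF h(1)]] by simp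
    show "g \<in> lim_cob i"
    proof (cases i)
      case 0
      then have "transition i n k h = \<zero>\<^bsub>hom_sys i k\<^esub>" using k(2) cob_0 by blast
      then have "g = \<zero>\<^bsub>G i\<^esub>" using gk cls_zero[of i k] by simp
      then show ?thesis by (simp add: lim_cob_def 0)
    next
      case (Suc p)
      then obtain u where u: "u \<in> mod_hom R (F k p) N" "transition i n k h = diff p k u" using k(2) cob_Suc by blast
      have "g = lim_diff p (cls p k u)" using gk u(2) lim_diff_cls[OF u(1)] Suc by simp
      then show ?thesis using cls_closed[OF u(1)] by (simp add: lim_cob_def Suc)
    qed
  qed
  show "lim_cob i \<subseteq> {g \<in> lim_coc i. coh_class i g = \<zero>\<^bsub>H i\<^esub>}"
  proof
    fix g assume g: "g \<in> lim_cob i"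
    have "\<exists>n h. h \<in> cob i n \<and> g = cls i n h"
    proof (cases i)
      case 0
      then have "g = cls i 0 \<zero>\<^bsub>hom_sys i 0\<^esub>" using g cls_zero[of i 0] by (simp add: lim_cob_def)
      moreover have "\<zero>\<^bsub>hom_sys i 0\<^esub> \<in> cob i 0" by (rule module.submoduleD(3)[OF module_hom_sys submodule_cob])
      ultimately show ?thesis by blast
    next
      case (Suc p)
      then obtain w where w: "w \<in> carrier (G p)" "g = lim_diff p w" using g by (auto simp: lim_cob_def)
      obtain n u where u: "u \<in> mod_hom R (F n p) N" "w = cls p n u" using cls_cases[OF w(1)] .
      have "g = cls i n (diff p n u)" using w(2) u lim_diff_cls[OF u(1)] Suc by simp
      moreover have "diff p n u \<in> cob i n" unfolding Suc cob_Suc using u(1) by blast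
      ultimately show ?thesis by blast
    qed
    then obtain n h where h: "h \<in> cob i n" "g = cls i n h" by blast
    have hc: "h \<in> coc i n" using h(1) cob_coc by blast
    have "transition i n n h \<in> cob i n" by (rule cob_transition[OF order_refl h(1)])
    then have "coh_class i g = \<zero>\<^bsub>H i\<^esub>"
      unfolding h(2) coh_class_cls[OF hc] ecls_eq_zero_iff[OF hc] by blast
    then show "g \<in> {g \<in> lim_coc i. coh_class i g = \<zero>\<^bsub>H i\<^esub>}" using cls_in_lim_coc[OF hc] h(2) by blast
  qed
qed

lemma artinian_imp_dcc:
  assumes "artinian_module R (H i)"
  shows "dcc R (G i) (lim_cob i) (lim_coc i)"
proof -
  have A: "module R (G i\<lparr>carrier := lim_coc i\<rparr>)" by (rule module_restrict[OF module_G submodule_lim_coc])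
  have "dcc R (G i\<lparr>carrier := lim_coc i\<rparr>) (lim_cob i) (lim_coc i)"
    using dcc_kernel_of_surjection[OF A module_H coh_class_hom _ assms] coh_class_surj coh_class_kernel by simp
  then show ?thesis unfolding dcc_restrict_iff[OF module_G submodule_lim_coc] .
qed

lemma dcc_imp_artinian_quotient:
  assumes "dcc R (G i) (lim_cob i <+>\<^bsub>G i\<^esub> ideal_span R (G i) I (lim_coc i)) (lim_coc i)"
  shows "artinian_module R (quot_module R (H i) (ideal_smult R I (H i)))"
proof -
  interpret H: module R "H i" by (rule module_H)
  let ?A = "G i\<lparr>carrier := lim_coc i\<rparr>" and ?J = "ideal_smult R I (H i)"
  have A: "module R ?A" by (rule module_restrict[OF module_G submodule_lim_coc])
  have J: "submodule ?J R (H i)"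
    unfolding ideal_smult_eq_span by (rule H.submodule_ideal_span[OF M.R.idealD(1)[OF I] order_refl])
  define \<pi> where "\<pi> = (\<lambda>c\<in>carrier (H i). ?J +>\<^bsub>H i\<^esub> c)"
  have \<pi>: "\<pi> \<in> mod_hom R (H i) (quot_module R (H i) ?J)" unfolding \<pi>_def by (rule H.quot_map_hom[OF J])
  let ?\<theta> = "\<lambda>g\<in>carrier ?A. \<pi> (coh_class i g)"
  have \<theta>: "?\<theta> \<in> mod_hom R ?A (quot_module R (H i) ?J)" by (rule mod_hom_compose[OF A coh_class_hom \<pi>])
  have surj: "?\<theta> ` carrier ?A = carrier (quot_module R (H i) ?J)"
  proof -
    have "?\<theta> ` carrier ?A = \<pi> ` coh_class i ` lim_coc i" by (simp add: image_image)
    then show ?thesis unfolding coh_class_surj H.quot_carrier \<pi>_def by simp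
  qed
  have Q: "module R (quot_module R (H i) ?J)" by (rule H.module_quot_module[OF J])
  have cl: "coh_class i g \<in> carrier (H i)" if "g \<in> lim_coc i" for g using mod_hom_closed[OF coh_class_hom] that by simp
  have \<pi>0: "\<pi> c = \<zero>\<^bsub>quot_module R (H i) ?J\<^esub>" if "c \<in> ?J" for c
    using H.coset_mem_iff[OF J] H.submoduleD(2)[OF J that] that by (simp add: \<pi>_def)
  let ?K = "{g \<in> carrier ?A. ?\<theta> g \<in> {\<zero>\<^bsub>quot_module R (H i) ?J\<^esub>}}"
  have "submodule ?K R ?A" by (rule submodule_vimage[OF A Q \<theta> module.submodule_zero[OF Q]])
  then have K: "submodule ?K R (G i)" unfolding submodule_restrict_iff[OF module_G submodule_lim_coc] by blast
  have "lim_cob i <+>\<^bsub>G i\<^esub> ideal_span R (G i) I (lim_coc i) \<subseteq> ?K"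
  proof (rule module.sum_least[OF module_G K])
    show "lim_cob i \<subseteq> ?K"
    proof
      fix g assume "g \<in> lim_cob i"
      then have "g \<in> lim_coc i" "coh_class i g = \<zero>\<^bsub>H i\<^esub>" unfolding coh_class_kernel[symmetric] by simp_all
      then show "g \<in> ?K" using \<pi>0[OF H.submoduleD(3)[OF J]] by simp
    qed
    show "ideal_span R (G i) I (lim_coc i) \<subseteq> ?K"
      unfolding ideal_span_le_iff[OF K]
    proof (intro ballI)
      fix r g assume r: "r \<in> I" and g: "g \<in> lim_coc i"
      have rc: "r \<in> carrier R" using r M.R.idealD(1)[OF I] by blast
      have "coh_class i (r \<odot>\<^bsub>G i\<^esub> g) = r \<odot>\<^bsub>H i\<^esub> coh_class i g"
        using mod_hom_smult[OF coh_class_hom rc, of g] g by simp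
      also have "\<dots> \<in> ?J" unfolding ideal_smult_eq_span by (rule ideal_span_mem[OF r cl[OF g]])
      finally have "\<pi> (coh_class i (r \<odot>\<^bsub>G i\<^esub> g)) = \<zero>\<^bsub>quot_module R (H i) ?J\<^esub>" by (rule \<pi>0)
      then show "r \<odot>\<^bsub>G i\<^esub> g \<in> ?K" using module.submoduleD(5)[OF module_G submodule_lim_coc rc g] by simp
    qed
  qed
  then have "dcc R (G i) ?K (lim_coc i)" by (rule dcc_subinterval[OF assms _ order_refl])
  then have "dcc R ?A {g \<in> carrier ?A. ?\<theta> g = \<zero>\<^bsub>quot_module R (H i) ?J\<^esub>} (carrier ?A)"
    using dcc_restrict_iff[OF module_G submodule_lim_coc, of i ?K] by simp
  then show ?thesis by (rule artinian_of_surjection[OF A Q \<theta> surj])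
qed

lemma lim_into_zero: "lim_into i {\<zero>\<^bsub>N\<^esub>} = {\<zero>\<^bsub>G i\<^esub>}"
proof -
  have "cls i n h = \<zero>\<^bsub>G i\<^esub>" if "h \<in> hom_into i {\<zero>\<^bsub>N\<^esub>} n" for n h
  proof -
    have "h = \<zero>\<^bsub>hom_sys i n\<^esub>"
      by (rule mod_hom_eqI[of h R "F n i" N _ N])
        (use that abelian_monoid.zero_closed[OF abelian_group.axioms(1)[OF module.axioms(2)[OF module_hom_sys]], of i n]
          in \<open>auto simp: hom_into_def\<close>)
    then show ?thesis using cls_zero[of i n] by simp
  qed
  then have "lim_into i {\<zero>\<^bsub>N\<^esub>} \<subseteq> {\<zero>\<^bsub>G i\<^esub>}" by (auto elim: lim_into_cases)
  then show ?thesis using module.submoduleD(3)[OF module_G submodule_lim_into[OF N.submodule_zero]] by blast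
qed

text \<open>
  For \<open>L = 0\<close> the subcomplex \<open>C L\<close> vanishes, and the relative cocycles and coboundaries are those of the
  limit complex.
\<close>

theorem artinian_top_local_cohomology:
  fixes P :: "nat \<Rightarrow> ('a, 'p) module"
  assumes P: "projective_resolution R M P dP eP" and Pi: "\<And>i. t \<le> i \<Longrightarrow> carrier (P i) = {\<zero>\<^bsub>P i\<^esub>}"
    and fin: "\<And>L. submodule L R N \<Longrightarrow> finite (Ass R (quot_module R N L))"
    and dim: "\<not> prime_chain R N {\<zero>\<^bsub>N\<^esub>} n"
    and art: "\<And>j. j > t \<Longrightarrow> artinian_module R (H j)"
  shows "artinian_module R (quot_module R (H t) (ideal_smult R I (H t)))"
proof -
  interpret FC: filtered_complex R I N G lim_diff lim_into t by (rule filtered_complex_lim[OF P Pi])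
  have Z: "FC.cocycles j {\<zero>\<^bsub>N\<^esub>} = lim_coc j" for j
    unfolding FC.cocycles_def lim_coc_def lim_into_zero by simp
  have B: "FC.coboundaries j {\<zero>\<^bsub>N\<^esub>} = lim_cob j" for j
  proof -
    interpret Gj: module R "G j" by (rule module_G)
    have b: "FC.d_image j (carrier N) = lim_cob j"
      unfolding FC.d_image_def lim_cob_def by (cases j) (simp_all add: FC.C_top)
    have bs: "submodule (lim_cob j) R (G j)" using FC.submodule_d_image[OF N.carrier_is_submodule, of j] b by simp
    show ?thesis
      unfolding FC.coboundaries_def lim_into_zero b
      using Gj.sum_ge(1)[OF bs Gj.submodule_zero] Gj.sum_least[OF bs order_refl, of "{\<zero>\<^bsub>G j\<^esub>}"] Gj.submoduleD(3)[OF bs]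
      by blast
  qed
  have "FC.artinian_top_quotient {\<zero>\<^bsub>N\<^esub>}"
    by (rule FC.artinian_top_quotient_of_finite_dimension[OF fin N.submodule_zero dim])
  then have "dcc R (G t) (lim_cob t <+>\<^bsub>G t\<^esub> ideal_span R (G t) I (lim_coc t)) (lim_coc t)"
    unfolding FC.artinian_top_quotient_def Z B using artinian_imp_dcc[OF art] by blast
  then show ?thesis by (rule dcc_imp_artinian_quotient)
qed

end

text \<open>
  If \<open>p\<close> contains the annihilator of \<open>y\<close>, the fraction \<open>y/1\<close> is nonzero.
\<close>

lemma supported_at_zero_Supp:
  assumes N: "module R N" and p: "supported_at R N {\<zero>\<^bsub>N\<^esub>} p"
  shows "p \<in> Supp R N"
proof -
  interpret N: module R N by fact
  obtain y where y: "y \<in> carrier N" "colon R N {\<zero>\<^bsub>N\<^esub>} y \<subseteq> p" and pp: "primeideal p R"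
    using p by (auto simp: supported_at_def)
  have one: "\<one>\<^bsub>R\<^esub> \<in> carrier R - p" using N.R.primeD(2)[OF pp] by simp
  let ?C = "frac_rel R N p `` {(y, \<one>\<^bsub>R\<^esub>)}"
  have mem: "(y, \<one>\<^bsub>R\<^esub>) \<in> ?C" using y(1) one by (auto simp: frac_rel_def)
  have "?C \<in> localized_carrier R N p" unfolding localized_carrier_def using y(1) one by (auto intro!: quotientI)
  moreover have "?C \<noteq> frac_rel R N p `` {(\<zero>\<^bsub>N\<^esub>, \<one>\<^bsub>R\<^esub>)}"
  proof
    assume "?C = frac_rel R N p `` {(\<zero>\<^bsub>N\<^esub>, \<one>\<^bsub>R\<^esub>)}"
    then have "((\<zero>\<^bsub>N\<^esub>, \<one>\<^bsub>R\<^esub>), (y, \<one>\<^bsub>R\<^esub>)) \<in> frac_rel R N p" using mem by blast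
    then obtain v where v: "v \<in> carrier R" "v \<notin> p" "v \<odot>\<^bsub>N\<^esub> (\<one>\<^bsub>R\<^esub> \<odot>\<^bsub>N\<^esub> \<zero>\<^bsub>N\<^esub>) = v \<odot>\<^bsub>N\<^esub> (\<one>\<^bsub>R\<^esub> \<odot>\<^bsub>N\<^esub> y)"
      by (auto simp: frac_rel_def)
    then have "v \<in> colon R N {\<zero>\<^bsub>N\<^esub>} y" using y(1) by (simp add: colon_def)
    then show False using y(2) v(2) by blast
  qed
  ultimately have "localized_carrier R N p \<noteq> {frac_rel R N p `` {(\<zero>\<^bsub>N\<^esub>, \<one>\<^bsub>R\<^esub>)}}" by (metis singletonD)
  then show ?thesis using pp by (simp add: Supp_def)
qed

lemma finite_dimension_bounds_chains:
  assumes N: "module R N" and dim: "module_dim R N < \<infinity>"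
  shows "\<exists>n. \<not> prime_chain R N {\<zero>\<^bsub>N\<^esub>} n"
proof (rule ccontr)
  assume "\<nexists>n. \<not> prime_chain R N {\<zero>\<^bsub>N\<^esub>} n"
  then have "\<exists>c :: nat \<Rightarrow> 'a set. (\<forall>i\<le>n. c i \<in> Supp R N) \<and> (\<forall>i<n. c i \<subset> c (Suc i))" for n
    unfolding prime_chain_def using supported_at_zero_Supp[OF N] by meson
  then have le: "ereal (real n) \<le> module_dim R N" for n
    unfolding module_dim_def by (intro Sup_upper CollectI exI[of _ n]) simp
  obtain m :: nat where "module_dim R N \<le> ereal (real m)"
  proof (cases "module_dim R N")
    case (real r)
    obtain m :: nat where "r \<le> real m" using real_arch_simple by blast
    then show thesis using that real by simp
  next
    case MInf
    then show thesis using that[of 0] by simp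
  qed (use dim in simp)
  then have "ereal (real (Suc m)) \<le> ereal (real m)" using le[of "Suc m"] by (rule order_trans[rotated])
  then show False by simp
qed

theorem theorem3p1:
  fixes R :: "('a, 'r) ring_scheme" and I :: "'a set"
    and M :: "('a, 'm, 'k) module_scheme" and N :: "('a, 'n, 'l) module_scheme"
    and t :: nat
  assumes "cring R" and "noetherian_ring R"
    and "ideal I R"
    and "module R M" and "fin_gen_module R M" and "proj_dim R M < \<infinity>"
    and "module R N" and "weakly_laskerian R N" and "module_dim R N < \<infinity>"
    and "proj_dim R M < ereal (real t)"
    and "\<And>j. j > t \<Longrightarrow> artinian_module R (gen_loc_coh R I j M N)"
  shows "artinian_module R (quot_module R (gen_loc_coh R I t M N)
           (ideal_smult R I (gen_loc_coh R I t M N)))"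
proof -
  interpret generalized_local_cohomology R I M N
    by (intro generalized_local_cohomology.intro adic_quotients.intro generalized_local_cohomology_axioms.intro)
      (use assms in simp_all)
  obtain n and P :: "nat \<Rightarrow> ('a, ('a, 'm) syz \<Rightarrow> 'a) module" and d e where
    n: "ereal (real_of_int n) < ereal (real t)" and P: "projective_resolution R M P d e"
    and P0: "\<And>i. n < int i \<Longrightarrow> carrier (P i) = {\<zero>\<^bsub>P i\<^esub>}"
    using assms(10) unfolding proj_dim_def Inf_less_iff by blast
  have "n < int t" using n by simp
  then have Pi: "carrier (P i) = {\<zero>\<^bsub>P i\<^esub>}" if "t \<le> i" for i using P0 that by simp
  obtain k where k: "\<not> prime_chain R N {\<zero>\<^bsub>N\<^esub>} k" using finite_dimension_bounds_chains[OF assms(7,9)] by blast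
  have fin: "finite (Ass R (quot_module R N L))" if "submodule L R N" for L
    using assms(8) that by (simp add: weakly_laskerian_def)
  show ?thesis by (rule artinian_top_local_cohomology[OF P Pi fin k assms(11)])
qed

end
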